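(* Let $T\in\mathcal{KC}(V)$ be such that $T$ and $\overline{T}$ are injective operators of type $\omega\in(0,\pi)$, and let $\theta\in(\omega,\pi)$. Then for every $f\in\mathcal{F}_L(S_\theta)$ there exists $e\in\Psi^Q(S_\theta)$ such that $e(T)$ and $e(\overline{T})$ are injective and $ef\in\Psi_L^Q(S_\theta)$. For every such $e$ the operators $$e(\overline{T})^{-1}\big(D(ef)(T)-f(T)De(T)\big)\quad\text{and}\quad e(T)^{-1}\big(D(ef)(T)-f(\overline{T})De(T)\big)$$ coincide, and this operator (denoted $Df(T)$) does not depend on the choice of such $e$. Moreover, for all $f,g\in\Psi_L(S_\theta)$ with $Df(s)=Dg(s)$ for all $s\in S_\theta$, the operators $Df(T)=Dg(T)$ coincide.
   Context: $\mathbb{H}$ denotes the quaternions $s=s_0+s_1e_1+s_2e_2+s_3e_3$ with $e_1^2=e_2^2=e_3^2=-1$, $e_1e_2=-e_2e_1=e_3$, $e_2e_3=-e_3e_2=e_1$, $e_3e_1=-e_1e_3=e_2$; $\overline{s}=s_0-s_1e_1-s_2e_2-s_3e_3$, $|s|$ the Euclidean norm, $\mathbb{S}=\{s: s_0=0,|s|=1\}$, $\mathbb{C}_J=\{u+Jv:u,v\in\mathbb{R}\}$. For $\omega\in(0,\pi)$, $S_\omega=\{re^{J\phi}: r>0,\ J\in\mathbb{S},\ |\phi|<\omega\}$, $\overline{S_\omega}$ its closure, $S_\omega^c=\mathbb{H}\setminus S_\omega$. $V$ is a two-sided Banach space over $\mathbb{H}$, $\mathcal{I}$ the identity. $\mathcal{KC}(V)$: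 closed right-linear operators $T$ with two-sided linear domain, $T=T_0+e_1T_1+e_2T_2+e_3T_3$ with two-sided linear $T_i$, $\operatorname{dom}(T_i)=\operatorname{dom}(T)$, $\operatorname{dom}(T^2)\subseteq\operatorname{dom}(T_iT_j)$, $T_iT_j=T_jT_i$ on $\operatorname{dom}(T^2)$. $\overline{T}:=T_0-e_1T_1-e_2T_2-e_3T_3$, $|T|^2:=\sum T_i^2$, $Q_{c,s}(T):=s^2\mathcal{I}-2sT_0+|T|^2$ on $\operatorname{dom}(T^2)$; $\rho_S(T)$ is the set of $s$ where $Q_{c,s}(T):\operatorname{dom}(T^2)\to V$ is bijective, $Q_{c,s}^{-1}(T)$ the inverse, $\sigma_S(T)=\mathbb{H}\setminus\rho_S(T)$. $S_L^{-1}(s,T):=(s\mathcal{I}-\overline{T})Q_{c,s}^{-1}(T)$, $S_R^{-1}(s,T):=sQ_{c,s}^{-1}(T)-\sum_{i=0}^3T_iQ_{c,s}^{-1}(T)\overline{e_i}$ ($e_0=1$). $T$ is of type $\omega$ if $\sigma_S(T)\subseteq\overline{S_\omega}$ and for each $\theta\in(\omega,\pi)$ there is $C_\theta$ with $\|S_L^{-1}(s,T)\|,\|S_R^{-1}(s,T)\|\leq C_\theta/|s|$ on $S_\theta^c\setminus\{0\}$. Left/right slice hyperholomorphic functions on an open axially symmetric set $U$: $f(u+Jv)=\alpha(u,v)+J\beta(u,v)$ (left), resp. $\alpha(u,v)+\beta(u,v)J$ (right), for all $J\in\mathbb{S}$, with $C^1$ $\mathbb{H}$-valued $\alpha$ even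 in $v$, $\beta$ odd in $v$, satisfying $\partial_u\alpha=\partial_v\beta$, $\partial_v\alpha=-\partial_u\beta$; $f$ is intrinsic if $\alpha,\beta$ are real valued. Function classes on $S_\theta$: $\Psi_L(S_\theta)$ (resp. $\Psi(S_\theta)$): left slice hyperholomorphic (resp. intrinsic) $f$ with $|f(s)|\leq C|s|^\alpha/(1+|s|^{1+2\alpha})$ for some $\alpha>0$, $C\ge0$; $\Psi_L^Q(S_\theta)$ (resp. $\Psi^Q(S_\theta)$): left slice hyperholomorphic (resp. intrinsic) $f$ with $|f(s)|\leq C|s|^{1+\alpha}/(1+|s|^{1+2\alpha})$; $\mathcal{F}_L(S_\theta)$: left slice hyperholomorphic $f$ with $|f(s)|\leq C(|s|^\alpha+|s|^{-\alpha})$ for some $\alpha>0,C\ge0$. Path integral: with $\gamma(t)=-te^{J\varphi}$ ($t<0$), $\gamma(t)=te^{-J\varphi}$ ($t>0$), $\int_{\partial(S_\varphi\cap\mathbb{C}_J)}F(s)ds_JG(s):=\int_{\mathbb{R}\setminus\{0\}}F(\gamma(t))\gamma'(t)J^{-1}G(\gamma(t))dt$. For $T\in\mathcal{KC}(V)$ of type $\omega$ and $\theta\in(\omega,\pi)$: the $S$-functional calculus of $h\in\Psi_L(S_\theta)$ is the bounded operator $h(T):=\frac{1}{2\pi}\int_{\partial(S_\varphi\cap\mathbb{C}_J)}S_L^{-1}(s,T)ds_Jh(s)$ ($\varphi\in(\omega,\theta)$, $J\in\mathbb{S}$ arbitrary; independent of these). If $T$ is moreover injective, for $f\in\mathcal{F}_L(S_\theta)$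 one sets $f(T):=e(T)^{-1}(ef)(T)$ for any $e\in\Psi(S_\theta)$ with $e(T)$ injective and $ef\in\Psi_L(S_\theta)$ (known to exist and to give a result independent of $e$). If $T,\overline{T}$ are of type $\omega$, the harmonic functional calculus of $h\in\Psi_L^Q(S_\theta)$ is $Dh(T):=\frac{-1}{\pi}\int_{\partial(S_\varphi\cap\mathbb{C}_J)}Q_{c,s}^{-1}(T)ds_Jh(s)$ (bounded, independent of $\varphi\in(\omega,\theta)$ and $J$). $D=\partial_{q_0}+e_1\partial_{q_1}+e_2\partial_{q_2}+e_3\partial_{q_3}$ is the Cauchy–Fueter operator. Sums and products of unbounded operators are taken with their natural domains. For $f\in\mathcal{F}_L(S_\theta)$ (in particular $f\in\Psi_L(S_\theta)$), $Df(T)$ denotes the operator $e(\overline{T})^{-1}(D(ef)(T)-f(T)De(T))$ with $e$ as in the claim. *)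

theory Defs
  imports "HOL-Analysis.Analysis"
begin

type_synonym quat = "real \<times> real \<times> real \<times> real"

definition qof_real :: "real \<Rightarrow> quat" where
  "qof_real r = (r, 0, 0, 0)"

definition qmul :: "quat \<Rightarrow> quat \<Rightarrow> quat" where
  "qmul p q = (case p of (a0, a1, a2, a3) \<Rightarrow> case q of (b0, b1, b2, b3) \<Rightarrow>
     (a0*b0 - a1*b1 - a2*b2 - a3*b3,
      a0*b1 + a1*b0 + a2*b3 - a3*b2,
      a0*b2 - a1*b3 + a2*b0 + a3*b1,
      a0*b3 + a1*b2 - a2*b1 + a3*b0))"

definition qcnj :: "quat \<Rightarrow> quat" where
  "qcnj p = (case p of (a0, a1, a2, a3) \<Rightarrow> (a0, -a1, -a2, -a3))"

definition qinv :: "quat \<Rightarrow> quat" where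
  "qinv p = (1 / (norm p)\<^sup>2) *\<^sub>R qcnj p"

definition qe :: "nat \<Rightarrow> quat" where
  "qe i = (if i = 0 then (1,0,0,0) else if i = 1 then (0,1,0,0)
           else if i = 2 then (0,0,1,0) else (0,0,0,1))"

definition qsph :: "quat set" where
  "qsph = {s. fst s = 0 \<and> norm s = 1}"

definition qexpJ :: "quat \<Rightarrow> real \<Rightarrow> quat" where
  "qexpJ J \<phi> = qof_real (cos \<phi>) + sin \<phi> *\<^sub>R J"

definition sector :: "real \<Rightarrow> quat set" where
  "sector \<omega> = {r *\<^sub>R qexpJ J \<phi> | r J \<phi>. r > 0 \<and> J \<in> qsph \<and> \<bar>\<phi>\<bar> < \<omega>}"

definition qpartial :: "nat \<Rightarrow> (quat \<Rightarrow> quat) \<Rightarrow> quat \<Rightarrow> quat" where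
  "qpartial i f q = vector_derivative (\<lambda>t::real. f (q + t *\<^sub>R qe i)) (at 0)"

definition cauchy_fueter :: "(quat \<Rightarrow> quat) \<Rightarrow> quat \<Rightarrow> quat" where
  "cauchy_fueter f q = qpartial 0 f q + qmul (qe 1) (qpartial 1 f q)
      + qmul (qe 2) (qpartial 2 f q) + qmul (qe 3) (qpartial 3 f q)"

definition slice_dom :: "quat set \<Rightarrow> (real \<times> real) set" where
  "slice_dom U = {(u, v). \<exists>J\<in>qsph. qof_real u + v *\<^sub>R J \<in> U}"

definition slice_rep ::
  "quat set \<Rightarrow> (quat \<Rightarrow> quat) \<Rightarrow> (real \<times> real \<Rightarrow> quat) \<Rightarrow> (real \<times> real \<Rightarrow> quat) \<Rightarrow> bool" where
  "slice_rep U f \<alpha> \<beta> \<longleftrightarrow>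
     (\<forall>u v J. J \<in> qsph \<and> qof_real u + v *\<^sub>R J \<in> U \<longrightarrow>
         f (qof_real u + v *\<^sub>R J) = \<alpha> (u, v) + qmul J (\<beta> (u, v))) \<and>
     (\<forall>p\<in>slice_dom U. \<alpha> differentiable (at p) \<and> \<beta> differentiable (at p)) \<and>
     continuous_on (slice_dom U) (\<lambda>p. frechet_derivative \<alpha> (at p) (1, 0)) \<and>
     continuous_on (slice_dom U) (\<lambda>p. frechet_derivative \<alpha> (at p) (0, 1)) \<and>
     continuous_on (slice_dom U) (\<lambda>p. frechet_derivative \<beta> (at p) (1, 0)) \<and>
     continuous_on (slice_dom U) (\<lambda>p. frechet_derivative \<beta> (at p) (0, 1)) \<and>
     (\<forall>u v. (u, v) \<in> slice_dom U \<longrightarrow> \<alpha> (u, -v) = \<alpha> (u, v) \<and> \<beta> (u, -v) = - \<beta> (u, v)) \<and>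
     (\<forall>p\<in>slice_dom U.
        frechet_derivative \<alpha> (at p) (1, 0) = frechet_derivative \<beta> (at p) (0, 1) \<and>
        frechet_derivative \<alpha> (at p) (0, 1) = - frechet_derivative \<beta> (at p) (1, 0))"

definition left_slice_hol :: "quat set \<Rightarrow> (quat \<Rightarrow> quat) \<Rightarrow> bool" where
  "left_slice_hol U f \<longleftrightarrow> (\<exists>\<alpha> \<beta>. slice_rep U f \<alpha> \<beta>)"

definition intrinsic_hol :: "quat set \<Rightarrow> (quat \<Rightarrow> quat) \<Rightarrow> bool" where
  "intrinsic_hol U f \<longleftrightarrow> (\<exists>\<alpha> \<beta>. slice_rep U f \<alpha> \<beta> \<and>
      (\<forall>p\<in>slice_dom U. \<alpha> p \<in> range qof_real \<and> \<beta> p \<in> range qof_real))"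

definition Psi_L :: "real \<Rightarrow> (quat \<Rightarrow> quat) set" where
  "Psi_L \<theta> = {f. left_slice_hol (sector \<theta>) f \<and> (\<exists>a>0. \<exists>c\<ge>0. \<forall>s\<in>sector \<theta>.
      norm (f s) \<le> c * norm s powr a / (1 + norm s powr (1 + 2 * a)))}"

definition Psi :: "real \<Rightarrow> (quat \<Rightarrow> quat) set" where
  "Psi \<theta> = {f. intrinsic_hol (sector \<theta>) f \<and> (\<exists>a>0. \<exists>c\<ge>0. \<forall>s\<in>sector \<theta>.
      norm (f s) \<le> c * norm s powr a / (1 + norm s powr (1 + 2 * a)))}"

definition PsiQ_L :: "real \<Rightarrow> (quat \<Rightarrow> quat) set" where
  "PsiQ_L \<theta> = {f. left_slice_hol (sector \<theta>) f \<and> (\<exists>a>0. \<exists>c\<ge>0. \<forall>s\<in>sector \<theta>.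
      norm (f s) \<le> c * norm s powr (1 + a) / (1 + norm s powr (1 + 2 * a)))}"

definition PsiQ :: "real \<Rightarrow> (quat \<Rightarrow> quat) set" where
  "PsiQ \<theta> = {f. intrinsic_hol (sector \<theta>) f \<and> (\<exists>a>0. \<exists>c\<ge>0. \<forall>s\<in>sector \<theta>.
      norm (f s) \<le> c * norm s powr (1 + a) / (1 + norm s powr (1 + 2 * a)))}"

definition F_L :: "real \<Rightarrow> (quat \<Rightarrow> quat) set" where
  "F_L \<theta> = {f. left_slice_hol (sector \<theta>) f \<and> (\<exists>a>0. \<exists>c\<ge>0. \<forall>s\<in>sector \<theta>.
      norm (f s) \<le> c * (norm s powr a + norm s powr (- a)))}"

definition fmul :: "(quat \<Rightarrow> quat) \<Rightarrow> (quat \<Rightarrow> quat) \<Rightarrow> quat \<Rightarrow> quat" where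
  "fmul e f = (\<lambda>s. qmul (e s) (f s))"

definition two_sided_banach :: "(quat \<Rightarrow> 'v::banach \<Rightarrow> 'v) \<Rightarrow> (quat \<Rightarrow> 'v \<Rightarrow> 'v) \<Rightarrow> bool" where
  "two_sided_banach lm rm \<longleftrightarrow>
     (\<forall>a b v. lm (a + b) v = lm a v + lm b v) \<and> (\<forall>a v w. lm a (v + w) = lm a v + lm a w) \<and>
     (\<forall>a b v. rm (a + b) v = rm a v + rm b v) \<and> (\<forall>a v w. rm a (v + w) = rm a v + rm a w) \<and>
     (\<forall>a b v. lm (qmul a b) v = lm a (lm b v)) \<and> (\<forall>a b v. rm (qmul a b) v = rm b (rm a v)) \<and>
     (\<forall>r v. lm (qof_real r) v = r *\<^sub>R v \<and> rm (qof_real r) v = r *\<^sub>R v) \<and>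
     (\<forall>a b v. lm a (rm b v) = rm b (lm a v)) \<and>
     (\<forall>a v. norm (lm a v) \<le> norm a * norm v \<and> norm (rm a v) \<le> norm a * norm v)"

definition two_sided_subspace :: "(quat \<Rightarrow> 'v::banach \<Rightarrow> 'v) \<Rightarrow> (quat \<Rightarrow> 'v \<Rightarrow> 'v) \<Rightarrow> 'v set \<Rightarrow> bool" where
  "two_sided_subspace lm rm D \<longleftrightarrow> 0 \<in> D \<and> (\<forall>v\<in>D. \<forall>w\<in>D. v + w \<in> D) \<and>
     (\<forall>a. \<forall>v\<in>D. lm a v \<in> D \<and> rm a v \<in> D)"

definition right_linear_on :: "(quat \<Rightarrow> 'v::banach \<Rightarrow> 'v) \<Rightarrow> 'v set \<Rightarrow> ('v \<Rightarrow> 'v) \<Rightarrow> bool" where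
  "right_linear_on rm D A \<longleftrightarrow> (\<forall>v\<in>D. \<forall>w\<in>D. A (v + w) = A v + A w) \<and>
     (\<forall>a. \<forall>v\<in>D. A (rm a v) = rm a (A v))"

definition two_sided_linear_on ::
  "(quat \<Rightarrow> 'v::banach \<Rightarrow> 'v) \<Rightarrow> (quat \<Rightarrow> 'v \<Rightarrow> 'v) \<Rightarrow> 'v set \<Rightarrow> ('v \<Rightarrow> 'v) \<Rightarrow> bool" where
  "two_sided_linear_on lm rm D A \<longleftrightarrow> right_linear_on rm D A \<and> (\<forall>a. \<forall>v\<in>D. A (lm a v) = lm a (A v))"

section \<open>Operators in KC(V), given by their common domain D and components C 0..C 3\<close>

definition kcop :: "(quat \<Rightarrow> 'v::banach \<Rightarrow> 'v) \<Rightarrow> (nat \<Rightarrow> 'v \<Rightarrow> 'v) \<Rightarrow> 'v \<Rightarrow> 'v" where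
  "kcop lm C v = C 0 v + lm (qe 1) (C 1 v) + lm (qe 2) (C 2 v) + lm (qe 3) (C 3 v)"

definition kconj :: "(nat \<Rightarrow> 'v::banach \<Rightarrow> 'v) \<Rightarrow> nat \<Rightarrow> 'v \<Rightarrow> 'v" where
  "kconj C i = (if i = 0 then C 0 else (\<lambda>v. - C i v))"

definition dom_sq :: "(quat \<Rightarrow> 'v::banach \<Rightarrow> 'v) \<Rightarrow> 'v set \<Rightarrow> (nat \<Rightarrow> 'v \<Rightarrow> 'v) \<Rightarrow> 'v set" where
  "dom_sq lm D C = {v \<in> D. kcop lm C v \<in> D}"

definition KC :: "(quat \<Rightarrow> 'v::banach \<Rightarrow> 'v) \<Rightarrow> (quat \<Rightarrow> 'v \<Rightarrow> 'v) \<Rightarrow> 'v set \<Rightarrow> (nat \<Rightarrow> 'v \<Rightarrow> 'v) \<Rightarrow> bool" where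
  "KC lm rm D C \<longleftrightarrow>
     two_sided_subspace lm rm D \<and>
     right_linear_on rm D (kcop lm C) \<and>
     closed {(v, kcop lm C v) | v. v \<in> D} \<and>
     (\<forall>i<4. two_sided_linear_on lm rm D (C i)) \<and>
     (\<forall>i<4. \<forall>j<4. \<forall>v\<in>dom_sq lm D C. C j v \<in> D \<and> C i (C j v) = C j (C i v))"

definition Qcs :: "(quat \<Rightarrow> 'v::banach \<Rightarrow> 'v) \<Rightarrow> (nat \<Rightarrow> 'v \<Rightarrow> 'v) \<Rightarrow> quat \<Rightarrow> 'v \<Rightarrow> 'v" where
  "Qcs lm C s v = lm (qmul s s) v - lm (2 *\<^sub>R s) (C 0 v) + (\<Sum>i\<in>{0..3}. C i (C i v))"

definition S_resolvent_set :: "(quat \<Rightarrow> 'v::banach \<Rightarrow> 'v) \<Rightarrow> 'v set \<Rightarrow> (nat \<Rightarrow> 'v \<Rightarrow> 'v) \<Rightarrow> quat set" where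
  "S_resolvent_set lm D C = {s. bij_betw (Qcs lm C s) (dom_sq lm D C) UNIV}"

definition S_spectrum :: "(quat \<Rightarrow> 'v::banach \<Rightarrow> 'v) \<Rightarrow> 'v set \<Rightarrow> (nat \<Rightarrow> 'v \<Rightarrow> 'v) \<Rightarrow> quat set" where
  "S_spectrum lm D C = - S_resolvent_set lm D C"

definition Qinv :: "(quat \<Rightarrow> 'v::banach \<Rightarrow> 'v) \<Rightarrow> 'v set \<Rightarrow> (nat \<Rightarrow> 'v \<Rightarrow> 'v) \<Rightarrow> quat \<Rightarrow> 'v \<Rightarrow> 'v" where
  "Qinv lm D C s = the_inv_into (dom_sq lm D C) (Qcs lm C s)"

definition SLres :: "(quat \<Rightarrow> 'v::banach \<Rightarrow> 'v) \<Rightarrow> 'v set \<Rightarrow> (nat \<Rightarrow> 'v \<Rightarrow> 'v) \<Rightarrow> quat \<Rightarrow> 'v \<Rightarrow> 'v" where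
  "SLres lm D C s v = lm s (Qinv lm D C s v) - kcop lm (kconj C) (Qinv lm D C s v)"

definition SRres :: "(quat \<Rightarrow> 'v::banach \<Rightarrow> 'v) \<Rightarrow> 'v set \<Rightarrow> (nat \<Rightarrow> 'v \<Rightarrow> 'v) \<Rightarrow> quat \<Rightarrow> 'v \<Rightarrow> 'v" where
  "SRres lm D C s v = lm s (Qinv lm D C s v)
      - (\<Sum>i\<in>{0..3}. C i (Qinv lm D C s (lm (qcnj (qe i)) v)))"

definition of_type :: "(quat \<Rightarrow> 'v::banach \<Rightarrow> 'v) \<Rightarrow> 'v set \<Rightarrow> (nat \<Rightarrow> 'v \<Rightarrow> 'v) \<Rightarrow> real \<Rightarrow> bool" where
  "of_type lm D C \<omega> \<longleftrightarrow>
     S_spectrum lm D C \<subseteq> closure (sector \<omega>) \<and>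
     (\<forall>\<theta>. \<omega> < \<theta> \<and> \<theta> < pi \<longrightarrow> (\<exists>K. \<forall>s. s \<notin> sector \<theta> \<and> s \<noteq> 0 \<longrightarrow>
        (\<forall>v. norm (SLres lm D C s v) \<le> K / norm s * norm v) \<and>
        (\<forall>v. norm (SRres lm D C s v) \<le> K / norm s * norm v)))"

text \<open>The path gamma along the boundary of S_phi intersected with C_J, and its derivative.\<close>
definition gam :: "real \<Rightarrow> quat \<Rightarrow> real \<Rightarrow> quat" where
  "gam \<phi> J t = (if t < 0 then (- t) *\<^sub>R qexpJ J \<phi> else t *\<^sub>R qexpJ J (- \<phi>))"

definition dgam :: "real \<Rightarrow> quat \<Rightarrow> real \<Rightarrow> quat" where
  "dgam \<phi> J t = (if t < 0 then - qexpJ J \<phi> else qexpJ J (- \<phi>))"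

text \<open>(1/2pi) int S_L^{-1}(s,T) ds_J h(s), with phi = (omega+theta)/2 and J = e1
  (the result is known to be independent of these choices).\<close>
definition S_calc :: "(quat \<Rightarrow> 'v::banach \<Rightarrow> 'v) \<Rightarrow> 'v set \<Rightarrow> (nat \<Rightarrow> 'v \<Rightarrow> 'v) \<Rightarrow> real \<Rightarrow> real
     \<Rightarrow> (quat \<Rightarrow> quat) \<Rightarrow> 'v \<Rightarrow> 'v" where
  "S_calc lm D C \<omega> \<theta> h v =
     (let \<phi> = (\<omega> + \<theta>) / 2; J = qe 1 in
      (1 / (2 * pi)) *\<^sub>R integral (UNIV - {0})
        (\<lambda>t. SLres lm D C (gam \<phi> J t) (lm (qmul (dgam \<phi> J t) (qmul (qinv J) (h (gam \<phi> J t)))) v)))"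

definition H_calc :: "(quat \<Rightarrow> 'v::banach \<Rightarrow> 'v) \<Rightarrow> 'v set \<Rightarrow> (nat \<Rightarrow> 'v \<Rightarrow> 'v) \<Rightarrow> real \<Rightarrow> real
     \<Rightarrow> (quat \<Rightarrow> quat) \<Rightarrow> 'v \<Rightarrow> 'v" where
  "H_calc lm D C \<omega> \<theta> h v =
     (let \<phi> = (\<omega> + \<theta>) / 2; J = qe 1 in
      (- 1 / pi) *\<^sub>R integral (UNIV - {0})
        (\<lambda>t. Qinv lm D C (gam \<phi> J t) (lm (qmul (dgam \<phi> J t) (qmul (qinv J) (h (gam \<phi> J t)))) v)))"

subsection \<open>Unbounded operators as (domain, map) pairs, with natural domains\<close>

type_synonym 'v uop = "'v set \<times> ('v \<Rightarrow> 'v)"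

definition bop :: "('v \<Rightarrow> 'v) \<Rightarrow> 'v uop" where
  "bop A = (UNIV, A)"

definition uinv :: "'v uop \<Rightarrow> 'v uop" where
  "uinv A = (snd A ` fst A, the_inv_into (fst A) (snd A))"

definition ucomp :: "'v uop \<Rightarrow> 'v uop \<Rightarrow> 'v uop" where
  "ucomp A B = ({v \<in> fst B. snd B v \<in> fst A}, \<lambda>v. snd A (snd B v))"

definition udiff :: "'v::ab_group_add uop \<Rightarrow> 'v uop \<Rightarrow> 'v uop" where
  "udiff A B = (fst A \<inter> fst B, \<lambda>v. snd A v - snd B v)"

definition uinj :: "'v uop \<Rightarrow> bool" where
  "uinj A \<longleftrightarrow> inj_on (snd A) (fst A)"

definition uop_eq :: "'v uop \<Rightarrow> 'v uop \<Rightarrow> bool" where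
  "uop_eq A B \<longleftrightarrow> fst A = fst B \<and> (\<forall>v\<in>fst A. snd A v = snd B v)"

definition regularizer :: "(quat \<Rightarrow> 'v::banach \<Rightarrow> 'v) \<Rightarrow> 'v set \<Rightarrow> (nat \<Rightarrow> 'v \<Rightarrow> 'v) \<Rightarrow> real \<Rightarrow> real
     \<Rightarrow> (quat \<Rightarrow> quat) \<Rightarrow> (quat \<Rightarrow> quat) \<Rightarrow> bool" where
  "regularizer lm D C \<omega> \<theta> f e \<longleftrightarrow>
     e \<in> Psi \<theta> \<and> inj (S_calc lm D C \<omega> \<theta> e) \<and> fmul e f \<in> Psi_L \<theta>"

definition FL_calc :: "(quat \<Rightarrow> 'v::banach \<Rightarrow> 'v) \<Rightarrow> 'v set \<Rightarrow> (nat \<Rightarrow> 'v \<Rightarrow> 'v) \<Rightarrow> real \<Rightarrow> real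
     \<Rightarrow> (quat \<Rightarrow> quat) \<Rightarrow> 'v uop" where
  "FL_calc lm D C \<omega> \<theta> f =
     (let e = (SOME e. regularizer lm D C \<omega> \<theta> f e) in
      ucomp (uinv (bop (S_calc lm D C \<omega> \<theta> e))) (bop (S_calc lm D C \<omega> \<theta> (fmul e f))))"

definition DfT_1 :: "(quat \<Rightarrow> 'v::banach \<Rightarrow> 'v) \<Rightarrow> 'v set \<Rightarrow> (nat \<Rightarrow> 'v \<Rightarrow> 'v) \<Rightarrow> real \<Rightarrow> real
     \<Rightarrow> (quat \<Rightarrow> quat) \<Rightarrow> (quat \<Rightarrow> quat) \<Rightarrow> 'v uop" where
  "DfT_1 lm D C \<omega> \<theta> f e =
     ucomp (uinv (FL_calc lm D (kconj C) \<omega> \<theta> e))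
       (udiff (bop (H_calc lm D C \<omega> \<theta> (fmul e f)))
              (ucomp (FL_calc lm D C \<omega> \<theta> f) (bop (H_calc lm D C \<omega> \<theta> e))))"

definition DfT_2 :: "(quat \<Rightarrow> 'v::banach \<Rightarrow> 'v) \<Rightarrow> 'v set \<Rightarrow> (nat \<Rightarrow> 'v \<Rightarrow> 'v) \<Rightarrow> real \<Rightarrow> real
     \<Rightarrow> (quat \<Rightarrow> quat) \<Rightarrow> (quat \<Rightarrow> quat) \<Rightarrow> 'v uop" where
  "DfT_2 lm D C \<omega> \<theta> f e =
     ucomp (uinv (FL_calc lm D C \<omega> \<theta> e))
       (udiff (bop (H_calc lm D C \<omega> \<theta> (fmul e f)))
              (ucomp (FL_calc lm D (kconj C) \<omega> \<theta> f) (bop (H_calc lm D C \<omega> \<theta> e))))"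

definition harm_regularizer :: "(quat \<Rightarrow> 'v::banach \<Rightarrow> 'v) \<Rightarrow> 'v set \<Rightarrow> (nat \<Rightarrow> 'v \<Rightarrow> 'v) \<Rightarrow> real \<Rightarrow> real
     \<Rightarrow> (quat \<Rightarrow> quat) \<Rightarrow> (quat \<Rightarrow> quat) \<Rightarrow> bool" where
  "harm_regularizer lm D C \<omega> \<theta> f e \<longleftrightarrow>
     e \<in> PsiQ \<theta> \<and> uinj (FL_calc lm D C \<omega> \<theta> e) \<and> uinj (FL_calc lm D (kconj C) \<omega> \<theta> e) \<and>
     fmul e f \<in> PsiQ_L \<theta>"

end

theory Submission
  imports Defs "HOL-Complex_Analysis.Complex_Analysis" "HOL-Real_Asymp.Real_Asymp"
begin

text \<open>In the coordinate \<open>s = exp z\<close> the two rays of the path become the two lines \<open>Im z = \<plusminus> \<phi>\<close>, and a left slice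
  hyperholomorphic function becomes a pair of holomorphic functions \<open>h\<^sub>1 + h\<^sub>2 e\<^sub>2\<close> on a strip. Both calculi are
  then contour integrals of \<open>q s = Q\<^bsub>c,s\<^esub>\<^sup>-\<^sup>1(T)\<close> and \<open>w i s = T\<^sub>i q s\<close>. These operators commute, satisfy resolvent
  identities and the exchange rules \<open>w i s q p = q s w i p\<close>; they are bounded by \<open>K / \<bar>s\<bar>\<^sup>2\<close> and \<open>K / \<bar>s\<bar>\<close>, because
  conjugation by the units separates the components of the difference of the S-resolvents of \<open>T\<close> and of its conjugate.
  With \<open>A e\<close> the harmonic integral and \<open>T'\<close> the conjugate of \<open>T\<close>, the resolvent identities give \<open>(ef)(T) = e(T) f(T)\<close>
  and \<open>A (ef) = e(T') A f + f(T) A e\<close>; the exchange rules give \<open>(e(T') - e(T)) A g = (g(T') - g(T)) A e\<close>, also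
  with a factor \<open>h(T)\<close> inserted before \<open>A\<close>.

  Multiplying by \<open>e(T)\<close> and cancelling the regularizer of \<open>f\<close>, the pair \<open>(v, y)\<close> lies in the graph of the first operator
  iff \<open>e(T) e(T') y = -2 (e(T) A (ef) - (ef)(T) A e) v\<close>. The right hand side is symmetric in \<open>T\<close> and \<open>T'\<close>, and for a second
  regularizer the two conditions become the same after cross multiplication. Regularizers are powers of
  \<open>s / ((1 + s) (2 + s))\<close>, whose value at \<open>T\<close> is \<open>2 (2 + T)\<^sup>-\<^sup>1 - (1 + T)\<^sup>-\<^sup>1\<close>, injective with \<open>T\<close>. Finally \<open>D f = D g\<close> on
  the sector forces \<open>f = g\<close> there, since \<open>D f\<close> is \<open>-2 / v\<close> times the slice component \<open>\<beta>\<close> of \<open>f\<close>,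
  and a function in \<open>\<Psi>\<^sub>L\<close> with \<open>\<beta> = 0\<close> is a decaying constant.\<close>

section \<open>Integrals of exponentially decaying functions\<close>

text \<open>The obstacle is noncommutativity. A left slice function f need not be intrinsic, so f(T)
  need not commute with the units \<open>e1\<close>, \<open>e2\<close>, \<open>e3\<close>; what
  commutes with the units and with the calculus of other functions is a component
  \<open>U i e\<close> of an intrinsic e. Hence the object that gets exchanged is the difference
  e(T') - e(T), a combination of the products of \<open>e1\<close>, \<open>e2\<close>,
  \<open>e3\<close> with these components, and comparing two regularizers calls for the variant with
  h(T) inserted. Type \<omega> for T alone would control only the sum of the parts of the
  S-resolvent; the hypothesis on both operators isolates them. The coordinate s = exp z turns ds / s
  into Lebesgue measure on two lines and powers of the modulus into exponentials. Convergence,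
  Fubini and contour shifts then concern continuous Banach space valued functions with exponential
  decay, and limits of integrals over [-N, N] suffice. The regularizing function s / ((1 + s) (2 +
  s)) has two distinct simple poles on the negative axis, so partial fractions express its value at
  T by two ordinary resolvents and no square of a resolvent appears.\<close>

definition rapid :: "(real \<Rightarrow> 'b::real_normed_vector) \<Rightarrow> bool" where
  "rapid k \<longleftrightarrow> continuous_on UNIV k \<and> (\<exists>M. \<exists>c>0. \<forall>x. norm (k x) \<le> M * exp (- c * \<bar>x\<bar>))"

lemma rapidI: "continuous_on UNIV k \<Longrightarrow> c > 0 \<Longrightarrow> (\<And>x. norm (k x) \<le> M * exp (- c * \<bar>x\<bar>)) \<Longrightarrow> rapid k"
  unfolding rapid_def by blast

lemma exp_abs_mono: "c \<le> d \<Longrightarrow> exp (- d * \<bar>x::real\<bar>) \<le> exp (- c * \<bar>x\<bar>)"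
  by (simp add: mult_right_mono)

lemma exp_bound_weaken:
  fixes n M d c x :: real
  assumes "n \<le> M * exp (- d * \<bar>x\<bar>)" "c \<le> d"
  shows "n \<le> \<bar>M\<bar> * exp (- c * \<bar>x\<bar>)"
proof -
  have "n \<le> \<bar>M\<bar> * exp (- d * \<bar>x\<bar>)" using assms(1) by (smt (verit) abs_ge_self exp_gt_zero mult_right_mono)
  also have "\<dots> \<le> \<bar>M\<bar> * exp (- c * \<bar>x\<bar>)" by (intro mult_left_mono exp_abs_mono assms) auto
  finally show ?thesis .
qed

lemma rapid_add:
  assumes "rapid k" "rapid l" shows "rapid (\<lambda>x. k x + l x)"
proof -
  obtain M c where k: "continuous_on UNIV k" "c > 0" "\<And>x. norm (k x) \<le> M * exp (- c * \<bar>x\<bar>)"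
    using assms(1) unfolding rapid_def by blast
  obtain N d where l: "continuous_on UNIV l" "d > 0" "\<And>x. norm (l x) \<le> N * exp (- d * \<bar>x\<bar>)"
    using assms(2) unfolding rapid_def by blast
  show ?thesis
  proof (rule rapidI[where c = "min c d" and M = "\<bar>M\<bar> + \<bar>N\<bar>"])
    show "continuous_on UNIV (\<lambda>x. k x + l x)" using k l by (intro continuous_intros)
    show "min c d > 0" using k l by auto
    fix x
    have "norm (k x) \<le> \<bar>M\<bar> * exp (- min c d * \<bar>x\<bar>)" by (rule exp_bound_weaken[OF k(3)]) auto
    moreover have "norm (l x) \<le> \<bar>N\<bar> * exp (- min c d * \<bar>x\<bar>)" by (rule exp_bound_weaken[OF l(3)]) auto
    ultimately show "norm (k x + l x) \<le> (\<bar>M\<bar> + \<bar>N\<bar>) * exp (- min c d * \<bar>x\<bar>)"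
      using norm_triangle_ineq[of "k x" "l x"] by (simp add: algebra_simps)
  qed
qed

lemma rapid_bounded_linear:
  assumes "bounded_linear T" "rapid k" shows "rapid (\<lambda>x. T (k x))"
proof -
  interpret T: bounded_linear T by fact
  obtain M c where k: "continuous_on UNIV k" "c > 0" "\<And>x. norm (k x) \<le> M * exp (- c * \<bar>x\<bar>)"
    using assms(2) unfolding rapid_def by blast
  obtain B where B: "B > 0" "\<And>x. norm (T x) \<le> norm x * B" using T.pos_bounded by blast
  show ?thesis
  proof (rule rapidI[where c = c and M = "M * B"])
    show "continuous_on UNIV (\<lambda>x. T (k x))" using k by (intro T.continuous_on)
    fix x have "norm (T (k x)) \<le> norm (k x) * B" by (rule B)
    also have "\<dots> \<le> (M * exp (- c * \<bar>x\<bar>)) * B" using B k(3) by (intro mult_right_mono) auto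
    finally show "norm (T (k x)) \<le> M * B * exp (- c * \<bar>x\<bar>)" by (simp add: mult_ac)
  qed (use k in auto)
qed

lemma rapid_minus: "rapid k \<Longrightarrow> rapid (\<lambda>x. - k x)"
  using rapid_bounded_linear[OF bounded_linear_minus[OF bounded_linear_ident]] by blast

lemma rapid_diff: "rapid k \<Longrightarrow> rapid l \<Longrightarrow> rapid (\<lambda>x. k x - l x)"
  using rapid_add[OF _ rapid_minus] by fastforce

lemma rapid_reflect: "rapid k \<Longrightarrow> rapid (\<lambda>x. k (- x))"
proof -
  assume "rapid k"
  then obtain M c where k: "continuous_on UNIV k" "c > 0" "\<And>x. norm (k x) \<le> M * exp (- c * \<bar>x\<bar>)"
    unfolding rapid_def by blast
  show ?thesis
    by (rule rapidI[where M = M, OF _ k(2)])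
      (use k(3)[of "- x" for x] in \<open>auto intro!: continuous_on_compose2[OF k(1)] continuous_intros\<close>)
qed

lemma has_integral_exp_neg:
  fixes c :: real assumes "c > 0" "a \<le> b"
  shows "((\<lambda>x. M * exp (- c * x)) has_integral (M / c * (exp (- c * a) - exp (- c * b)))) {a..b}"
proof -
  have "((\<lambda>x. M * exp (- c * x)) has_integral ((- M / c * exp (- c * b)) - (- M / c * exp (- c * a)))) {a..b}"
    using assms
    by (intro fundamental_theorem_of_calculus)
       (auto intro!: derivative_eq_intros simp: has_real_derivative_iff_has_vector_derivative[symmetric])
  then show ?thesis by (simp add: algebra_simps diff_divide_distrib)
qed

lemma norm_integral_le_exp:
  fixes k :: "real \<Rightarrow> 'b::banach"
  assumes "continuous_on UNIV k" "c > 0" "\<And>x. norm (k x) \<le> M * exp (- c * \<bar>x\<bar>)" "0 \<le> a" "a \<le> b"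
  shows "norm (integral {a..b} k) \<le> M / c * exp (- c * a)"
proof -
  have M: "M \<ge> 0" using order_trans[OF norm_ge_zero assms(3)[of 0]] by simp
  have "norm (integral {a..b} k) \<le> integral {a..b} (\<lambda>x. M * exp (- c * x))"
  proof (rule integral_norm_bound_integral)
    show "k integrable_on {a..b}" using assms by (intro integrable_continuous_real continuous_on_subset[OF assms(1)]) auto
    show "(\<lambda>x. M * exp (- c * x)) integrable_on {a..b}" using has_integral_exp_neg[OF assms(2,5)] by blast
    show "norm (k x) \<le> M * exp (- c * x)" if "x \<in> {a..b}" for x using assms(3)[of x] assms(4) that by auto
  qed
  also have "\<dots> = M / c * (exp (- c * a) - exp (- c * b))" by (rule integral_unique[OF has_integral_exp_neg[OF assms(2,5)]])
  also have "\<dots> \<le> M / c * exp (- c * a)" using M assms(2) by (intro mult_left_mono) auto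
  finally show ?thesis .
qed

text \<open>Continuity at the exceptional points lets the substitution \<open>t = exp x\<close> below be read off at
  the end point \<open>t = 0\<close> as well.\<close>
lemma has_integral_UNIV_antiderivative:
  fixes G :: "real \<Rightarrow> 'b::banach"
  assumes "finite S" "continuous_on UNIV G" "\<And>x. x \<notin> S \<Longrightarrow> (G has_vector_derivative k x) (at x)"
    and "(G \<longlongrightarrow> g1) at_top" "(G \<longlongrightarrow> g0) at_bot"
  shows "(k has_integral (g1 - g0)) UNIV"
proof -
  have FTC: "(k has_integral (G b - G a)) {a..b}" if "a \<le> b" for a b
    using assms that by (intro fundamental_theorem_of_calculus_strong[of S]) (auto intro: continuous_on_subset)
  show ?thesis unfolding has_integral_alt'[where s=UNIV and f=k]
  proof (intro conjI allI impI)
    fix a b :: real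
    have "k integrable_on {a..b}"
      using FTC[of a b] by (cases "a \<le> b") (auto simp: integrable_on_def intro: has_integral_empty)
    then show "(\<lambda>x. if x \<in> UNIV then k x else 0) integrable_on cbox a b" by simp
  next
    fix e :: real assume e: "e > 0"
    obtain B1 where B1: "\<And>x. x \<ge> B1 \<Longrightarrow> dist (G x) g1 < e/2"
      using tendstoD[OF assms(4), of "e/2"] e by (auto simp: eventually_at_top_linorder)
    obtain B0 where B0: "\<And>x. x \<le> B0 \<Longrightarrow> dist (G x) g0 < e/2"
      using tendstoD[OF assms(5), of "e/2"] e by (auto simp: eventually_at_bot_linorder)
    define B where "B = \<bar>B0\<bar> + \<bar>B1\<bar> + 1"
    show "\<exists>B>0. \<forall>a b. ball 0 B \<subseteq> cbox a b \<longrightarrow>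
            norm (integral (cbox a b) (\<lambda>x. if x \<in> UNIV then k x else 0) - (g1 - g0)) < e"
    proof (intro exI conjI allI impI)
      show "B > 0" by (simp add: B_def)
      fix a b :: real assume "ball 0 B \<subseteq> cbox a b"
      then have sub: "{-B<..<B} \<subseteq> {a..b}" by (auto simp: ball_def dist_real_def subset_iff)
      then have "closure {-B<..<B} \<subseteq> {a..b}" by (intro closure_minimal) auto
      then have ab: "a \<le> -B" "B \<le> b" using \<open>B > 0\<close> by auto
      have I: "integral {a..b} k = G b - G a" using FTC[of a b] ab \<open>B>0\<close> by (intro integral_unique) auto
      have "dist (G b) g1 < e/2" using B1[of b] ab by (auto simp: B_def)
      moreover have "dist (G a) g0 < e/2" using B0[of a] ab by (auto simp: B_def)
      ultimately show "norm (integral (cbox a b) (\<lambda>x. if x \<in> UNIV then k x else 0) - (g1 - g0)) < e"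
        using norm_triangle_ineq4[of "G b - g1" "G a - g0"]
        by (simp add: I dist_norm algebra_simps)
    qed
  qed
qed

text \<open>Increments of \<open>G\<close> beyond \<open>a \<ge> 0\<close> are integrals of
  \<open>k\<close> and at most \<open>M / c * exp (- c * a)\<close>; so \<open>G\<close> is Cauchy
  at infinity and completeness supplies the limit.\<close>

lemma antiderivative_limit_at_top:
  fixes k :: "real \<Rightarrow> 'b::banach"
  assumes "rapid k" "\<And>x. (G has_vector_derivative k x) (at x)"
  shows "\<exists>g. (G \<longlongrightarrow> g) at_top"
proof -
  obtain M c where k: "continuous_on UNIV k" "c > 0" "\<And>x. norm (k x) \<le> M * exp (- c * \<bar>x\<bar>)"
    using assms(1) unfolding rapid_def by blast
  have diff: "norm (G b - G a) \<le> M / c * exp (- c * a)" if "0 \<le> a" "a \<le> b" for a b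
  proof -
    have "(k has_integral (G b - G a)) {a..b}"
      using that assms(2) by (intro fundamental_theorem_of_calculus) (auto intro: has_vector_derivative_at_within)
    then have "integral {a..b} k = G b - G a" by (rule integral_unique)
    then show ?thesis using norm_integral_le_exp[OF k that] by simp
  qed
  have lim0: "((\<lambda>x. M / c * exp (- c * x)) \<longlongrightarrow> 0) at_top"
    using k(2) by real_asymp
  have "cauchy_filter (filtermap G at_top)"
    unfolding cauchy_filter_metric_filtermap
  proof (intro allI impI)
    fix e :: real assume "e > 0"
    then have "eventually (\<lambda>x. M / c * exp (- c * x) < e/2) at_top"
      using order_tendstoD(2)[OF lim0, of "e/2"] by simp
    then obtain N where N: "\<And>x. x \<ge> N \<Longrightarrow> M / c * exp (- c * x) < e/2" by (auto simp: eventually_at_top_linorder)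
    define A where "A = max 0 N"
    have "dist (G x) (G y) < e" if "x \<ge> A" "y \<ge> A" for x y
    proof -
      have "norm (G x - G A) < e/2" "norm (G y - G A) < e/2"
        using diff[of A x] diff[of A y] N[of A] that unfolding A_def by (smt (verit))+
      then show ?thesis using norm_triangle_ineq4[of "G x - G A" "G y - G A"] by (simp add: dist_norm)
    qed
    then show "\<exists>P. eventually P at_top \<and> (\<forall>x y. P x \<and> P y \<longrightarrow> dist (G x) (G y) < e)"
      by (intro exI[of _ "\<lambda>x. x \<ge> A"]) (auto simp: eventually_ge_at_top)
  qed
  then show ?thesis
    using complete_uniform[where S = "UNIV :: 'b set"] complete_UNIV
    by (force simp: filterlim_def filtermap_bot_iff)
qed

lemma rapid_antiderivative:
  fixes k :: "real \<Rightarrow> 'b::banach"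
  assumes "rapid k"
  obtains G g1 g0 where "\<And>x. (G has_vector_derivative k x) (at x)" "(G \<longlongrightarrow> g1) at_top" "(G \<longlongrightarrow> g0) at_bot"
proof -
  have k: "continuous_on UNIV k" using assms by (simp add: rapid_def)
  then have kc: "continuous_on {a..b} k" for a b by (rule continuous_on_subset) auto
  \<comment> \<open>The signed integral from 0 to x: an integral over \<open>{a..b}\<close> with
    \<open>b < a\<close> is 0, so at most one of the two terms survives.\<close>
  define G where "G x = integral {0..x} k - integral {x..0} k" for x
  have G: "G x = integral {-N..x} k - integral {-N..0} k" if "-N \<le> x" "N \<ge> 0" for x N
  proof (cases "x \<ge> 0")
    case True
    then have "integral {-N..0} k + integral {0..x} k = integral {-N..x} k"
      using that by (intro Henstock_Kurzweil_Integration.integral_combine integrable_continuous_real kc) auto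
    moreover have "integral {x..0} k = 0" using True by (cases "x = 0") auto
    ultimately show ?thesis by (simp add: G_def algebra_simps)
  next
    case False
    then have "integral {-N..x} k + integral {x..0} k = integral {-N..0} k"
      using that by (intro Henstock_Kurzweil_Integration.integral_combine integrable_continuous_real kc) auto
    then show ?thesis using False by (simp add: G_def algebra_simps)
  qed
  have der: "(G has_vector_derivative k x) (at x)" for x
  proof -
    define N where "N = \<bar>x\<bar> + 1"
    have "((\<lambda>u. integral {-N..u} k) has_vector_derivative k x) (at x within {-N..N})"
      by (rule integral_has_vector_derivative[OF kc]) (auto simp: N_def)
    then have "((\<lambda>u. integral {-N..u} k) has_vector_derivative k x) (at x)"
      using at_within_interior[of x "{-N..N}"] by (auto simp: N_def abs_real_def split: if_splits)
    then have "((\<lambda>u. integral {-N..u} k - integral {-N..0} k) has_vector_derivative k x) (at x)"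
      by (auto intro!: derivative_eq_intros)
    then show ?thesis
      by (rule has_vector_derivative_transform_within_open[where S="{-N<..}"]) (use G[of N] in \<open>auto simp: N_def\<close>)
  qed
  obtain g1 where g1: "(G \<longlongrightarrow> g1) at_top" using antiderivative_limit_at_top[OF assms der] by blast
  \<comment> \<open>The limit at the left end follows by reflection: \<open>- G (- x)\<close> is an
    antiderivative of the reflected function, which is again rapid.\<close>
  have "((\<lambda>x. - G (- x)) has_vector_derivative k (- x)) (at x)" for x
  proof -
    have "(uminus has_vector_derivative (-1)) (at x)" by (auto intro!: derivative_eq_intros)
    from vector_diff_chain_at[OF this der] have "((\<lambda>x. G (- x)) has_vector_derivative - k (- x)) (at x)"
      by (simp add: o_def)
    from has_vector_derivative_minus[OF this] show ?thesis by simp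
  qed
  then obtain g0 where "((\<lambda>x. - G (- x)) \<longlongrightarrow> g0) at_top"
    using antiderivative_limit_at_top[OF rapid_reflect[OF assms], of "\<lambda>x. - G (- x)"] by blast
  then have "(G \<longlongrightarrow> - g0) at_bot"
    using tendsto_minus[of "\<lambda>x. - G (- x)"] by (simp add: filterlim_at_bot_mirror)
  with der g1 show ?thesis using that by blast
qed

lemma rapid_integrable: "rapid (k :: real \<Rightarrow> 'b::banach) \<Longrightarrow> k integrable_on UNIV"
  by (erule rapid_antiderivative)
     (blast intro: has_integral_integrable has_integral_UNIV_antiderivative[of "{}"]
        continuous_at_imp_continuous_on has_vector_derivative_continuous)

lemma rapid_integral_limit:
  fixes k :: "real \<Rightarrow> 'b::banach"
  assumes "rapid k"
  shows "((\<lambda>N. integral {-N..N} k) \<longlongrightarrow> integral UNIV k) at_top"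
proof -
  obtain G g1 g0 where G: "\<And>x. (G has_vector_derivative k x) (at x)" "(G \<longlongrightarrow> g1) at_top" "(G \<longlongrightarrow> g0) at_bot"
    using rapid_antiderivative[OF assms] by blast
  have "integral UNIV k = g1 - g0"
    using G by (intro integral_unique has_integral_UNIV_antiderivative[of "{}"])
      (auto intro: continuous_at_imp_continuous_on has_vector_derivative_continuous)
  moreover have "((\<lambda>N. G N - G (-N)) \<longlongrightarrow> g1 - g0) at_top"
    using G by (intro tendsto_diff) (auto simp: filterlim_at_bot_mirror)
  moreover have "eventually (\<lambda>N. G N - G (-N) = integral {-N..N} k) at_top"
    using eventually_ge_at_top[of 0]
    by eventually_elim (auto intro!: integral_unique[symmetric] fundamental_theorem_of_calculus G intro: has_vector_derivative_at_within)
  ultimately show ?thesis by (simp add: tendsto_cong)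
qed

text \<open>The substitution t = exp x, which carries a line of the strip to a ray; dx = dt / t
  explains the factor. It is carried out on an antiderivative composed with
  \<open>ln\<close>.\<close>

lemma rapid_integral_log:
  fixes k :: "real \<Rightarrow> 'b::banach"
  assumes "rapid k"
  shows "((\<lambda>t. (1 / t) *\<^sub>R k (ln t)) has_integral (integral UNIV k)) {0<..}"
proof -
  obtain G g1 g0 where G: "\<And>x. (G has_vector_derivative k x) (at x)" "(G \<longlongrightarrow> g1) at_top" "(G \<longlongrightarrow> g0) at_bot"
    using rapid_antiderivative[OF assms] by blast
  have I: "integral UNIV k = g1 - g0"
    using G by (intro integral_unique has_integral_UNIV_antiderivative[of "{}"])
      (auto intro: continuous_at_imp_continuous_on has_vector_derivative_continuous)
  \<comment> \<open>Extended by the limit at 0, so that \<open>H\<close> is continuous on the whole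
    line and 0 is the only exceptional point for the derivative.\<close>
  define H where "H t = (if t \<le> 0 then g0 else G (ln t))" for t
  have Hpos: "(H has_vector_derivative (1 / t) *\<^sub>R k (ln t)) (at t)" if "t > 0" for t
  proof -
    have "(ln has_vector_derivative (1/t)) (at t)" using that
      by (auto intro!: derivative_eq_intros simp: has_real_derivative_iff_has_vector_derivative[symmetric] field_simps)
    from vector_diff_chain_at[OF this G(1)] have "((\<lambda>t. G (ln t)) has_vector_derivative (1 / t) *\<^sub>R k (ln t)) (at t)"
      by (simp add: o_def)
    then show ?thesis
      by (rule has_vector_derivative_transform_within_open[where S="{0<..}"]) (use that in \<open>auto simp: H_def\<close>)
  qed
  have Hneg: "(H has_vector_derivative 0) (at t)" if "t < 0" for t
    by (rule has_vector_derivative_transform_within_open[where S="{..<0}" and f="\<lambda>_. g0"]) (use that in \<open>auto simp: H_def\<close>)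
  have H0: "isCont H 0"
  proof -
    have "(H \<longlongrightarrow> g0) (at_right 0)"
    proof -
      have "((\<lambda>t. G (ln t)) \<longlongrightarrow> g0) (at_right 0)"
        by (rule filterlim_compose[OF G(3) ln_at_0])
      then show ?thesis
        by (rule Lim_transform_eventually) (auto simp: H_def eventually_at_filter)
    qed
    moreover have "(H \<longlongrightarrow> g0) (at_left 0)"
      by (rule Lim_transform_eventually[OF tendsto_const]) (auto simp: H_def eventually_at_filter)
    ultimately show ?thesis by (simp add: isCont_def filterlim_at_split H_def)
  qed
  have "((\<lambda>t. if t \<in> {0<..} then (1 / t) *\<^sub>R k (ln t) else 0) has_integral (g1 - g0)) UNIV"
  proof (rule has_integral_UNIV_antiderivative[of "{0}" H])
    show "continuous_on UNIV H"
    proof (rule continuous_at_imp_continuous_on, rule ballI)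
      fix t show "isCont H t"
        using H0 Hpos[of t] Hneg[of t] by (cases "t = 0"; cases "t > 0") (auto intro: has_vector_derivative_continuous)
    qed
    show "(H has_vector_derivative (if t \<in> {0<..} then (1 / t) *\<^sub>R k (ln t) else 0)) (at t)" if "t \<notin> {0}" for t
      using that Hpos[of t] Hneg[of t] by auto
    have "((\<lambda>t. G (ln t)) \<longlongrightarrow> g1) at_top" by (rule filterlim_compose[OF G(2) ln_at_top])
    then show "(H \<longlongrightarrow> g1) at_top"
      by (rule Lim_transform_eventually) (use eventually_gt_at_top[of 0] in eventually_elim, auto simp: H_def)
    show "(H \<longlongrightarrow> g0) at_bot"
      by (rule Lim_transform_eventually[OF tendsto_const]) (use eventually_le_at_bot[of 0] in eventually_elim, auto simp: H_def)
  qed auto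
  then show ?thesis unfolding has_integral_restrict_UNIV I .
qed

text \<open>The bound sees \<open>k\<close> only through \<open>M\<close> and \<open>c\<close>,
  which makes truncation uniform in a parameter; iterated integrals rely on this.\<close>

lemma rapid_integral_norm_le:
  fixes k :: "real \<Rightarrow> 'b::banach"
  assumes "continuous_on UNIV k" "c > 0" "\<And>x. norm (k x) \<le> M * exp (- c * \<bar>x\<bar>)"
    and "N \<ge> 0"
  shows "norm (integral UNIV k - integral {-N..N} k) \<le> 2 * M / c * exp (- c * N)"
proof -
  have r: "rapid k" using assms(1-3) by (rule rapidI)
  have kc: "continuous_on {a..b} k" for a b by (rule continuous_on_subset[OF assms(1)]) auto
  have "norm (integral {-N'..N'} k - integral {-N..N} k) \<le> 2 * M / c * exp (- c * N)" if "N' \<ge> N" for N'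
  proof -
    have 1: "integral {-N'..N'} k = integral {-N'..-N} k + integral {-N..N} k + integral {N..N'} k"
    proof -
      have "integral {-N'..-N} k + integral {-N..N} k = integral {-N'..N} k"
        using that \<open>N\<ge>0\<close> by (intro Henstock_Kurzweil_Integration.integral_combine integrable_continuous_real kc) auto
      moreover have "integral {-N'..N} k + integral {N..N'} k = integral {-N'..N'} k"
        using that \<open>N\<ge>0\<close> by (intro Henstock_Kurzweil_Integration.integral_combine integrable_continuous_real kc) auto
      ultimately show ?thesis by simp
    qed
    have 2: "norm (integral {N..N'} k) \<le> M / c * exp (- c * N)"
      by (rule norm_integral_le_exp[OF assms(1-3)]) (use that \<open>N\<ge>0\<close> in auto)
    have "norm (integral {N..N'} (\<lambda>x. k (- x))) \<le> M / c * exp (- c * N)"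
      by (rule norm_integral_le_exp)
        (use that \<open>N\<ge>0\<close> assms(2) assms(3)[of "- x" for x] in \<open>auto intro!: continuous_on_compose2[OF assms(1)] continuous_intros\<close>)
    then have 3: "norm (integral {-N'..-N} k) \<le> M / c * exp (- c * N)"
      by (simp add: Henstock_Kurzweil_Integration.integral_reflect_real[of "-N" "-N'" k, simplified])
    have "norm (integral {-N'..-N} k + integral {N..N'} k) \<le> 2 * M / c * exp (- c * N)"
      using norm_triangle_ineq[of "integral {-N'..-N} k" "integral {N..N'} k"] 2 3 by simp
    then show ?thesis unfolding 1 by (simp add: algebra_simps)
  qed
  then have "eventually (\<lambda>N'. norm (integral {-N'..N'} k - integral {-N..N} k) \<le> 2 * M / c * exp (- c * N)) at_top"
    unfolding eventually_at_top_linorder by blast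
  moreover have "((\<lambda>N'. norm (integral {-N'..N'} k - integral {-N..N} k)) \<longlongrightarrow> norm (integral UNIV k - integral {-N..N} k)) at_top"
    by (intro tendsto_intros rapid_integral_limit r)
  ultimately show ?thesis by (intro tendsto_upperbound[OF _ _ trivial_limit_at_top_linorder])
qed

text \<open>Fubini is reduced to squares, where it is known for continuous functions. Truncating the
  inner integral costs a multiple of \<open>exp (- c * n)\<close> uniformly in x, so the error still
  tends to 0 after integration over an outer interval of length \<open>2 * n\<close>.\<close>

lemma iterated_integral_limit:
  fixes K :: "real \<Rightarrow> real \<Rightarrow> 'b::banach"
  assumes cont: "continuous_on UNIV (\<lambda>(x,y). K x y)" and "c > 0"
    and le: "\<And>x y. norm (K x y) \<le> M * exp (- c * \<bar>x\<bar>) * exp (- c * \<bar>y\<bar>)"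
  shows "rapid (\<lambda>x. integral UNIV (K x))"
    and "((\<lambda>n. integral {-n..n} (\<lambda>x. integral {-n..n} (K x))) \<longlongrightarrow> integral UNIV (\<lambda>x. integral UNIV (K x))) at_top"
proof -
  define I where "I x = integral UNIV (K x)" for x
  define J where "J n x = integral {-n..n} (K x)" for n x
  have M: "M \<ge> 0" using order_trans[OF norm_ge_zero le[of 0 0]] by simp
  have contx: "continuous_on UNIV (K x)" for x
    by (rule continuous_on_compose2[OF cont, of UNIV "\<lambda>y. (x, y)", simplified]) (auto intro!: continuous_intros)
  have IJ: "norm (I x - J n x) \<le> 2 * (M * exp (- c * \<bar>x\<bar>)) / c * exp (- c * n)" if "n \<ge> 0" for x n
    unfolding I_def J_def by (rule rapid_integral_norm_le[OF contx \<open>c > 0\<close> le that])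
  have IJ': "norm (I x - J n x) \<le> 2 * M / c * exp (- c * n)" if "n \<ge> 0" for x n
  proof -
    have "2 * (M * exp (- c * \<bar>x\<bar>)) / c * exp (- c * n) \<le> 2 * (M * 1) / c * exp (- c * n)"
      using M \<open>c > 0\<close> by (intro mult_right_mono divide_right_mono mult_left_mono) auto
    then show ?thesis using IJ[OF that, of x] by simp
  qed
  have Jc: "continuous_on UNIV (J n)" for n
    using integral_continuous_on_param[of UNIV "-n" n K] continuous_on_subset[OF cont] by (simp add: J_def[abs_def])
  have lim: "((\<lambda>n. 2 * M / c * exp (- c * n)) \<longlongrightarrow> 0) at_top" using \<open>c > 0\<close> by real_asymp
  have "uniform_limit UNIV J I at_top"
    unfolding uniform_limit_iff
  proof (intro allI impI)
    fix e :: real assume "e > 0"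
    show "\<forall>\<^sub>F n in at_top. \<forall>x\<in>UNIV. dist (J n x) (I x) < e"
      using order_tendstoD(2)[OF lim \<open>e > 0\<close>] eventually_ge_at_top[of 0]
    proof eventually_elim
      case (elim n) then show ?case using IJ'[of n] by (auto simp: dist_norm norm_minus_commute intro: le_less_trans)
    qed
  qed
  then have Ic: "continuous_on UNIV I"
    by (rule uniform_limit_theorem[rotated]) (auto simp: Jc)
  have rI: "rapid I"
    by (rule rapidI[OF Ic \<open>c > 0\<close>, of "2 * M / c"]) (use IJ[of 0] in \<open>auto simp: J_def algebra_simps\<close>)
  then show "rapid (\<lambda>x. integral UNIV (K x))" by (simp add: I_def[abs_def])
  have "((\<lambda>n. integral {-n..n} I - integral {-n..n} (J n)) \<longlongrightarrow> 0) at_top"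
  proof (rule Lim_null_comparison)
    show "((\<lambda>n. 2 * M / c * exp (- c * n) * (2 * n)) \<longlongrightarrow> 0) at_top" using \<open>c > 0\<close> by real_asymp
    show "\<forall>\<^sub>F n in at_top. norm (integral {-n..n} I - integral {-n..n} (J n)) \<le> 2 * M / c * exp (- c * n) * (2 * n)"
      using eventually_ge_at_top[of 0]
    proof eventually_elim
      case (elim n)
      have int: "I integrable_on {-n..n}" "J n integrable_on {-n..n}"
        using continuous_on_subset[OF Ic] continuous_on_subset[OF Jc] by (auto intro!: integrable_continuous_real)
      have "norm (integral {-n..n} (\<lambda>x. I x - J n x)) \<le> 2 * M / c * exp (- c * n) * (n - (- n))"
        by (rule integral_bound) (use elim IJ' in \<open>auto intro!: continuous_intros continuous_on_subset[OF Ic] continuous_on_subset[OF Jc]\<close>)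
      then show ?case using int by (simp add: Henstock_Kurzweil_Integration.integral_diff)
    qed
  qed
  then have "((\<lambda>n. integral {-n..n} I - (integral {-n..n} I - integral {-n..n} (J n))) \<longlongrightarrow> integral UNIV I - 0) at_top"
    by (intro tendsto_diff rapid_integral_limit rI)
  then show "((\<lambda>n. integral {-n..n} (\<lambda>x. integral {-n..n} (K x))) \<longlongrightarrow> integral UNIV (\<lambda>x. integral UNIV (K x))) at_top"
    by (simp add: I_def[abs_def] J_def[abs_def])
qed

text \<open>Both iterated integrals are limits of the same integrals over squares.\<close>

lemma rapid_swap:
  fixes K :: "real \<Rightarrow> real \<Rightarrow> 'b::banach"
  assumes cont: "continuous_on UNIV (\<lambda>(x,y). K x y)" and "c > 0"
    and le: "\<And>x y. norm (K x y) \<le> M * exp (- c * \<bar>x\<bar>) * exp (- c * \<bar>y\<bar>)"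
  shows "integral UNIV (\<lambda>x. integral UNIV (K x)) = integral UNIV (\<lambda>y. integral UNIV (\<lambda>x. K x y))"
proof -
  have "continuous_on UNIV (\<lambda>(y,x). K x y)"
    using continuous_on_compose2[OF cont, OF continuous_on_swap, of UNIV]
    by (simp add: case_prod_unfold prod.swap_def)
  moreover have "norm (K x y) \<le> M * exp (- c * \<bar>y\<bar>) * exp (- c * \<bar>x\<bar>)" for x y using le[of x y] by (simp add: mult_ac)
  ultimately have 1: "((\<lambda>n. integral {-n..n} (\<lambda>y. integral {-n..n} (\<lambda>x. K x y))) \<longlongrightarrow> integral UNIV (\<lambda>y. integral UNIV (\<lambda>x. K x y))) at_top"
    using \<open>c > 0\<close> by (intro iterated_integral_limit(2))
  have "integral {-n..n} (\<lambda>y. integral {-n..n} (\<lambda>x. K x y)) = integral {-n..n} (\<lambda>x. integral {-n..n} (K x))" for n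
    using integral_swap_continuous[of "-n" "-n" n n K] continuous_on_subset[OF cont] by simp
  with 1 have "((\<lambda>n. integral {-n..n} (\<lambda>x. integral {-n..n} (K x))) \<longlongrightarrow> integral UNIV (\<lambda>y. integral UNIV (\<lambda>x. K x y))) at_top"
    by simp
  with iterated_integral_limit(2)[OF assms] show ?thesis
    by (intro tendsto_unique[OF trivial_limit_at_top_linorder])
qed

text \<open>For \<phi> > 0 this is the positively oriented boundary of the strip of half-width
  \<phi>: lower line from left to right, upper line from right to left. Under exp it becomes the
  boundary of the sector.\<close>

definition CI :: "real \<Rightarrow> (complex \<Rightarrow> 'b::banach) \<Rightarrow> 'b" where
  "CI \<phi> k = integral UNIV (\<lambda>x. k (Complex x (- \<phi>)) - k (Complex x \<phi>))"

definition rap :: "real \<Rightarrow> (complex \<Rightarrow> 'b::banach) \<Rightarrow> bool" where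
  "rap \<phi> k \<longleftrightarrow> rapid (\<lambda>x. k (Complex x (- \<phi>))) \<and> rapid (\<lambda>x. k (Complex x \<phi>))"

lemma continuous_on_Complex [continuous_intros]:
  "continuous_on S f \<Longrightarrow> continuous_on S g \<Longrightarrow> continuous_on S (\<lambda>x. Complex (f x) (g x))"
  unfolding Complex_eq by (intro continuous_intros)

lemma rapI:
  assumes "continuous_on {z. \<bar>Im z\<bar> = \<bar>\<phi>\<bar>} k" "c > 0" "\<And>z. \<bar>Im z\<bar> = \<bar>\<phi>\<bar> \<Longrightarrow> norm (k z) \<le> M * exp (- c * \<bar>Re z\<bar>)"
  shows "rap \<phi> k"
proof -
  have "rapid (\<lambda>x. k (Complex x b))" if "\<bar>b\<bar> = \<bar>\<phi>\<bar>" for b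
  proof (rule rapidI[OF _ assms(2)])
    show "continuous_on UNIV (\<lambda>x. k (Complex x b))"
      by (rule continuous_on_compose2[OF assms(1)]) (auto intro!: continuous_intros simp: that)
    show "norm (k (Complex x b)) \<le> M * exp (- c * \<bar>x\<bar>)" for x using assms(3)[of "Complex x b"] that by simp
  qed
  then show ?thesis by (simp add: rap_def)
qed

lemma rap_add: "rap \<phi> k \<Longrightarrow> rap \<phi> l \<Longrightarrow> rap \<phi> (\<lambda>z. k z + l z)"
  and rap_diff: "rap \<phi> k \<Longrightarrow> rap \<phi> l \<Longrightarrow> rap \<phi> (\<lambda>z. k z - l z)"
  and rap_bounded_linear: "bounded_linear T \<Longrightarrow> rap \<phi> k \<Longrightarrow> rap \<phi> (\<lambda>z. T (k z))"
  unfolding rap_def by (auto intro: rapid_add rapid_diff rapid_bounded_linear)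

lemma rap_integrable: "rap \<phi> k \<Longrightarrow> (\<lambda>x. k (Complex x (- \<phi>)) - k (Complex x \<phi>)) integrable_on UNIV"
  unfolding rap_def by (intro rapid_integrable rapid_diff) auto

lemma CI_add: "rap \<phi> k \<Longrightarrow> rap \<phi> l \<Longrightarrow> CI \<phi> (\<lambda>z. k z + l z) = CI \<phi> k + CI \<phi> l"
  unfolding CI_def
  by (subst Henstock_Kurzweil_Integration.integral_add[symmetric]) (auto intro: rap_integrable simp: algebra_simps)

lemma CI_diff: "rap \<phi> k \<Longrightarrow> rap \<phi> l \<Longrightarrow> CI \<phi> (\<lambda>z. k z - l z) = CI \<phi> k - CI \<phi> l"
  unfolding CI_def
  by (subst Henstock_Kurzweil_Integration.integral_diff[symmetric]) (auto intro: rap_integrable simp: algebra_simps)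

lemma CI_bounded_linear:
  assumes "bounded_linear T" "rap \<phi> k" shows "CI \<phi> (\<lambda>z. T (k z)) = T (CI \<phi> k)"
proof -
  interpret T: bounded_linear T by fact
  show ?thesis unfolding CI_def
    using integral_linear[OF rap_integrable[OF assms(2)] assms(1)] by (simp add: o_def T.diff)
qed

lemma CI_cong: "(\<And>z. \<bar>Im z\<bar> = \<bar>\<phi>\<bar> \<Longrightarrow> k z = l z) \<Longrightarrow> CI \<phi> k = CI \<phi> l"
  unfolding CI_def by (intro Henstock_Kurzweil_Integration.integral_cong) auto

lemma CI_cnj: "CI \<phi> (\<lambda>z. k (cnj z)) = - CI \<phi> k"
  unfolding CI_def by (simp add: Henstock_Kurzweil_Integration.integral_neg[symmetric] complex_cnj del: Henstock_Kurzweil_Integration.integral_neg)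

lemma rap_cong: "(\<And>z. \<bar>Im z\<bar> = \<bar>\<phi>\<bar> \<Longrightarrow> k z = l z) \<Longrightarrow> rap \<phi> k \<longleftrightarrow> rap \<phi> l"
  unfolding rap_def by simp

lemma CI_swap:
  fixes K :: "complex \<Rightarrow> complex \<Rightarrow> 'b::banach"
  assumes cont: "continuous_on ({z. \<bar>Im z\<bar> = \<bar>\<phi>1\<bar>} \<times> {w. \<bar>Im w\<bar> = \<bar>\<phi>2\<bar>}) (\<lambda>(z,w). K z w)" and "c > 0"
    and le: "\<And>z w. \<bar>Im z\<bar> = \<bar>\<phi>1\<bar> \<Longrightarrow> \<bar>Im w\<bar> = \<bar>\<phi>2\<bar> \<Longrightarrow>
       norm (K z w) \<le> M * exp (- c * \<bar>Re z\<bar>) * exp (- c * \<bar>Re w\<bar>)"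
  shows "CI \<phi>1 (\<lambda>z. CI \<phi>2 (K z)) = CI \<phi>2 (\<lambda>w. CI \<phi>1 (\<lambda>z. K z w))"
    and "rap \<phi>1 (\<lambda>z. CI \<phi>2 (K z))"
proof -
  define L where "L a b x y = K (Complex x a) (Complex y b)" for a b x y
  have Lc: "continuous_on UNIV (\<lambda>(x,y). L a b x y)" if "\<bar>a\<bar> = \<bar>\<phi>1\<bar>" "\<bar>b\<bar> = \<bar>\<phi>2\<bar>" for a b
  proof -
    have "continuous_on UNIV (\<lambda>p. (Complex (fst p) a, Complex (snd p) b))" by (intro continuous_intros)
    from continuous_on_compose2[OF cont this] that show ?thesis by (force simp: case_prod_unfold L_def)
  qed
  have Lle: "norm (L a b x y) \<le> M * exp (- c * \<bar>x\<bar>) * exp (- c * \<bar>y\<bar>)" if "\<bar>a\<bar> = \<bar>\<phi>1\<bar>" "\<bar>b\<bar> = \<bar>\<phi>2\<bar>" for a b x y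
    using le[of "Complex x a" "Complex y b"] that by (simp add: L_def)
  have Lr: "rapid (L a b x)" "rapid (\<lambda>x. L a b x y)" if "\<bar>a\<bar> = \<bar>\<phi>1\<bar>" "\<bar>b\<bar> = \<bar>\<phi>2\<bar>" for a b x y
  proof -
    show "rapid (L a b x)"
      using Lle[OF that]
      by (intro rapidI[OF continuous_on_compose2[OF Lc[OF that], of UNIV "\<lambda>y. (x,y)", simplified] \<open>c > 0\<close>, of "M * exp (- c * \<bar>x\<bar>)"])
        (auto intro!: continuous_intros)
    show "rapid (\<lambda>x. L a b x y)"
      using Lle[OF that]
      by (intro rapidI[OF continuous_on_compose2[OF Lc[OF that], of UNIV "\<lambda>x. (x,y)", simplified] \<open>c > 0\<close>, of "M * exp (- c * \<bar>y\<bar>)"])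
        (auto intro!: continuous_intros simp: mult_ac)
  qed
  have rI: "rapid (\<lambda>x. integral UNIV (L a b x))" if "\<bar>a\<bar> = \<bar>\<phi>1\<bar>" "\<bar>b\<bar> = \<bar>\<phi>2\<bar>" for a b
    by (rule iterated_integral_limit(1)[OF Lc[OF that] \<open>c > 0\<close> Lle[OF that]])
  have Lc': "continuous_on UNIV (\<lambda>(y,x). L a b x y)" if "\<bar>a\<bar> = \<bar>\<phi>1\<bar>" "\<bar>b\<bar> = \<bar>\<phi>2\<bar>" for a b
    using continuous_on_compose2[OF Lc[OF that], OF continuous_on_swap, of UNIV]
    by (simp add: case_prod_unfold prod.swap_def)
  have rI': "rapid (\<lambda>y. integral UNIV (\<lambda>x. L a b x y))" if "\<bar>a\<bar> = \<bar>\<phi>1\<bar>" "\<bar>b\<bar> = \<bar>\<phi>2\<bar>" for a b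
    by (rule iterated_integral_limit(1)[OF Lc'[OF that] \<open>c > 0\<close>, of M]) (subst mult.assoc, subst mult.commute[of "exp _"], subst mult.assoc[symmetric], rule Lle[OF that])
  have sw: "integral UNIV (\<lambda>x. integral UNIV (L a b x)) = integral UNIV (\<lambda>y. integral UNIV (\<lambda>x. L a b x y))"
    if "\<bar>a\<bar> = \<bar>\<phi>1\<bar>" "\<bar>b\<bar> = \<bar>\<phi>2\<bar>" for a b
    by (rule rapid_swap[OF Lc[OF that] \<open>c > 0\<close> Lle[OF that]])
  note int = rapid_integrable rapid_diff
  have CI1: "CI \<phi>2 (K (Complex x a)) = integral UNIV (L a (-\<phi>2) x) - integral UNIV (L a \<phi>2 x)" if "\<bar>a\<bar> = \<bar>\<phi>1\<bar>" for a x
    unfolding CI_def using Lr that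
    by (subst Henstock_Kurzweil_Integration.integral_diff[symmetric]) (auto intro!: rapid_integrable simp: L_def[abs_def])
  have CI2: "CI \<phi>1 (\<lambda>z. K z (Complex y b)) = integral UNIV (\<lambda>x. L (-\<phi>1) b x y) - integral UNIV (\<lambda>x. L \<phi>1 b x y)" if "\<bar>b\<bar> = \<bar>\<phi>2\<bar>" for b y
    unfolding CI_def using Lr that
    by (subst Henstock_Kurzweil_Integration.integral_diff[symmetric]) (auto intro!: rapid_integrable simp: L_def[abs_def])
  have "CI \<phi>1 (\<lambda>z. CI \<phi>2 (K z)) =
     (integral UNIV (\<lambda>x. integral UNIV (L (-\<phi>1) (-\<phi>2) x)) - integral UNIV (\<lambda>x. integral UNIV (L (-\<phi>1) \<phi>2 x))) -
     (integral UNIV (\<lambda>x. integral UNIV (L \<phi>1 (-\<phi>2) x)) - integral UNIV (\<lambda>x. integral UNIV (L \<phi>1 \<phi>2 x)))"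
    unfolding CI_def[of \<phi>1] by (simp add: CI1 Henstock_Kurzweil_Integration.integral_diff int rI)
  moreover have "CI \<phi>2 (\<lambda>w. CI \<phi>1 (\<lambda>z. K z w)) =
     (integral UNIV (\<lambda>y. integral UNIV (\<lambda>x. L (-\<phi>1) (-\<phi>2) x y)) - integral UNIV (\<lambda>y. integral UNIV (\<lambda>x. L \<phi>1 (-\<phi>2) x y))) -
     (integral UNIV (\<lambda>y. integral UNIV (\<lambda>x. L (-\<phi>1) \<phi>2 x y)) - integral UNIV (\<lambda>y. integral UNIV (\<lambda>x. L \<phi>1 \<phi>2 x y)))"
    unfolding CI_def[of \<phi>2] by (simp add: CI2 Henstock_Kurzweil_Integration.integral_diff int rI')
  ultimately show "CI \<phi>1 (\<lambda>z. CI \<phi>2 (K z)) = CI \<phi>2 (\<lambda>w. CI \<phi>1 (\<lambda>z. K z w))"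
    by (simp add: sw)
  show "rap \<phi>1 (\<lambda>z. CI \<phi>2 (K z))"
    unfolding rap_def by (simp add: CI1 rapid_diff rI)
qed

text \<open>Cauchy's theorem between two horizontal lines. The bounded operator \<open>J\<close>
  plays the imaginary unit in the Cauchy-Riemann equation, so the lemma serves complex values as
  well as left and right multiplication by a unit in a noncommutative algebra. The derivative in y
  of the truncated integral is \<open>J\<close> of the difference of the two end values, which
  vanishes as N grows.\<close>

lemma line_shift:
  fixes k :: "complex \<Rightarrow> 'a::banach"
  assumes J: "bounded_linear J" and ab: "a \<le> b"
    and der: "\<And>z. Im z \<in> {a..b} \<Longrightarrow> (k has_derivative (\<lambda>h. Re h *\<^sub>R k' z + Im h *\<^sub>R J (k' z))) (at z)"
    and k'c: "continuous_on {z. Im z \<in> {a..b}} k'"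
    and "c > 0" and le: "\<And>z. Im z \<in> {a..b} \<Longrightarrow> norm (k z) \<le> M * exp (- c * \<bar>Re z\<bar>)"
  shows "integral UNIV (\<lambda>x. k (Complex x a)) = integral UNIV (\<lambda>x. k (Complex x b))"
proof -
  interpret J: bounded_linear J by fact
  obtain B where B: "\<And>x. norm (J x) \<le> norm x * B" and "B > 0" using J.pos_bounded by blast
  have M: "M \<ge> 0" using order_trans[OF norm_ge_zero le[of "Complex 0 a"]] ab by simp
  have kc: "continuous_on {z. Im z \<in> {a..b}} k"
    by (rule continuous_at_imp_continuous_on) (blast intro: has_derivative_continuous der)
  have rk: "rapid (\<lambda>x. k (Complex x y))" if "y \<in> {a..b}" for y
  proof (rule rapidI[OF _ \<open>c > 0\<close>])
    show "continuous_on UNIV (\<lambda>x. k (Complex x y))"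
      by (rule continuous_on_compose2[OF kc]) (use that in \<open>auto intro!: continuous_intros\<close>)
    show "norm (k (Complex x y)) \<le> M * exp (- c * \<bar>x\<bar>)" for x using le[of "Complex x y"] that by simp
  qed
  have dx: "((\<lambda>x. k (Complex x y)) has_vector_derivative k' (Complex x y)) (at x)" if "y \<in> {a..b}" for x y
  proof -
    have "((\<lambda>x. Complex x y) has_derivative (\<lambda>h. of_real h + 0)) (at x)"
      unfolding Complex_eq by (rule has_derivative_add[OF has_derivative_of_real[OF has_derivative_ident] has_derivative_const])
    from has_derivative_compose[OF this der] that
    show ?thesis by (simp add: has_vector_derivative_def)
  qed
  have dy: "((\<lambda>y. k (Complex x y)) has_vector_derivative J (k' (Complex x y))) (at y within {a..b})" if "y \<in> {a..b}" for x y
  proof -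
    have "((\<lambda>y. Complex x y) has_derivative (\<lambda>h. 0 + \<i> * of_real h)) (at y)"
      unfolding Complex_eq by (rule has_derivative_add[OF has_derivative_const has_derivative_mult_right[OF has_derivative_of_real[OF has_derivative_ident]]])
    from has_derivative_compose[OF this der] that
    show ?thesis by (simp add: has_vector_derivative_def has_derivative_at_withinI)
  qed
  have bd: "norm (integral {-N..N} (\<lambda>x. k (Complex x b)) - integral {-N..N} (\<lambda>x. k (Complex x a)))
      \<le> B * (2 * M * exp (- c * N)) * (b - a)" if "N \<ge> 0" for N
  proof -
    define F where "F y = integral (cbox (-N) N) (\<lambda>x. k (Complex x y))" for y
    have "(F has_vector_derivative integral (cbox (-N) N) (\<lambda>x. J (k' (Complex x y)))) (at y within {a..b})" if "y \<in> {a..b}" for y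
      unfolding F_def
    proof (rule leibniz_rule_vector_derivative)
      show "\<And>y x. y \<in> {a..b} \<Longrightarrow> x \<in> cbox (- N) N \<Longrightarrow>
           ((\<lambda>y. k (Complex x y)) has_vector_derivative J (k' (Complex x y))) (at y within {a..b})" by (rule dy)
      show "(\<lambda>x. k (Complex x y)) integrable_on cbox (- N) N" if "y \<in> {a..b}" for y
        unfolding cbox_interval by (intro integrable_continuous_real continuous_on_compose2[OF kc]) (use that in \<open>auto intro!: continuous_intros\<close>)
      show "continuous_on ({a..b} \<times> cbox (- N) N) (\<lambda>(y, x). J (k' (Complex x y)))"
        unfolding case_prod_unfold
        by (intro J.continuous_on continuous_intros continuous_on_compose2[OF k'c]) auto
    qed (use that in auto)
    moreover have "integral (cbox (-N) N) (\<lambda>x. J (k' (Complex x y))) = J (k (Complex N y) - k (Complex (-N) y))"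
      if "y \<in> {a..b}" for y
    proof -
      have "((\<lambda>x. k' (Complex x y)) has_integral (k (Complex N y) - k (Complex (-N) y))) {-N..N}"
        using \<open>N \<ge> 0\<close> dx[OF that] by (intro fundamental_theorem_of_calculus) (auto intro: has_vector_derivative_at_within)
      from has_integral_linear[OF this J] show ?thesis by (simp add: integral_unique o_def)
    qed
    ultimately have dF: "(F has_vector_derivative J (k (Complex N y) - k (Complex (-N) y))) (at y within {a..b})" if "y \<in> {a..b}" for y
      using that by simp
    have nF: "norm (J (k (Complex N y) - k (Complex (-N) y))) \<le> B * (2 * M * exp (- c * N))" if "y \<in> {a..b}" for y
    proof -
      have "norm (k (Complex N y) - k (Complex (-N) y)) \<le> M * exp (- c * N) + M * exp (- c * N)"
        using le[of "Complex N y"] le[of "Complex (-N) y"] that \<open>N \<ge> 0\<close> by (intro order_trans[OF norm_triangle_ineq4] add_mono) auto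
      then have "norm (k (Complex N y) - k (Complex (-N) y)) * B \<le> (M * exp (- c * N) + M * exp (- c * N)) * B"
        using \<open>B > 0\<close> by (intro mult_right_mono) auto
      then show ?thesis by (intro order_trans[OF B]) (simp add: algebra_simps)
    qed
    have "norm (F b - F a) \<le> B * (2 * M * exp (- c * N)) * norm (b - a)"
    proof (rule differentiable_bound[of "{a..b}" F "\<lambda>y h. h *\<^sub>R (J (k (Complex N y) - k (Complex (-N) y)))"])
      show "onorm (\<lambda>h. h *\<^sub>R (J (k (Complex N y) - k (Complex (-N) y)))) \<le> B * (2 * M * exp (- c * N))" if "y \<in> {a..b}" for y
        using nF[OF that] by (intro onorm_le) (simp add: mult.commute mult_left_mono)
    qed (use dF ab in \<open>auto simp: has_vector_derivative_def\<close>)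
    then show ?thesis using ab by (simp add: F_def)
  qed
  have "((\<lambda>N. integral {-N..N} (\<lambda>x. k (Complex x b)) - integral {-N..N} (\<lambda>x. k (Complex x a))) \<longlongrightarrow> 0) at_top"
  proof (rule Lim_null_comparison)
    show "((\<lambda>N. B * (2 * M * exp (- c * N)) * (b - a)) \<longlongrightarrow> 0) at_top" using \<open>c > 0\<close> by real_asymp
    show "\<forall>\<^sub>F N in at_top. norm (integral {-N..N} (\<lambda>x. k (Complex x b)) - integral {-N..N} (\<lambda>x. k (Complex x a))) \<le> B * (2 * M * exp (- c * N)) * (b - a)"
      using eventually_ge_at_top[of 0] by eventually_elim (rule bd)
  qed
  moreover have "((\<lambda>N. integral {-N..N} (\<lambda>x. k (Complex x b)) - integral {-N..N} (\<lambda>x. k (Complex x a))) \<longlongrightarrow>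
     integral UNIV (\<lambda>x. k (Complex x b)) - integral UNIV (\<lambda>x. k (Complex x a))) at_top"
    using ab by (intro tendsto_diff rapid_integral_limit rk) auto
  ultimately have "integral UNIV (\<lambda>x. k (Complex x b)) - integral UNIV (\<lambda>x. k (Complex x a)) = 0"
    by (rule tendsto_unique[OF trivial_limit_at_top_linorder, rotated])
  then show ?thesis by simp
qed

section \<open>Cauchy's formula in a strip\<close>

lemma cos_le_of_dist:
  assumes "0 \<le> \<eta>" "\<eta> \<le> \<bar>a\<bar>" "\<bar>a\<bar> \<le> 2 * pi - \<eta>"
  shows "cos a \<le> cos \<eta>"
proof (cases "\<bar>a\<bar> \<le> pi")
  case True
  then have "cos \<bar>a\<bar> \<le> cos \<eta>" using assms by (intro cos_monotone_0_pi_le) auto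
  then show ?thesis by simp
next
  case False
  then have "cos (2 * pi - \<bar>a\<bar>) \<le> cos \<eta>" using assms by (intro cos_monotone_0_pi_le) auto
  then show ?thesis by (simp add: cos_diff)
qed

text \<open>With r = exp (Re u) the squared norm is 1 - 2 r cos (Im u) + r^2; completing the square
  once in r and once with the roles of r and 1 exchanged gives the two bounds.
  \<open>sqrt (1 - C\<^sup>2)\<close> is the sine of the angle with cosine \<open>C\<close>.\<close>

lemma norm_one_minus_exp_ge:
  assumes "cos (Im u) \<le> C" "0 \<le> C" "C < 1"
  shows "sqrt (1 - C\<^sup>2) \<le> norm (1 - exp u)" "sqrt (1 - C\<^sup>2) * exp (Re u) \<le> norm (1 - exp u)"
proof -
  define r where "r = exp (Re u)"
  have r: "r > 0" by (simp add: r_def)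
  have "(norm (1 - exp u))\<^sup>2 = (1 - r * cos (Im u))\<^sup>2 + (r * sin (Im u))\<^sup>2"
    by (simp add: cmod_power2 Re_exp Im_exp r_def)
  also have "\<dots> = 1 - 2 * r * cos (Im u) + r\<^sup>2" using sin_cos_squared_add[of "Im u"] by algebra
  finally have n: "(norm (1 - exp u))\<^sup>2 = 1 - 2 * r * cos (Im u) + r\<^sup>2" .
  have "r * cos (Im u) \<le> r * C" using assms r by (intro mult_left_mono) auto
  then have n2: "(norm (1 - exp u))\<^sup>2 \<ge> 1 - 2 * r * C + r\<^sup>2" unfolding n by simp
  have "1 - 2 * r * C + r\<^sup>2 = (r - C)\<^sup>2 + (1 - C\<^sup>2)" "1 - 2 * r * C + r\<^sup>2 = (1 - r * C)\<^sup>2 + r\<^sup>2 * (1 - C\<^sup>2)"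
    by (simp_all add: power2_eq_square algebra_simps)
  then have a: "1 - C\<^sup>2 \<le> (norm (1 - exp u))\<^sup>2" and b: "r\<^sup>2 * (1 - C\<^sup>2) \<le> (norm (1 - exp u))\<^sup>2"
    using n2 zero_le_power2[of "r - C"] zero_le_power2[of "1 - r * C"] by linarith+
  show "sqrt (1 - C\<^sup>2) \<le> norm (1 - exp u)" using a by (intro real_le_lsqrt) auto
  have "sqrt (r\<^sup>2 * (1 - C\<^sup>2)) \<le> norm (1 - exp u)" using b by (intro real_le_lsqrt) auto
  then show "sqrt (1 - C\<^sup>2) * exp (Re u) \<le> norm (1 - exp u)" using r by (simp add: real_sqrt_mult r_def mult.commute)
qed

text \<open>With \<open>s = exp z\<close> and \<open>p = exp w\<close> one has \<open>1 / (1 - exp (z - w)) = p / (p - s)\<close> and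
  \<open>exp (z - w) / (1 - exp (z - w)) = s / (p - s)\<close>.\<close>
lemma exp_kernel_bound:
  assumes "0 < \<eta>" "\<eta> \<le> \<bar>Im w - Im z\<bar>" "\<bar>Im w - Im z\<bar> \<le> 2 * pi - \<eta>"
  shows "norm (1 / (1 - exp (z - w))) \<le> 1 / sqrt (1 - (max 0 (cos \<eta>))\<^sup>2)"
    and "norm (exp (z - w) / (1 - exp (z - w))) \<le> 1 / sqrt (1 - (max 0 (cos \<eta>))\<^sup>2)"
    and "norm (1 / (1 - exp (z - w))) \<le> exp (Re w - Re z) / sqrt (1 - (max 0 (cos \<eta>))\<^sup>2)"
    and "exp (z - w) \<noteq> 1"
proof -
  define C where "C = max 0 (cos \<eta>)"
  have eta: "\<eta> \<le> pi" using assms by linarith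
  have C: "0 \<le> C" "C < 1" using assms eta cos_monotone_0_pi[of 0 \<eta>] by (auto simp: C_def)
  have "cos (Im (z - w)) \<le> cos \<eta>" using assms by (intro cos_le_of_dist) auto
  then have "cos (Im (z - w)) \<le> C" by (simp add: C_def)
  note b = norm_one_minus_exp_ge[OF this C]
  have s: "sqrt (1 - C\<^sup>2) > 0" using C power_strict_mono[of C 1 2] by simp
  have pos: "norm (1 - exp (z - w)) > 0" using b(1) s by linarith
  then show "exp (z - w) \<noteq> 1" by auto
  show "norm (1 / (1 - exp (z - w))) \<le> 1 / sqrt (1 - (max 0 (cos \<eta>))\<^sup>2)"
    using b(1) s pos unfolding C_def[symmetric] by (simp add: norm_divide frac_le)
  have e: "sqrt (1 - C\<^sup>2) * exp (Re z - Re w) \<le> norm (1 - exp (z - w))" using b(2) by simp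
  show "norm (exp (z - w) / (1 - exp (z - w))) \<le> 1 / sqrt (1 - (max 0 (cos \<eta>))\<^sup>2)"
    using e s pos unfolding C_def[symmetric] by (simp add: norm_divide field_simps)
  have "sqrt (1 - C\<^sup>2) \<le> exp (Re w - Re z) * norm (1 - exp (z - w))"
    using mult_left_mono[OF e, of "exp (Re w - Re z)"] by (simp add: exp_diff field_simps)
  then show "norm (1 / (1 - exp (z - w))) \<le> exp (Re w - Re z) / sqrt (1 - (max 0 (cos \<eta>))\<^sup>2)"
    using s pos unfolding C_def[symmetric] by (simp add: norm_divide field_simps)
qed

lemma contour_integral_horizontal:
  assumes "continuous_on (closed_segment (Complex a y) (Complex b y)) f" "a < b"
  shows "contour_integral (linepath (Complex a y) (Complex b y)) f = integral {a..b} (\<lambda>x. f (Complex x y))"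
proof -
  define g where "g x = f (x + \<i> * of_real y)" for x
  have c: "f contour_integrable_on linepath (Complex a y) (Complex b y)"
    by (rule contour_integrable_continuous_linepath[OF assms(1)])
  have "((\<lambda>x. f (linepath (Complex a y) (Complex b y) x) * (Complex b y - Complex a y)) has_integral
      contour_integral (linepath (Complex a y) (Complex b y)) f) {0..1}"
    using has_contour_integral_integral[OF c] unfolding has_contour_integral_linepath .
  moreover have "linepath (Complex a y) (Complex b y) x = linepath (of_real a) (of_real b) x + \<i> * of_real y" for x
    by (simp add: complex_eq_iff linepath_def algebra_simps)
  moreover have "Complex b y - Complex a y = of_real b - of_real a" by (simp add: complex_eq_iff)
  ultimately have "(g has_contour_integral contour_integral (linepath (Complex a y) (Complex b y)) f) (linepath (of_real a) (of_real b))"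
    by (simp add: has_contour_integral_linepath g_def)
  then have "((\<lambda>x. g (of_real x)) has_integral contour_integral (linepath (Complex a y) (Complex b y)) f) {a..b}"
    using assms(2) by (subst (asm) has_contour_integral_linepath_Reals_iff) auto
  moreover have "of_real x + \<i> * of_real y = Complex x y" for x by (simp add: complex_eq_iff)
  ultimately show ?thesis by (simp add: g_def integral_unique)
qed

text \<open>The kernel tends to 1 as Re w grows, so decay at the right end must come from
  \<open>g\<close>; at the left end the kernel itself decays like exp (Re w), and \<open>g\<close>
  may tend to a nonzero constant. This asymmetry is used for the function (a + 1) / (a + exp w)
  below.\<close>

lemma strip_kernel_rap:
  fixes g :: "complex \<Rightarrow> complex"
  assumes hol: "continuous_on {w. \<bar>Im w\<bar> < \<theta>} g" and "\<theta> \<le> pi" "0 < \<phi>" "\<phi> < \<theta>" "\<bar>Im z\<bar> < \<phi>" "c > 0"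
    and le1: "\<And>w. \<bar>Im w\<bar> < \<theta> \<Longrightarrow> norm (g w) \<le> M" and le2: "\<And>w. \<bar>Im w\<bar> < \<theta> \<Longrightarrow> norm (g w) \<le> M * exp (- c * Re w)"
  shows "rap \<phi> (\<lambda>w. g w / (1 - exp (z - w)))"
proof -
  define \<eta> where "\<eta> = \<phi> - \<bar>Im z\<bar>"
  define s where "s = sqrt (1 - (max 0 (cos \<eta>))\<^sup>2)"
  have \<eta>: "0 < \<eta>" "\<And>w. \<bar>Im w\<bar> = \<phi> \<Longrightarrow> \<eta> \<le> \<bar>Im w - Im z\<bar>" "\<And>w. \<bar>Im w\<bar> = \<phi> \<Longrightarrow> \<bar>Im w - Im z\<bar> \<le> 2 * pi - \<eta>"
    using assms(2-5) by (auto simp: \<eta>_def abs_if)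
  note kb = exp_kernel_bound[OF \<eta>(1) \<eta>(2) \<eta>(3), folded s_def]
  have M: "M \<ge> 0" using order_trans[OF norm_ge_zero le1[of 0]] assms by simp
  have "cos \<eta> < cos 0" using \<eta>(1) assms(2-5) by (intro cos_monotone_0_pi) (auto simp: \<eta>_def)
  then have s: "s > 0" unfolding s_def using power_strict_mono[of "max 0 (cos \<eta>)" 1 2] by simp
  define d where "d = min c 1"
  define N where "N = M / s * (1 + exp (- Re z))"
  show ?thesis
  proof (rule rapI[where c = d and M = N])
    show "continuous_on {w. \<bar>Im w\<bar> = \<bar>\<phi>\<bar>} (\<lambda>w. g w / (1 - exp (z - w)))"
      using kb(4) assms(3,4) by (intro continuous_intros continuous_on_subset[OF hol]) auto
    show "d > 0" using \<open>c > 0\<close> by (simp add: d_def)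
    fix w assume "\<bar>Im w\<bar> = \<bar>\<phi>\<bar>"
    then have w: "\<bar>Im w\<bar> = \<phi>" "\<bar>Im w\<bar> < \<theta>" using assms by auto
    note kb = kb[OF w(1) w(1)]
    show "norm (g w / (1 - exp (z - w))) \<le> N * exp (- d * \<bar>Re w\<bar>)"
    proof (cases "Re w \<ge> 0")
      case True
      have "norm (g w) * norm (1 / (1 - exp (z - w))) \<le> (M * exp (- c * Re w)) * (1 / s)"
        by (intro mult_mono kb le2 w) (use M in auto)
      also have "\<dots> = (M / s) * exp (- c * Re w)" by simp
      also have "\<dots> \<le> N * exp (- d * \<bar>Re w\<bar>)"
      proof (intro mult_mono)
        have "d * Re w \<le> c * Re w" using True by (intro mult_right_mono) (auto simp: d_def)
        then show "exp (- c * Re w) \<le> exp (- d * \<bar>Re w\<bar>)" using True by simp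
      qed (use M s in \<open>auto simp: N_def field_simps\<close>)
      finally show ?thesis by (simp add: norm_divide)
    next
      case False
      have "norm (g w) * norm (1 / (1 - exp (z - w))) \<le> M * (exp (Re w - Re z) / s)"
        by (intro mult_mono kb le1 w) (use M in auto)
      also have "\<dots> = (M / s * exp (- Re z)) * exp (Re w)" by (simp add: exp_diff exp_minus field_simps)
      also have "\<dots> \<le> N * exp (- d * \<bar>Re w\<bar>)"
      proof (intro mult_mono)
        have "d * \<bar>Re w\<bar> \<le> 1 * \<bar>Re w\<bar>" by (intro mult_right_mono) (auto simp: d_def)
        then show "exp (Re w) \<le> exp (- d * \<bar>Re w\<bar>)" using False by simp
      qed (use M s in \<open>auto simp: N_def field_simps\<close>)
      finally show ?thesis by (simp add: norm_divide)
    qed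
  qed
qed

text \<open>The kernel has a simple pole with residue 1 at w = z; its other poles differ from z by
  multiples of 2 pi i and lie outside the strip because \<open>\<theta> \<le> pi\<close>. The
  formula is Cauchy's on rectangles whose vertical sides are pushed to infinity.\<close>

lemma strip_Cauchy_formula:
  fixes g :: "complex \<Rightarrow> complex"
  assumes hol: "g holomorphic_on {w. \<bar>Im w\<bar> < \<theta>}" and "\<theta> \<le> pi" "0 < \<phi>" "\<phi> < \<theta>" "\<bar>Im z\<bar> < \<phi>" "c > 0"
    and le1: "\<And>w. \<bar>Im w\<bar> < \<theta> \<Longrightarrow> norm (g w) \<le> M" and le2: "\<And>w. \<bar>Im w\<bar> < \<theta> \<Longrightarrow> norm (g w) \<le> M * exp (- c * Re w)"
  shows "CI \<phi> (\<lambda>w. g w / (1 - exp (z - w))) = 2 * pi * \<i> * g z"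
proof -
  define S where "S = {w. \<bar>Im w\<bar> < \<theta>}"
  define k where "k w = g w / (1 - exp (z - w))" for w
  \<comment> \<open>The integrand times w - z, with the removable singularity filled by its limit
    \<open>g z\<close>; the integrand is then \<open>h w / (w - z)\<close>.\<close>
  define h where "h w = (if w = z then g z else g w * ((w - z) / (1 - exp (z - w))))" for w
  have contg: "continuous_on {w. \<bar>Im w\<bar> < \<theta>} g" using hol by (rule holomorphic_on_imp_continuous_on)
  have S_eq: "S = {w. - \<theta> < Im w} \<inter> {w. Im w < \<theta>}" by (auto simp: S_def abs_less_iff)
  have oS: "open S" unfolding S_eq by (intro open_Int open_halfspace_Im_gt open_halfspace_Im_lt)
  have cS: "convex S" unfolding S_eq by (intro convex_Int convex_halfspace_Im_gt convex_halfspace_Im_lt)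
  have zS: "z \<in> S" using assms by (simp add: S_def)
  have ne: "exp (z - w) \<noteq> 1" if "w \<in> S" "w \<noteq> z" for w
  proof
    assume "exp (z - w) = 1"
    then obtain n :: int where n: "Re (z - w) = 0" "Im (z - w) = of_int (2 * n) * pi" by (auto simp: exp_eq_1)
    have "\<bar>Im (z - w)\<bar> < 2 * pi" using that zS \<open>\<theta> \<le> pi\<close> by (auto simp: S_def)
    then have "\<bar>of_int n :: real\<bar> * (2 * pi) < 1 * (2 * pi)" unfolding n by (simp add: abs_mult)
    then have "\<bar>of_int n :: real\<bar> < 1" by (subst (asm) mult_less_cancel_right_pos) auto
    then have "n = 0" by linarith
    with n that show False by (auto simp: complex_eq_iff)
  qed
  have holh: "h holomorphic_on S"
  proof (rule no_isolated_singularity'[of "{z}"])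
    have "(\<lambda>w. g w * ((w - z) / (1 - exp (z - w)))) holomorphic_on S - {z}"
      using ne hol by (intro holomorphic_intros holomorphic_on_subset[OF hol]) (auto simp: S_def)
    then show "h holomorphic_on S - {z}"
      by (rule holomorphic_transform) (auto simp: h_def)
    have "((\<lambda>w. 1 - exp (z - w)) has_field_derivative 1) (at z)"
      by (auto intro!: derivative_eq_intros)
    then have "((\<lambda>w. (1 - exp (z - w)) / (w - z)) \<longlongrightarrow> 1) (at z)"
      by (simp add: has_field_derivative_iff)
    then have "((\<lambda>w. inverse ((1 - exp (z - w)) / (w - z))) \<longlongrightarrow> inverse 1) (at z)"
      by (intro tendsto_inverse) auto
    moreover have "(g \<longlongrightarrow> g z) (at z)"
      using contg oS zS unfolding S_def[symmetric] by (meson continuous_on_eq_continuous_at isCont_def)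
    ultimately have "((\<lambda>w. g w * inverse ((1 - exp (z - w)) / (w - z))) \<longlongrightarrow> g z * inverse 1) (at z)"
      by (intro tendsto_mult)
    then have "(h \<longlongrightarrow> h z) (at z)"
      by (subst (asm) tendsto_cong[of _ h]) (auto simp: h_def eventually_at_filter)
    then show "(h \<longlongrightarrow> h w) (at w within S)" if "w \<in> {z}" for w
      using that by (auto intro: tendsto_within_subset)
  qed (use oS in auto)
  have hk: "h w / (w - z) = k w" if "w \<noteq> z" for w using that by (simp add: h_def k_def)
  have contk: "continuous_on (S - {z}) k"
    unfolding k_def using ne by (intro continuous_intros continuous_on_subset[OF contg]) (auto simp: S_def)
  have M: "M \<ge> 0" using order_trans[OF norm_ge_zero le1[of 0]] assms by simp
  have side: "norm (integral {-N..N} (\<lambda>x. k (Complex x (- \<phi>)) - k (Complex x \<phi>)) - 2 * pi * \<i> * g z)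
      \<le> (2 * M * exp (- c * N) + 2 * M * exp (- Re z - N)) * (2 * \<phi>)" if N: "N \<ge> \<bar>Re z\<bar> + 1" for N
  proof -
    define a1 a2 a3 a4 where a_def: "a1 = Complex (-N) (-\<phi>)" "a2 = Complex N (-\<phi>)" "a3 = Complex N \<phi>" "a4 = Complex (-N) \<phi>"
    have zbox: "z \<in> box a1 a3" using N assms by (auto simp: in_box_complex_iff a_def)
    have seg: "closed_segment a1 a2 \<subseteq> S - {z}" "closed_segment a2 a3 \<subseteq> S - {z}" "closed_segment a3 a4 \<subseteq> S - {z}" "closed_segment a4 a1 \<subseteq> S - {z}"
      using N assms(3-5) by (auto simp: a_def closed_segment_same_Im closed_segment_same_Re closed_segment_eq_real_ivl S_def split: if_splits)
    note ci = contour_integrable_continuous_linepath[OF continuous_on_subset[OF contk]]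
    have pi: "path_image (rectpath a1 a3) = closed_segment a1 a2 \<union> closed_segment a2 a3 \<union> closed_segment a3 a4 \<union> closed_segment a4 a1"
      by (simp add: rectpath_def Let_def path_image_join a_def Un_assoc)
    have "((\<lambda>w. h w / (w - z)) has_contour_integral (2 * pi * \<i> * winding_number (rectpath a1 a3) z * h z)) (rectpath a1 a3)"
      by (rule Cauchy_integral_formula_convex_simple[OF cS holh]) (use zS oS seg pi in \<open>auto simp: interior_open\<close>)
    moreover have "h z = g z" by (simp add: h_def)
    ultimately have "((\<lambda>w. h w / (w - z)) has_contour_integral (2 * pi * \<i> * g z)) (rectpath a1 a3)"
      using winding_number_rectpath[OF zbox] by simp
    then have "(k has_contour_integral (2 * pi * \<i> * g z)) (rectpath a1 a3)"
    proof (rule has_contour_integral_eq)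
      fix w assume "w \<in> path_image (rectpath a1 a3)"
      then have "w \<noteq> z" using seg unfolding pi by blast
      then show "h w / (w - z) = k w" by (rule hk)
    qed
    then have c0: "contour_integral (rectpath a1 a3) k = 2 * pi * \<i> * g z" by (rule contour_integral_unique)
    have c1: "contour_integral (rectpath a1 a3) k = contour_integral (linepath a1 a2) k + contour_integral (linepath a2 a3) k
        + contour_integral (linepath a3 a4) k + contour_integral (linepath a4 a1) k"
      using ci[OF seg(1)] ci[OF seg(2)] ci[OF seg(3)] ci[OF seg(4)]
      by (simp add: rectpath_def Let_def a_def contour_integrable_join)
    have c2: "contour_integral (linepath a3 a4) k = - contour_integral (linepath a4 a3) k"
      by (rule contour_integral_reverse_linepath) (use seg(3) contk in \<open>auto intro: continuous_on_subset simp: closed_segment_commute\<close>)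
    have c3: "contour_integral (linepath a1 a2) k = integral {-N..N} (\<lambda>x. k (Complex x (-\<phi>)))"
      unfolding a_def by (rule contour_integral_horizontal) (use seg(1) N contk in \<open>auto intro: continuous_on_subset simp: a_def\<close>)
    have c4: "contour_integral (linepath a4 a3) k = integral {-N..N} (\<lambda>x. k (Complex x \<phi>))"
      unfolding a_def by (rule contour_integral_horizontal) (use seg(3) N contk in \<open>auto intro: continuous_on_subset simp: a_def closed_segment_commute\<close>)
    have c5: "integral {-N..N} (\<lambda>x. k (Complex x (- \<phi>)) - k (Complex x \<phi>)) = integral {-N..N} (\<lambda>x. k (Complex x (- \<phi>))) - integral {-N..N} (\<lambda>x. k (Complex x \<phi>))"
      by (intro Henstock_Kurzweil_Integration.integral_diff integrable_continuous_real continuous_on_compose2[OF contk] continuous_intros)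
         (use assms(3-5) in \<open>auto simp: S_def\<close>)
    have eq: "integral {-N..N} (\<lambda>x. k (Complex x (- \<phi>)) - k (Complex x \<phi>)) - 2 * pi * \<i> * g z
        = - (contour_integral (linepath a2 a3) k + contour_integral (linepath a4 a1) k)"
      unfolding c0[symmetric] c1 c2 c3 c4 c5 by simp
    \<comment> \<open>Each vertical side has horizontal distance at least 1 from z, so
      \<open>exp (z - w)\<close> has modulus at most 1/2 on the right side and at least 2 on the
      left side.\<close>
    have e1: "exp (-1::real) \<le> 1/2" using exp_ge_add_one_self[of 1] by (simp add: exp_minus field_simps)
    have R: "norm (k w) \<le> 2 * M * exp (- c * N)" if "w \<in> closed_segment a2 a3" for w
    proof -
      have w: "Re w = N" "w \<in> S" using that seg(2) by (auto simp: a_def closed_segment_same_Re)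
      have "exp (Re z - Re w) \<le> exp (-1)" using N w by simp
      then have "norm (exp (z - w)) \<le> 1/2" unfolding norm_exp_eq_Re minus_complex.sel using e1 by (rule order_trans)
      then have "1/2 \<le> norm (1 - exp (z - w))" using norm_triangle_ineq2[of 1 "exp (z - w)"] by simp
      then have "norm (g w) / norm (1 - exp (z - w)) \<le> (M * exp (- c * Re w)) / (1/2)"
        using w by (intro frac_le le2) (auto simp: S_def M)
      then show ?thesis using w by (simp add: k_def norm_divide)
    qed
    have L: "norm (k w) \<le> 2 * M * exp (- Re z - N)" if "w \<in> closed_segment a4 a1" for w
    proof -
      have w: "Re w = - N" "w \<in> S" using that seg(4) by (auto simp: a_def closed_segment_same_Re)
      have "exp (Re w - Re z) \<le> exp (-1)" using N w by simp
      then have "exp (Re w - Re z) \<le> 1/2" using e1 by (rule order_trans)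
      then have "1 \<le> exp (Re z - Re w) / 2" by (simp add: exp_diff field_simps)
      then have "exp (Re z - Re w) / 2 \<le> norm (1 - exp (z - w))" using norm_triangle_ineq2[of "exp (z - w)" 1] by (simp add: norm_minus_commute)
      then have "norm (g w) / norm (1 - exp (z - w)) \<le> M / (exp (Re z - Re w) / 2)"
        using w by (intro frac_le le1) (auto simp: S_def M)
      also have "\<dots> = 2 * M * exp (- Re z - N)" using w by (simp add: exp_diff exp_minus exp_add field_simps)
      finally show ?thesis by (simp add: k_def norm_divide)
    qed
    have len: "norm (a3 - a2) = 2 * \<phi>" "norm (a1 - a4) = 2 * \<phi>"
    proof -
      have "a3 - a2 = Complex 0 (2 * \<phi>)" "a1 - a4 = Complex 0 (- 2 * \<phi>)" by (simp_all add: a_def complex_eq_iff)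
      then show "norm (a3 - a2) = 2 * \<phi>" "norm (a1 - a4) = 2 * \<phi>" using assms(3) by (simp_all add: complex_norm real_sqrt_mult)
    qed
    have "norm (contour_integral (linepath a2 a3) k) \<le> 2 * M * exp (- c * N) * (2 * \<phi>)"
      using contour_integral_bound_linepath[OF ci[OF seg(2)], of "2 * M * exp (- c * N)"] R M len by simp
    moreover have "norm (contour_integral (linepath a4 a1) k) \<le> 2 * M * exp (- Re z - N) * (2 * \<phi>)"
      using contour_integral_bound_linepath[OF ci[OF seg(4)], of "2 * M * exp (- Re z - N)"] L M len by simp
    ultimately show ?thesis unfolding eq norm_minus_cancel
      by (intro order_trans[OF norm_triangle_ineq]) (simp add: algebra_simps)
  qed
  have "((\<lambda>N. integral {-N..N} (\<lambda>x. k (Complex x (- \<phi>)) - k (Complex x \<phi>)) - 2 * pi * \<i> * g z) \<longlongrightarrow> 0) at_top"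
  proof (rule Lim_null_comparison)
    have "((\<lambda>N. exp (- c * N)) \<longlongrightarrow> 0) at_top" "((\<lambda>N. exp (- r - N)) \<longlongrightarrow> 0) at_top" for r :: real
      using \<open>c > 0\<close> by real_asymp+
    then have "((\<lambda>N. (2 * M * exp (- c * N) + 2 * M * exp (- r - N)) * (2 * \<phi>)) \<longlongrightarrow> (2 * M * 0 + 2 * M * 0) * (2 * \<phi>)) at_top" for r :: real
      by (intro tendsto_intros)
    then show "((\<lambda>N. (2 * M * exp (- c * N) + 2 * M * exp (- Re z - N)) * (2 * \<phi>)) \<longlongrightarrow> 0) at_top" by simp
  qed (use eventually_ge_at_top[of "\<bar>Re z\<bar> + 1"] in eventually_elim, rule side)
  moreover have "rap \<phi> k" unfolding k_def by (rule strip_kernel_rap[OF contg assms(2-6) le1 le2])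
  then have "((\<lambda>N. integral {-N..N} (\<lambda>x. k (Complex x (- \<phi>)) - k (Complex x \<phi>)) - 2 * pi * \<i> * g z) \<longlongrightarrow> CI \<phi> k - 2 * pi * \<i> * g z) at_top"
    unfolding CI_def rap_def by (intro tendsto_diff tendsto_const rapid_integral_limit rapid_diff) auto
  ultimately have "CI \<phi> k - 2 * pi * \<i> * g z = 0" by (rule tendsto_unique[OF trivial_limit_at_top_linorder, rotated])
  then show ?thesis by (simp add: k_def[abs_def])
qed

text \<open>Here the pole w lies outside the contour: the integrand is holomorphic for
  \<open>\<bar>Im z\<bar> < \<bar>Im w\<bar>\<close>, so one line can be moved onto the
  other.\<close>

lemma strip_Cauchy_zero:
  fixes f :: "complex \<Rightarrow> complex"
  assumes hol: "f holomorphic_on {w. \<bar>Im w\<bar> < \<theta>}" and "\<theta> \<le> pi" "0 < \<phi>" "\<phi> < \<bar>Im w\<bar>" "\<bar>Im w\<bar> < \<theta>" "c > 0"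
    and le: "\<And>w. \<bar>Im w\<bar> < \<theta> \<Longrightarrow> norm (f w) \<le> M * exp (- c * \<bar>Re w\<bar>)"
  shows "CI \<phi> (\<lambda>z. f z * (exp (z - w) / (1 - exp (z - w)))) = 0"
proof -
  define S where "S = {z. \<bar>Im z\<bar> < \<bar>Im w\<bar>}"
  define k where "k z = f z * (exp (z - w) / (1 - exp (z - w)))" for z
  have S_eq: "S = {z. - \<bar>Im w\<bar> < Im z} \<inter> {z. Im z < \<bar>Im w\<bar>}" by (auto simp: S_def abs_less_iff)
  have oS: "open S" unfolding S_eq by (intro open_Int open_halfspace_Im_gt open_halfspace_Im_lt)
  define \<eta> where "\<eta> = \<bar>Im w\<bar> - \<phi>"
  define s where "s = sqrt (1 - (max 0 (cos \<eta>))\<^sup>2)"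
  have ne: "exp (z - w) \<noteq> 1" if "z \<in> S" for z
    using that assms(2-5) by (intro exp_kernel_bound(4)[of "\<bar>Im w\<bar> - \<bar>Im z\<bar>"]) (auto simp: S_def abs_if)
  have kb: "norm (exp (z - w) / (1 - exp (z - w))) \<le> 1 / s" if "\<bar>Im z\<bar> \<le> \<phi>" for z
    unfolding s_def by (rule exp_kernel_bound(2)) (use that assms(2-5) in \<open>unfold \<eta>_def, linarith+\<close>)
  have hk: "k holomorphic_on S"
    unfolding k_def using ne assms(5) by (intro holomorphic_intros holomorphic_on_subset[OF hol]) (auto simp: S_def)
  have "integral UNIV (\<lambda>x. k (Complex x (-\<phi>))) = integral UNIV (\<lambda>x. k (Complex x \<phi>))"
  proof (rule line_shift[where J = "\<lambda>x. \<i> * x" and k' = "deriv k" and c = c and M = "M * (1 / s)"])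
    show "(k has_derivative (\<lambda>h. Re h *\<^sub>R deriv k z + Im h *\<^sub>R (\<i> * deriv k z))) (at z)" if "Im z \<in> {-\<phi>..\<phi>}" for z
    proof -
      have "(k has_field_derivative deriv k z) (at z)"
        by (rule holomorphic_derivI[OF hk oS]) (use that assms(4) in \<open>auto simp: S_def abs_if\<close>)
      moreover have "deriv k z * h = Re h *\<^sub>R deriv k z + Im h *\<^sub>R (\<i> * deriv k z)" for h
        by (simp add: complex_eq_iff algebra_simps)
      ultimately show ?thesis unfolding has_field_derivative_def by (rule has_derivative_eq_rhs[OF _ ext])
    qed
    show "continuous_on {z. Im z \<in> {-\<phi>..\<phi>}} (deriv k)"
      by (rule continuous_on_subset[OF holomorphic_on_imp_continuous_on[OF holomorphic_deriv[OF hk oS]]])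
         (use assms(4) in \<open>auto simp: S_def abs_if\<close>)
    show "norm (k z) \<le> M * (1 / s) * exp (- c * \<bar>Re z\<bar>)" if "Im z \<in> {-\<phi>..\<phi>}" for z
    proof -
      have "norm (f z) * norm (exp (z - w) / (1 - exp (z - w))) \<le> (M * exp (- c * \<bar>Re z\<bar>)) * (1 / s)"
        using that assms(4,5) order_trans[OF norm_ge_zero le[of z]] by (intro mult_mono le kb) auto
      then show ?thesis unfolding k_def norm_mult by simp
    qed
  qed (use assms in \<open>auto simp: bounded_linear_mult_right\<close>)
  moreover have "rap \<phi> k"
  proof (rule rapI[OF _ \<open>c > 0\<close>])
    show "continuous_on {z. \<bar>Im z\<bar> = \<bar>\<phi>\<bar>} k"
      by (rule continuous_on_subset[OF holomorphic_on_imp_continuous_on[OF hk]]) (use assms(3,4) in \<open>auto simp: S_def\<close>)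
    fix z assume z: "\<bar>Im z\<bar> = \<bar>\<phi>\<bar>"
    have "norm (f z) * norm (exp (z - w) / (1 - exp (z - w))) \<le> (M * exp (- c * \<bar>Re z\<bar>)) * (1 / s)"
      using z assms(3-5) order_trans[OF norm_ge_zero le[of z]] by (intro mult_mono le kb) auto
    then show "norm (k z) \<le> M * (1 / s) * exp (- c * \<bar>Re z\<bar>)" unfolding k_def norm_mult by simp
  qed
  ultimately show ?thesis
    unfolding CI_def rap_def k_def[symmetric] by (subst Henstock_Kurzweil_Integration.integral_diff) (auto intro: rapid_integrable)
qed

section \<open>Contour integrals in a Banach algebra with a quaternion action\<close>

text \<open>Slices are parametrised by \<open>s = exp z\<close>: the sector becomes the strip \<open>\<bar>Im z\<bar> < \<theta>\<close>, membership in
  \<open>\<Psi>\<close> and \<open>\<Psi>\<^sup>Q\<close> becomes \<open>E0\<close> and \<open>E1\<close>, and intrinsic functions become the conjugation symmetric ones.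
  \<open>Om \<psi>\<close> is the complement of the closed sector of half-angle \<open>\<psi>\<close>.\<close>
definition Om :: "real \<Rightarrow> complex set" where "Om \<psi> = {s. Re s < norm s * cos \<psi>}"

definition E0 :: "real \<Rightarrow> (complex \<Rightarrow> complex) \<Rightarrow> bool" where
  "E0 \<theta> f \<longleftrightarrow> f holomorphic_on {z. \<bar>Im z\<bar> < \<theta>} \<and>
     (\<exists>M. \<exists>c>0. \<forall>z. \<bar>Im z\<bar> < \<theta> \<longrightarrow> norm (f z) \<le> M * exp (- c * \<bar>Re z\<bar>))"

definition E1 :: "real \<Rightarrow> (complex \<Rightarrow> complex) \<Rightarrow> bool" where
  "E1 \<theta> f \<longleftrightarrow> E0 \<theta> f \<and> (\<exists>M. \<exists>c>0. \<forall>z. \<bar>Im z\<bar> < \<theta> \<longrightarrow> norm (f z) * exp (- Re z) \<le> M * exp (- c * \<bar>Re z\<bar>))"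

definition conj_sym :: "real \<Rightarrow> (complex \<Rightarrow> complex) \<Rightarrow> bool" where
  "conj_sym \<theta> f \<longleftrightarrow> (\<forall>z. \<bar>Im z\<bar> < \<theta> \<longrightarrow> f (cnj z) = cnj (f z))"

text \<open>The model is \<open>L a\<close> = left multiplication by a on V. The sort does not
  include \<open>norm 1 = 1\<close>, so that operators on the zero space are covered.\<close>

locale quat_rep =
  fixes L :: "quat \<Rightarrow> 'a::{real_normed_algebra,monoid_mult,banach}"
  assumes L_add: "L (a + b) = L a + L b" and L_mult: "L (qmul a b) = L a * L b"
    and L_real: "L (qof_real r) = r *\<^sub>R 1" and L_norm: "norm (L a) \<le> norm a"
begin

lemma L_scaleR: "L (r *\<^sub>R a) = r *\<^sub>R L a"
proof -
  have "r *\<^sub>R a = qmul (qof_real r) a" by (cases a) (simp add: qmul_def qof_real_def)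
  then show ?thesis by (simp add: L_mult L_real)
qed

text \<open>The copy of the complex numbers spanned by 1 and e1; together with \<open>jj\<close>,
  the image of e2, it generates all \<open>L a\<close>.\<close>

definition \<iota> :: "complex \<Rightarrow> 'a" where "\<iota> z = L (Re z, Im z, 0, 0)"

lemma iota_bounded_linear: "bounded_linear \<iota>"
proof (rule bounded_linear_intro[where K = 1])
  show "\<iota> (x + y) = \<iota> x + \<iota> y" for x y by (simp add: \<iota>_def flip: L_add)
  show "\<iota> (r *\<^sub>R x) = r *\<^sub>R \<iota> x" for r x by (simp add: \<iota>_def flip: L_scaleR)
  show "norm (\<iota> x) \<le> norm x * 1" for x
    using L_norm[of "(Re x, Im x, 0, 0)"] by (simp add: \<iota>_def norm_Pair cmod_def)
qed

lemma iota_norm: "norm (\<iota> z) \<le> norm z"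
  using L_norm[of "(Re z, Im z, 0, 0)"] by (simp add: \<iota>_def norm_Pair cmod_def)

lemma iota_one [simp]: "\<iota> 1 = 1"
  using L_real[of 1] by (simp add: \<iota>_def qof_real_def)

lemma iota_zero [simp]: "\<iota> 0 = 0" using iota_bounded_linear by (simp add: bounded_linear.linear linear_0)

lemma iota_mult: "\<iota> (a * b) = \<iota> a * \<iota> b"
  by (simp add: \<iota>_def qmul_def flip: L_mult)

lemma iota_add: "\<iota> (a + b) = \<iota> a + \<iota> b"
  and iota_diff: "\<iota> (a - b) = \<iota> a - \<iota> b"
  and iota_minus: "\<iota> (- a) = - \<iota> a"
  using iota_bounded_linear by (simp_all add: bounded_linear.linear linear_add linear_diff linear_neg)

lemma iota_of_real: "\<iota> (of_real r) = r *\<^sub>R 1"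
  using L_real[of r] by (simp add: \<iota>_def qof_real_def)

lemma iota_split: "\<iota> h * x = Re h *\<^sub>R x + Im h *\<^sub>R (\<iota> \<i> * x)" "x * \<iota> h = Re h *\<^sub>R x + Im h *\<^sub>R (x * \<iota> \<i>)"
proof -
  have "h = of_real (Re h) + Im h *\<^sub>R \<i>" by (simp add: complex_eq_iff)
  then have "\<iota> h = Re h *\<^sub>R 1 + Im h *\<^sub>R \<iota> \<i>"
    by (metis iota_add iota_of_real bounded_linear.linear iota_bounded_linear linear_cmul)
  then show "\<iota> h * x = Re h *\<^sub>R x + Im h *\<^sub>R (\<iota> \<i> * x)" "x * \<iota> h = Re h *\<^sub>R x + Im h *\<^sub>R (x * \<iota> \<i>)"
    by (simp_all add: distrib_left distrib_right)
qed

lemma iota_commute: "\<iota> a * \<iota> b = \<iota> b * \<iota> a"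
  by (simp add: mult.commute flip: iota_mult)

lemma iota_left_commute: "\<iota> a * (\<iota> b * x) = \<iota> b * (\<iota> a * x)"
  by (simp add: iota_commute flip: mult.assoc)

definition jj :: 'a where "jj = L (qe 2)"

lemma jj_iota: "jj * \<iota> z = \<iota> (cnj z) * jj"
  by (simp add: \<iota>_def jj_def qmul_def qe_def flip: L_mult)

lemma L_decomp: "L (a, b, c, d) = \<iota> (Complex a b) + \<iota> (Complex c d) * jj"
  by (simp add: \<iota>_def jj_def qmul_def qe_def flip: L_mult L_add)

lemma continuous_on_iota [continuous_intros]: "continuous_on S f \<Longrightarrow> continuous_on S (\<lambda>x. \<iota> (f x))"
  by (rule bounded_linear.continuous_on[OF iota_bounded_linear])

lemma norm_iota_mult: "norm (\<iota> a * x) \<le> norm a * norm x"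
  by (rule order_trans[OF norm_mult_ineq]) (intro mult_right_mono iota_norm norm_ge_zero)

text \<open>Because the values commute with \<open>\<iota>\<close>, scalar factors move freely
  through products of such functions. Continuity of the derivative is part of the notion since
  \<open>line_shift\<close> asks for it.\<close>

definition regular :: "real \<Rightarrow> (complex \<Rightarrow> 'a) \<Rightarrow> bool" where
  "regular \<psi> W \<longleftrightarrow> (\<forall>s\<in>Om \<psi>. \<forall>c. W s * \<iota> c = \<iota> c * W s) \<and>
     (\<exists>W'. continuous_on (Om \<psi>) W' \<and> (\<forall>s\<in>Om \<psi>. (W has_derivative (\<lambda>h. \<iota> h * W' s)) (at s)))"

text \<open>The factor \<open>exp z\<close> is ds / dz. Decay is asked for where
  \<open>\<psi> < \<bar>Im z\<bar>\<close>, which for \<theta> < pi is the part of the strip mapped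
  into the domain \<open>Om \<psi>\<close> of \<open>W\<close>.\<close>

definition adm :: "real \<Rightarrow> real \<Rightarrow> (complex \<Rightarrow> 'a) \<Rightarrow> (complex \<Rightarrow> complex) \<Rightarrow> bool" where
  "adm \<psi> \<theta> W f \<longleftrightarrow> E0 \<theta> f \<and> (\<exists>M. \<exists>c>0. \<forall>z. \<psi> < \<bar>Im z\<bar> \<and> \<bar>Im z\<bar> < \<theta> \<longrightarrow>
      norm (\<iota> (exp z * f z) * W (exp z)) \<le> M * exp (- c * \<bar>Re z\<bar>))"

text \<open>1 / (2 pi i) times the integral of f(s) W(s) ds with s = exp z; for the resolvent of an
  ordinary operator in place of \<open>W\<close> this is the Riesz-Dunford integral.\<close>

definition \<Phi> :: "real \<Rightarrow> (complex \<Rightarrow> 'a) \<Rightarrow> (complex \<Rightarrow> complex) \<Rightarrow> 'a" where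
  "\<Phi> \<phi> W f = \<iota> (1 / (2 * pi * \<i>)) * CI \<phi> (\<lambda>z. \<iota> (exp z * f z) * W (exp z))"

lemma Om_nonzero: "s \<in> Om \<psi> \<Longrightarrow> s \<noteq> 0" by (auto simp: Om_def)

lemma open_Om: "open (Om \<psi>)"
  unfolding Om_def by (intro open_Collect_less continuous_intros)

text \<open>The range reaches up to 2 pi - \<psi>, beyond the principal strip: contours can thus be
  moved across the negative axis.\<close>

lemma exp_in_Om:
  assumes "0 < \<psi>" "\<psi> < \<bar>Im z\<bar>" "\<bar>Im z\<bar> < 2 * pi - \<psi>"
  shows "exp z \<in> Om \<psi>"
proof -
  define \<eta> where "\<eta> = min \<bar>Im z\<bar> (2 * pi - \<bar>Im z\<bar>)"
  have "cos (Im z) \<le> cos \<eta>" using assms by (intro cos_le_of_dist) (auto simp: \<eta>_def)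
  also have "cos \<eta> < cos \<psi>" using assms by (intro cos_monotone_0_pi) (auto simp: \<eta>_def)
  finally show ?thesis by (simp add: Om_def Re_exp)
qed

lemma regularD:
  assumes "regular \<psi> W"
  shows "s \<in> Om \<psi> \<Longrightarrow> W s * \<iota> c = \<iota> c * W s" "continuous_on (Om \<psi>) W"
proof -
  show "s \<in> Om \<psi> \<Longrightarrow> W s * \<iota> c = \<iota> c * W s" using assms by (simp add: regular_def)
  obtain W' where "\<forall>s\<in>Om \<psi>. (W has_derivative (\<lambda>h. \<iota> h * W' s)) (at s)" using assms by (auto simp: regular_def)
  then show "continuous_on (Om \<psi>) W"
    by (intro continuous_at_imp_continuous_on) (blast intro: has_derivative_continuous)
qed

lemma strip_open: "open {z. \<bar>Im z\<bar> < \<theta>}"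
  by (intro open_Collect_less continuous_intros)

lemma adm_rap:
  assumes W: "regular \<psi> W" and f: "adm \<psi> \<theta> W f" and "0 < \<psi>" "\<psi> < \<phi>" "\<phi> < \<theta>" "\<theta> < pi"
  shows "rap \<phi> (\<lambda>z. \<iota> (exp z * f z) * W (exp z))"
proof -
  obtain M c where c: "c > 0" and le: "\<And>z. \<psi> < \<bar>Im z\<bar> \<Longrightarrow> \<bar>Im z\<bar> < \<theta> \<Longrightarrow>
      norm (\<iota> (exp z * f z) * W (exp z)) \<le> M * exp (- c * \<bar>Re z\<bar>)" using f by (auto simp: adm_def)
  have hol: "f holomorphic_on {z. \<bar>Im z\<bar> < \<theta>}" using f by (auto simp: adm_def E0_def)
  show ?thesis
  proof (rule rapI[OF _ c])
    show "continuous_on {z. \<bar>Im z\<bar> = \<bar>\<phi>\<bar>} (\<lambda>z. \<iota> (exp z * f z) * W (exp z))"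
      using assms(3-6)
      by (intro continuous_intros continuous_on_compose2[OF regularD(2)[OF W]] continuous_on_subset[OF holomorphic_on_imp_continuous_on[OF hol]])
         (auto intro!: exp_in_Om)
  qed (use le assms(3-6) in auto)
qed

text \<open>Independence of the angle: the upper and the lower line are moved separately, with left
  multiplication by \<open>\<iota> \<i>\<close> as the unit in \<open>line_shift\<close>.\<close>

lemma adm_shift:
  assumes W: "regular \<psi> W" and f: "adm \<psi> \<theta> W f" and \<psi>: "0 < \<psi>" "\<psi> < \<phi>1" "\<phi>1 \<le> \<phi>2" "\<phi>2 < \<theta>" "\<theta> < pi"
  shows "CI \<phi>1 (\<lambda>z. \<iota> (exp z * f z) * W (exp z)) = CI \<phi>2 (\<lambda>z. \<iota> (exp z * f z) * W (exp z))"
proof -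
  obtain M c where c: "c > 0" and le: "\<And>z. \<psi> < \<bar>Im z\<bar> \<Longrightarrow> \<bar>Im z\<bar> < \<theta> \<Longrightarrow>
      norm (\<iota> (exp z * f z) * W (exp z)) \<le> M * exp (- c * \<bar>Re z\<bar>)" using f by (auto simp: adm_def)
  have hol: "f holomorphic_on {z. \<bar>Im z\<bar> < \<theta>}" using f by (auto simp: adm_def E0_def)
  obtain W' where W'c: "continuous_on (Om \<psi>) W'" and W': "\<And>s. s \<in> Om \<psi> \<Longrightarrow> (W has_derivative (\<lambda>h. \<iota> h * W' s)) (at s)"
    using W by (auto simp: regular_def)
  define F where "F z = exp z * f z" for z
  have holF: "F holomorphic_on {z. \<bar>Im z\<bar> < \<theta>}" unfolding F_def by (intro holomorphic_intros hol)
  define k where "k z = \<iota> (F z) * W (exp z)" for z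
  define k' where "k' z = \<iota> (deriv F z) * W (exp z) + \<iota> (F z) * (\<iota> (exp z) * W' (exp z))" for z
  have der: "(k has_derivative (\<lambda>h. \<iota> h * k' z)) (at z)" if "\<psi> < \<bar>Im z\<bar>" "\<bar>Im z\<bar> < \<theta>" for z
  proof -
    have z: "exp z \<in> Om \<psi>" using that \<psi> by (intro exp_in_Om) auto
    have "(F has_field_derivative deriv F z) (at z)"
      by (rule holomorphic_derivI[OF holF strip_open]) (use that in auto)
    then have 1: "((\<lambda>z. \<iota> (F z)) has_derivative (\<lambda>h. \<iota> (deriv F z * h))) (at z)"
      unfolding has_field_derivative_def by (rule bounded_linear.has_derivative[OF iota_bounded_linear])
    have "(exp has_derivative (\<lambda>h. exp z * h)) (at z)"
      using DERIV_exp[of z] by (simp add: has_field_derivative_def)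
    from has_derivative_compose[OF this W'[OF z]]
    have 2: "((\<lambda>z. W (exp z)) has_derivative (\<lambda>h. \<iota> (exp z * h) * W' (exp z))) (at z)" .
    show ?thesis unfolding k_def[abs_def]
      by (rule has_derivative_eq_rhs[OF has_derivative_mult[OF 1 2]])
         (simp add: fun_eq_iff k'_def iota_mult algebra_simps iota_commute iota_left_commute)
  qed
  have k'c: "continuous_on {z. \<psi> < \<bar>Im z\<bar> \<and> \<bar>Im z\<bar> < \<theta>} k'"
    unfolding k'_def using \<psi>
    by (intro continuous_intros continuous_on_compose2[OF regularD(2)[OF W]] continuous_on_compose2[OF W'c]
         continuous_on_subset[OF holomorphic_on_imp_continuous_on[OF holF]]
         continuous_on_subset[OF holomorphic_on_imp_continuous_on[OF holomorphic_deriv[OF holF strip_open]]])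
       (auto intro!: exp_in_Om)
  have sh: "integral UNIV (\<lambda>x. k (Complex x a)) = integral UNIV (\<lambda>x. k (Complex x b))"
    if ab: "a \<le> b" "\<And>y. y \<in> {a..b} \<Longrightarrow> \<psi> < \<bar>y\<bar> \<and> \<bar>y\<bar> < \<theta>" for a b
  proof (rule line_shift[OF bounded_linear_mult_right[of "\<iota> \<i>"] ab(1), where k' = k' and c = c and M = M])
    show "(k has_derivative (\<lambda>h. Re h *\<^sub>R k' z + Im h *\<^sub>R (\<iota> \<i> * k' z))) (at z)" if "Im z \<in> {a..b}" for z
      unfolding iota_split(1)[symmetric] using ab(2)[OF that] der by blast
    show "continuous_on {z. Im z \<in> {a..b}} k'" by (rule continuous_on_subset[OF k'c]) (use ab(2) in auto)
    show "norm (k z) \<le> M * exp (- c * \<bar>Re z\<bar>)" if "Im z \<in> {a..b}" for z using ab(2)[OF that] le by (auto simp: k_def F_def)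
  qed (rule c)
  have rk: "rap \<phi>1 k" "rap \<phi>2 k"
    unfolding k_def F_def using \<psi> by (auto intro!: adm_rap[OF W f])
  have CIk: "CI \<phi> k = integral UNIV (\<lambda>x. k (Complex x (- \<phi>))) - integral UNIV (\<lambda>x. k (Complex x \<phi>))" if "rap \<phi> k" for \<phi>
    using that unfolding CI_def rap_def
    by (intro Henstock_Kurzweil_Integration.integral_diff) (auto intro: rapid_integrable)
  have "CI \<phi>1 k = CI \<phi>2 k"
    unfolding CIk[OF rk(1)] CIk[OF rk(2)] using \<psi> sh[of \<phi>1 \<phi>2] sh[of "-\<phi>2" "-\<phi>1"] by auto
  then show ?thesis by (simp add: k_def[abs_def] F_def)
qed

text \<open>The double integral that turns a resolvent identity for \<open>W\<close> into a product rule: one half collapses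
  by Cauchy's formula on the outer contour, the other vanishes by Cauchy's theorem on the inner one.\<close>
lemma double_integral:
  assumes W: "regular \<psi> W" and f: "adm \<psi> \<theta> W f" and g: "adm \<psi> \<theta> W g"
    and \<psi>: "0 < \<psi>" "\<psi> < \<phi>1" "\<phi>1 < \<phi>2" "\<phi>2 < \<theta>" "\<theta> < pi"
  shows "CI \<phi>1 (\<lambda>z. CI \<phi>2 (\<lambda>w. \<iota> (exp z * f z * (exp w * g w) / (exp w - exp z)) * (W (exp z) - W (exp w))))
     = \<iota> (2 * pi * \<i>) * CI \<phi>1 (\<lambda>z. \<iota> (exp z * (f z * g z)) * W (exp z))"
    and "rap \<phi>1 (\<lambda>z. \<iota> (exp z * (f z * g z)) * W (exp z))"
proof -
  have holf: "f holomorphic_on {z. \<bar>Im z\<bar> < \<theta>}" and holg: "g holomorphic_on {z. \<bar>Im z\<bar> < \<theta>}"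
    using f g by (auto simp: adm_def E0_def)
  obtain Mf cf where cf: "cf > 0" and lef: "\<And>z. \<bar>Im z\<bar> < \<theta> \<Longrightarrow> norm (f z) \<le> Mf * exp (- cf * \<bar>Re z\<bar>)"
    using f by (auto simp: adm_def E0_def)
  obtain Mg cg where cg: "cg > 0" and leg: "\<And>z. \<bar>Im z\<bar> < \<theta> \<Longrightarrow> norm (g z) \<le> Mg * exp (- cg * \<bar>Re z\<bar>)"
    using g by (auto simp: adm_def E0_def)
  obtain MF cF where cF: "cF > 0" and leF: "\<And>z. \<psi> < \<bar>Im z\<bar> \<Longrightarrow> \<bar>Im z\<bar> < \<theta> \<Longrightarrow>
      norm (\<iota> (exp z * f z) * W (exp z)) \<le> MF * exp (- cF * \<bar>Re z\<bar>)" using f by (auto simp: adm_def)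
  obtain MG cG where cG: "cG > 0" and leG: "\<And>z. \<psi> < \<bar>Im z\<bar> \<Longrightarrow> \<bar>Im z\<bar> < \<theta> \<Longrightarrow>
      norm (\<iota> (exp z * g z) * W (exp z)) \<le> MG * exp (- cG * \<bar>Re z\<bar>)" using g by (auto simp: adm_def)
  \<comment> \<open>With s = exp z and p = exp w, the scalar s p f g / (p - s) is written in two
    ways. In \<open>A\<close> it contains 1 / (1 - exp (z - w)), so that w is integrated by Cauchy's
    formula; in \<open>B\<close> it contains exp (z - w) / (1 - exp (z - w)), so that the z-integral
    vanishes.\<close>
  define A where "A z w = \<iota> (exp z * f z) * W (exp z) * \<iota> (g w / (1 - exp (z - w)))" for z w
  define B where "B z w = \<iota> (exp w * g w) * W (exp w) * \<iota> (f z * (exp (z - w) / (1 - exp (z - w))))" for z w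
  define \<eta> where "\<eta> = \<phi>2 - \<phi>1"
  define s where "s = sqrt (1 - (max 0 (cos \<eta>))\<^sup>2)"
  have \<eta>: "0 < \<eta>" "\<eta> \<le> \<bar>Im w - Im z\<bar>" "\<bar>Im w - Im z\<bar> \<le> 2 * pi - \<eta>" if "\<bar>Im z\<bar> = \<phi>1" "\<bar>Im w\<bar> = \<phi>2" for z w
    using \<psi> that unfolding \<eta>_def by linarith+
  note kb = exp_kernel_bound[OF \<eta>(1) \<eta>(2) \<eta>(3), folded s_def]
  have inOm: "exp z \<in> Om \<psi>" if "\<bar>Im z\<bar> = \<phi>1 \<or> \<bar>Im z\<bar> = \<phi>2" for z using that \<psi> by (intro exp_in_Om) auto
  have eq: "\<iota> (exp z * f z * (exp w * g w) / (exp w - exp z)) * (W (exp z) - W (exp w)) = A z w - B z w"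
    if "\<bar>Im z\<bar> = \<phi>1" "\<bar>Im w\<bar> = \<phi>2" for z w
  proof -
    have ne: "exp (z - w) \<noteq> 1" using kb(4) that by blast
    have ew: "exp w - exp z = exp w * (1 - exp (z - w))" by (simp add: exp_diff algebra_simps)
    have 1: "exp z * f z * (exp w * g w) / (exp w - exp z) = exp z * f z * (g w / (1 - exp (z - w)))"
      unfolding ew using ne by (simp add: field_simps)
    have ez: "exp z = exp w * exp (z - w)" by (simp add: exp_diff)
    have 2: "exp z * f z * (exp w * g w) / (exp w - exp z) = exp w * g w * (f z * (exp (z - w) / (1 - exp (z - w))))"
      unfolding ew by (subst (1) ez) (use ne in \<open>simp add: field_simps\<close>)
    have c: "W (exp z) * \<iota> c = \<iota> c * W (exp z)" "W (exp w) * \<iota> c = \<iota> c * W (exp w)" for c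
      using regularD(1)[OF W inOm] that by auto
    have "A z w = \<iota> (exp z * f z) * \<iota> (g w / (1 - exp (z - w))) * W (exp z)" by (simp only: A_def mult.assoc c)
    then have "\<iota> (exp z * f z * (exp w * g w) / (exp w - exp z)) * W (exp z) = A z w" unfolding 1 by (simp only: iota_mult)
    moreover have "B z w = \<iota> (exp w * g w) * \<iota> (f z * (exp (z - w) / (1 - exp (z - w)))) * W (exp w)"
      by (simp only: B_def mult.assoc c)
    then have "\<iota> (exp z * f z * (exp w * g w) / (exp w - exp z)) * W (exp w) = B z w" unfolding 2 by (simp only: iota_mult)
    ultimately show ?thesis by (simp add: right_diff_distrib)
  qed
  have Aw: "rap \<phi>2 (A z)" "CI \<phi>2 (A z) = \<iota> (exp z * f z) * W (exp z) * \<iota> (2 * pi * \<i> * g z)" if z: "\<bar>Im z\<bar> = \<phi>1" for z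
  proof -
    have Mg: "0 \<le> Mg" using order_trans[OF norm_ge_zero leg[of 0]] \<psi> by simp
    have le1: "norm (g w) \<le> Mg" if "\<bar>Im w\<bar> < \<theta>" for w
      using exp_bound_weaken[OF leg[OF that], of 0] cg Mg by simp
    have le2: "norm (g w) \<le> Mg * exp (- cg * Re w)" if "\<bar>Im w\<bar> < \<theta>" for w
    proof -
      have "Mg * exp (- cg * \<bar>Re w\<bar>) \<le> Mg * exp (- cg * Re w)" using Mg cg by (intro mult_left_mono) auto
      then show ?thesis using leg[OF that] by linarith
    qed
    have bl: "bounded_linear (\<lambda>x. \<iota> (exp z * f z) * W (exp z) * \<iota> x)"
      by (rule bounded_linear_compose[OF bounded_linear_mult_right iota_bounded_linear])
    have r: "rap \<phi>2 (\<lambda>w. g w / (1 - exp (z - w)))"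
      by (rule strip_kernel_rap[OF holomorphic_on_imp_continuous_on[OF holg] _ _ _ _ cg le1 le2]) (use \<psi> z in auto)
    show "rap \<phi>2 (A z)" unfolding A_def[abs_def] by (rule rap_bounded_linear[OF bl r])
    have "CI \<phi>2 (\<lambda>w. g w / (1 - exp (z - w))) = 2 * pi * \<i> * g z"
      by (rule strip_Cauchy_formula[OF holg _ _ _ _ cg le1 le2]) (use \<psi> z in auto)
    then show "CI \<phi>2 (A z) = \<iota> (exp z * f z) * W (exp z) * \<iota> (2 * pi * \<i> * g z)"
      unfolding A_def[abs_def] by (simp only: CI_bounded_linear[OF bl r])
  qed
  define d where "d = min cf cG"
  have d: "d > 0" using cf cG by (simp add: d_def)
  define N where "N = \<bar>Mf\<bar> * \<bar>MG\<bar> / s"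
  have Bc: "continuous_on ({z. \<bar>Im z\<bar> = \<bar>\<phi>1\<bar>} \<times> {w. \<bar>Im w\<bar> = \<bar>\<phi>2\<bar>}) (\<lambda>(z,w). B z w)"
    unfolding B_def case_prod_unfold using \<psi>
    by (intro continuous_intros continuous_on_compose2[OF regularD(2)[OF W]]
         continuous_on_compose2[OF holomorphic_on_imp_continuous_on[OF holf]] continuous_on_compose2[OF holomorphic_on_imp_continuous_on[OF holg]])
       (auto intro!: inOm simp: kb(4))
  have Ble: "norm (B z w) \<le> N * exp (- d * \<bar>Re z\<bar>) * exp (- d * \<bar>Re w\<bar>)" if "\<bar>Im z\<bar> = \<bar>\<phi>1\<bar>" "\<bar>Im w\<bar> = \<bar>\<phi>2\<bar>" for z w
  proof -
    have zw: "\<bar>Im z\<bar> = \<phi>1" "\<bar>Im w\<bar> = \<phi>2" using that \<psi> by auto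
    have "norm (B z w) \<le> norm (\<iota> (exp w * g w) * W (exp w)) * norm (\<iota> (f z * (exp (z - w) / (1 - exp (z - w)))))"
      unfolding B_def by (rule norm_mult_ineq)
    also have "\<dots> \<le> (\<bar>MG\<bar> * exp (- d * \<bar>Re w\<bar>)) * ((\<bar>Mf\<bar> * exp (- d * \<bar>Re z\<bar>)) * (1 / s))"
    proof (intro mult_mono)
      show "norm (\<iota> (exp w * g w) * W (exp w)) \<le> \<bar>MG\<bar> * exp (- d * \<bar>Re w\<bar>)"
        by (rule exp_bound_weaken[OF leG]) (use zw \<psi> in \<open>auto simp: d_def\<close>)
      have "norm (\<iota> (f z * (exp (z - w) / (1 - exp (z - w))))) \<le> norm (f z) * norm (exp (z - w) / (1 - exp (z - w)))"
        unfolding norm_mult[symmetric] by (rule iota_norm)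
      also have "\<dots> \<le> (\<bar>Mf\<bar> * exp (- d * \<bar>Re z\<bar>)) * (1 / s)"
        by (intro mult_mono exp_bound_weaken[OF lef] kb(2)) (use zw \<psi> in \<open>auto simp: d_def\<close>)
      finally show "norm (\<iota> (f z * (exp (z - w) / (1 - exp (z - w))))) \<le> (\<bar>Mf\<bar> * exp (- d * \<bar>Re z\<bar>)) * (1 / s)" .
    qed auto
    finally show ?thesis by (simp add: N_def mult_ac)
  qed
  have Br: "rap \<phi>2 (B z)" if z: "\<bar>Im z\<bar> = \<phi>1" for z
  proof (rule rapI[OF _ d])
    have "continuous_on {w. \<bar>Im w\<bar> = \<bar>\<phi>2\<bar>} (\<lambda>w. (z, w))" by (intro continuous_intros)
    from continuous_on_compose2[OF Bc this] show "continuous_on {w. \<bar>Im w\<bar> = \<bar>\<phi>2\<bar>} (B z)"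
      using z \<psi> by auto
    show "norm (B z w) \<le> (N * exp (- d * \<bar>Re z\<bar>)) * exp (- d * \<bar>Re w\<bar>)" if "\<bar>Im w\<bar> = \<bar>\<phi>2\<bar>" for w
      using Ble[of z w] z that \<psi> by simp
  qed
  \<comment> \<open>In \<open>B\<close> the operator sits at the outer point w, so the z-integral
    has to be done first; decay of f in z and of g W in w justifies the interchange.\<close>
  have Bsw: "CI \<phi>1 (\<lambda>z. CI \<phi>2 (B z)) = CI \<phi>2 (\<lambda>w. CI \<phi>1 (\<lambda>z. B z w))" "rap \<phi>1 (\<lambda>z. CI \<phi>2 (B z))"
    using CI_swap[OF Bc d Ble] by auto
  have "CI \<phi>1 (\<lambda>z. B z w) = 0" if w: "\<bar>Im w\<bar> = \<phi>2" for w
  proof -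
    have bl: "bounded_linear (\<lambda>x. \<iota> (exp w * g w) * W (exp w) * \<iota> x)"
      by (rule bounded_linear_compose[OF bounded_linear_mult_right iota_bounded_linear])
    have r: "rap \<phi>1 (\<lambda>z. f z * (exp (z - w) / (1 - exp (z - w))))"
    proof (rule rapI[OF _ cf])
      show "continuous_on {z. \<bar>Im z\<bar> = \<bar>\<phi>1\<bar>} (\<lambda>z. f z * (exp (z - w) / (1 - exp (z - w))))"
        using \<psi> w kb(4) by (intro continuous_intros continuous_on_subset[OF holomorphic_on_imp_continuous_on[OF holf]]) auto
      fix z assume z: "\<bar>Im z\<bar> = \<bar>\<phi>1\<bar>"
      have "norm (f z) * norm (exp (z - w) / (1 - exp (z - w))) \<le> (\<bar>Mf\<bar> * exp (- cf * \<bar>Re z\<bar>)) * (1 / s)"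
        by (intro mult_mono exp_bound_weaken[OF lef] kb(2)) (use z w \<psi> in auto)
      then show "norm (f z * (exp (z - w) / (1 - exp (z - w)))) \<le> (\<bar>Mf\<bar> * (1 / s)) * exp (- cf * \<bar>Re z\<bar>)"
        unfolding norm_mult by (simp add: mult_ac)
    qed
    have "CI \<phi>1 (\<lambda>z. f z * (exp (z - w) / (1 - exp (z - w)))) = 0"
      by (rule strip_Cauchy_zero[OF holf _ _ _ _ cf lef]) (use \<psi> w in auto)
    then show ?thesis unfolding B_def[abs_def] by (simp only: CI_bounded_linear[OF bl r]) simp
  qed
  then have "CI \<phi>2 (\<lambda>w. CI \<phi>1 (\<lambda>z. B z w)) = CI \<phi>2 (\<lambda>w. 0 :: 'a)" using \<psi> by (intro CI_cong) auto
  then have B0: "CI \<phi>1 (\<lambda>z. CI \<phi>2 (B z)) = 0" unfolding Bsw(1) by (simp add: CI_def)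
  have Ar0: "rap \<phi>1 (\<lambda>z. \<iota> (exp z * (f z * g z)) * W (exp z))"
  proof (rule rapI[OF _ cF])
    show "continuous_on {z. \<bar>Im z\<bar> = \<bar>\<phi>1\<bar>} (\<lambda>z. \<iota> (exp z * (f z * g z)) * W (exp z))"
      using \<psi>
      by (intro continuous_intros continuous_on_compose2[OF regularD(2)[OF W]]
          continuous_on_subset[OF holomorphic_on_imp_continuous_on[OF holf]] continuous_on_subset[OF holomorphic_on_imp_continuous_on[OF holg]])
        (auto intro!: inOm)
    fix z assume z: "\<bar>Im z\<bar> = \<bar>\<phi>1\<bar>"
    have "norm (\<iota> (g z) * (\<iota> (exp z * f z) * W (exp z))) \<le> norm (g z) * norm (\<iota> (exp z * f z) * W (exp z))"
      by (rule norm_iota_mult)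
    also have "\<dots> \<le> \<bar>Mg\<bar> * (\<bar>MF\<bar> * exp (- cF * \<bar>Re z\<bar>))"
    proof (intro mult_mono)
      have "norm (g z) \<le> \<bar>Mg\<bar> * exp (- 0 * \<bar>Re z\<bar>)" by (rule exp_bound_weaken[OF leg]) (use z \<psi> cg in auto)
      then show "norm (g z) \<le> \<bar>Mg\<bar>" by simp
      show "norm (\<iota> (exp z * f z) * W (exp z)) \<le> \<bar>MF\<bar> * exp (- cF * \<bar>Re z\<bar>)"
        by (rule exp_bound_weaken[OF leF]) (use z \<psi> in auto)
    qed auto
    finally show "norm (\<iota> (exp z * (f z * g z)) * W (exp z)) \<le> (\<bar>Mg\<bar> * \<bar>MF\<bar>) * exp (- cF * \<bar>Re z\<bar>)"
      by (simp add: mult.assoc[symmetric] iota_mult[symmetric]) (simp add: mult_ac)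
  qed
  then show "rap \<phi>1 (\<lambda>z. \<iota> (exp z * (f z * g z)) * W (exp z))" .
  have Ar: "rap \<phi>1 (\<lambda>z. \<iota> (2 * pi * \<i>) * (\<iota> (exp z * (f z * g z)) * W (exp z)))"
    by (rule rap_bounded_linear[OF bounded_linear_mult_right Ar0])
  have Aeq: "CI \<phi>2 (A z) = \<iota> (2 * pi * \<i>) * (\<iota> (exp z * (f z * g z)) * W (exp z))" if z: "\<bar>Im z\<bar> = \<phi>1" for z
  proof -
    have "\<iota> (exp z * f z) * W (exp z) * \<iota> (2 * pi * \<i> * g z) = \<iota> (exp z * f z) * (\<iota> (2 * pi * \<i> * g z) * W (exp z))"
      using regularD(1)[OF W inOm, of z] z by (simp add: mult.assoc)
    also have "\<dots> = \<iota> (2 * pi * \<i>) * (\<iota> (exp z * (f z * g z)) * W (exp z))"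
      by (simp only: mult.assoc[symmetric] iota_mult[symmetric]) (simp add: mult_ac)
    finally show ?thesis using Aw(2)[OF z] by simp
  qed
  have "CI \<phi>1 (\<lambda>z. CI \<phi>2 (\<lambda>w. \<iota> (exp z * f z * (exp w * g w) / (exp w - exp z)) * (W (exp z) - W (exp w))))
      = CI \<phi>1 (\<lambda>z. \<iota> (2 * pi * \<i>) * (\<iota> (exp z * (f z * g z)) * W (exp z)) - CI \<phi>2 (B z))"
  proof (rule CI_cong)
    fix z assume "\<bar>Im z\<bar> = \<bar>\<phi>1\<bar>"
    then have z: "\<bar>Im z\<bar> = \<phi>1" using \<psi> by simp
    have "CI \<phi>2 (\<lambda>w. \<iota> (exp z * f z * (exp w * g w) / (exp w - exp z)) * (W (exp z) - W (exp w))) = CI \<phi>2 (\<lambda>w. A z w - B z w)"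
      by (rule CI_cong) (use eq z \<psi> in auto)
    also have "\<dots> = CI \<phi>2 (A z) - CI \<phi>2 (B z)" by (rule CI_diff[OF Aw(1)[OF z] Br[OF z]])
    finally show "CI \<phi>2 (\<lambda>w. \<iota> (exp z * f z * (exp w * g w) / (exp w - exp z)) * (W (exp z) - W (exp w))) =
       \<iota> (2 * pi * \<i>) * (\<iota> (exp z * (f z * g z)) * W (exp z)) - CI \<phi>2 (B z)" by (simp add: Aeq[OF z])
  qed
  also have "\<dots> = CI \<phi>1 (\<lambda>z. \<iota> (2 * pi * \<i>) * (\<iota> (exp z * (f z * g z)) * W (exp z)))"
    unfolding CI_diff[OF Ar Bsw(2)] B0 by simp
  also have "\<dots> = \<iota> (2 * pi * \<i>) * CI \<phi>1 (\<lambda>z. \<iota> (exp z * (f z * g z)) * W (exp z))"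
    by (rule CI_bounded_linear[OF bounded_linear_mult_right Ar0])
  finally show "CI \<phi>1 (\<lambda>z. CI \<phi>2 (\<lambda>w. \<iota> (exp z * f z * (exp w * g w) / (exp w - exp z)) * (W (exp z) - W (exp w))))
     = \<iota> (2 * pi * \<i>) * CI \<phi>1 (\<lambda>z. \<iota> (exp z * (f z * g z)) * W (exp z))" .
qed

end

context quat_rep begin

lemma CI_sum:
  fixes k :: "'i \<Rightarrow> complex \<Rightarrow> 'b::banach"
  assumes "finite I" "\<And>i. i \<in> I \<Longrightarrow> rap \<phi> (k i)"
  shows "rap \<phi> (\<lambda>z. \<Sum>i\<in>I. k i z) \<and> CI \<phi> (\<lambda>z. \<Sum>i\<in>I. k i z) = (\<Sum>i\<in>I. CI \<phi> (k i))"
  using assms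
proof (induction I rule: finite_induct)
  case empty
  have "rap \<phi> (\<lambda>z. 0 :: 'b)" by (rule rapI[where M = 0 and c = 1]) auto
  then show ?case by (simp add: CI_def)
next
  case (insert i I)
  then show ?case by (auto intro: rap_add simp: CI_add)
qed

text \<open>The hypothesis \<open>eq\<close> is an abstract resolvent identity. A larger angle
  \<open>\<phi>2\<close> for the outer variable keeps 1 / (p - s) finite; the factor p - s then
  cancels, the double integral separates into products, and \<open>adm_shift\<close> brings the
  outer contour back to \<open>\<phi>\<close>.\<close>

lemma Phi_mult:
  assumes \<psi>: "0 < \<psi>" "\<psi> < \<phi>" "\<phi> < \<theta>" "\<theta> < pi"
    and W: "regular \<psi> W" "adm \<psi> \<theta> W f" "adm \<psi> \<theta> W g" and "finite I"
    and X: "\<And>i. i \<in> I \<Longrightarrow> regular \<psi> (X i)" "\<And>i. i \<in> I \<Longrightarrow> adm \<psi> \<theta> (X i) f"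
    and Y: "\<And>i. i \<in> I \<Longrightarrow> regular \<psi> (Y i)" "\<And>i. i \<in> I \<Longrightarrow> adm \<psi> \<theta> (Y i) g"
    and eq: "\<And>s p. s \<in> Om \<psi> \<Longrightarrow> p \<in> Om \<psi> \<Longrightarrow> W s - W p = \<iota> (p - s) * (\<Sum>i\<in>I. X i s * Y i p)"
  shows "\<Phi> \<phi> W (\<lambda>z. f z * g z) = (\<Sum>i\<in>I. \<Phi> \<phi> (X i) f * \<Phi> \<phi> (Y i) g)"
proof -
  define \<phi>2 where "\<phi>2 = (\<phi> + \<theta>) / 2"
  have p2: "\<phi> < \<phi>2" "\<phi>2 < \<theta>" using \<psi> by (auto simp: \<phi>2_def)
  define x where "x i z = \<iota> (exp z * f z) * X i (exp z)" for i z
  define y where "y i z = \<iota> (exp z * g z) * Y i (exp z)" for i z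
  have rx: "rap \<phi> (x i)" if "i \<in> I" for i
    unfolding x_def by (rule adm_rap[OF X(1)[OF that] X(2)[OF that]]) (use \<psi> in auto)
  have ry: "rap \<phi>2 (y i)" if "i \<in> I" for i
    unfolding y_def by (rule adm_rap[OF Y(1)[OF that] Y(2)[OF that]]) (use \<psi> p2 in auto)
  have sh: "CI \<phi>2 (y i) = CI \<phi> (y i)" if "i \<in> I" for i
    unfolding y_def by (rule adm_shift[OF Y(1)[OF that] Y(2)[OF that], symmetric]) (use \<psi> p2 in auto)
  have inOm: "exp z \<in> Om \<psi>" if "\<bar>Im z\<bar> = \<phi> \<or> \<bar>Im z\<bar> = \<phi>2" for z using that \<psi> p2 by (intro exp_in_Om) auto
  have pt: "\<iota> (exp z * f z * (exp w * g w) / (exp w - exp z)) * (W (exp z) - W (exp w)) = (\<Sum>i\<in>I. x i z * y i w)"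
    if "\<bar>Im z\<bar> = \<phi>" "\<bar>Im w\<bar> = \<phi>2" for z w
  proof -
    have "exp (z - w) \<noteq> 1"
      by (rule exp_kernel_bound(4)[of "\<phi>2 - \<phi>"]) (use that \<psi> p2 in linarith)+
    then have ne: "exp w - exp z \<noteq> 0" by (simp add: exp_diff)
    have "\<iota> (exp z * f z * (exp w * g w) / (exp w - exp z)) * (W (exp z) - W (exp w)) =
        \<iota> (exp z * f z * (exp w * g w) / (exp w - exp z)) * (\<iota> (exp w - exp z) * (\<Sum>i\<in>I. X i (exp z) * Y i (exp w)))"
      using eq[OF inOm inOm] that by simp
    also have "\<dots> = \<iota> (exp z * f z) * (\<iota> (exp w * g w) * (\<Sum>i\<in>I. X i (exp z) * Y i (exp w)))"
      using ne by (simp add: mult.assoc[symmetric] iota_mult[symmetric])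
    also have "\<dots> = (\<Sum>i\<in>I. x i z * y i w)"
      unfolding sum_distrib_left
    proof (rule sum.cong[OF refl])
      fix i assume "i \<in> I"
      then have "X i (exp z) * \<iota> (exp w * g w) = \<iota> (exp w * g w) * X i (exp z)"
        using regularD(1)[OF X(1)] inOm[of z] that by simp
      then have "X i (exp z) * (\<iota> (exp w * g w) * t) = \<iota> (exp w * g w) * (X i (exp z) * t)" for t
        by (simp only: mult.assoc[symmetric])
      then show "\<iota> (exp z * f z) * (\<iota> (exp w * g w) * (X i (exp z) * Y i (exp w))) = x i z * y i w"
        by (simp only: x_def y_def mult.assoc)
    qed
    finally show ?thesis .
  qed
  have inner: "CI \<phi>2 (\<lambda>w. \<Sum>i\<in>I. x i z * y i w) = (\<Sum>i\<in>I. x i z * CI \<phi> (y i))" for z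
  proof -
    have "CI \<phi>2 (\<lambda>w. \<Sum>i\<in>I. x i z * y i w) = (\<Sum>i\<in>I. CI \<phi>2 (\<lambda>w. x i z * y i w))"
      by (rule CI_sum[OF \<open>finite I\<close>, THEN conjunct2]) (rule rap_bounded_linear[OF bounded_linear_mult_right ry])
    also have "\<dots> = (\<Sum>i\<in>I. x i z * CI \<phi> (y i))"
      by (intro sum.cong refl) (simp only: CI_bounded_linear[OF bounded_linear_mult_right ry] sh)
    finally show ?thesis .
  qed
  have "\<iota> (2 * pi * \<i>) * CI \<phi> (\<lambda>z. \<iota> (exp z * (f z * g z)) * W (exp z)) =
      CI \<phi> (\<lambda>z. CI \<phi>2 (\<lambda>w. \<iota> (exp z * f z * (exp w * g w) / (exp w - exp z)) * (W (exp z) - W (exp w))))"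
    by (rule double_integral(1)[OF W, symmetric]) (use \<psi> p2 in auto)
  also have "\<dots> = CI \<phi> (\<lambda>z. CI \<phi>2 (\<lambda>w. \<Sum>i\<in>I. x i z * y i w))"
    using \<psi> p2 by (intro CI_cong pt) auto
  also have "\<dots> = CI \<phi> (\<lambda>z. \<Sum>i\<in>I. x i z * CI \<phi> (y i))" by (simp add: inner)
  also have "\<dots> = (\<Sum>i\<in>I. CI \<phi> (\<lambda>z. x i z * CI \<phi> (y i)))"
    by (rule CI_sum[OF \<open>finite I\<close>, THEN conjunct2]) (rule rap_bounded_linear[OF bounded_linear_mult_left rx])
  also have "\<dots> = (\<Sum>i\<in>I. CI \<phi> (x i) * CI \<phi> (y i))"
    by (intro sum.cong refl) (simp only: CI_bounded_linear[OF bounded_linear_mult_left rx])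
  finally have main: "\<iota> (2 * pi * \<i>) * CI \<phi> (\<lambda>z. \<iota> (exp z * (f z * g z)) * W (exp z)) = (\<Sum>i\<in>I. CI \<phi> (x i) * CI \<phi> (y i))" .
  have com: "CI \<phi> (x i) * \<iota> c = \<iota> c * CI \<phi> (x i)" if "i \<in> I" for i c
  proof -
    have "CI \<phi> (\<lambda>z. x i z * \<iota> c) = CI \<phi> (\<lambda>z. \<iota> c * x i z)"
    proof (rule CI_cong)
      fix z assume "\<bar>Im z\<bar> = \<bar>\<phi>\<bar>"
      then have "X i (exp z) * \<iota> c = \<iota> c * X i (exp z)" using \<psi> inOm regularD(1)[OF X(1)[OF that]] by auto
      then show "x i z * \<iota> c = \<iota> c * x i z" unfolding x_def by (simp add: mult.assoc iota_left_commute)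
    qed
    then show ?thesis
      by (simp only: CI_bounded_linear[OF bounded_linear_mult_left rx[OF that]] CI_bounded_linear[OF bounded_linear_mult_right rx[OF that]])
  qed
  let ?c = "1 / (2 * pi * \<i>) :: complex"
  have "\<Phi> \<phi> W (\<lambda>z. f z * g z) = \<iota> ?c * (\<iota> ?c * (\<iota> (2 * pi * \<i>) * CI \<phi> (\<lambda>z. \<iota> (exp z * (f z * g z)) * W (exp z))))"
    unfolding \<Phi>_def by (simp add: mult.assoc[symmetric] iota_mult[symmetric])
  also have "\<dots> = (\<Sum>i\<in>I. \<iota> ?c * CI \<phi> (x i) * (\<iota> ?c * CI \<phi> (y i)))"
    unfolding main sum_distrib_left
  proof (rule sum.cong[OF refl])
    fix i assume "i \<in> I"
    then have "CI \<phi> (x i) * (\<iota> ?c * t) = \<iota> ?c * (CI \<phi> (x i) * t)" for t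
      by (simp only: mult.assoc[symmetric] com)
    then show "\<iota> ?c * (\<iota> ?c * (CI \<phi> (x i) * CI \<phi> (y i))) = \<iota> ?c * CI \<phi> (x i) * (\<iota> ?c * CI \<phi> (y i))"
      by (simp only: mult.assoc)
  qed
  finally show ?thesis unfolding \<Phi>_def x_def y_def .
qed

text \<open>Up to sign \<open>\<Delta>\<close> is a difference quotient, so its continuity at the
  diagonal yields the derivative \<open>- \<Delta> p p\<close>. Resolvent identities have exactly
  this form.\<close>

lemma regularI:
  assumes com: "\<And>s c. s \<in> Om \<psi> \<Longrightarrow> W s * \<iota> c = \<iota> c * W s"
    and \<Delta>: "\<And>s p. s \<in> Om \<psi> \<Longrightarrow> p \<in> Om \<psi> \<Longrightarrow> W s - W p = \<iota> (p - s) * \<Delta> s p"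
    and lim: "\<And>p. p \<in> Om \<psi> \<Longrightarrow> ((\<lambda>s. \<Delta> s p) \<longlongrightarrow> \<Delta> p p) (at p)"
    and cont: "continuous_on (Om \<psi>) (\<lambda>p. \<Delta> p p)"
  shows "regular \<psi> W"
  unfolding regular_def
proof (intro conjI ballI allI exI)
  show "continuous_on (Om \<psi>) (\<lambda>p. - \<Delta> p p)" by (intro continuous_intros cont)
  fix p assume p: "p \<in> Om \<psi>"
  show "W p * \<iota> c = \<iota> c * W p" for c by (rule com[OF p])
  show "(W has_derivative (\<lambda>h. \<iota> h * - \<Delta> p p)) (at p)"
    unfolding has_derivative_iff_norm
  proof
    show "bounded_linear (\<lambda>h. \<iota> h * - \<Delta> p p)"
      by (rule bounded_linear_compose[OF bounded_linear_mult_left iota_bounded_linear])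
    show "((\<lambda>s. norm ((W s - W p) - \<iota> (s - p) * - \<Delta> p p) / norm (s - p)) \<longlongrightarrow> 0) (at p)"
    proof (rule Lim_null_comparison)
      have "((\<lambda>s. \<Delta> s p - \<Delta> p p) \<longlongrightarrow> \<Delta> p p - \<Delta> p p) (at p)" by (intro tendsto_diff lim p tendsto_const)
      then show "((\<lambda>s. norm (\<Delta> s p - \<Delta> p p)) \<longlongrightarrow> 0) (at p)" by (simp add: tendsto_norm_zero)
      have "eventually (\<lambda>s. s \<in> Om \<psi>) (at p)" using p open_Om by (auto simp: eventually_at_topological)
      then show "\<forall>\<^sub>F s in at p. norm (norm ((W s - W p) - \<iota> (s - p) * - \<Delta> p p) / norm (s - p)) \<le> norm (\<Delta> s p - \<Delta> p p)"
        using eventually_neq_at_within[of p p UNIV]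
      proof eventually_elim
        case (elim s)
        have "(W s - W p) - \<iota> (s - p) * - \<Delta> p p = \<iota> (p - s) * (\<Delta> s p - \<Delta> p p)"
          using \<Delta>[OF elim(1) p] by (simp add: iota_diff algebra_simps)
        then have "norm ((W s - W p) - \<iota> (s - p) * - \<Delta> p p) \<le> norm (s - p) * norm (\<Delta> s p - \<Delta> p p)"
          using norm_iota_mult[of "p - s" "\<Delta> s p - \<Delta> p p"] by (simp add: norm_minus_commute[of s p])
        then show ?case using elim(2) by (simp add: divide_le_eq mult.commute)
      qed
    qed
  qed
qed

lemma adm_bound1:
  assumes f: "E0 \<theta> f" and "0 < \<psi>" "\<theta> < pi" and le: "\<And>s. s \<in> Om \<psi> \<Longrightarrow> norm (W s) \<le> K / norm s"
  shows "adm \<psi> \<theta> W f"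
proof -
  obtain M c where c: "c > 0" and lef: "\<And>z. \<bar>Im z\<bar> < \<theta> \<Longrightarrow> norm (f z) \<le> M * exp (- c * \<bar>Re z\<bar>)"
    using f by (auto simp: E0_def)
  have "norm (\<iota> (exp z * f z) * W (exp z)) \<le> (M * \<bar>K\<bar>) * exp (- c * \<bar>Re z\<bar>)" if z: "\<psi> < \<bar>Im z\<bar>" "\<bar>Im z\<bar> < \<theta>" for z
  proof -
    have Om: "exp z \<in> Om \<psi>" using that assms by (intro exp_in_Om) auto
    have "norm (W (exp z)) \<le> \<bar>K\<bar> / exp (Re z)" using le[OF Om] by (smt (verit) divide_right_mono exp_gt_zero norm_exp_eq_Re)
    then have "norm (exp z * f z) * norm (W (exp z)) \<le> (exp (Re z) * norm (f z)) * (\<bar>K\<bar> / exp (Re z))"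
      by (intro mult_mono) (auto simp: norm_mult)
    also have "\<dots> = \<bar>K\<bar> * norm (f z)" by simp
    also have "\<dots> \<le> \<bar>K\<bar> * (M * exp (- c * \<bar>Re z\<bar>))" using lef z by (intro mult_left_mono) auto
    finally show ?thesis by (intro order_trans[OF norm_iota_mult]) (simp add: mult_ac)
  qed
  then show ?thesis using f c unfolding adm_def by blast
qed

text \<open>One power of 1 / norm s is absorbed by ds, the other one stays with f; this is why
  \<open>E1\<close> asks for decay of f(s) / s besides that of f(s).\<close>

lemma adm_bound2:
  assumes f: "E1 \<theta> f" and "0 < \<psi>" "\<theta> < pi" and le: "\<And>s. s \<in> Om \<psi> \<Longrightarrow> norm (W s) \<le> K / (norm s)\<^sup>2"
  shows "adm \<psi> \<theta> W f"
proof -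
  obtain M c where c: "c > 0" and lef: "\<And>z. \<bar>Im z\<bar> < \<theta> \<Longrightarrow> norm (f z) * exp (- Re z) \<le> M * exp (- c * \<bar>Re z\<bar>)"
    using f by (auto simp: E1_def)
  have "norm (\<iota> (exp z * f z) * W (exp z)) \<le> (M * \<bar>K\<bar>) * exp (- c * \<bar>Re z\<bar>)" if z: "\<psi> < \<bar>Im z\<bar>" "\<bar>Im z\<bar> < \<theta>" for z
  proof -
    have Om: "exp z \<in> Om \<psi>" using that assms by (intro exp_in_Om) auto
    have "norm (W (exp z)) \<le> \<bar>K\<bar> / (exp (Re z))\<^sup>2"
      using le[OF Om] by (smt (verit) divide_right_mono zero_le_power2 norm_exp_eq_Re)
    then have "norm (exp z * f z) * norm (W (exp z)) \<le> (exp (Re z) * norm (f z)) * (\<bar>K\<bar> / (exp (Re z))\<^sup>2)"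
      by (intro mult_mono) (auto simp: norm_mult)
    also have "\<dots> = \<bar>K\<bar> * (norm (f z) * exp (- Re z))" by (simp add: power2_eq_square exp_minus field_simps)
    also have "\<dots> \<le> \<bar>K\<bar> * (M * exp (- c * \<bar>Re z\<bar>))" using lef z by (intro mult_left_mono) auto
    finally show ?thesis by (intro order_trans[OF norm_iota_mult]) (simp add: mult_ac)
  qed
  then show ?thesis using f c unfolding adm_def E1_def by blast
qed

end

text \<open>\<open>q s\<close> and \<open>w i s\<close> stand for \<open>Q\<^bsub>c,s\<^esub>\<^sup>-\<^sup>1(T)\<close> and \<open>T\<^sub>i Q\<^bsub>c,s\<^esub>\<^sup>-\<^sup>1(T)\<close> with \<open>s \<in> \<complex>\<^sub>J\<close>, \<open>J = e\<^sub>1\<close>.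
  Passing from \<open>T\<close> to its conjugate only changes the sign of \<open>w 1\<close>, \<open>w 2\<close>, \<open>w 3\<close>.\<close>
locale Q_family = quat_rep L for L :: "quat \<Rightarrow> 'a::{real_normed_algebra,monoid_mult,banach}" +
  fixes q :: "complex \<Rightarrow> 'a" and w :: "nat \<Rightarrow> complex \<Rightarrow> 'a" and \<psi> K :: real
  assumes psi: "0 < \<psi>" "\<psi> < pi" and K: "0 \<le> K"
    and q_iota: "s \<in> Om \<psi> \<Longrightarrow> q s * \<iota> c = \<iota> c * q s"
    and w_iota: "s \<in> Om \<psi> \<Longrightarrow> i < 4 \<Longrightarrow> w i s * \<iota> c = \<iota> c * w i s"
    and q_jj: "s \<in> Om \<psi> \<Longrightarrow> q s * jj = jj * q (cnj s)"
    and w_jj: "s \<in> Om \<psi> \<Longrightarrow> i < 4 \<Longrightarrow> w i s * jj = jj * w i (cnj s)"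
    and q_q: "s \<in> Om \<psi> \<Longrightarrow> p \<in> Om \<psi> \<Longrightarrow> q s * q p = q p * q s"
    and w_q: "s \<in> Om \<psi> \<Longrightarrow> p \<in> Om \<psi> \<Longrightarrow> i < 4 \<Longrightarrow> w i s * q p = q p * w i s"
    and w_w: "s \<in> Om \<psi> \<Longrightarrow> p \<in> Om \<psi> \<Longrightarrow> i < 4 \<Longrightarrow> k < 4 \<Longrightarrow> w i s * w k p = w k p * w i s"
    and w_q_exch: "s \<in> Om \<psi> \<Longrightarrow> p \<in> Om \<psi> \<Longrightarrow> i < 4 \<Longrightarrow> w i s * q p = q s * w i p"
    and w_w_exch: "s \<in> Om \<psi> \<Longrightarrow> p \<in> Om \<psi> \<Longrightarrow> i < 4 \<Longrightarrow> k < 4 \<Longrightarrow> w i s * w k p = w k s * w i p"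
    and q_diff: "s \<in> Om \<psi> \<Longrightarrow> p \<in> Om \<psi> \<Longrightarrow>
       q s - q p = \<iota> (p - s) * (\<iota> (p + s) * (q s * q p) - 2 *\<^sub>R (w 0 s * q p))"
    and w_diff: "s \<in> Om \<psi> \<Longrightarrow> p \<in> Om \<psi> \<Longrightarrow> i < 4 \<Longrightarrow>
       w i s - w i p = \<iota> (p - s) * (\<iota> (p + s) * (w i s * q p) - 2 *\<^sub>R (w 0 s * w i p))"
    and sq_diff: "s \<in> Om \<psi> \<Longrightarrow> p \<in> Om \<psi> \<Longrightarrow>
       \<iota> s * q s - \<iota> p * q p = \<iota> (p - s) * (\<iota> (s * p) * (q s * q p) - (\<Sum>i<4. w i s * w i p))"
    and q_norm: "s \<in> Om \<psi> \<Longrightarrow> norm (q s) \<le> K / (norm s)\<^sup>2"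
    and w_norm: "s \<in> Om \<psi> \<Longrightarrow> i < 4 \<Longrightarrow> norm (w i s) \<le> K / norm s"
begin

definition sq :: "complex \<Rightarrow> 'a" where "sq s = \<iota> s * q s"

lemma sq_norm: "s \<in> Om \<psi> \<Longrightarrow> norm (sq s) \<le> K / norm s"
proof -
  assume s: "s \<in> Om \<psi>"
  have "norm (sq s) \<le> norm s * norm (q s)" unfolding sq_def by (rule norm_iota_mult)
  also have "\<dots> \<le> norm s * (K / (norm s)\<^sup>2)" by (intro mult_left_mono q_norm s) auto
  also have "\<dots> = K / norm s" using Om_nonzero[OF s] by (simp add: power2_eq_square)
  finally show ?thesis .
qed

text \<open>Continuity is bootstrapped from the resolvent identities: the right sides carry the
  factor p - s, and the norm bounds keep the remaining factor bounded near p. The identities for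
  \<open>q\<close> and for \<open>w i\<close> share one shape, with \<open>X\<close> being
  \<open>q\<close> or \<open>w i\<close>.\<close>

lemma q_cont: "continuous_on (Om \<psi>) q"
  and w_cont: "i < 4 \<Longrightarrow> continuous_on (Om \<psi>) (w i)"
proof -
  have *: "continuous_on (Om \<psi>) W"
    if eq: "\<And>s p. s \<in> Om \<psi> \<Longrightarrow> p \<in> Om \<psi> \<Longrightarrow> W s - W p = \<iota> (p - s) * (\<iota> (p + s) * (X s * q p) - 2 *\<^sub>R (w 0 s * X p))"
      and le: "\<And>s. s \<in> Om \<psi> \<Longrightarrow> norm (X s) \<le> B s" and B: "continuous_on (Om \<psi>) B" for W X B
  proof (rule continuous_at_imp_continuous_on, rule ballI)
    fix p assume p: "p \<in> Om \<psi>"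
    have p0: "p \<noteq> 0" by (rule Om_nonzero[OF p])
    have Bp: "(B \<longlongrightarrow> B p) (at p)" using B p by (simp add: continuous_on_eq_continuous_at[OF open_Om] isCont_def)
    have "((\<lambda>s. W s - W p) \<longlongrightarrow> 0) (at p)"
    proof (rule Lim_null_comparison)
      have "((\<lambda>s. norm (p - s) * (norm (p + s) * (B s * (K / (norm p)\<^sup>2)) + 2 * (K / norm s * B p))) \<longlongrightarrow>
         norm (p - p) * (norm (p + p) * (B p * (K / (norm p)\<^sup>2)) + 2 * (K / norm p * B p))) (at p)"
        using p0 by (intro tendsto_intros Bp) auto
      then show "((\<lambda>s. norm (p - s) * (norm (p + s) * (B s * (K / (norm p)\<^sup>2)) + 2 * (K / norm s * B p))) \<longlongrightarrow> 0) (at p)" by simp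
      have "eventually (\<lambda>s. s \<in> Om \<psi>) (at p)" using p open_Om by (auto simp: eventually_at_topological)
      then show "\<forall>\<^sub>F s in at p. norm (W s - W p) \<le> norm (p - s) * (norm (p + s) * (B s * (K / (norm p)\<^sup>2)) + 2 * (K / norm s * B p))"
      proof eventually_elim
        case (elim s)
        have B0: "0 \<le> B s" "0 \<le> B p" using order_trans[OF norm_ge_zero le] elim p by auto
        have "norm (X s * q p) \<le> B s * (K / (norm p)\<^sup>2)"
          by (rule order_trans[OF norm_mult_ineq]) (intro mult_mono le q_norm elim p norm_ge_zero B0)
        then have 1: "norm (\<iota> (p + s) * (X s * q p)) \<le> norm (p + s) * (B s * (K / (norm p)\<^sup>2))"
          by (intro order_trans[OF norm_iota_mult] mult_left_mono) auto
        have "norm (w 0 s * X p) \<le> K / norm s * B p"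
          by (rule order_trans[OF norm_mult_ineq]) (intro mult_mono le w_norm elim p norm_ge_zero; use K in simp)
        then have 2: "norm (2 *\<^sub>R (w 0 s * X p)) \<le> 2 * (K / norm s * B p)" by simp
        have "norm (\<iota> (p + s) * (X s * q p) - 2 *\<^sub>R (w 0 s * X p)) \<le> norm (p + s) * (B s * (K / (norm p)\<^sup>2)) + 2 * (K / norm s * B p)"
          using norm_triangle_ineq4 add_mono[OF 1 2] by (rule order_trans)
        then show ?case unfolding eq[OF elim p]
          by (intro order_trans[OF norm_iota_mult] mult_left_mono) auto
      qed
    qed
    then show "isCont W p" by (simp add: isCont_def LIM_zero_iff)
  qed
  show "continuous_on (Om \<psi>) q"
    by (rule *[where X = q and B = "\<lambda>s. K / (norm s)\<^sup>2", OF q_diff q_norm]) (auto intro!: continuous_intros simp: Om_nonzero)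
  show "continuous_on (Om \<psi>) (w i)" if "i < 4"
    by (rule *[where X = "w i" and B = "\<lambda>s. K / norm s", OF w_diff w_norm]) (use that in \<open>auto intro!: continuous_intros simp: Om_nonzero\<close>)
qed

lemma cont_tendsto: "continuous_on (Om \<psi>) F \<Longrightarrow> p \<in> Om \<psi> \<Longrightarrow> (F \<longlongrightarrow> F p) (at p)"
  by (simp add: continuous_on_eq_continuous_at[OF open_Om] isCont_def)

lemma regular_q: "regular \<psi> q"
proof (rule regularI[OF q_iota q_diff])
  fix p assume p: "p \<in> Om \<psi>"
  show "((\<lambda>s. \<iota> (p + s) * (q s * q p) - 2 *\<^sub>R (w 0 s * q p)) \<longlongrightarrow> \<iota> (p + p) * (q p * q p) - 2 *\<^sub>R (w 0 p * q p)) (at p)"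
    by (intro tendsto_intros bounded_linear.tendsto[OF iota_bounded_linear] cont_tendsto[OF q_cont p] cont_tendsto[OF w_cont p]) auto
next
  show "continuous_on (Om \<psi>) (\<lambda>p. \<iota> (p + p) * (q p * q p) - 2 *\<^sub>R (w 0 p * q p))"
    by (intro continuous_intros q_cont w_cont) auto
qed auto

lemma regular_w:
  assumes i: "i < 4" shows "regular \<psi> (w i)"
proof (rule regularI[OF w_iota w_diff])
  fix p assume p: "p \<in> Om \<psi>"
  show "((\<lambda>s. \<iota> (p + s) * (w i s * q p) - 2 *\<^sub>R (w 0 s * w i p)) \<longlongrightarrow> \<iota> (p + p) * (w i p * q p) - 2 *\<^sub>R (w 0 p * w i p)) (at p)"
    by (intro tendsto_intros bounded_linear.tendsto[OF iota_bounded_linear] cont_tendsto[OF q_cont p] cont_tendsto[OF w_cont p] i) auto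
next
  show "continuous_on (Om \<psi>) (\<lambda>p. \<iota> (p + p) * (w i p * q p) - 2 *\<^sub>R (w 0 p * w i p))"
    by (intro continuous_intros q_cont w_cont i) auto
qed (use i in auto)

lemma regular_scaleR:
  assumes "regular \<psi> W" shows "regular \<psi> (\<lambda>s. r *\<^sub>R W s)"
proof -
  obtain W' where W': "continuous_on (Om \<psi>) W'" "\<And>s. s \<in> Om \<psi> \<Longrightarrow> (W has_derivative (\<lambda>h. \<iota> h * W' s)) (at s)"
    using assms unfolding regular_def by blast
  show ?thesis unfolding regular_def
  proof (intro conjI exI ballI allI)
    show "r *\<^sub>R W s * \<iota> c = \<iota> c * (r *\<^sub>R W s)" if "s \<in> Om \<psi>" for s c
      using regularD(1)[OF assms that, of c] by simp
    show "continuous_on (Om \<psi>) (\<lambda>s. r *\<^sub>R W' s)" by (intro continuous_intros W')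
    show "((\<lambda>s. r *\<^sub>R W s) has_derivative (\<lambda>h. \<iota> h * (r *\<^sub>R W' s))) (at s)" if "s \<in> Om \<psi>" for s
      using has_derivative_scaleR_right[OF W'(2)[OF that], of r] by simp
  qed
qed

lemma sq_diff': "s \<in> Om \<psi> \<Longrightarrow> p \<in> Om \<psi> \<Longrightarrow> sq s - sq p = \<iota> (p - s) * (sq s * sq p - (\<Sum>i<4. w i s * w i p))"
proof -
  assume s: "s \<in> Om \<psi>" and p: "p \<in> Om \<psi>"
  have "sq s * sq p = \<iota> s * (q s * \<iota> p) * q p" by (simp add: sq_def mult.assoc)
  also have "\<dots> = \<iota> (s * p) * (q s * q p)" using q_iota[OF s] by (simp add: iota_mult mult.assoc)
  finally show ?thesis using sq_diff[OF s p] by (simp add: sq_def)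
qed

lemma sq_cont: "continuous_on (Om \<psi>) sq" unfolding sq_def[abs_def] by (intro continuous_intros q_cont)

lemma regular_sq: "regular \<psi> sq"
proof (rule regularI[OF _ sq_diff'])
  show "sq s * \<iota> c = \<iota> c * sq s" if "s \<in> Om \<psi>" for s c
    using q_iota[OF that] by (simp add: sq_def mult.assoc iota_left_commute)
  fix p assume p: "p \<in> Om \<psi>"
  show "((\<lambda>s. sq s * sq p - (\<Sum>i<4. w i s * w i p)) \<longlongrightarrow> sq p * sq p - (\<Sum>i<4. w i p * w i p)) (at p)"
    by (intro tendsto_intros cont_tendsto[OF sq_cont p] cont_tendsto[OF w_cont p]) auto
next
  show "continuous_on (Om \<psi>) (\<lambda>p. sq p * sq p - (\<Sum>i<4. w i p * w i p))"
    by (intro continuous_intros sq_cont w_cont) auto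
qed auto

end

section \<open>Product rules\<close>

text \<open>The exchange hypotheses \<open>x\<close> kill the mixed products, for instance e1 e2 u1
  v2 + e2 e1 u2 v1 = e3 (u1 v2 - u2 v1) = 0, so only the sum of the products u_i v_i with a minus
  sign remains. Independent \<open>\<sigma>\<close> and \<open>\<tau>\<close> allow one factor to
  belong to T and the other to its conjugate.\<close>

lemma quaternion_split_product:
  fixes a b :: "'a::{real_normed_algebra,monoid_mult}"
  assumes e: "e1 * e1 = -1" "e2 * e2 = -1" "e3 * e3 = -1" "e1 * e2 = e3" "e2 * e1 = - e3"
      "e2 * e3 = e1" "e3 * e2 = - e1" "e3 * e1 = e2" "e1 * e3 = - e2"
    and c: "a * e1 = e1 * a" "a * e2 = e2 * a" "a * e3 = e3 * a"
      "u1 * e1 = e1 * u1" "u1 * e2 = e2 * u1" "u1 * e3 = e3 * u1"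
      "u2 * e1 = e1 * u2" "u2 * e2 = e2 * u2" "u2 * e3 = e3 * u2"
      "u3 * e1 = e1 * u3" "u3 * e2 = e2 * u3" "u3 * e3 = e3 * u3"
    and x: "u1 * v2 = u2 * v1" "u1 * v3 = u3 * v1" "u2 * v3 = u3 * v2"
  shows "(a + \<sigma> *\<^sub>R (e1 * u1 + e2 * u2 + e3 * u3)) * (b + \<tau> *\<^sub>R (e1 * v1 + e2 * v2 + e3 * v3)) =
     (a * b - (\<sigma> * \<tau>) *\<^sub>R (u1 * v1 + u2 * v2 + u3 * v3)) +
     (e1 * (\<sigma> *\<^sub>R (u1 * b) + \<tau> *\<^sub>R (a * v1)) + e2 * (\<sigma> *\<^sub>R (u2 * b) + \<tau> *\<^sub>R (a * v2)) + e3 * (\<sigma> *\<^sub>R (u3 * b) + \<tau> *\<^sub>R (a * v3)))"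
proof -
  have lc: "p * (f * t) = f * (p * t)" if "p * f = f * p" for p f t :: 'a
    using that by (simp flip: mult.assoc)
  have le: "f * (g * t) = h * t" if "f * g = h" for f g h t :: 'a using that by (simp flip: mult.assoc)
  note [simp] = c[THEN lc] e[THEN le]
  define E where "E = e1 * u1 + e2 * u2 + e3 * u3"
  define F where "F = e1 * v1 + e2 * v2 + e3 * v3"
  have EF: "E * F = - (u1 * v1 + u2 * v2 + u3 * v3)"
    by (simp add: E_def F_def distrib_left distrib_right mult.assoc x)
  have Eb: "E * b = e1 * (u1 * b) + e2 * (u2 * b) + e3 * (u3 * b)"
    and aF: "a * F = e1 * (a * v1) + e2 * (a * v2) + e3 * (a * v3)"
    by (simp_all add: E_def F_def distrib_left distrib_right mult.assoc)
  have "(a + \<sigma> *\<^sub>R E) * (b + \<tau> *\<^sub>R F) = a * b + \<tau> *\<^sub>R (a * F) + \<sigma> *\<^sub>R (E * b) + (\<sigma> * \<tau>) *\<^sub>R (E * F)"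
    by (simp add: distrib_left distrib_right scaleR_add_right mult.commute)
  also have "\<dots> = (a * b - (\<sigma> * \<tau>) *\<^sub>R (u1 * v1 + u2 * v2 + u3 * v3)) +
     (e1 * (\<sigma> *\<^sub>R (u1 * b) + \<tau> *\<^sub>R (a * v1)) + e2 * (\<sigma> *\<^sub>R (u2 * b) + \<tau> *\<^sub>R (a * v2)) + e3 * (\<sigma> *\<^sub>R (u3 * b) + \<tau> *\<^sub>R (a * v3)))"
    unfolding EF Eb aF by (simp add: distrib_left scaleR_add_right scaleR_diff_right)
  finally show ?thesis by (simp only: E_def F_def)
qed

locale Q_calculus = Q_family L q w \<psi> K
  for L :: "quat \<Rightarrow> 'a::{real_normed_algebra,monoid_mult,banach}" and q w \<psi> K +
  fixes \<phi> \<theta> :: real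
  assumes phi: "\<psi> < \<phi>" "\<phi> < \<theta>" "\<theta> < pi"
begin

abbreviation "A \<equiv> \<Phi> \<phi> q"
abbreviation "B \<equiv> \<Phi> \<phi> sq"
abbreviation "U i \<equiv> \<Phi> \<phi> (w i)"

abbreviation "e1 \<equiv> L (qe 1)"
abbreviation "e2 \<equiv> L (qe 2)"
abbreviation "e3 \<equiv> L (qe 3)"

text \<open>\<open>S 1 f\<close> and \<open>S (-1) f\<close> are \<open>f(T)\<close> and \<open>f\<close> of the conjugate of \<open>T\<close>; \<open>A f\<close> is the harmonic calculus up to the factor \<open>-2\<close>.\<close>
definition S :: "real \<Rightarrow> (complex \<Rightarrow> complex) \<Rightarrow> 'a" where
  "S \<sigma> f = (B f - U 0 f) + \<sigma> *\<^sub>R (e1 * U 1 f + e2 * U 2 f + e3 * U 3 f)"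

lemma adm_q: "E1 \<theta> f \<Longrightarrow> adm \<psi> \<theta> q f" using psi phi q_norm by (intro adm_bound2) auto
lemma adm_sq: "E0 \<theta> f \<Longrightarrow> adm \<psi> \<theta> sq f" using psi phi sq_norm by (intro adm_bound1) auto
lemma adm_w: "E0 \<theta> f \<Longrightarrow> i < 4 \<Longrightarrow> adm \<psi> \<theta> (w i) f" using psi phi w_norm by (intro adm_bound1) auto

lemma adm_scaleR:
  assumes "adm \<psi> \<theta> W f" shows "adm \<psi> \<theta> (\<lambda>s. r *\<^sub>R W s) f"
proof -
  obtain M c where c: "c > 0" and le: "\<And>z. \<psi> < \<bar>Im z\<bar> \<Longrightarrow> \<bar>Im z\<bar> < \<theta> \<Longrightarrow>
      norm (\<iota> (exp z * f z) * W (exp z)) \<le> M * exp (- c * \<bar>Re z\<bar>)" using assms by (auto simp: adm_def)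
  have "norm (\<iota> (exp z * f z) * (r *\<^sub>R W (exp z))) \<le> (\<bar>r\<bar> * M) * exp (- c * \<bar>Re z\<bar>)" if "\<psi> < \<bar>Im z\<bar>" "\<bar>Im z\<bar> < \<theta>" for z
    using mult_left_mono[OF le[OF that], of "\<bar>r\<bar>"] by (simp add: mult_ac)
  then show ?thesis using assms c unfolding adm_def by blast
qed

lemma adm_minus: "adm \<psi> \<theta> W f \<Longrightarrow> adm \<psi> \<theta> (\<lambda>s. - W s) f"
  and regular_minus: "regular \<psi> W \<Longrightarrow> regular \<psi> (\<lambda>s. - W s)"
  using adm_scaleR[of W f "-1"] regular_scaleR[of W "-1"] by simp_all

lemma E1_E0: "E1 \<theta> f \<Longrightarrow> E0 \<theta> f" by (simp add: E1_def)

lemma Phi_rap: "regular \<psi> W \<Longrightarrow> adm \<psi> \<theta> W f \<Longrightarrow> rap \<phi> (\<lambda>z. \<iota> (exp z * f z) * W (exp z))"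
  using psi phi by (intro adm_rap) auto

lemma Phi_scaleR:
  assumes "regular \<psi> W" "adm \<psi> \<theta> W f"
  shows "\<Phi> \<phi> (\<lambda>s. r *\<^sub>R W s) f = r *\<^sub>R \<Phi> \<phi> W f"
  unfolding \<Phi>_def using CI_bounded_linear[OF bounded_linear_scaleR_right Phi_rap[OF assms], of r] by simp

lemma line_in_Om: "\<bar>Im z\<bar> = \<bar>\<phi>\<bar> \<Longrightarrow> exp z \<in> Om \<psi>" using psi phi by (intro exp_in_Om) auto

text \<open>Both sides are the double integral of f(s) g(p) times the common value in
  \<open>eq\<close>. Nothing is singular at s = p, so one contour serves both variables.\<close>

lemma Phi_exch:
  assumes X: "regular \<psi> X" "adm \<psi> \<theta> X f" and Y: "regular \<psi> Y" "adm \<psi> \<theta> Y g"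
    and X': "regular \<psi> X'" "adm \<psi> \<theta> X' f" and Y': "regular \<psi> Y'" "adm \<psi> \<theta> Y' g"
    and eq: "\<And>s p. s \<in> Om \<psi> \<Longrightarrow> p \<in> Om \<psi> \<Longrightarrow> X s * Y p = X' s * Y' p"
  shows "\<Phi> \<phi> X f * \<Phi> \<phi> Y g = \<Phi> \<phi> X' f * \<Phi> \<phi> Y' g"
proof -
  have *: "CI \<phi> (\<lambda>z. \<iota> (exp z * f z) * X (exp z)) * (\<iota> (1 / (2 * pi * \<i>)) * CI \<phi> (\<lambda>z. \<iota> (exp z * g z) * Y (exp z))) =
      CI \<phi> (\<lambda>z. \<iota> (1 / (2 * pi * \<i>)) * CI \<phi> (\<lambda>w. \<iota> (exp z * f z) * (\<iota> (exp w * g w) * (X (exp z) * Y (exp w)))))"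
    if X: "regular \<psi> X" "adm \<psi> \<theta> X f" and Y: "regular \<psi> Y" "adm \<psi> \<theta> Y g" for X Y
  proof -
    have "CI \<phi> (\<lambda>z. \<iota> (exp z * f z) * X (exp z)) * (\<iota> (1 / (2 * pi * \<i>)) * CI \<phi> (\<lambda>z. \<iota> (exp z * g z) * Y (exp z))) =
      CI \<phi> (\<lambda>z. \<iota> (exp z * f z) * X (exp z) * (\<iota> (1 / (2 * pi * \<i>)) * CI \<phi> (\<lambda>z. \<iota> (exp z * g z) * Y (exp z))))"
      by (rule CI_bounded_linear[OF bounded_linear_mult_left Phi_rap[OF X], symmetric])
    also have "\<dots> = CI \<phi> (\<lambda>z. \<iota> (1 / (2 * pi * \<i>)) * CI \<phi> (\<lambda>w. \<iota> (exp z * f z) * (\<iota> (exp w * g w) * (X (exp z) * Y (exp w)))))"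
    proof (rule CI_cong)
      fix z assume "\<bar>Im z\<bar> = \<bar>\<phi>\<bar>"
      then have c: "X (exp z) * \<iota> c = \<iota> c * X (exp z)" for c using line_in_Om regularD(1)[OF X(1)] by blast
      then have c': "X (exp z) * (\<iota> c * t) = \<iota> c * (X (exp z) * t)" for c t by (simp only: mult.assoc[symmetric])
      have "\<iota> (exp z * f z) * X (exp z) * (\<iota> (1 / (2 * pi * \<i>)) * CI \<phi> (\<lambda>z. \<iota> (exp z * g z) * Y (exp z))) =
         \<iota> (1 / (2 * pi * \<i>)) * ((\<iota> (exp z * f z) * X (exp z)) * CI \<phi> (\<lambda>z. \<iota> (exp z * g z) * Y (exp z)))"
        by (simp only: mult.assoc c') (rule iota_left_commute)
      also have "(\<iota> (exp z * f z) * X (exp z)) * CI \<phi> (\<lambda>z. \<iota> (exp z * g z) * Y (exp z)) =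
          CI \<phi> (\<lambda>w. (\<iota> (exp z * f z) * X (exp z)) * (\<iota> (exp w * g w) * Y (exp w)))"
        by (rule CI_bounded_linear[OF bounded_linear_mult_right Phi_rap[OF Y], symmetric])
      finally show "\<iota> (exp z * f z) * X (exp z) * (\<iota> (1 / (2 * pi * \<i>)) * CI \<phi> (\<lambda>z. \<iota> (exp z * g z) * Y (exp z))) =
         \<iota> (1 / (2 * pi * \<i>)) * CI \<phi> (\<lambda>w. \<iota> (exp z * f z) * (\<iota> (exp w * g w) * (X (exp z) * Y (exp w))))"
        by (simp only: mult.assoc c')
    qed
    finally show ?thesis .
  qed
  have "CI \<phi> (\<lambda>z. \<iota> (1 / (2 * pi * \<i>)) * CI \<phi> (\<lambda>w. \<iota> (exp z * f z) * (\<iota> (exp w * g w) * (X (exp z) * Y (exp w))))) =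
    CI \<phi> (\<lambda>z. \<iota> (1 / (2 * pi * \<i>)) * CI \<phi> (\<lambda>w. \<iota> (exp z * f z) * (\<iota> (exp w * g w) * (X' (exp z) * Y' (exp w)))))"
    by (intro CI_cong arg_cong2[where f = "(*)"] refl eq line_in_Om)
  then show ?thesis unfolding \<Phi>_def mult.assoc *[OF X Y] *[OF X' Y'] by simp
qed

lemma Phi_iota:
  assumes W: "regular \<psi> W" "adm \<psi> \<theta> W f" shows "\<Phi> \<phi> W f * \<iota> c = \<iota> c * \<Phi> \<phi> W f"
proof -
  have "CI \<phi> (\<lambda>z. \<iota> (exp z * f z) * W (exp z)) * \<iota> c = CI \<phi> (\<lambda>z. \<iota> (exp z * f z) * W (exp z) * \<iota> c)"
    by (rule CI_bounded_linear[OF bounded_linear_mult_left Phi_rap[OF W], symmetric])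
  also have "\<dots> = CI \<phi> (\<lambda>z. \<iota> c * (\<iota> (exp z * f z) * W (exp z)))"
  proof (rule CI_cong)
    fix z assume "\<bar>Im z\<bar> = \<bar>\<phi>\<bar>"
    then have "W (exp z) * \<iota> c = \<iota> c * W (exp z)" using line_in_Om regularD(1)[OF W(1)] by blast
    then show "\<iota> (exp z * f z) * W (exp z) * \<iota> c = \<iota> c * (\<iota> (exp z * f z) * W (exp z))"
      by (simp only: mult.assoc) (rule iota_left_commute)
  qed
  also have "\<dots> = \<iota> c * CI \<phi> (\<lambda>z. \<iota> (exp z * f z) * W (exp z))"
    by (rule CI_bounded_linear[OF bounded_linear_mult_right Phi_rap[OF W]])
  finally show ?thesis unfolding \<Phi>_def by (simp only: mult.assoc) (rule iota_left_commute)
qed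

text \<open>The same interchange with the roles of the two contours reversed.\<close>
lemma Phi_comm:
  assumes X: "regular \<psi> X" "adm \<psi> \<theta> X f" and Y: "regular \<psi> Y" "adm \<psi> \<theta> Y g"
    and eq: "\<And>s p. s \<in> Om \<psi> \<Longrightarrow> p \<in> Om \<psi> \<Longrightarrow> X s * Y p = Y p * X s"
  shows "\<Phi> \<phi> X f * \<Phi> \<phi> Y g = \<Phi> \<phi> Y g * \<Phi> \<phi> X f"
proof -
  define x where "x z = \<iota> (exp z * f z) * X (exp z)" for z
  define y where "y z = \<iota> (exp z * g z) * Y (exp z)" for z
  have rx: "rap \<phi> x" and ry: "rap \<phi> y" unfolding x_def y_def by (rule Phi_rap[OF X] Phi_rap[OF Y])+
  have xy: "x z * y w = y w * x z" if "\<bar>Im z\<bar> = \<bar>\<phi>\<bar>" "\<bar>Im w\<bar> = \<bar>\<phi>\<bar>" for z w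
  proof -
    have z: "exp z \<in> Om \<psi>" and w: "exp w \<in> Om \<psi>" using that line_in_Om by auto
    have cx: "X (exp z) * (\<iota> c * t) = \<iota> c * (X (exp z) * t)" for c t using regularD(1)[OF X(1) z] by (simp only: mult.assoc[symmetric])
    have cy: "Y (exp w) * (\<iota> c * t) = \<iota> c * (Y (exp w) * t)" for c t using regularD(1)[OF Y(1) w] by (simp only: mult.assoc[symmetric])
    show ?thesis unfolding x_def y_def mult.assoc cx cy eq[OF z w] by (rule iota_left_commute)
  qed
  have "CI \<phi> x * CI \<phi> y = CI \<phi> (\<lambda>z. x z * CI \<phi> y)" by (rule CI_bounded_linear[OF bounded_linear_mult_left rx, symmetric])
  also have "\<dots> = CI \<phi> (\<lambda>z. CI \<phi> y * x z)"
  proof (rule CI_cong)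
    fix z assume z: "\<bar>Im z\<bar> = \<bar>\<phi>\<bar>"
    have "x z * CI \<phi> y = CI \<phi> (\<lambda>w. x z * y w)" by (rule CI_bounded_linear[OF bounded_linear_mult_right ry, symmetric])
    also have "\<dots> = CI \<phi> (\<lambda>w. y w * x z)" by (rule CI_cong) (rule xy[OF z])
    also have "\<dots> = CI \<phi> y * x z" by (rule CI_bounded_linear[OF bounded_linear_mult_left ry])
    finally show "x z * CI \<phi> y = CI \<phi> y * x z" .
  qed
  also have "\<dots> = CI \<phi> y * CI \<phi> x" by (rule CI_bounded_linear[OF bounded_linear_mult_right rx])
  finally have com: "CI \<phi> x * CI \<phi> y = CI \<phi> y * CI \<phi> x" .
  let ?c = "1 / (2 * pi * \<i>) :: complex"
  have "\<Phi> \<phi> X f * \<Phi> \<phi> Y g = \<iota> ?c * (CI \<phi> x * \<Phi> \<phi> Y g)" unfolding \<Phi>_def[of _ X] x_def mult.assoc by simp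
  also have "CI \<phi> x * \<Phi> \<phi> Y g = \<Phi> \<phi> Y g * CI \<phi> x"
  proof -
    have "\<iota> (2 * pi * \<i>) * \<Phi> \<phi> X f = CI \<phi> x"
      unfolding \<Phi>_def x_def by (simp add: mult.assoc[symmetric] iota_mult[symmetric])
    then have "CI \<phi> x * \<iota> ?c = \<iota> ?c * CI \<phi> x"
      by (simp only: mult.assoc Phi_iota[OF X] flip: \<open>_ = CI \<phi> x\<close>) (rule iota_left_commute)
    then have "CI \<phi> x * \<Phi> \<phi> Y g = \<iota> ?c * (CI \<phi> x * CI \<phi> y)" unfolding \<Phi>_def[of _ Y] y_def by (simp only: mult.assoc[symmetric])
    also have "\<dots> = \<Phi> \<phi> Y g * CI \<phi> x" unfolding com \<Phi>_def[of _ Y] y_def by (simp only: mult.assoc)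
    finally show ?thesis .
  qed
  also have "\<iota> ?c * (\<Phi> \<phi> Y g * CI \<phi> x) = \<Phi> \<phi> Y g * \<Phi> \<phi> X f"
    using Phi_iota[OF Y, of ?c] unfolding \<Phi>_def[of _ X] x_def by (simp only: mult.assoc[symmetric])
  finally show ?thesis .
qed

text \<open>Moving \<open>jj\<close> across conjugates the slice coordinate. For conjugation
  symmetric f this reflects the contour, which reverses its orientation, and it also conjugates 1 /
  (2 pi i); the two signs cancel.\<close>

lemma Phi_jj:
  assumes W: "regular \<psi> W" "adm \<psi> \<theta> W f" and f: "conj_sym \<theta> f"
    and Wj: "\<And>s. s \<in> Om \<psi> \<Longrightarrow> W s * jj = jj * W (cnj s)"
  shows "\<Phi> \<phi> W f * jj = jj * \<Phi> \<phi> W f"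
proof -
  define k where "k z = \<iota> (exp z * f z) * W (exp z)" for z
  have rk: "rap \<phi> k" unfolding k_def by (rule Phi_rap[OF W])
  have rkc: "rap \<phi> (\<lambda>z. k (cnj z))" using rk unfolding rap_def by (simp add: complex_cnj)
  have "CI \<phi> k * jj = CI \<phi> (\<lambda>z. k z * jj)"
    by (rule CI_bounded_linear[OF bounded_linear_mult_left rk, symmetric])
  also have "\<dots> = CI \<phi> (\<lambda>z. jj * k (cnj z))"
  proof (rule CI_cong)
    fix z assume z: "\<bar>Im z\<bar> = \<bar>\<phi>\<bar>"
    have "k z * jj = \<iota> (exp z * f z) * jj * W (cnj (exp z))"
      unfolding k_def mult.assoc by (simp only: Wj[OF line_in_Om[OF z]])
    also have "\<iota> (exp z * f z) * jj = jj * \<iota> (cnj (exp z * f z))" by (simp add: jj_iota)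
    also have "cnj (exp z * f z) = exp (cnj z) * f (cnj z)" using f z phi psi by (simp add: conj_sym_def exp_cnj)
    finally show "k z * jj = jj * k (cnj z)" by (simp add: k_def mult.assoc exp_cnj)
  qed
  also have "\<dots> = jj * CI \<phi> (\<lambda>z. k (cnj z))" by (rule CI_bounded_linear[OF bounded_linear_mult_right rkc])
  also have "\<dots> = - (jj * CI \<phi> k)" by (simp add: CI_cnj)
  finally have 1: "CI \<phi> k * jj = - (jj * CI \<phi> k)" .
  have 2: "jj * \<iota> (1 / (2 * pi * \<i>)) = - (\<iota> (1 / (2 * pi * \<i>)) * jj)"
  proof -
    have "cnj (1 / (2 * pi * \<i>)) = - (1 / (2 * pi * \<i>))" by simp
    then show ?thesis unfolding jj_iota by (simp only: iota_minus mult_minus_left)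
  qed
  have "\<Phi> \<phi> W f * jj = \<iota> (1 / (2 * pi * \<i>)) * (CI \<phi> k * jj)" by (simp add: \<Phi>_def k_def[abs_def] mult.assoc)
  also have "\<dots> = (jj * \<iota> (1 / (2 * pi * \<i>))) * CI \<phi> k" unfolding 1 2 by (simp add: mult.assoc)
  finally show ?thesis by (simp add: \<Phi>_def k_def[abs_def] mult.assoc)
qed

text \<open>The images of \<open>\<iota>\<close> together with \<open>jj\<close> generate every
  \<open>L a\<close>, by \<open>L_decomp\<close>.\<close>

lemma comm_L:
  assumes "\<And>c. x * \<iota> c = \<iota> c * x" "x * jj = jj * x" shows "x * L a = L a * x"
proof -
  obtain a0 a1 a2 a3 where "a = (a0, a1, a2, a3)" by (cases a) auto
  moreover have "x * (\<iota> c * jj) = \<iota> c * jj * x" for c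
    by (simp only: mult.assoc[symmetric] assms(1)) (simp only: mult.assoc assms(2))
  ultimately show ?thesis using assms(1) by (simp add: L_decomp distrib_left distrib_right)
qed

lemma sq_jj: "s \<in> Om \<psi> \<Longrightarrow> sq s * jj = jj * sq (cnj s)"
  unfolding sq_def mult.assoc q_jj by (simp only: mult.assoc[symmetric] jj_iota complex_cnj_cnj)

lemma A_L: "E1 \<theta> f \<Longrightarrow> conj_sym \<theta> f \<Longrightarrow> A f * L a = L a * A f"
  by (intro comm_L Phi_iota Phi_jj regular_q adm_q q_jj)
lemma B_L: "E0 \<theta> f \<Longrightarrow> conj_sym \<theta> f \<Longrightarrow> B f * L a = L a * B f"
  by (intro comm_L Phi_iota Phi_jj regular_sq adm_sq sq_jj)
lemma U_L: "E0 \<theta> f \<Longrightarrow> conj_sym \<theta> f \<Longrightarrow> i < 4 \<Longrightarrow> U i f * L a = L a * U i f"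
  by (intro comm_L Phi_iota Phi_jj regular_w adm_w w_jj)

lemma sq_q: "s \<in> Om \<psi> \<Longrightarrow> p \<in> Om \<psi> \<Longrightarrow> sq s * q p = q p * sq s"
  by (simp only: sq_def mult.assoc q_q) (simp only: mult.assoc[symmetric] q_iota)
lemma w_sq: "s \<in> Om \<psi> \<Longrightarrow> p \<in> Om \<psi> \<Longrightarrow> i < 4 \<Longrightarrow> w i s * sq p = sq p * w i s"
  by (simp only: sq_def mult.assoc w_q[symmetric]) (simp only: mult.assoc[symmetric] w_iota)
lemma sq_sq: "s \<in> Om \<psi> \<Longrightarrow> p \<in> Om \<psi> \<Longrightarrow> sq s * sq p = sq p * sq s"
  by (simp only: sq_def[of p] mult.assoc[symmetric] regularD(1)[OF regular_sq]) (simp only: mult.assoc sq_q)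

lemma Phi_commute_rules:
  "E0 \<theta> f \<Longrightarrow> E0 \<theta> g \<Longrightarrow> B f * B g = B g * B f"
  "E0 \<theta> f \<Longrightarrow> E0 \<theta> g \<Longrightarrow> i < 4 \<Longrightarrow> U i f * B g = B g * U i f"
  "E0 \<theta> f \<Longrightarrow> E0 \<theta> g \<Longrightarrow> i < 4 \<Longrightarrow> k < 4 \<Longrightarrow> U i f * U k g = U k g * U i f"
  "E1 \<theta> f \<Longrightarrow> E0 \<theta> g \<Longrightarrow> B g * A f = A f * B g"
  "E1 \<theta> f \<Longrightarrow> E0 \<theta> g \<Longrightarrow> i < 4 \<Longrightarrow> U i g * A f = A f * U i g"
  "E1 \<theta> f \<Longrightarrow> E1 \<theta> g \<Longrightarrow> A f * A g = A g * A f"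
  by (intro Phi_comm regular_q regular_w regular_sq adm_q adm_sq adm_w q_q w_q w_w sq_q w_sq sq_sq; assumption)+

lemma Phi_exchange_rules:
  "E0 \<theta> f \<Longrightarrow> E0 \<theta> g \<Longrightarrow> i < 4 \<Longrightarrow> k < 4 \<Longrightarrow> U i f * U k g = U k f * U i g"
  "E1 \<theta> f \<Longrightarrow> E1 \<theta> g \<Longrightarrow> i < 4 \<Longrightarrow> U i f * A g = A f * U i g"
  by (intro Phi_exch regular_q regular_w regular_sq adm_q adm_sq adm_w w_w_exch w_q_exch; (assumption | erule E1_E0))+

lemma U_A_exch: "E1 \<theta> f \<Longrightarrow> E1 \<theta> g \<Longrightarrow> i < 4 \<Longrightarrow> U i f * A g = U i g * A f"
  using Phi_exchange_rules(2)[of f g i] Phi_commute_rules(5)[of f g i] E1_E0 by simp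

lemma E0_mult: assumes "E0 \<theta> f" "E0 \<theta> g" shows "E0 \<theta> (\<lambda>z. f z * g z)"
proof -
  obtain M c where f: "c > 0" "\<And>z. \<bar>Im z\<bar> < \<theta> \<Longrightarrow> norm (f z) \<le> M * exp (- c * \<bar>Re z\<bar>)" using assms by (auto simp: E0_def)
  obtain N d where g: "d > 0" "\<And>z. \<bar>Im z\<bar> < \<theta> \<Longrightarrow> norm (g z) \<le> N * exp (- d * \<bar>Re z\<bar>)" using assms by (auto simp: E0_def)
  have "norm (f z * g z) \<le> (\<bar>M\<bar> * \<bar>N\<bar>) * exp (- c * \<bar>Re z\<bar>)" if "\<bar>Im z\<bar> < \<theta>" for z
  proof -
    have "norm (f z) * norm (g z) \<le> (\<bar>M\<bar> * exp (- c * \<bar>Re z\<bar>)) * (\<bar>N\<bar> * exp (- 0 * \<bar>Re z\<bar>))"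
      by (intro mult_mono exp_bound_weaken[OF f(2)] exp_bound_weaken[OF g(2)]) (use that f g in auto)
    then show ?thesis unfolding norm_mult by (simp add: mult_ac)
  qed
  then show ?thesis using assms f(1) unfolding E0_def by (auto intro: holomorphic_on_mult)
qed

text \<open>Brings the resolvent identity into a sum of products of a function of s and a function
  of p, the shape that \<open>Phi_mult\<close> requires; the exchange rule moves the component from
  s to p.\<close>

lemma w_split:
  assumes "s \<in> Om \<psi>" "p \<in> Om \<psi>" "i < 4"
  shows "\<iota> (p + s) * (w i s * q p) = w i s * sq p + sq s * w i p"
proof -
  have "\<iota> p * (w i s * q p) = w i s * sq p"
    unfolding sq_def using w_iota[OF assms(1,3)] by (simp only: mult.assoc[symmetric])
  moreover have "\<iota> s * (w i s * q p) = sq s * w i p"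
    unfolding sq_def w_q_exch[OF assms] by (simp only: mult.assoc)
  ultimately show ?thesis by (simp add: iota_add distrib_right)
qed

lemma q_split:
  assumes "s \<in> Om \<psi>" "p \<in> Om \<psi>"
  shows "\<iota> (p + s) * (q s * q p) = q s * sq p + sq s * q p"
proof -
  have "\<iota> p * (q s * q p) = q s * sq p"
    unfolding sq_def using q_iota[OF assms(1)] by (simp only: mult.assoc[symmetric])
  then show ?thesis by (simp add: iota_add distrib_right sq_def mult.assoc)
qed

lemma U_mult:
  assumes f: "E0 \<theta> f" and g: "E0 \<theta> g" and i: "i < 4"
  shows "U i (\<lambda>z. f z * g z) = U i f * B g + B f * U i g - 2 *\<^sub>R (U 0 f * U i g)"
proof -
  \<comment> \<open>The three terms of the identity as an indexed family, with the coefficient -2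
    absorbed into \<open>X\<close>.\<close>
  define X where "X n = (if n = 0 then w i else if n = 1 then sq else (\<lambda>s. (-2) *\<^sub>R w 0 s))" for n :: nat
  define Y where "Y n = (if n = 0 then sq else w i)" for n :: nat
  have "U i (\<lambda>z. f z * g z) = (\<Sum>n\<in>{..<3}. \<Phi> \<phi> (X n) f * \<Phi> \<phi> (Y n) g)"
  proof (rule Phi_mult)
    fix s p assume "s \<in> Om \<psi>" "p \<in> Om \<psi>"
    then show "w i s - w i p = \<iota> (p - s) * (\<Sum>n<3. X n s * Y n p)"
      using w_diff[of s p i] w_split[of s p i] i by (simp add: X_def Y_def numeral_3_eq_3)
  qed (use psi phi i in \<open>auto simp: X_def Y_def intro!: regular_w regular_sq regular_scaleR regular_minus adm_minus adm_w adm_sq adm_scaleR f g\<close>)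
  also have "\<dots> = U i f * B g + B f * U i g - 2 *\<^sub>R (U 0 f * U i g)"
    using Phi_scaleR[OF regular_w[of 0] adm_w[OF f, of 0], of "-2"] by (simp add: X_def Y_def numeral_3_eq_3)
  finally show ?thesis .
qed

lemma A_mult:
  assumes f: "E1 \<theta> f" and g: "E1 \<theta> g"
  shows "A (\<lambda>z. f z * g z) = A f * B g + B f * A g - 2 *\<^sub>R (U 0 f * A g)"
proof -
  define X where "X n = (if n = 0 then q else if n = 1 then sq else (\<lambda>s. (-2) *\<^sub>R w 0 s))" for n :: nat
  define Y where "Y n = (if n = 0 then sq else q)" for n :: nat
  have "A (\<lambda>z. f z * g z) = (\<Sum>n\<in>{..<3}. \<Phi> \<phi> (X n) f * \<Phi> \<phi> (Y n) g)"
  proof (rule Phi_mult)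
    fix s p assume "s \<in> Om \<psi>" "p \<in> Om \<psi>"
    then show "q s - q p = \<iota> (p - s) * (\<Sum>n<3. X n s * Y n p)"
      using q_diff[of s p] q_split[of s p] by (simp add: X_def Y_def numeral_3_eq_3)
  qed (use psi phi in \<open>auto simp: X_def Y_def intro!: regular_q regular_w regular_sq regular_scaleR regular_minus adm_minus adm_q adm_w adm_sq adm_scaleR f g E1_E0\<close>)
  also have "\<dots> = A f * B g + B f * A g - 2 *\<^sub>R (U 0 f * A g)"
    using Phi_scaleR[OF regular_w[of 0] adm_w[OF E1_E0[OF f], of 0], of "-2"] by (simp add: X_def Y_def numeral_3_eq_3)
  finally show ?thesis .
qed

lemma B_mult:
  assumes f: "E0 \<theta> f" and g: "E0 \<theta> g"
  shows "B (\<lambda>z. f z * g z) = B f * B g - (U 0 f * U 0 g + U 1 f * U 1 g + U 2 f * U 2 g + U 3 f * U 3 g)"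
proof -
  \<comment> \<open>Index 4 stands for \<open>sq\<close>, so that 0 to 3 can number the components
    \<open>w n\<close>.\<close>
  define X where "X n = (if n = 4 then sq else (\<lambda>s. (-1) *\<^sub>R w n s))" for n :: nat
  define Y where "Y n = (if n = 4 then sq else w n)" for n :: nat
  have 5: "{..<5::nat} = insert 4 {..<4}" "{..<4::nat} = {0,1,2,3}" by auto
  have "B (\<lambda>z. f z * g z) = (\<Sum>n\<in>{..<5}. \<Phi> \<phi> (X n) f * \<Phi> \<phi> (Y n) g)"
  proof (rule Phi_mult)
    fix s p assume "s \<in> Om \<psi>" "p \<in> Om \<psi>"
    then have "sq s - sq p = \<iota> (p - s) * (sq s * sq p - (\<Sum>i<4. w i s * w i p))" by (rule sq_diff')
    also have "sq s * sq p - (\<Sum>i<4. w i s * w i p) = (\<Sum>n<5. X n s * Y n p)"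
      unfolding 5 by (simp add: X_def Y_def)
    finally show "sq s - sq p = \<iota> (p - s) * (\<Sum>n<5. X n s * Y n p)" .
  qed (use psi phi in \<open>auto simp del: scaleR_minus_left simp: X_def Y_def intro!: regular_w regular_sq regular_scaleR regular_minus adm_minus adm_w adm_sq adm_scaleR f g\<close>)
  also have "\<dots> = B f * B g - (U 0 f * U 0 g + U 1 f * U 1 g + U 2 f * U 2 g + U 3 f * U 3 g)"
  proof -
    have "\<Phi> \<phi> (\<lambda>s. - w n s) f = - U n f" if "n < 4" for n
      using Phi_scaleR[OF regular_w[OF that] adm_w[OF f that], of "-1"] by simp
    then show ?thesis unfolding 5 by (simp add: X_def Y_def)
  qed
  finally show ?thesis .
qed

lemma e_mult: "e1 * e1 = -1" "e2 * e2 = -1" "e3 * e3 = -1" "e1 * e2 = e3" "e2 * e1 = - e3"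
      "e2 * e3 = e1" "e3 * e2 = - e1" "e3 * e1 = e2" "e1 * e3 = - e2"
proof -
  have m: "L (- a) = - L a" for a using L_scaleR[of "-1" a] by simp
  have 1: "L (1, 0, 0, 0) = 1" using L_real[of 1] by (simp add: qof_real_def)
  show "e1 * e1 = -1" "e2 * e2 = -1" "e3 * e3 = -1" "e1 * e2 = e3" "e2 * e1 = - e3"
      "e2 * e3 = e1" "e3 * e2 = - e1" "e3 * e1 = e2" "e1 * e3 = - e2"
    by (simp_all add: qmul_def qe_def 1[symmetric] flip: L_mult m)
qed

text \<open>The components of f stand to the left of the units belonging to g and have to commute
  with them, whence the symmetry of f. The condition on \<open>\<sigma>\<close> turns the products U
  i f U i g into those of \<open>B_mult\<close>, with the same sign for T and for its
  conjugate.\<close>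

lemma S_mult:
  assumes f: "E0 \<theta> f" "conj_sym \<theta> f" and g: "E0 \<theta> g" and \<sigma>: "\<sigma> * \<sigma> = 1"
  shows "S \<sigma> (\<lambda>z. f z * g z) = S \<sigma> f * S \<sigma> g"
proof -
  note m = U_mult[OF f(1) g] B_mult[OF f(1) g]
  note x = Phi_exchange_rules(1)[OF f(1) g]
  have "S \<sigma> f * S \<sigma> g = ((B f - U 0 f) * (B g - U 0 g) - (\<sigma> * \<sigma>) *\<^sub>R (U 1 f * U 1 g + U 2 f * U 2 g + U 3 f * U 3 g)) +
     (e1 * (\<sigma> *\<^sub>R (U 1 f * (B g - U 0 g)) + \<sigma> *\<^sub>R ((B f - U 0 f) * U 1 g)) + e2 * (\<sigma> *\<^sub>R (U 2 f * (B g - U 0 g)) + \<sigma> *\<^sub>R ((B f - U 0 f) * U 2 g))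
      + e3 * (\<sigma> *\<^sub>R (U 3 f * (B g - U 0 g)) + \<sigma> *\<^sub>R ((B f - U 0 f) * U 3 g)))"
    unfolding S_def
    by (rule quaternion_split_product; (rule e_mult)?)
       (simp_all add: U_L[OF f] B_L[OF f] right_diff_distrib left_diff_distrib x)
  also have "\<dots> = S \<sigma> (\<lambda>z. f z * g z)"
  proof -
    have u: "U i f * (B g - U 0 g) + (B f - U 0 f) * U i g = U i (\<lambda>z. f z * g z)" if "i < 4" for i
      unfolding m(1)[OF that] using x[of i 0] that by (simp add: algebra_simps scaleR_2)
    have "(B f - U 0 f) * (B g - U 0 g) - (U 1 f * U 1 g + U 2 f * U 2 g + U 3 f * U 3 g) = B (\<lambda>z. f z * g z) - U 0 (\<lambda>z. f z * g z)"
      unfolding m(2) m(1)[of 0, simplified] by (simp add: algebra_simps scaleR_2)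
    then show ?thesis
      unfolding S_def \<sigma> by (simp add: scaleR_add_right[symmetric] u distrib_left del: scaleR_add_right)
  qed
  finally show ?thesis by simp
qed

text \<open>Compared with \<open>A_mult\<close>, the terms with \<open>e1\<close>,
  \<open>e2\<close>, \<open>e3\<close> of the two summands cancel, since they enter with opposite
  signs and U i g A f = U i f A g; by the same rule the two terms with \<open>U 0\<close> add up to
  the one with coefficient 2.\<close>

lemma A_product:
  assumes f: "E1 \<theta> f" "conj_sym \<theta> f" and g: "E1 \<theta> g"
  shows "A (\<lambda>z. f z * g z) = S (-1) f * A g + S 1 g * A f"
proof -
  have u: "U i g * A f = U i f * A g" if "i < 4" for i using U_A_exch[OF g f(1) that] .
  have "B g * A f = A f * B g" by (rule Phi_commute_rules(4)[OF f(1) E1_E0[OF g]])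
  then show ?thesis
    unfolding A_mult[OF f(1) g] S_def
    by (simp add: left_diff_distrib distrib_right mult.assoc u scaleR_2)
qed

lemma S_diff_A:
  assumes f: "E1 \<theta> f" and g: "E1 \<theta> g"
  shows "(S (-1) f - S 1 f) * A g = (S (-1) g - S 1 g) * A f"
proof -
  have u: "U i g * A f = U i f * A g" if "i < 4" for i using U_A_exch[OF g f(1) that] .
  have S: "S (-1) h - S 1 h = - 2 *\<^sub>R (e1 * U 1 h + e2 * U 2 h + e3 * U 3 h)" for h
    by (simp add: S_def scaleR_2)
  show ?thesis unfolding S by (simp add: distrib_right mult.assoc u)
qed

lemma U_S_comm:
  assumes f: "E0 \<theta> f" "conj_sym \<theta> f" and g: "E0 \<theta> g" and i: "i < 4"
  shows "U i f * S \<sigma> g = S \<sigma> g * U i f"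
proof -
  have l: "U i f * (L a * t) = L a * (U i f * t)" for a t using U_L[OF f i, of a] by (simp flip: mult.assoc)
  show ?thesis unfolding S_def
    by (simp add: distrib_left distrib_right left_diff_distrib right_diff_distrib mult.assoc l Phi_commute_rules(2,3)[OF f(1) g] i)
qed

lemma S_comm_L:
  assumes "\<And>a. x * L a = L a * x" "x * S \<sigma> f = S \<sigma> f * x" "x * S \<sigma> g = S \<sigma> g * x"
  shows "x * (S \<sigma> f + S \<sigma> g * jj) = (S \<sigma> f + S \<sigma> g * jj) * x"
proof -
  have "x * (S \<sigma> g * jj) = S \<sigma> g * jj * x"
    using assms(3) assms(1)[of "qe 2"] by (metis jj_def mult.assoc)
  then show ?thesis using assms(2) by (simp add: distrib_left distrib_right)
qed

lemma S_comm:
  assumes f: "E0 \<theta> f" "conj_sym \<theta> f" and g: "E0 \<theta> g" "conj_sym \<theta> g"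
  shows "S \<sigma> f * S \<tau> g = S \<tau> g * S \<sigma> f"
proof -
  have x: "U i f * U k g = U k f * U i g" if "i < 4" "k < 4" for i k by (rule Phi_exchange_rules(1)[OF f(1) g(1) that])
  have x': "U i g * U k f = U k g * U i f" if "i < 4" "k < 4" for i k by (rule Phi_exchange_rules(1)[OF g(1) f(1) that])
  have 1: "S \<sigma> f * S \<tau> g = ((B f - U 0 f) * (B g - U 0 g) - (\<sigma> * \<tau>) *\<^sub>R (U 1 f * U 1 g + U 2 f * U 2 g + U 3 f * U 3 g)) +
     (e1 * (\<sigma> *\<^sub>R (U 1 f * (B g - U 0 g)) + \<tau> *\<^sub>R ((B f - U 0 f) * U 1 g)) + e2 * (\<sigma> *\<^sub>R (U 2 f * (B g - U 0 g)) + \<tau> *\<^sub>R ((B f - U 0 f) * U 2 g))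
      + e3 * (\<sigma> *\<^sub>R (U 3 f * (B g - U 0 g)) + \<tau> *\<^sub>R ((B f - U 0 f) * U 3 g)))"
    unfolding S_def
    by (rule quaternion_split_product; (rule e_mult)?)
       (simp_all add: U_L[OF f] B_L[OF f] right_diff_distrib left_diff_distrib x)
  have 2: "S \<tau> g * S \<sigma> f = ((B g - U 0 g) * (B f - U 0 f) - (\<tau> * \<sigma>) *\<^sub>R (U 1 g * U 1 f + U 2 g * U 2 f + U 3 g * U 3 f)) +
     (e1 * (\<tau> *\<^sub>R (U 1 g * (B f - U 0 f)) + \<sigma> *\<^sub>R ((B g - U 0 g) * U 1 f)) + e2 * (\<tau> *\<^sub>R (U 2 g * (B f - U 0 f)) + \<sigma> *\<^sub>R ((B g - U 0 g) * U 2 f))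
      + e3 * (\<tau> *\<^sub>R (U 3 g * (B f - U 0 f)) + \<sigma> *\<^sub>R ((B g - U 0 g) * U 3 f)))"
    unfolding S_def
    by (rule quaternion_split_product; (rule e_mult)?)
       (simp_all add: U_L[OF g] B_L[OF g] right_diff_distrib left_diff_distrib x')
  have b: "(B f - U 0 f) * (B g - U 0 g) = (B g - U 0 g) * (B f - U 0 f)"
    using Phi_commute_rules(1)[OF f(1) g(1)] Phi_commute_rules(2)[OF f(1) g(1), of 0] Phi_commute_rules(2)[OF g(1) f(1), of 0] Phi_commute_rules(3)[OF f(1) g(1), of 0 0]
    by (simp add: right_diff_distrib left_diff_distrib)
  have u: "U i f * (B g - U 0 g) = (B g - U 0 g) * U i f" "(B f - U 0 f) * U i g = U i g * (B f - U 0 f)" if "i < 4" for i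
    using Phi_commute_rules(2)[OF f(1) g(1), of i] Phi_commute_rules(2)[OF g(1) f(1), of i] Phi_commute_rules(3)[OF f(1) g(1), of i 0] Phi_commute_rules(3)[OF g(1) f(1), of i 0] that
    by (simp_all add: right_diff_distrib left_diff_distrib)
  have uu: "U i f * U i g = U i g * U i f" if "i < 4" for i by (rule Phi_commute_rules(3)[OF f(1) g(1) that that])
  show ?thesis unfolding 1 2 by (simp add: b u uu mult.commute[of \<tau> \<sigma>] add.commute)
qed

text \<open>\<open>X\<close> is the value at T of the left slice function with parts h1, h2 and need
  not commute with the units. They stay at the far left; only the components \<open>U i f\<close>,
  which do commute with \<open>X\<close> as f is intrinsic, are moved through it to meet
  \<open>A g\<close>.\<close>

lemma S_diff_exch:
  assumes f: "E1 \<theta> f" "conj_sym \<theta> f" and g: "E1 \<theta> g" "conj_sym \<theta> g" and h: "E0 \<theta> h1" "E0 \<theta> h2"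
  defines "X \<equiv> S 1 h1 + S 1 h2 * jj"
  shows "(S (-1) f - S 1 f) * X * A g = (S (-1) g - S 1 g) * X * A f"
proof -
  have S: "S (-1) h - S 1 h = - 2 *\<^sub>R (e1 * U 1 h + e2 * U 2 h + e3 * U 3 h)" for h
    by (simp add: S_def scaleR_2)
  have c: "U i f * X = X * U i f" if "E0 \<theta> f" "conj_sym \<theta> f" "i < 4" for f i
    unfolding X_def using that h by (intro S_comm_L U_L U_S_comm)
  have u: "U i f * (X * A g) = U i g * (X * A f)" if "i < 4" for i
  proof -
    have "U i f * (X * A g) = X * (U i f * A g)" using c[OF E1_E0[OF f(1)] f(2) that] by (metis mult.assoc)
    also have "\<dots> = X * (U i g * A f)" by (simp only: U_A_exch[OF f(1) g(1) that])
    also have "\<dots> = U i g * (X * A f)" using c[OF E1_E0[OF g(1)] g(2) that] by (metis mult.assoc)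
    finally show ?thesis .
  qed
  show ?thesis unfolding S by (simp add: distrib_right mult.assoc u)
qed

end

section \<open>The value of the regularizing function at T\<close>

context quat_rep begin

text \<open>Holomorphy with \<open>\<iota> h\<close> on the right. The resolvent \<open>sL\<close>
  has units on the left of its components and is multiplied from the left by operators that need not
  commute with \<open>\<iota>\<close>; right multiplication is unaffected by both.\<close>

definition rdiff :: "complex set \<Rightarrow> (complex \<Rightarrow> 'a) \<Rightarrow> bool" where
  "rdiff D k \<longleftrightarrow> (\<exists>k'. continuous_on D k' \<and> (\<forall>z\<in>D. (k has_derivative (\<lambda>h. k' z * \<iota> h)) (at z)))"

lemma rdiff_add: "rdiff D k \<Longrightarrow> rdiff D l \<Longrightarrow> rdiff D (\<lambda>z. k z + l z)"
proof -
  assume "rdiff D k" "rdiff D l"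
  then obtain k' l' where k: "continuous_on D k'" "\<And>z. z \<in> D \<Longrightarrow> (k has_derivative (\<lambda>h. k' z * \<iota> h)) (at z)"
    and l: "continuous_on D l'" "\<And>z. z \<in> D \<Longrightarrow> (l has_derivative (\<lambda>h. l' z * \<iota> h)) (at z)"
    unfolding rdiff_def by blast
  have "((\<lambda>z. k z + l z) has_derivative (\<lambda>h. (k' z + l' z) * \<iota> h)) (at z)" if "z \<in> D" for z
    using has_derivative_add[OF k(2)[OF that] l(2)[OF that]] by (simp add: distrib_right)
  moreover have "continuous_on D (\<lambda>z. k' z + l' z)" using k l by (intro continuous_intros)
  ultimately show ?thesis unfolding rdiff_def by blast
qed

lemma rdiff_lmult: "rdiff D k \<Longrightarrow> rdiff D (\<lambda>z. c * k z)"
proof -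
  assume "rdiff D k"
  then obtain k' where k: "continuous_on D k'" "\<And>z. z \<in> D \<Longrightarrow> (k has_derivative (\<lambda>h. k' z * \<iota> h)) (at z)"
    unfolding rdiff_def by blast
  have "((\<lambda>z. c * k z) has_derivative (\<lambda>h. (c * k' z) * \<iota> h)) (at z)" if "z \<in> D" for z
    using has_derivative_mult_right[OF k(2)[OF that], of c] by (simp add: mult.assoc)
  moreover have "continuous_on D (\<lambda>z. c * k' z)" using k by (intro continuous_intros)
  ultimately show ?thesis unfolding rdiff_def by blast
qed

lemma rdiff_minus: "rdiff D k \<Longrightarrow> rdiff D (\<lambda>z. - k z)"
  using rdiff_lmult[of D k "-1"] by simp

lemma rdiff_diff: "rdiff D k \<Longrightarrow> rdiff D l \<Longrightarrow> rdiff D (\<lambda>z. k z - l z)"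
  using rdiff_add[OF _ rdiff_minus] by simp

lemma rdiff_scaleR: "rdiff D k \<Longrightarrow> rdiff D (\<lambda>z. r *\<^sub>R k z)"
  using rdiff_lmult[of D k "r *\<^sub>R 1"] by simp

lemma rdiff_iota:
  assumes "r holomorphic_on D" "open D" shows "rdiff D (\<lambda>z. \<iota> (r z))"
  unfolding rdiff_def
proof (intro exI conjI ballI)
  show "continuous_on D (\<lambda>z. \<iota> (deriv r z))"
    by (intro continuous_intros holomorphic_on_imp_continuous_on holomorphic_deriv assms)
  fix z assume "z \<in> D"
  then have "(r has_field_derivative deriv r z) (at z)" by (rule holomorphic_derivI[OF assms])
  then have "((\<lambda>z. \<iota> (r z)) has_derivative (\<lambda>h. \<iota> (deriv r z * h))) (at z)"
    unfolding has_field_derivative_def by (rule bounded_linear.has_derivative[OF iota_bounded_linear])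
  then show "((\<lambda>z. \<iota> (r z)) has_derivative (\<lambda>h. \<iota> (deriv r z) * \<iota> h)) (at z)" by (simp add: iota_mult)
qed

lemma rdiff_regular:
  assumes W: "regular \<psi> W" shows "rdiff {z. exp z \<in> Om \<psi>} (\<lambda>z. W (exp z) * \<iota> (exp z))"
proof -
  obtain W' where W'c: "continuous_on (Om \<psi>) W'" and W': "\<And>s. s \<in> Om \<psi> \<Longrightarrow> (W has_derivative (\<lambda>h. \<iota> h * W' s)) (at s)"
    using W unfolding regular_def by blast
  \<comment> \<open>Commutation with \<open>\<iota>\<close> passes from \<open>W\<close> to its
    derivative: the two products with a constant coincide on an open set, and derivatives are
    unique.\<close>
  have com: "W' s * \<iota> c = \<iota> c * W' s" if s: "s \<in> Om \<psi>" for s c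
  proof -
    have 1: "((\<lambda>s. W s * \<iota> c) has_derivative (\<lambda>h. \<iota> h * W' s * \<iota> c)) (at s)"
      by (rule has_derivative_mult_left[OF W'[OF s]])
    have 2: "((\<lambda>s. \<iota> c * W s) has_derivative (\<lambda>h. \<iota> c * (\<iota> h * W' s))) (at s)"
      by (rule has_derivative_mult_right[OF W'[OF s]])
    have "((\<lambda>s. W s * \<iota> c) has_derivative (\<lambda>h. \<iota> c * (\<iota> h * W' s))) (at s)"
      by (rule has_derivative_transform_within_open[OF 2 open_Om s]) (simp add: regularD(1)[OF W])
    from has_derivative_unique[OF 1 this] have "\<iota> 1 * W' s * \<iota> c = \<iota> c * (\<iota> 1 * W' s)" by (rule fun_cong)
    then show ?thesis by simp
  qed
  show ?thesis unfolding rdiff_def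
  proof (intro exI conjI ballI)
    show "continuous_on {z. exp z \<in> Om \<psi>} (\<lambda>z. W' (exp z) * \<iota> (exp z) * \<iota> (exp z) + W (exp z) * \<iota> (exp z))"
      by (intro continuous_intros continuous_on_compose2[OF W'c] continuous_on_compose2[OF regularD(2)[OF W]]) auto
    fix z assume "z \<in> {z. exp z \<in> Om \<psi>}"
    then have z: "exp z \<in> Om \<psi>" by simp
    have e: "(exp has_derivative (\<lambda>h. exp z * h)) (at z)"
      using DERIV_exp[of z] by (simp add: has_field_derivative_def)
    from has_derivative_compose[OF this W'[OF z]]
    have 1: "((\<lambda>z. W (exp z)) has_derivative (\<lambda>h. \<iota> (exp z * h) * W' (exp z))) (at z)" .
    have 2: "((\<lambda>z. \<iota> (exp z)) has_derivative (\<lambda>h. \<iota> (exp z * h))) (at z)"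
      by (rule bounded_linear.has_derivative[OF iota_bounded_linear e])
    show "((\<lambda>z. W (exp z) * \<iota> (exp z)) has_derivative
        (\<lambda>h. (W' (exp z) * \<iota> (exp z) * \<iota> (exp z) + W (exp z) * \<iota> (exp z)) * \<iota> h)) (at z)"
    proof (rule has_derivative_eq_rhs[OF has_derivative_mult[OF 1 2]], rule ext)
      fix h
      have "\<iota> (exp z * h) * W' (exp z) * \<iota> (exp z) = W' (exp z) * \<iota> (exp z) * \<iota> (exp z) * \<iota> h"
        unfolding com[OF z, symmetric] mult.assoc iota_mult[symmetric] by (simp add: mult_ac)
      then show "W (exp z) * \<iota> (exp z * h) + \<iota> (exp z * h) * W' (exp z) * \<iota> (exp z) =
         (W' (exp z) * \<iota> (exp z) * \<iota> (exp z) + W (exp z) * \<iota> (exp z)) * \<iota> h"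
        by (simp add: distrib_right iota_mult mult.assoc)
    qed
  qed
qed

end

lemma norm_add_exp_ge:
  assumes "\<bar>Im z\<bar> < \<theta>" "\<theta> < pi" "a > 0"
  defines "k \<equiv> sqrt (1 - (max 0 (- cos \<theta>))\<^sup>2)"
  shows "k > 0" "k * a \<le> norm (of_real a + exp z)" "k * exp (Re z) \<le> norm (of_real a + exp z)"
proof -
  \<comment> \<open>Chosen so that a + exp z = a (1 - exp u): subtracting ln a rescales and adding i
    pi changes the sign, so the distance to - a becomes a distance to 1.\<close>
  define u where "u = z - of_real (ln a) + \<i> * of_real pi"
  have eu: "exp u = - exp z / of_real a"
  proof -
    have "exp (complex_of_real (ln a)) = of_real a" using \<open>a > 0\<close> by (simp add: exp_of_real)
    then show ?thesis by (simp add: u_def exp_add exp_diff exp_pi_i)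
  qed
  have "cos \<theta> \<le> cos \<bar>Im z\<bar>" using assms by (intro cos_monotone_0_pi_le) auto
  then have c: "cos (Im u) \<le> max 0 (- cos \<theta>)" by (simp add: u_def)
  have "cos pi < cos \<theta>" using assms by (intro cos_monotone_0_pi) auto
  then have m: "0 \<le> max 0 (- cos \<theta>)" "max 0 (- cos \<theta>) < 1" by auto
  show "k > 0" unfolding k_def using power_strict_mono[OF m(2,1), of 2] by simp
  note b = norm_one_minus_exp_ge[OF c m, folded k_def]
  have e: "of_real a + exp z = of_real a * (1 - exp u)" using \<open>a > 0\<close> by (simp add: eu field_simps)
  have n: "norm (of_real a + exp z) = a * norm (1 - exp u)" unfolding e norm_mult using \<open>a > 0\<close> by simp
  show "k * a \<le> norm (of_real a + exp z)" unfolding n using b(1) \<open>a > 0\<close> by (simp add: mult.commute)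
  have "exp (Re u) = exp (Re z) / a" using \<open>a > 0\<close> by (simp add: u_def exp_diff)
  then have kz: "k * exp (Re z) = a * (k * exp (Re u))" using \<open>a > 0\<close> by simp
  show "k * exp (Re z) \<le> norm (of_real a + exp z)" unfolding n kz using \<open>a > 0\<close> by (intro mult_left_mono b(2)) simp
qed

text \<open>The function \<open>s / ((1 + s) (2 + s))\<close> in the coordinate \<open>s = exp z\<close>.\<close>
definition rho :: "complex \<Rightarrow> complex" where "rho z = 2 / (2 + exp z) - 1 / (1 + exp z)"

lemma rho_eq:
  assumes "\<bar>Im z\<bar> < pi"
  shows "2 + exp z \<noteq> 0" "1 + exp z \<noteq> 0" "rho z = exp z / ((1 + exp z) * (2 + exp z))"
proof -
  obtain \<theta> where \<theta>: "\<bar>Im z\<bar> < \<theta>" "\<theta> < pi" using dense assms by blast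
  show 1: "2 + exp z \<noteq> 0" and 2: "1 + exp z \<noteq> 0"
    using norm_add_exp_ge(1,2)[OF \<theta>, of 2] norm_add_exp_ge(1,2)[OF \<theta>, of 1] by auto
  show "rho z = exp z / ((1 + exp z) * (2 + exp z))" using 1 2 by (simp add: rho_def field_simps)
qed

lemma rho_holomorphic: "rho holomorphic_on {z. \<bar>Im z\<bar> < pi}"
  unfolding rho_def using rho_eq by (intro holomorphic_intros) auto

lemma rho_bound:
  assumes "\<theta> < pi"
  shows "\<exists>M. \<forall>z. \<bar>Im z\<bar> < \<theta> \<longrightarrow> norm (rho z) \<le> M * exp (- \<bar>Re z\<bar>)"
proof -
  define k where "k = sqrt (1 - (max 0 (- cos \<theta>))\<^sup>2)"
  have "norm (rho z) \<le> 1 / k\<^sup>2 * exp (- \<bar>Re z\<bar>)" if z: "\<bar>Im z\<bar> < \<theta>" for z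
  proof -
    note b1 = norm_add_exp_ge[OF z assms, of 1, folded k_def, simplified]
    note b2 = norm_add_exp_ge[OF z assms, of 2, folded k_def, simplified]
    have k: "k > 0" by (rule b1)
    have nz: "1 + exp z \<noteq> 0" "2 + exp z \<noteq> 0" using rho_eq(1,2)[of z] z assms by auto
    have n: "norm (rho z) = exp (Re z) / (norm (1 + exp z) * norm (2 + exp z))"
      using rho_eq(3)[of z] z assms by (simp add: norm_divide norm_mult)
    show ?thesis
    proof (cases "Re z \<ge> 0")
      case True
      have "(k * exp (Re z)) * (k * exp (Re z)) \<le> norm (1 + exp z) * norm (2 + exp z)"
        using b1 b2 k by (intro mult_mono) auto
      then have "norm (rho z) \<le> exp (Re z) / ((k * exp (Re z)) * (k * exp (Re z)))"
        unfolding n using k by (intro divide_left_mono mult_pos_pos) (auto simp: nz)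
      also have "\<dots> = 1 / k\<^sup>2 * exp (- \<bar>Re z\<bar>)" using True k by (simp add: power2_eq_square exp_minus field_simps)
      finally show ?thesis .
    next
      case False
      have "k * k \<le> norm (1 + exp z) * norm (2 + exp z)"
        using b1 b2 k by (intro mult_mono) auto
      then have "norm (rho z) \<le> exp (Re z) / (k * k)"
        unfolding n using k by (intro divide_left_mono mult_pos_pos) (auto simp: nz)
      also have "\<dots> = 1 / k\<^sup>2 * exp (- \<bar>Re z\<bar>)" using False k by (simp add: power2_eq_square field_simps)
      finally show ?thesis .
    qed
  qed
  then show ?thesis by blast
qed

context Q_calculus begin

text \<open>For \<open>\<sigma> = 1\<close> this is (s - T') q s, the left S-resolvent of T; for
  \<open>\<sigma> = -1\<close> it is that of the conjugate T'.\<close>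

definition sL :: "real \<Rightarrow> complex \<Rightarrow> 'a" where
  "sL \<sigma> s = (sq s - w 0 s) + \<sigma> *\<^sub>R (e1 * w 1 s + e2 * w 2 s + e3 * w 3 s)"

text \<open>Since \<open>W\<close> commutes with \<open>\<iota>\<close>, the scalar may stand to its
  right, where the path integrals in the definitions of the calculi have the measure and the
  function.\<close>

lemma Phi_CI:
  assumes "regular \<psi> W" "adm \<psi> \<theta> W f"
  shows "rap \<phi> (\<lambda>z. W (exp z) * \<iota> (exp z * f z / (2 * pi * \<i>)))"
    "CI \<phi> (\<lambda>z. W (exp z) * \<iota> (exp z * f z / (2 * pi * \<i>))) = \<Phi> \<phi> W f"
proof -
  have eq: "W (exp z) * \<iota> (exp z * f z / (2 * pi * \<i>)) = \<iota> (1 / (2 * pi * \<i>)) * (\<iota> (exp z * f z) * W (exp z))"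
    if "\<bar>Im z\<bar> = \<bar>\<phi>\<bar>" for z
    unfolding regularD(1)[OF assms(1) line_in_Om[OF that]] by (simp add: mult.assoc[symmetric] iota_mult[symmetric])
  note r = rap_bounded_linear[OF bounded_linear_mult_right Phi_rap[OF assms], of "\<iota> (1 / (2 * pi * \<i>))"]
  show "rap \<phi> (\<lambda>z. W (exp z) * \<iota> (exp z * f z / (2 * pi * \<i>)))"
    by (rule iffD2[OF rap_cong r]) (rule eq)
  have "CI \<phi> (\<lambda>z. W (exp z) * \<iota> (exp z * f z / (2 * pi * \<i>))) = CI \<phi> (\<lambda>z. \<iota> (1 / (2 * pi * \<i>)) * (\<iota> (exp z * f z) * W (exp z)))"
    by (rule CI_cong) (rule eq)
  then show "CI \<phi> (\<lambda>z. W (exp z) * \<iota> (exp z * f z / (2 * pi * \<i>))) = \<Phi> \<phi> W f"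
    unfolding \<Phi>_def CI_bounded_linear[OF bounded_linear_mult_right Phi_rap[OF assms]] .
qed

lemma S_CI:
  assumes f: "E0 \<theta> f"
  shows "rap \<phi> (\<lambda>z. sL \<sigma> (exp z) * \<iota> (exp z * f z / (2 * pi * \<i>)))"
    "CI \<phi> (\<lambda>z. sL \<sigma> (exp z) * \<iota> (exp z * f z / (2 * pi * \<i>))) = S \<sigma> f"
proof -
  define V where "V W z = W (exp z) * \<iota> (exp z * f z / (2 * pi * \<i>))" for W z
  have rs: "rap \<phi> (V sq)" and rw: "\<And>i. i < 4 \<Longrightarrow> rap \<phi> (V (w i))"
    unfolding V_def by (intro Phi_CI regular_sq regular_w adm_sq adm_w f; assumption)+
  have cs: "CI \<phi> (V sq) = B f" and cw: "\<And>i. i < 4 \<Longrightarrow> CI \<phi> (V (w i)) = U i f"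
    unfolding V_def by (intro Phi_CI regular_sq regular_w adm_sq adm_w f; assumption)+
  have eq: "sL \<sigma> (exp z) * \<iota> (exp z * f z / (2 * pi * \<i>)) =
     (V sq z - V (w 0) z) + \<sigma> *\<^sub>R ((e1 * V (w 1) z + e2 * V (w 2) z) + e3 * V (w 3) z)" for z
    unfolding sL_def V_def by (simp add: distrib_right left_diff_distrib mult.assoc)
  note bl = bounded_linear_mult_right bounded_linear_scaleR_right
  have re: "rap \<phi> (\<lambda>z. e1 * V (w 1) z)" "rap \<phi> (\<lambda>z. e2 * V (w 2) z)" "rap \<phi> (\<lambda>z. e3 * V (w 3) z)"
    by (intro rap_bounded_linear[OF bounded_linear_mult_right] rw; simp)+
  have r1: "rap \<phi> (\<lambda>z. e1 * V (w 1) z + e2 * V (w 2) z)" by (rule rap_add[OF re(1,2)])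
  have r2: "rap \<phi> (\<lambda>z. e1 * V (w 1) z + e2 * V (w 2) z + e3 * V (w 3) z)" by (rule rap_add[OF r1 re(3)])
  have r3: "rap \<phi> (\<lambda>z. \<sigma> *\<^sub>R (e1 * V (w 1) z + e2 * V (w 2) z + e3 * V (w 3) z))"
    by (rule rap_bounded_linear[OF bounded_linear_scaleR_right r2])
  have r4: "rap \<phi> (\<lambda>z. V sq z - V (w 0) z)" by (intro rap_diff rs rw) simp
  show "rap \<phi> (\<lambda>z. sL \<sigma> (exp z) * \<iota> (exp z * f z / (2 * pi * \<i>)))"
    unfolding eq by (rule rap_add[OF r4 r3])
  show "CI \<phi> (\<lambda>z. sL \<sigma> (exp z) * \<iota> (exp z * f z / (2 * pi * \<i>))) = S \<sigma> f"
    unfolding eq CI_add[OF r4 r3] CI_bounded_linear[OF bounded_linear_scaleR_right r2] CI_add[OF r1 re(3)] CI_add[OF re(1,2)]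
    using CI_bounded_linear[OF bounded_linear_mult_right rw] CI_diff[OF rs rw, of 0] by (simp add: S_def cs cw)
qed

text \<open>At a real point p the components commute with all quaternions, so the product splits
  into components and the identities for \<open>sq\<close> and \<open>w i\<close> assemble to the
  ordinary resolvent equation. For two nonreal points no such short form is available.\<close>

lemma sL_resolvent:
  assumes s: "s \<in> Om \<psi>" and p: "p \<in> Om \<psi>" "cnj p = p" and \<sigma>: "\<sigma> * \<sigma> = 1"
  shows "sL \<sigma> s - sL \<sigma> p = sL \<sigma> p * sL \<sigma> s * \<iota> (p - s)"
proof -
  have wL: "w i p * L a = L a * w i p" if "i < 4" for i a
    using w_iota[OF p(1) that] w_jj[OF p(1) that] p(2) by (intro comm_L) auto
  have sqL: "sq p * L a = L a * sq p" for a
    using regularD(1)[OF regular_sq p(1)] sq_jj[OF p(1)] p(2) by (intro comm_L) auto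
  have x: "w i p * w k s = w k p * w i s" if "i < 4" "k < 4" for i k by (rule w_w_exch[OF p(1) s that])
  define Y0 where "Y0 = (sq p - w 0 p) * (sq s - w 0 s) - (w 1 p * w 1 s + w 2 p * w 2 s + w 3 p * w 3 s)"
  define Y where "Y i = w i p * (sq s - w 0 s) + (sq p - w 0 p) * w i s" for i
  have prod: "sL \<sigma> p * sL \<sigma> s = Y0 + \<sigma> *\<^sub>R (e1 * Y 1 + e2 * Y 2 + e3 * Y 3)"
  proof -
    have "sL \<sigma> p * sL \<sigma> s = ((sq p - w 0 p) * (sq s - w 0 s) - (\<sigma> * \<sigma>) *\<^sub>R (w 1 p * w 1 s + w 2 p * w 2 s + w 3 p * w 3 s)) +
       (e1 * (\<sigma> *\<^sub>R (w 1 p * (sq s - w 0 s)) + \<sigma> *\<^sub>R ((sq p - w 0 p) * w 1 s)) + e2 * (\<sigma> *\<^sub>R (w 2 p * (sq s - w 0 s)) + \<sigma> *\<^sub>R ((sq p - w 0 p) * w 2 s))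
        + e3 * (\<sigma> *\<^sub>R (w 3 p * (sq s - w 0 s)) + \<sigma> *\<^sub>R ((sq p - w 0 p) * w 3 s)))"
      unfolding sL_def
      by (rule quaternion_split_product; (rule e_mult)?) (simp_all add: wL sqL right_diff_distrib left_diff_distrib x)
    then show ?thesis unfolding \<sigma> Y0_def Y_def by (simp add: scaleR_add_right distrib_left)
  qed
  have ci: "w i t * \<iota> c = \<iota> c * w i t" if "t \<in> {s, p}" "i < 4" for i t c
    using that w_iota[of _ i c] s p(1) by auto
  have cs: "sq t * \<iota> c = \<iota> c * sq t" if "t \<in> {s, p}" for t c
    using that s p(1) regularD(1)[OF regular_sq, of _ c] by auto
  have ci': "w i t * (\<iota> c * y) = \<iota> c * (w i t * y)" if "t \<in> {s, p}" "i < 4" for i t c y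
    using ci[OF that, of c] by (simp only: mult.assoc[symmetric])
  have cs': "sq t * (\<iota> c * y) = \<iota> c * (sq t * y)" if "t \<in> {s, p}" for t c y
    using cs[OF that, of c] by (simp only: mult.assoc[symmetric])
  have wd: "w i s - w i p = \<iota> (p - s) * (w i s * sq p + sq s * w i p - 2 *\<^sub>R (w 0 s * w i p))" if "i < 4" for i
    using w_diff[OF s p(1) that] w_split[OF s p(1) that] by simp
  have Yd: "Y i * \<iota> (p - s) = w i s - w i p" if "i < 4" for i
  proof -
    have c: "Y i * \<iota> (p - s) = \<iota> (p - s) * Y i"
      unfolding Y_def using that by (simp add: distrib_left distrib_right right_diff_distrib left_diff_distrib mult.assoc ci ci' cs cs')
    have Yi: "Y i = w i s * sq p + sq s * w i p - 2 *\<^sub>R (w 0 s * w i p)"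
      unfolding Y_def using that w_sq[OF p(1) s that] w_sq[OF s p(1) that] x[of i 0] x[of 0 i] w_w[OF p(1) s that, of 0] w_w[OF p(1) s _ that, of 0]
      by (simp add: right_diff_distrib left_diff_distrib scaleR_2)
    show ?thesis by (simp only: c) (simp only: Yi wd[OF that])
  qed
  have Y0d: "Y0 * \<iota> (p - s) = (sq s - w 0 s) - (sq p - w 0 p)"
  proof -
    have c: "Y0 * \<iota> (p - s) = \<iota> (p - s) * Y0"
      unfolding Y0_def by (simp add: distrib_left distrib_right right_diff_distrib left_diff_distrib mult.assoc ci ci' cs cs')
    have Y0: "Y0 = (sq s * sq p - (w 0 s * w 0 p + w 1 s * w 1 p + w 2 s * w 2 p + w 3 s * w 3 p)) - (w 0 s * sq p + sq s * w 0 p - 2 *\<^sub>R (w 0 s * w 0 p))"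
      unfolding Y0_def using w_sq[OF p(1) s, of 0] w_sq[OF s p(1), of 0] sq_sq[OF s p(1)] w_w[OF p(1) s, of 0 0] w_w[OF p(1) s, of 1 1] w_w[OF p(1) s, of 2 2] w_w[OF p(1) s, of 3 3]
      by (simp add: right_diff_distrib left_diff_distrib scaleR_2)
    have "\<iota> (p - s) * Y0 = (sq s - sq p) - (w 0 s - w 0 p)"
      unfolding Y0 sq_diff'[OF s p(1)] wd[of 0, simplified] by (simp add: eval_nat_numeral right_diff_distrib distrib_left)
    then show ?thesis unfolding c by simp
  qed
  have "sL \<sigma> p * sL \<sigma> s * \<iota> (p - s) = Y0 * \<iota> (p - s) + \<sigma> *\<^sub>R (e1 * (Y 1 * \<iota> (p - s)) + e2 * (Y 2 * \<iota> (p - s)) + e3 * (Y 3 * \<iota> (p - s)))"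
    unfolding prod by (simp add: distrib_right mult.assoc)
  also have "\<dots> = sL \<sigma> s - sL \<sigma> p"
    unfolding Y0d by (simp add: Yd sL_def right_diff_distrib scaleR_diff_right scaleR_add_right)
  finally show ?thesis by simp
qed

lemma E0_rho: "E0 \<theta> rho"
proof -
  obtain M where "\<And>z. \<bar>Im z\<bar> < \<theta> \<Longrightarrow> norm (rho z) \<le> M * exp (- \<bar>Re z\<bar>)" using rho_bound phi by blast
  then show ?thesis unfolding E0_def
    using phi by (intro conjI exI[of _ M] exI[of _ 1] holomorphic_on_subset[OF rho_holomorphic]) auto
qed

lemma intr_rho: "conj_sym \<theta> rho" by (simp add: conj_sym_def rho_def exp_cnj)

text \<open>The inverse of a + T for \<open>\<sigma> = 1\<close> and of a + T' for
  \<open>\<sigma> = -1\<close>, because the S-resolvent at the real point - a is the ordinary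
  resolvent.\<close>

definition R :: "real \<Rightarrow> real \<Rightarrow> 'a" where "R \<sigma> a = - sL \<sigma> (- of_real a)"

lemma neg_in_Om: assumes "a > 0" shows "- of_real a \<in> Om \<psi>"
proof -
  have "-1 < cos \<psi>" using cos_monotone_0_pi[of \<psi> pi] psi by simp
  then have "a * -1 < a * cos \<psi>" using assms by (intro mult_strict_left_mono)
  then show ?thesis using assms by (simp add: Om_def)
qed

text \<open>Two rearrangements of the resolvent equation at p = - a: the first trades a factor s for
  bounded terms and is used for large s, the second exposes 1 / (s + a) and is used near 0.\<close>

lemma R_sL:
  assumes s: "s \<in> Om \<psi>" and a: "a > 0" and \<sigma>: "\<sigma> * \<sigma> = 1"
  shows "R \<sigma> a * sL \<sigma> s * \<iota> s = sL \<sigma> s + R \<sigma> a - a *\<^sub>R (R \<sigma> a * sL \<sigma> s)"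
    and "s + of_real a \<noteq> 0 \<Longrightarrow> sL \<sigma> s * \<iota> (1 / (s + of_real a)) = R \<sigma> a * sL \<sigma> s - R \<sigma> a * \<iota> (1 / (s + of_real a))"
proof -
  have "sL \<sigma> s + R \<sigma> a = - R \<sigma> a * sL \<sigma> s * \<iota> (- of_real a - s)"
    using sL_resolvent[OF s neg_in_Om[OF a] _ \<sigma>] by (simp add: R_def)
  also have "\<dots> = R \<sigma> a * sL \<sigma> s * \<iota> (s + of_real a)"
  proof -
    have "- of_real a - s = - (s + of_real a)" by simp
    then show ?thesis by (simp only: iota_minus minus_mult_minus mult_minus_left mult_minus_right minus_minus)
  qed
  finally have *: "sL \<sigma> s + R \<sigma> a = R \<sigma> a * sL \<sigma> s * \<iota> (s + of_real a)" .
  then show "R \<sigma> a * sL \<sigma> s * \<iota> s = sL \<sigma> s + R \<sigma> a - a *\<^sub>R (R \<sigma> a * sL \<sigma> s)"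
    by (simp add: iota_add iota_of_real distrib_left)
  assume ne: "s + of_real a \<noteq> 0"
  have "(sL \<sigma> s + R \<sigma> a) * \<iota> (1 / (s + of_real a)) = R \<sigma> a * sL \<sigma> s"
    unfolding * using ne by (simp add: mult.assoc iota_mult[symmetric])
  then show "sL \<sigma> s * \<iota> (1 / (s + of_real a)) = R \<sigma> a * sL \<sigma> s - R \<sigma> a * \<iota> (1 / (s + of_real a))"
    by (simp add: distrib_right algebra_simps)
qed

lemma sL_norm:
  assumes "s \<in> Om \<psi>" "\<bar>\<sigma>\<bar> = 1" shows "norm (sL \<sigma> s) \<le> 5 * K / norm s"
proof -
  have "norm (qe i) = 1" for i by (simp add: qe_def norm_Pair)
  then have e: "norm (L (qe i) * x) \<le> norm x" for i x
    using order_trans[OF norm_mult_ineq mult_right_mono[OF L_norm norm_ge_zero], of "qe i" x] by simp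
  have "norm (sL \<sigma> s) \<le> (norm (sq s) + norm (w 0 s)) + (norm (e1 * w 1 s) + norm (e2 * w 2 s) + norm (e3 * w 3 s))"
    unfolding sL_def using assms(2)
    by (intro order_trans[OF norm_triangle_ineq] add_mono order_trans[OF norm_triangle_ineq4])
       (auto intro!: order_trans[OF norm_triangle_ineq] add_mono)
  also have "\<dots> \<le> (K / norm s + K / norm s) + (K / norm s + K / norm s + K / norm s)"
    by (intro add_mono order_trans[OF e] sq_norm w_norm assms) auto
  finally show ?thesis by (simp add: field_simps)
qed

text \<open>The two rays bounding the sector are joined through the complement of the sector:
  \<open>s (2 R\<^sub>2 - R\<^sub>1) (S\<^sup>-\<^sup>1(s) - (s - 1)\<^sup>-\<^sup>1)\<close> is holomorphic there and decays at both ends.\<close>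
lemma outer_integral:
  assumes \<sigma>: "\<sigma> * \<sigma> = 1"
  defines "P \<equiv> 2 *\<^sub>R R \<sigma> 2 - R \<sigma> 1"
  defines "N \<equiv> \<lambda>z. P * (sL \<sigma> (exp z) * \<iota> (exp z) - \<iota> (exp z / (exp z - 1)))"
  shows "rap \<phi> N" "CI \<phi> N = 0"
proof -
  define D where "D = {z. exp z \<in> Om \<psi>}"
  have oD: "open D"
    unfolding D_def using open_vimage[OF open_Om continuous_on_exp[OF continuous_on_id]] by (simp add: vimage_def)
  have s1: "\<bar>\<sigma>\<bar> = 1" using \<sigma> by (metis abs_mult_self_eq abs_ge_zero power2_eq_square power2_eq_1_iff abs_of_nonneg abs_1 abs_minus_cancel)
  define k where "k = sqrt (1 - (max 0 (cos \<psi>))\<^sup>2)"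
  have "cos \<psi> < cos 0" using psi by (intro cos_monotone_0_pi) auto
  then have m: "0 \<le> max 0 (cos \<psi>)" "max 0 (cos \<psi>) < 1" by auto
  have k0: "k > 0" unfolding k_def using power_strict_mono[OF m(2,1), of 2] by simp
  have kb: "k \<le> norm (exp z - 1)" "k * exp (Re z) \<le> norm (exp z - 1)" if "z \<in> D" for z
  proof -
    have "cos (Im z) \<le> max 0 (cos \<psi>)" using that by (simp add: D_def Om_def Re_exp)
    from norm_one_minus_exp_ge[OF this m] show "k \<le> norm (exp z - 1)" "k * exp (Re z) \<le> norm (exp z - 1)"
      by (simp_all add: k_def norm_minus_commute)
  qed
  have ne: "exp z - 1 \<noteq> 0" if "z \<in> D" for z using kb(1)[OF that] k0 by auto
  have rN: "rdiff D N"
    unfolding N_def sL_def D_def distrib_right left_diff_distrib mult_scaleR_left mult.assoc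
    by (intro rdiff_lmult rdiff_diff rdiff_add rdiff_scaleR rdiff_regular regular_sq regular_w rdiff_iota oD[unfolded D_def] holomorphic_intros)
       (use ne in \<open>auto simp: D_def\<close>)
  then obtain N' where N'c: "continuous_on D N'" and N': "\<And>z. z \<in> D \<Longrightarrow> (N has_derivative (\<lambda>h. N' z * \<iota> h)) (at z)"
    unfolding rdiff_def by blast
  define M1 where "M1 = 5 * K * (1 + 4 * norm (R \<sigma> 2) + norm (R \<sigma> 1)) + norm P / k"
  define M2 where "M2 = 10 * K + 2 * norm (R \<sigma> 2) + 2 * norm (R \<sigma> 1) + norm P / k"
  have M0: "M1 \<ge> 0" "M2 \<ge> 0" using K k0 by (auto simp: M1_def M2_def)
  have nm: "norm (x * \<iota> c) \<le> norm x * norm c" for x c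
    by (rule order_trans[OF norm_mult_ineq]) (intro mult_left_mono iota_norm norm_ge_zero)
  \<comment> \<open>Decay for large s: the expansion of P sL s by \<open>R_sL\<close> has the
    constant term \<open>P\<close>, and it cancels against s / (s - 1) = 1 + 1 / (s - 1). All other
    terms are of order 1 / norm s.\<close>
  have b1: "norm (N z) \<le> M1 / exp (Re z)" if z: "z \<in> D" for z
  proof -
    define s where "s = exp z"
    have s: "s \<in> Om \<psi>" "norm s = exp (Re z)" using z by (auto simp: D_def s_def)
    have "s / (s - 1) = 1 + 1 / (s - 1)" using ne[OF z] by (simp add: s_def field_simps)
    then have "N z = P * sL \<sigma> s * \<iota> s - P * (1 + \<iota> (1 / (s - 1)))"
      unfolding N_def s_def[symmetric] by (simp add: right_diff_distrib mult.assoc iota_add)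
    also have "P * sL \<sigma> s * \<iota> s = sL \<sigma> s + P - 4 *\<^sub>R (R \<sigma> 2 * sL \<sigma> s) + R \<sigma> 1 * sL \<sigma> s"
      using R_sL(1)[OF s(1) _ \<sigma>, of 2] R_sL(1)[OF s(1) _ \<sigma>, of 1]
      by (simp add: P_def left_diff_distrib scaleR_diff_right scaleR_add_right scaleR_2[of "sL \<sigma> s"])
    finally have Nz: "N z = sL \<sigma> s - 4 *\<^sub>R (R \<sigma> 2 * sL \<sigma> s) + R \<sigma> 1 * sL \<sigma> s - P * \<iota> (1 / (s - 1))"
      by (simp add: distrib_left)
    have n: "norm (sL \<sigma> s) \<le> 5 * K / exp (Re z)" using sL_norm[OF s(1) s1] s(2) by simp
    have n2: "norm (x * sL \<sigma> s) \<le> norm x * (5 * K / exp (Re z))" for x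
      by (rule order_trans[OF norm_mult_ineq]) (intro mult_left_mono n norm_ge_zero)
    have "k * exp (Re z) \<le> norm (s - 1)" using kb(2)[OF z] by (simp add: s_def)
    then have "norm (1 / (s - 1)) \<le> 1 / (k * exp (Re z))" using k0 by (simp add: norm_divide frac_le)
    then have n3: "norm (P * \<iota> (1 / (s - 1))) \<le> norm P * (1 / (k * exp (Re z)))"
      by (intro order_trans[OF nm] mult_left_mono) auto
    have "norm (N z) \<le> norm (sL \<sigma> s) + 4 * norm (R \<sigma> 2 * sL \<sigma> s) + norm (R \<sigma> 1 * sL \<sigma> s) + norm (P * \<iota> (1 / (s - 1)))"
      unfolding Nz by (intro order_trans[OF norm_triangle_ineq4] order_trans[OF norm_triangle_ineq] add_mono) auto
    also have "\<dots> \<le> 5 * K / exp (Re z) + 4 * (norm (R \<sigma> 2) * (5 * K / exp (Re z))) + norm (R \<sigma> 1) * (5 * K / exp (Re z)) + norm P * (1 / (k * exp (Re z)))"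
      using n n2[of "R \<sigma> 2"] n2[of "R \<sigma> 1"] n3 by linarith
    also have "\<dots> = M1 / exp (Re z)" using k0 by (simp add: M1_def field_simps)
    finally show ?thesis .
  qed
  \<comment> \<open>Decay for small s: 2 / (s + 2) - 1 / (s + 1) has a zero at s = 0 that
    compensates the growth 1 / norm s of \<open>sL\<close>, so P sL s stays bounded and the factor s
    remains.\<close>
  have b2: "norm (N z) \<le> M2 * exp (Re z)" if z: "z \<in> D" and small: "exp (Re z) \<le> 1 / 2" for z
  proof -
    define s where "s = exp z"
    have s: "s \<in> Om \<psi>" "norm s = exp (Re z)" using z by (auto simp: D_def s_def)
    have n1: "norm (s + 1) \<ge> 1 / 2" using norm_triangle_ineq2[of 1 "- s"] s(2) small by (simp add: add.commute)
    have n2: "norm (s + 2) \<ge> 1" using norm_triangle_ineq2[of 2 "- s"] s(2) small by (simp add: add.commute)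
    have ne1: "s + 1 \<noteq> 0" "s + 2 \<noteq> 0" using n1 n2 by auto
    have "P * sL \<sigma> s = sL \<sigma> s * \<iota> (2 / (s + 2) - 1 / (s + 1)) + 2 *\<^sub>R (R \<sigma> 2 * \<iota> (1 / (s + 2))) - R \<sigma> 1 * \<iota> (1 / (s + 1))"
    proof -
      have "2 / (s + 2) = 2 *\<^sub>R (1 / (s + 2))" by (simp add: scaleR_conv_of_real)
      then have "\<iota> (2 / (s + 2) - 1 / (s + 1)) = 2 *\<^sub>R \<iota> (1 / (s + 2)) - \<iota> (1 / (s + 1))"
        by (simp only: iota_diff linear_cmul[OF bounded_linear.linear[OF iota_bounded_linear]])
      then show ?thesis
        using R_sL(2)[OF s(1) _ \<sigma>, of 2] R_sL(2)[OF s(1) _ \<sigma>, of 1] ne1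
        by (simp add: P_def left_diff_distrib right_diff_distrib scaleR_diff_right)
    qed
    moreover have "2 / (s + 2) - 1 / (s + 1) = s / ((s + 1) * (s + 2))" using ne1 by (simp add: field_simps)
    ultimately have PsL: "P * sL \<sigma> s = sL \<sigma> s * \<iota> (s / ((s + 1) * (s + 2))) + 2 *\<^sub>R (R \<sigma> 2 * \<iota> (1 / (s + 2))) - R \<sigma> 1 * \<iota> (1 / (s + 1))"
      by simp
    have h1: "norm (s / ((s + 1) * (s + 2))) \<le> norm s / ((1/2) * 1)"
      unfolding norm_divide norm_mult by (intro divide_left_mono mult_mono n1 n2) (use ne1 in auto)
    have "norm (sL \<sigma> s * \<iota> (s / ((s + 1) * (s + 2)))) \<le> (5 * K / norm s) * (norm s / ((1/2) * 1))"
      by (rule order_trans[OF nm]) (intro mult_mono h1 sL_norm[OF s(1) s1], use K in auto)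
    also have "\<dots> = 10 * K" using Om_nonzero[OF s(1)] by simp
    finally have t1: "norm (sL \<sigma> s * \<iota> (s / ((s + 1) * (s + 2)))) \<le> 10 * K" .
    have "norm (1 / (s + 2)) \<le> 1 / 1" unfolding norm_divide norm_one by (intro divide_left_mono n2) (use ne1 in auto)
    then have t2: "norm (R \<sigma> 2 * \<iota> (1 / (s + 2))) \<le> norm (R \<sigma> 2) * (1 / 1)"
      by (intro order_trans[OF nm] mult_left_mono) auto
    have "norm (1 / (s + 1)) \<le> 1 / (1/2)" unfolding norm_divide norm_one by (intro divide_left_mono n1) (use ne1 in auto)
    then have t3: "norm (R \<sigma> 1 * \<iota> (1 / (s + 1))) \<le> norm (R \<sigma> 1) * (1 / (1/2))"
      by (intro order_trans[OF nm] mult_left_mono) auto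
    have "norm (P * sL \<sigma> s) \<le> norm (sL \<sigma> s * \<iota> (s / ((s + 1) * (s + 2)))) + 2 * norm (R \<sigma> 2 * \<iota> (1 / (s + 2))) + norm (R \<sigma> 1 * \<iota> (1 / (s + 1)))"
      unfolding PsL by (intro order_trans[OF norm_triangle_ineq4] order_trans[OF norm_triangle_ineq] add_mono) auto
    also have "\<dots> \<le> 10 * K + 2 * norm (R \<sigma> 2) + 2 * norm (R \<sigma> 1)" using t1 t2 t3 by simp
    finally have p1: "norm (P * sL \<sigma> s) \<le> 10 * K + 2 * norm (R \<sigma> 2) + 2 * norm (R \<sigma> 1)" .
    have "norm (s / (s - 1)) \<le> norm s / k" unfolding norm_divide using kb(1)[OF z] k0 by (intro divide_left_mono mult_pos_pos) (auto simp: s_def[symmetric] intro: less_le_trans)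
    then have p2: "norm (P * \<iota> (s / (s - 1))) \<le> norm P * (norm s / k)"
      by (intro order_trans[OF nm] mult_left_mono) auto
    have "norm (N z) \<le> norm (P * sL \<sigma> s * \<iota> s) + norm (P * \<iota> (s / (s - 1)))"
      unfolding N_def s_def[symmetric] right_diff_distrib mult.assoc by (rule norm_triangle_ineq4)
    also have "\<dots> \<le> (10 * K + 2 * norm (R \<sigma> 2) + 2 * norm (R \<sigma> 1)) * norm s + norm P * (norm s / k)"
      by (intro add_mono p2 order_trans[OF nm] mult_right_mono p1) auto
    also have "\<dots> = M2 * exp (Re z)" unfolding s(2) M2_def using k0 by (simp add: field_simps)
    finally show ?thesis .
  qed
  define M where "M = 4 * M1 + M2"
  have b: "norm (N z) \<le> M * exp (- 1 * \<bar>Re z\<bar>)" if z: "z \<in> D" for z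
  proof (cases "Re z \<ge> 0")
    case True
    have "M1 / exp (Re z) = M1 * exp (- 1 * \<bar>Re z\<bar>)" using True by (simp add: exp_minus field_simps)
    also have "\<dots> \<le> M * exp (- 1 * \<bar>Re z\<bar>)" using M0 by (intro mult_right_mono) (auto simp: M_def)
    finally show ?thesis using b1[OF z] by simp
  next
    case False
    show ?thesis
    proof (cases "exp (Re z) \<le> 1 / 2")
      case True
      have "M2 * exp (Re z) \<le> M * exp (Re z)" using M0 by (intro mult_right_mono) (auto simp: M_def)
      from order_trans[OF b2[OF z True] this] show ?thesis using False by simp
    next
      case F2: False
      \<comment> \<open>In the gap 1/2 < exp (Re z) < 1 the bound for large s is used; there 1 / r
        is at most 4 r, which is the origin of the 4 in \<open>M\<close>.\<close>
      have "1 \<le> 2 * exp (Re z) * (2 * exp (Re z))" using F2 mult_mono[of 1 "2 * exp (Re z)" 1 "2 * exp (Re z)"] by simp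
      then have "1 / exp (Re z) \<le> 4 * exp (Re z)" by (simp add: field_simps)
      then have "M1 * (1 / exp (Re z)) \<le> M1 * (4 * exp (Re z))" using M0 by (intro mult_left_mono) auto
      also have "\<dots> \<le> M * exp (Re z)" using M0 by (simp add: M_def algebra_simps)
      finally show ?thesis using b1[OF z] False by simp
    qed
  qed
  have inD: "z \<in> D" if "\<phi> \<le> \<bar>Im z\<bar>" "\<bar>Im z\<bar> \<le> 2 * pi - \<phi>" for z
    unfolding D_def using that psi phi by (auto intro!: exp_in_Om)
  have Nc: "continuous_on D N" by (rule continuous_at_imp_continuous_on) (blast intro: has_derivative_continuous N')
  show r: "rap \<phi> N"
    by (rule rapI[of _ _ 1 M]) (use b inD phi psi in \<open>auto intro!: continuous_on_subset[OF Nc]\<close>)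
  have "integral UNIV (\<lambda>x. N (Complex x \<phi>)) = integral UNIV (\<lambda>x. N (Complex x (2 * pi - \<phi>)))"
  proof (rule line_shift[OF bounded_linear_mult_left[of "\<iota> \<i>"], where k' = N' and c = 1 and M = M])
    show "(N has_derivative (\<lambda>h. Re h *\<^sub>R N' z + Im h *\<^sub>R (N' z * \<iota> \<i>))) (at z)" if "Im z \<in> {\<phi>..2 * pi - \<phi>}" for z
      unfolding iota_split(2)[symmetric] using that psi phi by (intro N' inD) auto
    show "continuous_on {z. Im z \<in> {\<phi>..2 * pi - \<phi>}} N'" by (rule continuous_on_subset[OF N'c]) (use psi phi in \<open>auto intro!: inD\<close>)
    show "norm (N z) \<le> M * exp (- 1 * \<bar>Re z\<bar>)" if "Im z \<in> {\<phi>..2 * pi - \<phi>}" for z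
      using that psi phi by (intro b inD) auto
  qed (use phi in auto)
  \<comment> \<open>By periodicity of exp the line at height 2 pi - \<phi> is the lower line of the
    contour, so the upper line has been moved to the lower one around the outside of the
    sector.\<close>
  moreover have "N (Complex x (2 * pi - \<phi>)) = N (Complex x (- \<phi>))" for x
  proof -
    have "exp (Complex x (2 * pi - \<phi>)) = exp (Complex x (- \<phi>))" by (simp add: complex_eq_iff Re_exp Im_exp cos_diff sin_diff)
    then show ?thesis by (simp add: N_def)
  qed
  ultimately show "CI \<phi> N = 0"
    using r unfolding CI_def rap_def by (subst Henstock_Kurzweil_Integration.integral_diff) (auto intro: rapid_integrable)
qed

text \<open>In the coordinate s = exp w the points s = 1 and s = - a lie inside and outside the
  sector. Up to the kernel at z = 0 the integrand is \<open>g\<close>, normalised by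
  \<open>g 0 = 1\<close>, so Cauchy's formula at z = 0 applies.\<close>

lemma scalar_integral:
  assumes a: "a > 0"
  defines "F \<equiv> \<lambda>z. exp z / (exp z - 1) - exp z / (exp z + of_real a)"
  shows "rap \<phi> F" "CI \<phi> F = 2 * pi * \<i>"
proof -
  define g where "g w = of_real (a + 1) / (of_real a + exp w)" for w :: complex
  define k where "k = sqrt (1 - (max 0 (- cos \<theta>))\<^sup>2)"
  note na = norm_add_exp_ge[OF _ phi(3) a, folded k_def]
  have k: "k > 0" using na(1)[of 0] phi psi by simp
  have ne: "of_real a + exp w \<noteq> 0" if "\<bar>Im w\<bar> < \<theta>" for w using less_le_trans[OF mult_pos_pos[OF k a] na(2)[OF that]] by auto
  have hol: "g holomorphic_on {w. \<bar>Im w\<bar> < \<theta>}" unfolding g_def using ne by (intro holomorphic_intros) auto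
  define M where "M = (a + 1) / (k * a) + (a + 1) / k"
  have le: "norm (g w) \<le> (a + 1) / (k * a)" "norm (g w) \<le> (a + 1) / k * exp (- 1 * Re w)" if "\<bar>Im w\<bar> < \<theta>" for w
  proof -
    have n: "norm (g w) = (a + 1) / norm (of_real a + exp w)" unfolding g_def norm_divide using a by simp
    show "norm (g w) \<le> (a + 1) / (k * a)"
      unfolding n by (rule divide_left_mono[OF na(2)[OF that]]) (use a k ne[OF that] in auto)
    have "norm (g w) \<le> (a + 1) / (k * exp (Re w))"
      unfolding n by (rule divide_left_mono[OF na(3)[OF that]]) (use a k ne[OF that] in auto)
    then show "norm (g w) \<le> (a + 1) / k * exp (- 1 * Re w)" by (simp add: exp_minus field_simps)
  qed
  have le': "norm (g w) \<le> M" "norm (g w) \<le> M * exp (- 1 * Re w)" if "\<bar>Im w\<bar> < \<theta>" for w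
  proof -
    show "norm (g w) \<le> M" using le(1)[OF that] a k by (simp add: M_def add_increasing2)
    have "(a + 1) / k * exp (- 1 * Re w) \<le> M * exp (- 1 * Re w)" using a k by (intro mult_right_mono) (auto simp: M_def)
    then show "norm (g w) \<le> M * exp (- 1 * Re w)" using le(2)[OF that] by linarith
  qed
  have eq: "F w = g w / (1 - exp (0 - w))" if "\<bar>Im w\<bar> = \<bar>\<phi>\<bar>" for w
  proof -
    have "exp (0 - w) \<noteq> 1" by (rule exp_kernel_bound(4)[of \<phi>]) (use that phi psi in auto)
    then have "exp w - 1 \<noteq> 0" by (auto simp: exp_minus)
    moreover have "of_real a + exp w \<noteq> 0" using that phi psi by (intro ne) auto
    moreover have e: "1 - exp (0 - w) = (exp w - 1) / exp w" by (simp add: exp_minus field_simps)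
    ultimately show ?thesis unfolding F_def g_def e by (simp add: field_simps)
  qed
  have "rap \<phi> (\<lambda>w. g w / (1 - exp (0 - w)))"
    by (rule strip_kernel_rap[OF holomorphic_on_imp_continuous_on[OF hol] _ _ _ _ _ le']) (use phi psi in auto)
  from iffD2[OF rap_cong this, of F] show "rap \<phi> F" using eq by blast
  have "CI \<phi> (\<lambda>w. g w / (1 - exp (0 - w))) = 2 * pi * \<i> * g 0"
    by (rule strip_Cauchy_formula[OF hol _ _ _ _ _ le']) (use phi psi in auto)
  moreover have "g 0 = 1" using a by (simp add: g_def add.commute) (metis of_real_1 of_real_add add_pos_pos less_irrefl of_real_eq_0_iff zero_less_one)
  ultimately show "CI \<phi> F = 2 * pi * \<i>" using CI_cong[of \<phi> F, OF eq] by simp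
qed

text \<open>The integrand of \<open>S \<sigma> rho\<close> is rewritten with \<open>R_sL\<close> as
  \<open>N\<close> plus scalar multiples of the resolvents: the term P s / (s - 1) subtracted in
  \<open>N\<close> is restored by the two functions \<open>F\<close>, since P = 2 R(2) - R(1). The
  integral of \<open>N\<close> is 0, and the others give 2 pi i each.\<close>

lemma S_rho:
  assumes \<sigma>: "\<sigma> * \<sigma> = 1"
  shows "S \<sigma> rho = 2 *\<^sub>R R \<sigma> 2 - R \<sigma> 1"
proof -
  define P where "P = 2 *\<^sub>R R \<sigma> 2 - R \<sigma> 1"
  define N where "N z = P * (sL \<sigma> (exp z) * \<iota> (exp z) - \<iota> (exp z / (exp z - 1)))" for z
  define F where "F a z = exp z / (exp z - 1) - exp z / (exp z + of_real a)" for a :: real and z :: complex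
  note N = outer_integral[OF \<sigma>, folded P_def, folded N_def]
  have F: "rap \<phi> (F a)" "CI \<phi> (F a) = 2 * pi * \<i>" if "a > 0" for a
    using scalar_integral[OF that] by (simp_all add: F_def[abs_def])
  have RF: "rap \<phi> (\<lambda>z. x * \<iota> (F a z))" "CI \<phi> (\<lambda>z. x * \<iota> (F a z)) = x * \<iota> (2 * pi * \<i>)" if "a > 0" for a x
  proof -
    have bl: "bounded_linear (\<lambda>y. x * \<iota> y)" by (rule bounded_linear_compose[OF bounded_linear_mult_right iota_bounded_linear])
    show "rap \<phi> (\<lambda>z. x * \<iota> (F a z))" by (rule rap_bounded_linear[OF bl F(1)[OF that]])
    show "CI \<phi> (\<lambda>z. x * \<iota> (F a z)) = x * \<iota> (2 * pi * \<i>)" unfolding CI_bounded_linear[OF bl F(1)[OF that]] F(2)[OF that] ..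
  qed
  have eq: "sL \<sigma> (exp z) * \<iota> (exp z * rho z / (2 * pi * \<i>)) =
      (N z + (2 *\<^sub>R R \<sigma> 2) * \<iota> (F 2 z) - R \<sigma> 1 * \<iota> (F 1 z)) * \<iota> (1 / (2 * pi * \<i>))" if z: "\<bar>Im z\<bar> = \<bar>\<phi>\<bar>" for z
  proof -
    define s where "s = exp z"
    have s: "s \<in> Om \<psi>" unfolding s_def by (rule line_in_Om[OF z])
    have ne: "s + 1 \<noteq> 0" "s + 2 \<noteq> 0" using rho_eq(1,2)[of z] z phi psi by (auto simp: s_def add.commute)
    have "exp z * rho z / (2 * pi * \<i>) = (2 *\<^sub>R (1 / (s + 2)) - 1 / (s + 1)) * s * (1 / (2 * pi * \<i>))"
      by (simp add: rho_def s_def add.commute scaleR_conv_of_real)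
    then have "sL \<sigma> (exp z) * \<iota> (exp z * rho z / (2 * pi * \<i>)) = sL \<sigma> s * (\<iota> (2 *\<^sub>R (1 / (s + 2)) - 1 / (s + 1)) * \<iota> s * \<iota> (1 / (2 * pi * \<i>)))"
      by (simp only: iota_mult s_def)
    also have "\<iota> (2 *\<^sub>R (1 / (s + 2)) - 1 / (s + 1)) = 2 *\<^sub>R \<iota> (1 / (s + 2)) - \<iota> (1 / (s + 1))"
      by (simp only: iota_diff linear_cmul[OF bounded_linear.linear[OF iota_bounded_linear]])
    also have "sL \<sigma> s * ((2 *\<^sub>R \<iota> (1 / (s + 2)) - \<iota> (1 / (s + 1))) * \<iota> s * \<iota> (1 / (2 * pi * \<i>))) =
        (2 *\<^sub>R (sL \<sigma> s * \<iota> (1 / (s + 2))) - sL \<sigma> s * \<iota> (1 / (s + 1))) * \<iota> s * \<iota> (1 / (2 * pi * \<i>))"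
      by (simp add: mult.assoc right_diff_distrib left_diff_distrib)
    also have "sL \<sigma> s * \<iota> (1 / (s + 2)) = R \<sigma> 2 * sL \<sigma> s - R \<sigma> 2 * \<iota> (1 / (s + 2))"
      using R_sL(2)[OF s _ \<sigma>, of 2] ne by simp
    also have "sL \<sigma> s * \<iota> (1 / (s + 1)) = R \<sigma> 1 * sL \<sigma> s - R \<sigma> 1 * \<iota> (1 / (s + 1))"
      using R_sL(2)[OF s _ \<sigma>, of 1] ne by simp
    also have "(2 *\<^sub>R (R \<sigma> 2 * sL \<sigma> s - R \<sigma> 2 * \<iota> (1 / (s + 2))) - (R \<sigma> 1 * sL \<sigma> s - R \<sigma> 1 * \<iota> (1 / (s + 1)))) * \<iota> s =
       P * sL \<sigma> s * \<iota> s - 2 *\<^sub>R (R \<sigma> 2 * \<iota> (s / (s + 2))) + R \<sigma> 1 * \<iota> (s / (s + 1))"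
    proof -
      have "\<iota> (1 / (s + 2)) * \<iota> s = \<iota> (s / (s + 2))" "\<iota> (1 / (s + 1)) * \<iota> s = \<iota> (s / (s + 1))" by (simp_all flip: iota_mult)
      then show ?thesis by (simp add: P_def left_diff_distrib scaleR_diff_right mult.assoc)
    qed
    also have "\<dots> = N z + (2 *\<^sub>R R \<sigma> 2) * \<iota> (F 2 z) - R \<sigma> 1 * \<iota> (F 1 z)"
      by (simp add: N_def F_def s_def P_def iota_diff left_diff_distrib right_diff_distrib scaleR_diff_right mult.assoc)
    finally show ?thesis .
  qed
  have r1: "rap \<phi> (\<lambda>z. N z + (2 *\<^sub>R R \<sigma> 2) * \<iota> (F 2 z))" by (rule rap_add[OF N(1) RF(1)]) simp
  have r2: "rap \<phi> (\<lambda>z. N z + (2 *\<^sub>R R \<sigma> 2) * \<iota> (F 2 z) - R \<sigma> 1 * \<iota> (F 1 z))" by (rule rap_diff[OF r1 RF(1)]) simp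
  have "S \<sigma> rho = CI \<phi> (\<lambda>z. (N z + (2 *\<^sub>R R \<sigma> 2) * \<iota> (F 2 z) - R \<sigma> 1 * \<iota> (F 1 z)) * \<iota> (1 / (2 * pi * \<i>)))"
    unfolding S_CI(2)[OF E0_rho, symmetric] by (rule CI_cong) (rule eq)
  also have "\<dots> = CI \<phi> (\<lambda>z. N z + (2 *\<^sub>R R \<sigma> 2) * \<iota> (F 2 z) - R \<sigma> 1 * \<iota> (F 1 z)) * \<iota> (1 / (2 * pi * \<i>))"
    by (rule CI_bounded_linear[OF bounded_linear_mult_left r2])
  also have "CI \<phi> (\<lambda>z. N z + (2 *\<^sub>R R \<sigma> 2) * \<iota> (F 2 z) - R \<sigma> 1 * \<iota> (F 1 z)) = P * \<iota> (2 * pi * \<i>)"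
    unfolding CI_diff[OF r1 RF(1)[OF zero_less_one]] CI_add[OF N(1) RF(1)[of 2, simplified]] N(2) RF(2)[OF zero_less_one] RF(2)[of 2, simplified]
    by (simp add: P_def left_diff_distrib)
  also have "P * \<iota> (2 * pi * \<i>) * \<iota> (1 / (2 * pi * \<i>)) = P" by (simp add: mult.assoc iota_mult[symmetric])
  finally show ?thesis by (simp add: P_def)
qed

end

section \<open>Slice hyperholomorphic functions on a sector\<close>

lemma norm_quat: "norm ((a, b, c, d) :: quat) = sqrt (a\<^sup>2 + b\<^sup>2 + c\<^sup>2 + d\<^sup>2)"
  by (simp add: norm_Pair)

lemma norm_axial:
  assumes "J \<in> qsph" shows "norm (qof_real u + v *\<^sub>R J) = sqrt (u\<^sup>2 + v\<^sup>2)" "fst (qof_real u + v *\<^sub>R J) = u"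
proof -
  obtain b c d where J: "J = (0, b, c, d)" using assms by (cases J) (auto simp: qsph_def)
  have 1: "b\<^sup>2 + c\<^sup>2 + d\<^sup>2 = 1" using assms by (auto simp: qsph_def J norm_quat)
  have "u\<^sup>2 + (v * b)\<^sup>2 + (v * c)\<^sup>2 + (v * d)\<^sup>2 = u\<^sup>2 + v\<^sup>2 * (b\<^sup>2 + c\<^sup>2 + d\<^sup>2)" by (simp add: power2_eq_square algebra_simps)
  then show "norm (qof_real u + v *\<^sub>R J) = sqrt (u\<^sup>2 + v\<^sup>2)" by (simp add: J qof_real_def norm_quat 1)
  show "fst (qof_real u + v *\<^sub>R J) = u" by (simp add: J qof_real_def)
qed

lemma axial_decomp:
  obtains u v J where "J \<in> qsph" "q = qof_real u + v *\<^sub>R J" "v \<ge> 0"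
proof -
  obtain a b c d where q: "q = (a, b, c, d)" by (cases q) auto
  define v where "v = sqrt (b\<^sup>2 + c\<^sup>2 + d\<^sup>2)"
  have v0: "v \<ge> 0" by (simp add: v_def)
  have v2: "v\<^sup>2 = b\<^sup>2 + c\<^sup>2 + d\<^sup>2" by (simp add: v_def)
  show ?thesis
  proof (cases "v = 0")
    case True
    then have "b\<^sup>2 + c\<^sup>2 + d\<^sup>2 = 0" using v2 by simp
    then have "b = 0" "c = 0" "d = 0" by (simp_all add: add_nonneg_eq_0_iff)
    then show ?thesis by (intro that[of "(0,1,0,0)" a 0]) (auto simp: q qsph_def qof_real_def norm_quat)
  next
    case False
    show ?thesis
    proof (rule that[of "(0, b/v, c/v, d/v)" a v])
      have "(b/v)\<^sup>2 + (c/v)\<^sup>2 + (d/v)\<^sup>2 = 1" using False by (simp add: power_divide add_divide_distrib[symmetric] flip: v2)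
      then show "(0, b/v, c/v, d/v) \<in> qsph" by (simp add: qsph_def norm_quat)
    qed (use False v0 in \<open>auto simp: q qof_real_def\<close>)
  qed
qed

text \<open>Replaces the polar parametrisation by one inequality between real part and norm, which
  makes openness and the comparison with \<open>Om\<close> immediate.\<close>

lemma sector_eq:
  assumes "0 < \<omega>" "\<omega> \<le> pi"
  shows "sector \<omega> = {q. norm q * cos \<omega> < fst q}"
proof (intro set_eqI iffI)
  fix q assume "q \<in> sector \<omega>"
  then obtain r J \<phi> where q: "q = r *\<^sub>R qexpJ J \<phi>" "r > 0" "J \<in> qsph" "\<bar>\<phi>\<bar> < \<omega>" by (auto simp: sector_def)
  have "cos \<omega> < cos \<bar>\<phi>\<bar>" using q(4) assms by (intro cos_monotone_0_pi) auto
  moreover have "norm (qexpJ J \<phi>) = 1" "fst (qexpJ J \<phi>) = cos \<phi>" using norm_axial[OF q(3), of "cos \<phi>" "sin \<phi>"] by (simp_all add: qexpJ_def)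
  ultimately show "q \<in> {q. norm q * cos \<omega> < fst q}" using q(2) by (simp add: q(1))
next
  fix q :: quat assume "q \<in> {q. norm q * cos \<omega> < fst q}"
  then have lt: "norm q * cos \<omega> < fst q" by simp
  obtain u v J where q: "J \<in> qsph" "q = qof_real u + v *\<^sub>R J" "v \<ge> 0" by (rule axial_decomp)
  define r where "r = sqrt (u\<^sup>2 + v\<^sup>2)"
  have n: "norm q = r" "fst q = u" using norm_axial[OF q(1), of u v] by (simp_all add: q(2) r_def)
  have "q \<noteq> 0" using lt by auto
  then have r0: "r > 0" using n by (metis norm_eq_zero norm_ge_zero less_eq_real_def)
  have r2: "u\<^sup>2 + v\<^sup>2 = r\<^sup>2" by (simp add: r_def)
  have uv: "(u / r)\<^sup>2 + (v / r)\<^sup>2 = 1" using r0 r2 by (simp add: power_divide add_divide_distrib[symmetric])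
  have "(u / r)\<^sup>2 \<le> 1" using uv zero_le_power2[of "v / r"] by linarith
  then have "\<bar>u / r\<bar> \<le> 1" by (simp only: abs_square_le_1)
  then have ur: "-1 \<le> u / r" "u / r \<le> 1" by linarith+
  define \<phi> where "\<phi> = arccos (u / r)"
  have c: "cos \<phi> = u / r" using ur by (simp add: \<phi>_def)
  have p: "0 \<le> \<phi>" "\<phi> \<le> pi" using ur by (simp_all add: \<phi>_def arccos_lbound arccos_ubound)
  have s: "sin \<phi> = v / r"
  proof -
    have "(sin \<phi>)\<^sup>2 = (v / r)\<^sup>2" using uv c sin_cos_squared_add[of \<phi>] by simp
    moreover have "sin \<phi> \<ge> 0" "v / r \<ge> 0" using p sin_ge_zero r0 q(3) by auto
    ultimately show ?thesis by (simp add: power2_eq_iff_nonneg)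
  qed
  have "r * cos \<omega> < r * cos \<phi>" using lt n r0 c by simp
  then have "cos \<omega> < cos \<phi>" using r0 by simp
  then have "\<phi> < \<omega>" using p assms cos_mono_less_eq[of \<omega> \<phi>] by simp
  moreover have "q = r *\<^sub>R qexpJ J \<phi>" using r0 by (simp add: qexpJ_def c s q(2) scaleR_add_right) (simp add: qof_real_def)
  ultimately show "q \<in> sector \<omega>" unfolding sector_def mem_Collect_eq using r0 q(1) p(1)
    by (intro exI[of _ r] exI[of _ J] exI[of _ \<phi>]) simp
qed

definition plane_sector :: "real \<Rightarrow> (real \<times> real) set" where
  "plane_sector \<theta> = {p. norm p * cos \<theta> < fst p}"

lemma open_plane_sector: "open (plane_sector \<theta>)"
  unfolding plane_sector_def by (intro open_Collect_less continuous_intros)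

lemma axial_in_sector:
  assumes "0 < \<theta>" "\<theta> \<le> pi" "J \<in> qsph"
  shows "qof_real u + v *\<^sub>R J \<in> sector \<theta> \<longleftrightarrow> (u, v) \<in> plane_sector \<theta>"
  using norm_axial[OF assms(3), of u v] by (simp add: sector_eq[OF assms(1,2)] plane_sector_def norm_Pair)

lemma qe1_qsph: "qe 1 \<in> qsph" by (simp add: qe_def qsph_def norm_quat)

lemma slice_dom_sector:
  assumes "0 < \<theta>" "\<theta> \<le> pi" shows "slice_dom (sector \<theta>) = plane_sector \<theta>"
proof (intro set_eqI)
  fix p :: "real \<times> real"
  obtain u v where p: "p = (u, v)" by (cases p)
  show "p \<in> slice_dom (sector \<theta>) \<longleftrightarrow> p \<in> plane_sector \<theta>"
    unfolding p slice_dom_def using axial_in_sector[OF assms, of _ u v] qe1_qsph by blast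
qed

lemma plane_sector_flip: "(u, v) \<in> plane_sector \<theta> \<Longrightarrow> (u, - v) \<in> plane_sector \<theta>"
  by (simp add: plane_sector_def norm_Pair)

lemma connected_plane_sector:
  assumes "0 < \<theta>" "\<theta> < pi" shows "connected (plane_sector \<theta>)"
proof (rule starlike_imp_connected)
  have c: "\<bar>cos \<theta>\<bar> < 1"
    using cos_monotone_0_pi[of 0 \<theta>] cos_monotone_0_pi[of \<theta> pi] assms by (simp add: abs_less_iff)
  show "starlike (plane_sector \<theta>)" unfolding starlike_def
  proof (intro bexI[of _ "(1,0)"] ballI subsetI)
    show "(1,0) \<in> plane_sector \<theta>" using c by (simp add: plane_sector_def norm_Pair)
    fix p x assume p: "p \<in> plane_sector \<theta>" and "x \<in> closed_segment (1,0) p"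
    then obtain t where t: "0 \<le> t" "t \<le> 1" "x = (1 - t) *\<^sub>R (1,0) + t *\<^sub>R p" by (auto simp: closed_segment_def)
    have fx: "fst x = (1 - t) + t * fst p" by (simp add: t)
    have n1: "norm ((1 - t) *\<^sub>R (1::real,0::real)) = 1 - t" using t by (simp add: norm_Pair)
    have le: "norm x * cos \<theta> \<le> (1 - t) * \<bar>cos \<theta>\<bar> + t * (norm p * cos \<theta>)"
    \<comment> \<open>For \<theta> > pi / 2 the sector is not convex and cos \<theta> is negative,
      so a lower bound for the norm of x is called for instead of an upper one.\<close>
    proof (cases "cos \<theta> \<ge> 0")
      case True
      have "norm x \<le> (1 - t) + t * norm p" unfolding t(3) using n1 t(1) by (intro order_trans[OF norm_triangle_ineq]) simp
      then have "norm x * cos \<theta> \<le> ((1 - t) + t * norm p) * cos \<theta>" using True by (rule mult_right_mono)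
      then show ?thesis using True by (simp add: algebra_simps)
    next
      case False
      have "t * norm p - (1 - t) \<le> norm x" unfolding t(3) using n1 t(1) norm_diff_ineq[of "t *\<^sub>R p" "(1 - t) *\<^sub>R (1::real,0::real)"] by (simp add: add.commute)
      then have "norm x * cos \<theta> \<le> (t * norm p - (1 - t)) * cos \<theta>" using False by (intro mult_right_mono_neg) auto
      then show ?thesis using False by (simp add: algebra_simps)
    qed
    show "x \<in> plane_sector \<theta>"
    proof (cases "t = 0")
      case True then show ?thesis using c t by (simp add: plane_sector_def norm_Pair)
    next
      case False
      have "t * (norm p * cos \<theta>) < t * fst p" using p False t by (intro mult_strict_left_mono) (auto simp: plane_sector_def)
      moreover have "(1 - t) * \<bar>cos \<theta>\<bar> \<le> (1 - t) * 1" using c t by (intro mult_left_mono) auto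
      ultimately show ?thesis using le fx by (simp add: plane_sector_def)
    qed
  qed
qed

text \<open>The four partial derivatives collapse to two functions by the Cauchy-Riemann equations:
  a is the u-derivative of \<alpha> and the v-derivative of \<beta>, and b is the u-derivative of
  \<beta> and minus the v-derivative of \<alpha>.\<close>

lemma slice_rep_sector:
  assumes \<theta>: "0 < \<theta>" "\<theta> \<le> pi"
  shows "slice_rep (sector \<theta>) f \<alpha> \<beta> \<longleftrightarrow>
     (\<forall>u v J. J \<in> qsph \<and> (u, v) \<in> plane_sector \<theta> \<longrightarrow> f (qof_real u + v *\<^sub>R J) = \<alpha> (u, v) + qmul J (\<beta> (u, v))) \<and>
     (\<forall>u v. (u, v) \<in> plane_sector \<theta> \<longrightarrow> \<alpha> (u, -v) = \<alpha> (u, v) \<and> \<beta> (u, -v) = - \<beta> (u, v)) \<and>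
     (\<exists>a b. continuous_on (plane_sector \<theta>) a \<and> continuous_on (plane_sector \<theta>) b \<and>
       (\<forall>p\<in>plane_sector \<theta>. (\<alpha> has_derivative (\<lambda>h. fst h *\<^sub>R a p - snd h *\<^sub>R b p)) (at p) \<and>
          (\<beta> has_derivative (\<lambda>h. fst h *\<^sub>R b p + snd h *\<^sub>R a p)) (at p)))"
    (is "?L \<longleftrightarrow> ?E \<and> ?P \<and> ?D")
proof
  note sd = slice_dom_sector[OF \<theta>]
  assume L: ?L
  note L' = L[unfolded slice_rep_def sd]
  from L' have df: "\<forall>p\<in>plane_sector \<theta>. \<alpha> differentiable (at p) \<and> \<beta> differentiable (at p)" by (elim conjE)
  from L' have CR: "\<forall>p\<in>plane_sector \<theta>.
        frechet_derivative \<alpha> (at p) (1, 0) = frechet_derivative \<beta> (at p) (0, 1) \<and>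
        frechet_derivative \<alpha> (at p) (0, 1) = - frechet_derivative \<beta> (at p) (1, 0)" by (elim conjE)
  from L' have ca: "continuous_on (plane_sector \<theta>) (\<lambda>p. frechet_derivative \<alpha> (at p) (1, 0))" by (elim conjE)
  from L' have cb: "continuous_on (plane_sector \<theta>) (\<lambda>p. frechet_derivative \<beta> (at p) (1, 0))" by (elim conjE)
  define a where "a p = frechet_derivative \<alpha> (at p) (1, 0)" for p
  define b where "b p = frechet_derivative \<beta> (at p) (1, 0)" for p
  have "(\<alpha> has_derivative (\<lambda>h. fst h *\<^sub>R a p - snd h *\<^sub>R b p)) (at p) \<and> (\<beta> has_derivative (\<lambda>h. fst h *\<^sub>R b p + snd h *\<^sub>R a p)) (at p)"
    if p: "p \<in> plane_sector \<theta>" for p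
  proof -
    have d: "(\<alpha> has_derivative frechet_derivative \<alpha> (at p)) (at p)" "(\<beta> has_derivative frechet_derivative \<beta> (at p)) (at p)"
      using df p by (simp_all add: frechet_derivative_works)
    have cr: "frechet_derivative \<alpha> (at p) (1, 0) = frechet_derivative \<beta> (at p) (0, 1)"
        "frechet_derivative \<alpha> (at p) (0, 1) = - frechet_derivative \<beta> (at p) (1, 0)"
      using CR p by blast+
    have lin: "F h = fst h *\<^sub>R F (1, 0) + snd h *\<^sub>R F (0, 1)" if "bounded_linear F" for F :: "real \<times> real \<Rightarrow> quat" and h
    proof -
      interpret F: bounded_linear F by fact
      show ?thesis by (cases h) (simp flip: F.add F.scaleR)
    qed
    have "frechet_derivative \<alpha> (at p) = (\<lambda>h. fst h *\<^sub>R a p - snd h *\<^sub>R b p)"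
    proof (rule ext)
      fix h show "frechet_derivative \<alpha> (at p) h = fst h *\<^sub>R a p - snd h *\<^sub>R b p"
        unfolding lin[OF has_derivative_bounded_linear[OF d(1)], of h] cr(2) a_def b_def by (simp only: scaleR_minus_right add_uminus_conv_diff)
    qed
    moreover have "frechet_derivative \<beta> (at p) = (\<lambda>h. fst h *\<^sub>R b p + snd h *\<^sub>R a p)"
    proof (rule ext)
      fix h show "frechet_derivative \<beta> (at p) h = fst h *\<^sub>R b p + snd h *\<^sub>R a p"
        unfolding lin[OF has_derivative_bounded_linear[OF d(2)], of h] cr(1)[symmetric] a_def b_def by (simp only:)
    qed
    ultimately show ?thesis using d by simp
  qed
  moreover have "continuous_on (plane_sector \<theta>) a" "continuous_on (plane_sector \<theta>) b"
    using ca cb by (simp_all add: a_def b_def)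
  ultimately have D: ?D by blast
  from L' have E0: "\<forall>u v J. J \<in> qsph \<and> qof_real u + v *\<^sub>R J \<in> sector \<theta> \<longrightarrow> f (qof_real u + v *\<^sub>R J) = \<alpha> (u, v) + qmul J (\<beta> (u, v))"
    by (elim conjE)
  have E: ?E
  proof (intro allI impI, elim conjE)
    fix u v J assume "J \<in> qsph" "(u, v) \<in> plane_sector \<theta>"
    then show "f (qof_real u + v *\<^sub>R J) = \<alpha> (u, v) + qmul J (\<beta> (u, v))"
      using E0[rule_format, of J u v] axial_in_sector[OF \<theta>, of J u v] by simp
  qed
  from L' have P: ?P by (elim conjE)
  show "?E \<and> ?P \<and> ?D" using E P D by blast
next
  note sd = slice_dom_sector[OF \<theta>]
  assume R: "?E \<and> ?P \<and> ?D"
  then obtain a b where c: "continuous_on (plane_sector \<theta>) a" "continuous_on (plane_sector \<theta>) b"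
    and d: "\<And>p. p \<in> plane_sector \<theta> \<Longrightarrow> (\<alpha> has_derivative (\<lambda>h. fst h *\<^sub>R a p - snd h *\<^sub>R b p)) (at p)"
      "\<And>p. p \<in> plane_sector \<theta> \<Longrightarrow> (\<beta> has_derivative (\<lambda>h. fst h *\<^sub>R b p + snd h *\<^sub>R a p)) (at p)"
    by blast
  have f: "frechet_derivative \<alpha> (at p) = (\<lambda>h. fst h *\<^sub>R a p - snd h *\<^sub>R b p)"
    "frechet_derivative \<beta> (at p) = (\<lambda>h. fst h *\<^sub>R b p + snd h *\<^sub>R a p)" if "p \<in> plane_sector \<theta>" for p
    using frechet_derivative_at[OF d(1)[OF that]] frechet_derivative_at[OF d(2)[OF that]] by auto
  have cn: "continuous_on (plane_sector \<theta>) (\<lambda>p. frechet_derivative \<alpha> (at p) (1, 0))"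
     "continuous_on (plane_sector \<theta>) (\<lambda>p. frechet_derivative \<alpha> (at p) (0, 1))"
     "continuous_on (plane_sector \<theta>) (\<lambda>p. frechet_derivative \<beta> (at p) (1, 0))"
     "continuous_on (plane_sector \<theta>) (\<lambda>p. frechet_derivative \<beta> (at p) (0, 1))"
    using c by (simp_all add: f continuous_on_minus cong: continuous_on_cong)
  have df: "\<forall>p\<in>plane_sector \<theta>. \<alpha> differentiable (at p) \<and> \<beta> differentiable (at p)"
    by (intro ballI conjI differentiableI) (erule d)+
  have E: "\<forall>u v J. J \<in> qsph \<and> qof_real u + v *\<^sub>R J \<in> sector \<theta> \<longrightarrow> f (qof_real u + v *\<^sub>R J) = \<alpha> (u, v) + qmul J (\<beta> (u, v))"
  proof (intro allI impI, elim conjE)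
    fix u v J assume "J \<in> qsph" "qof_real u + v *\<^sub>R J \<in> sector \<theta>"
    then show "f (qof_real u + v *\<^sub>R J) = \<alpha> (u, v) + qmul J (\<beta> (u, v))"
      using R[THEN conjunct1, rule_format, of J u v] axial_in_sector[OF \<theta>, of J u v] by simp
  qed
  show ?L unfolding slice_rep_def sd
    by (intro conjI E df cn R[THEN conjunct2, THEN conjunct1]) (simp add: f)
qed

lemma slice_rep_sectorI:
  assumes "0 < \<theta>" "\<theta> \<le> pi"
    and "\<And>u v J. J \<in> qsph \<Longrightarrow> (u, v) \<in> plane_sector \<theta> \<Longrightarrow> f (qof_real u + v *\<^sub>R J) = \<alpha> (u, v) + qmul J (\<beta> (u, v))"
    and "\<And>u v. (u, v) \<in> plane_sector \<theta> \<Longrightarrow> \<alpha> (u, -v) = \<alpha> (u, v)"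
    and "\<And>u v. (u, v) \<in> plane_sector \<theta> \<Longrightarrow> \<beta> (u, -v) = - \<beta> (u, v)"
    and "continuous_on (plane_sector \<theta>) a" "continuous_on (plane_sector \<theta>) b"
    and "\<And>p. p \<in> plane_sector \<theta> \<Longrightarrow> (\<alpha> has_derivative (\<lambda>h. fst h *\<^sub>R a p - snd h *\<^sub>R b p)) (at p)"
    and "\<And>p. p \<in> plane_sector \<theta> \<Longrightarrow> (\<beta> has_derivative (\<lambda>h. fst h *\<^sub>R b p + snd h *\<^sub>R a p)) (at p)"
  shows "slice_rep (sector \<theta>) f \<alpha> \<beta>"
  unfolding slice_rep_sector[OF assms(1,2)]
proof (intro conjI)
  show "\<exists>a b. continuous_on (plane_sector \<theta>) a \<and> continuous_on (plane_sector \<theta>) b \<and>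
      (\<forall>p\<in>plane_sector \<theta>. (\<alpha> has_derivative (\<lambda>h. fst h *\<^sub>R a p - snd h *\<^sub>R b p)) (at p) \<and>
        (\<beta> has_derivative (\<lambda>h. fst h *\<^sub>R b p + snd h *\<^sub>R a p)) (at p))"
    by (rule exI[of _ a], rule exI[of _ b], intro conjI ballI assms(6-))
qed (simp_all add: assms(3-5))

section \<open>Splitting along the slice of e1\<close>

definition qc :: "complex \<Rightarrow> quat" where "qc z = (Re z, Im z, 0, 0)"
text \<open>With \<open>cpart2\<close> this gives q = c1 + c2 e2, where c1 and c2 lie in the slice
  of e1; left multiplication by e1 is then multiplication by i in both parts.\<close>

definition cpart1 :: "quat \<Rightarrow> complex" where "cpart1 q = Complex (fst q) (fst (snd q))"
definition cpart2 :: "quat \<Rightarrow> complex" where "cpart2 q = Complex (fst (snd (snd q))) (snd (snd (snd q)))"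

lemma cpart_bounded_linear: "bounded_linear cpart1" "bounded_linear cpart2"
  and cpart_norm: "norm (cpart1 q) \<le> norm q" "norm (cpart2 q) \<le> norm q"
proof -
  show n: "norm (cpart1 q) \<le> norm q" "norm (cpart2 q) \<le> norm q" for q
    by (cases q; simp add: cpart1_def cpart2_def norm_quat complex_norm)+
  show "bounded_linear cpart1" "bounded_linear cpart2"
    by (rule bounded_linear_intro[where K = 1]; use n in \<open>simp add: cpart1_def cpart2_def complex_eq_iff\<close>)+
qed

lemma cpart_qe1: "cpart1 (qmul (qe 1) q) = \<i> * cpart1 q" "cpart2 (qmul (qe 1) q) = \<i> * cpart2 q"
  by (cases q; simp add: qmul_def qe_def cpart1_def cpart2_def complex_eq_iff)+

lemma qc_axial: "qc (Complex u v) = qof_real u + v *\<^sub>R qe 1"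
  by (simp add: qc_def qof_real_def qe_def)

lemma qc_eq: "qc w = qof_real (Re w) + Im w *\<^sub>R qe 1"
  using qc_axial[of "Re w" "Im w"] by simp

lemma qmul_bounded_linear: "bounded_linear (qmul p)"
proof (rule linear_conv_bounded_linear[THEN iffD1], rule linearI)
  show "qmul p (x + y) = qmul p x + qmul p y" for x y by (cases p; cases x; cases y) (simp add: qmul_def algebra_simps)
  show "qmul p (r *\<^sub>R x) = r *\<^sub>R qmul p x" for r x by (cases p; cases x) (simp add: qmul_def algebra_simps)
qed

lemma exp_in_plane_sector:
  assumes "\<bar>Im z\<bar> < \<theta>" "\<theta> \<le> pi" shows "(Re (exp z), Im (exp z)) \<in> plane_sector \<theta>"
proof -
  have "cos \<theta> < cos \<bar>Im z\<bar>" using assms by (intro cos_monotone_0_pi) auto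
  moreover have "norm (Re (exp z), Im (exp z)) = exp (Re z)" using norm_exp_eq_Re[of z] by (simp add: norm_Pair cmod_def)
  ultimately show ?thesis by (simp add: plane_sector_def Re_exp)
qed

lemma qc_exp_in_sector:
  assumes "\<bar>Im z\<bar> < \<theta>" "\<theta> \<le> pi" shows "qc (exp z) \<in> sector \<theta>"
proof -
  have "0 < \<theta>" using assms by linarith
  then show ?thesis
    using axial_in_sector[OF _ assms(2) qe1_qsph, of "Re (exp z)" "Im (exp z)"] exp_in_plane_sector[OF assms]
    by (simp add: qc_eq)
qed

text \<open>The splitting lemma: restricted to the slice of e1, f satisfies the Cauchy-Riemann
  equation with left multiplication by e1, which acts as i on each part.\<close>

lemma slice_hol_cpart:
  assumes \<theta>: "0 < \<theta>" "\<theta> \<le> pi" and f: "left_slice_hol (sector \<theta>) f"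
  shows "(\<lambda>z. cpart1 (f (qc (exp z)))) holomorphic_on {z. \<bar>Im z\<bar> < \<theta>}"
    and "(\<lambda>z. cpart2 (f (qc (exp z)))) holomorphic_on {z. \<bar>Im z\<bar> < \<theta>}"
proof -
  obtain \<alpha> \<beta> where "slice_rep (sector \<theta>) f \<alpha> \<beta>" using f by (auto simp: left_slice_hol_def)
  then obtain a b where eq: "\<And>u v J. J \<in> qsph \<Longrightarrow> (u, v) \<in> plane_sector \<theta> \<Longrightarrow> f (qof_real u + v *\<^sub>R J) = \<alpha> (u, v) + qmul J (\<beta> (u, v))"
    and d: "\<And>p. p \<in> plane_sector \<theta> \<Longrightarrow> (\<alpha> has_derivative (\<lambda>h. fst h *\<^sub>R a p - snd h *\<^sub>R b p)) (at p)"
      "\<And>p. p \<in> plane_sector \<theta> \<Longrightarrow> (\<beta> has_derivative (\<lambda>h. fst h *\<^sub>R b p + snd h *\<^sub>R a p)) (at p)"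
    unfolding slice_rep_sector[OF \<theta>] by blast
  define G where "G w = \<alpha> (Re w, Im w) + qmul (qe 1) (\<beta> (Re w, Im w))" for w
  define Om where "Om = {w. (Re w, Im w) \<in> plane_sector \<theta>}"
  have oOm: "open Om" unfolding Om_def plane_sector_def
    by (simp, intro open_Collect_less continuous_intros)
  have fG: "f (qc w) = G w" if "w \<in> Om" for w
    using eq[OF qe1_qsph, of "Re w" "Im w"] that by (simp add: G_def Om_def qc_eq)
  have dG: "(G has_derivative (\<lambda>h. Re h *\<^sub>R (a (Re w, Im w) + qmul (qe 1) (b (Re w, Im w))) +
      Im h *\<^sub>R qmul (qe 1) (a (Re w, Im w) + qmul (qe 1) (b (Re w, Im w))))) (at w)" if "w \<in> Om" for w
  proof -
    let ?p = "(Re w, Im w)"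
    have p: "?p \<in> plane_sector \<theta>" using that by (simp add: Om_def)
    have r: "((\<lambda>w. (Re w, Im w)) has_derivative (\<lambda>h. (Re h, Im h))) (at w)"
      by (intro has_derivative_Pair bounded_linear.has_derivative[OF bounded_linear_Re] bounded_linear.has_derivative[OF bounded_linear_Im] has_derivative_ident)
    have 1: "((\<lambda>w. \<alpha> (Re w, Im w)) has_derivative (\<lambda>h. Re h *\<^sub>R a ?p - Im h *\<^sub>R b ?p)) (at w)"
      using has_derivative_compose[OF r d(1)[OF p]] by simp
    have 2: "((\<lambda>w. \<beta> (Re w, Im w)) has_derivative (\<lambda>h. Re h *\<^sub>R b ?p + Im h *\<^sub>R a ?p)) (at w)"
      using has_derivative_compose[OF r d(2)[OF p]] by simp
    interpret Q: bounded_linear "qmul (qe 1)" by (rule qmul_bounded_linear)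
    have e: "qmul (qe 1) (qmul (qe 1) x) = - x" for x by (cases x) (simp add: qmul_def qe_def)
    show ?thesis unfolding G_def
      by (rule has_derivative_eq_rhs[OF has_derivative_add[OF 1 Q.has_derivative[OF 2]]], rule ext)
         (simp only: Q.add Q.scaleR e scaleR_add_right scaleR_minus_right diff_conv_add_uminus add_ac)
  qed
  have hol: "(\<lambda>w. c (f (qc w))) holomorphic_on Om" if c: "bounded_linear c" "\<And>q. c (qmul (qe 1) q) = \<i> * c q" for c :: "quat \<Rightarrow> complex"
  proof -
    interpret c: bounded_linear c by fact
    have "((\<lambda>w. c (G w)) has_field_derivative c (a (Re w, Im w) + qmul (qe 1) (b (Re w, Im w)))) (at w)" if "w \<in> Om" for w
      unfolding has_field_derivative_def
      by (rule has_derivative_eq_rhs[OF c.has_derivative[OF dG[OF that]]], rule ext,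
          simp only: c.add c.scaleR c(2)) (simp add: scaleR_conv_of_real complex_eq_iff algebra_simps)
    then have "(\<lambda>w. c (G w)) holomorphic_on Om" unfolding holomorphic_on_open[OF oOm] by blast
    then show ?thesis by (rule holomorphic_transform) (simp add: fG)
  qed
  have sub: "exp ` {z. \<bar>Im z\<bar> < \<theta>} \<subseteq> Om" using exp_in_plane_sector \<theta> by (auto simp: Om_def)
  have comp: "(\<lambda>z. c (f (qc (exp z)))) holomorphic_on {z. \<bar>Im z\<bar> < \<theta>}" if "(\<lambda>w. c (f (qc w))) holomorphic_on Om" for c :: "quat \<Rightarrow> complex"
    using holomorphic_on_compose_gen[OF holomorphic_on_exp that sub] by (simp add: o_def)
  show "(\<lambda>z. cpart1 (f (qc (exp z)))) holomorphic_on {z. \<bar>Im z\<bar> < \<theta>}"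
    "(\<lambda>z. cpart2 (f (qc (exp z)))) holomorphic_on {z. \<bar>Im z\<bar> < \<theta>}"
    by (intro comp hol cpart_bounded_linear cpart_qe1)+
qed

lemma intrinsic_left: "intrinsic_hol U f \<Longrightarrow> left_slice_hol U f"
  by (auto simp: intrinsic_hol_def left_slice_hol_def)

lemma intrinsic_cpart:
  assumes \<theta>: "0 < \<theta>" "\<theta> \<le> pi" and f: "intrinsic_hol (sector \<theta>) f" and z: "\<bar>Im z\<bar> < \<theta>"
  shows "f (qc (exp z)) = qc (cpart1 (f (qc (exp z))))"
    and "cpart1 (f (qc (exp (cnj z)))) = cnj (cpart1 (f (qc (exp z))))"
proof -
  obtain \<alpha> \<beta> where rep: "slice_rep (sector \<theta>) f \<alpha> \<beta>" and re: "\<And>p. p \<in> plane_sector \<theta> \<Longrightarrow> \<alpha> p \<in> range qof_real \<and> \<beta> p \<in> range qof_real"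
    using f slice_dom_sector[OF \<theta>] by (auto simp: intrinsic_hol_def)
  note rep' = rep[unfolded slice_rep_sector[OF \<theta>]]
  have eq: "f (qof_real u + v *\<^sub>R J) = \<alpha> (u, v) + qmul J (\<beta> (u, v))" if "J \<in> qsph" "(u, v) \<in> plane_sector \<theta>" for u v J
    using rep'[THEN conjunct1] that by blast
  have par: "\<alpha> (u, -v) = \<alpha> (u, v) \<and> \<beta> (u, -v) = - \<beta> (u, v)" if "(u, v) \<in> plane_sector \<theta>" for u v
    using rep'[THEN conjunct2, THEN conjunct1] that by blast
  let ?u = "Re (exp z)" and ?v = "Im (exp z)"
  have p: "(?u, ?v) \<in> plane_sector \<theta>" by (rule exp_in_plane_sector[OF z \<theta>(2)])
  obtain A B where AB: "\<alpha> (?u, ?v) = qof_real A" "\<beta> (?u, ?v) = qof_real B" using re[OF p] by auto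
  have "f (qof_real ?u + ?v *\<^sub>R qe 1) = \<alpha> (?u, ?v) + qmul (qe 1) (\<beta> (?u, ?v))"
    using eq[OF qe1_qsph p] .
  then have 1: "f (qc (exp z)) = qc (Complex A B)"
    unfolding AB by (simp add: qc_def qof_real_def qe_def qmul_def)
  have "f (qof_real ?u + (- ?v) *\<^sub>R qe 1) = \<alpha> (?u, - ?v) + qmul (qe 1) (\<beta> (?u, - ?v))"
    using eq[OF qe1_qsph plane_sector_flip[OF p]] .
  also have "\<alpha> (?u, - ?v) = \<alpha> (?u, ?v)" using par[OF p] by simp
  also have "\<beta> (?u, - ?v) = - \<beta> (?u, ?v)" using par[OF p] by simp
  finally have 2: "f (qc (exp (cnj z))) = qc (Complex A (- B))"
    unfolding AB by (simp add: qc_def qof_real_def qe_def qmul_def Re_exp Im_exp)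
  show "f (qc (exp z)) = qc (cpart1 (f (qc (exp z))))" "cpart1 (f (qc (exp (cnj z)))) = cnj (cpart1 (f (qc (exp z))))"
    unfolding 1 2 by (simp_all add: qc_def cpart1_def complex_eq_iff)
qed

lemma norm_qc: "norm (qc z) = norm z" by (simp add: qc_def norm_quat cmod_def)

lemma fmul_cpart:
  assumes "e q = qc (cpart1 (e q))"
  shows "cpart1 (fmul e f q) = cpart1 (e q) * cpart1 (f q)" "cpart2 (fmul e f q) = cpart1 (e q) * cpart2 (f q)"
proof -
  obtain a b c d where f: "f q = (a, b, c, d)" by (cases "f q") auto
  have "fmul e f q = qmul (qc (cpart1 (e q))) (f q)" unfolding fmul_def using assms by simp
  then show "cpart1 (fmul e f q) = cpart1 (e q) * cpart1 (f q)" "cpart2 (fmul e f q) = cpart1 (e q) * cpart2 (f q)"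
    by (simp_all add: f qmul_def qc_def cpart1_def cpart2_def complex_eq_iff)
qed

text \<open>At the right end the power 1 + 2 a in the denominator wins, at the left end the
  denominator is at least 1. In the third bound exp (- x) lowers the exponent 1 + a to a, which
  reduces it to the first.\<close>

lemma powr_decay:
  fixes a x :: real assumes "a > 0"
  shows "exp x powr a / (1 + exp x powr (1 + 2 * a)) \<le> exp (- a * \<bar>x\<bar>)"
    and "exp x powr (1 + a) / (1 + exp x powr (1 + 2 * a)) \<le> exp (- a * \<bar>x\<bar>)"
    and "exp x powr (1 + a) / (1 + exp x powr (1 + 2 * a)) * exp (- x) \<le> exp (- a * \<bar>x\<bar>)"
proof -
  define P where "P = 1 + exp x powr (1 + 2 * a)"
  have P: "P \<ge> 1" "P \<ge> exp ((1 + 2 * a) * x)" "P > 0" by (simp_all add: P_def powr_def add_pos_pos)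
  have big: "exp y / P \<le> exp (y - (1 + 2 * a) * x)" for y
    using P frac_le[of "exp y" "exp y" "exp ((1 + 2 * a) * x)" P] by (simp add: exp_diff)
  have small: "exp y / P \<le> exp y" for y using P frac_le[of "exp y" "exp y" 1 P] by simp
  have 1: "exp (a * x) / P \<le> exp (- a * \<bar>x\<bar>)"
  proof (cases "x \<ge> 0")
    case True
    then have "exp (a * x - (1 + 2 * a) * x) \<le> exp (- a * \<bar>x\<bar>)" by (simp add: algebra_simps)
    then show ?thesis using big[of "a * x"] by linarith
  next
    case False then show ?thesis using small[of "a * x"] by simp
  qed
  have 2: "exp ((1 + a) * x) / P \<le> exp (- a * \<bar>x\<bar>)"
  proof (cases "x \<ge> 0")
    case True
    then have "exp ((1 + a) * x - (1 + 2 * a) * x) \<le> exp (- a * \<bar>x\<bar>)" by (simp add: algebra_simps)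
    then show ?thesis using big[of "(1 + a) * x"] by linarith
  next
    case False
    then have "exp ((1 + a) * x) \<le> exp (- a * \<bar>x\<bar>)" by (simp add: algebra_simps)
    then show ?thesis using small[of "(1 + a) * x"] by linarith
  qed
  show "exp x powr a / (1 + exp x powr (1 + 2 * a)) \<le> exp (- a * \<bar>x\<bar>)" using 1 by (simp add: P_def powr_def)
  show "exp x powr (1 + a) / (1 + exp x powr (1 + 2 * a)) \<le> exp (- a * \<bar>x\<bar>)" using 2 by (simp add: P_def powr_def)
  have "exp ((1 + a) * x) * exp (- x) = exp (a * x)" unfolding mult_exp_exp by (simp add: algebra_simps)
  then have e1: "exp ((1 + a) * x) / P * exp (- x) = exp (a * x) / P" by (simp only: times_divide_eq_left)
  have e2: "exp x powr (1 + a) = exp ((1 + a) * x)" by (simp add: powr_def)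
  show "exp x powr (1 + a) / (1 + exp x powr (1 + 2 * a)) * exp (- x) \<le> exp (- a * \<bar>x\<bar>)"
    unfolding P_def[symmetric] e2 e1 by (rule 1)
qed

lemma slice_E0:
  assumes "0 < \<theta>" "\<theta> \<le> pi" "left_slice_hol (sector \<theta>) h" "a > 0"
    and le: "\<And>z. \<bar>Im z\<bar> < \<theta> \<Longrightarrow> norm (h (qc (exp z))) \<le> c * exp (- a * \<bar>Re z\<bar>)"
  shows "E0 \<theta> (\<lambda>z. cpart1 (h (qc (exp z))))" "E0 \<theta> (\<lambda>z. cpart2 (h (qc (exp z))))"
proof -
  have "norm (cpart1 (h (qc (exp z)))) \<le> c * exp (- a * \<bar>Re z\<bar>)" "norm (cpart2 (h (qc (exp z)))) \<le> c * exp (- a * \<bar>Re z\<bar>)"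
    if "\<bar>Im z\<bar> < \<theta>" for z
    by (rule order_trans[OF cpart_norm(1) le[OF that]] order_trans[OF cpart_norm(2) le[OF that]])+
  then show "E0 \<theta> (\<lambda>z. cpart1 (h (qc (exp z))))" "E0 \<theta> (\<lambda>z. cpart2 (h (qc (exp z))))"
    unfolding E0_def using \<open>a > 0\<close>
    by (intro conjI slice_hol_cpart[OF assms(1-3)] exI[of _ c] exI[of _ a] allI impI; simp)+
qed

lemma slice_E1:
  assumes "0 < \<theta>" "\<theta> \<le> pi" "left_slice_hol (sector \<theta>) h" "a > 0"
    and le: "\<And>z. \<bar>Im z\<bar> < \<theta> \<Longrightarrow> norm (h (qc (exp z))) \<le> c * exp (- a * \<bar>Re z\<bar>)"
    and le': "\<And>z. \<bar>Im z\<bar> < \<theta> \<Longrightarrow> norm (h (qc (exp z))) * exp (- Re z) \<le> c * exp (- a * \<bar>Re z\<bar>)"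
  shows "E1 \<theta> (\<lambda>z. cpart1 (h (qc (exp z))))" "E1 \<theta> (\<lambda>z. cpart2 (h (qc (exp z))))"
proof -
  have "norm (cpart1 (h (qc (exp z)))) * exp (- Re z) \<le> c * exp (- a * \<bar>Re z\<bar>)" "norm (cpart2 (h (qc (exp z)))) * exp (- Re z) \<le> c * exp (- a * \<bar>Re z\<bar>)"
    if "\<bar>Im z\<bar> < \<theta>" for z
    by (rule order_trans[OF mult_right_mono[OF cpart_norm(1) exp_ge_zero] le'[OF that]]
        order_trans[OF mult_right_mono[OF cpart_norm(2) exp_ge_zero] le'[OF that]])+
  then show "E1 \<theta> (\<lambda>z. cpart1 (h (qc (exp z))))" "E1 \<theta> (\<lambda>z. cpart2 (h (qc (exp z))))"
    unfolding E1_def using \<open>a > 0\<close>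
    by (intro conjI slice_E0[OF assms(1-5)] exI[of _ c] exI[of _ a] allI impI; simp)+
qed

lemma Psi_L_E0:
  assumes "0 < \<theta>" "\<theta> \<le> pi" "h \<in> Psi_L \<theta>"
  shows "E0 \<theta> (\<lambda>z. cpart1 (h (qc (exp z))))" "E0 \<theta> (\<lambda>z. cpart2 (h (qc (exp z))))"
proof -
  obtain a c where h: "left_slice_hol (sector \<theta>) h" "a > 0" "c \<ge> 0"
    and le: "\<And>s. s \<in> sector \<theta> \<Longrightarrow> norm (h s) \<le> c * norm s powr a / (1 + norm s powr (1 + 2 * a))"
    using assms(3) by (auto simp: Psi_L_def)
  have le': "norm (h (qc (exp z))) \<le> c * exp (- a * \<bar>Re z\<bar>)" if "\<bar>Im z\<bar> < \<theta>" for z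
    using le[OF qc_exp_in_sector[OF that assms(2)]] mult_left_mono[OF powr_decay(1)[OF h(2)] h(3), of "Re z"]
    by (simp add: norm_qc)
  show "E0 \<theta> (\<lambda>z. cpart1 (h (qc (exp z))))" "E0 \<theta> (\<lambda>z. cpart2 (h (qc (exp z))))"
    by (rule slice_E0[OF assms(1,2) h(1,2) le']; assumption)+
qed

lemma PsiQ_L_E1:
  assumes "0 < \<theta>" "\<theta> \<le> pi" "h \<in> PsiQ_L \<theta>"
  shows "E1 \<theta> (\<lambda>z. cpart1 (h (qc (exp z))))" "E1 \<theta> (\<lambda>z. cpart2 (h (qc (exp z))))"
proof -
  obtain a c where h: "left_slice_hol (sector \<theta>) h" "a > 0" "c \<ge> 0"
    and le: "\<And>s. s \<in> sector \<theta> \<Longrightarrow> norm (h s) \<le> c * norm s powr (1 + a) / (1 + norm s powr (1 + 2 * a))"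
    using assms(3) by (auto simp: PsiQ_L_def)
  have le0: "norm (h (qc (exp z))) \<le> c * (exp (Re z) powr (1 + a) / (1 + exp (Re z) powr (1 + 2 * a)))" if "\<bar>Im z\<bar> < \<theta>" for z
    using le[OF qc_exp_in_sector[OF that assms(2)]] by (simp add: norm_qc)
  have le': "norm (h (qc (exp z))) \<le> c * exp (- a * \<bar>Re z\<bar>)" if "\<bar>Im z\<bar> < \<theta>" for z
    using le0[OF that] mult_left_mono[OF powr_decay(2)[OF h(2)] h(3), of "Re z"] by linarith
  have le'': "norm (h (qc (exp z))) * exp (- Re z) \<le> c * exp (- a * \<bar>Re z\<bar>)" if "\<bar>Im z\<bar> < \<theta>" for z
  proof -
    have "norm (h (qc (exp z))) * exp (- Re z) \<le> c * (exp (Re z) powr (1 + a) / (1 + exp (Re z) powr (1 + 2 * a))) * exp (- Re z)"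
      by (rule mult_right_mono[OF le0[OF that]]) simp
    then show ?thesis using mult_left_mono[OF powr_decay(3)[OF h(2)] h(3), of "Re z"] by (simp only: mult.assoc)
  qed
  show "E1 \<theta> (\<lambda>z. cpart1 (h (qc (exp z))))" "E1 \<theta> (\<lambda>z. cpart2 (h (qc (exp z))))"
    by (rule slice_E1[OF assms(1,2) h(1,2) le' le'']; assumption)+
qed

text \<open>The derivatives in the directions \<open>e\<^sub>2\<close> and \<open>e\<^sub>3\<close> only turn the imaginary unit of a slice function.\<close>
lemma qpartial_transversal:
  assumes \<theta>: "0 < \<theta>" "\<theta> \<le> pi" and rep: "slice_rep (sector \<theta>) f \<alpha> \<beta>"
    and p: "(u, v) \<in> plane_sector \<theta>" "v > 0" and i: "i = 2 \<or> i = 3"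
  shows "qpartial i f (qof_real u + v *\<^sub>R qe 1) = qmul (qe i) ((1 / v) *\<^sub>R \<beta> (u, v))"
proof -
  from rep obtain a b where eq: "\<And>u v J. J \<in> qsph \<Longrightarrow> (u, v) \<in> plane_sector \<theta> \<Longrightarrow> f (qof_real u + v *\<^sub>R J) = \<alpha> (u, v) + qmul J (\<beta> (u, v))"
    and d: "\<And>p. p \<in> plane_sector \<theta> \<Longrightarrow> (\<alpha> has_derivative (\<lambda>h. fst h *\<^sub>R a p - snd h *\<^sub>R b p)) (at p)"
      "\<And>p. p \<in> plane_sector \<theta> \<Longrightarrow> (\<beta> has_derivative (\<lambda>h. fst h *\<^sub>R b p + snd h *\<^sub>R a p)) (at p)"
    unfolding slice_rep_sector[OF \<theta>] by blast
  define r where "r t = sqrt (v\<^sup>2 + t\<^sup>2)" for t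
  have r0: "r 0 = v" using p by (simp add: r_def)
  have rpos: "r t > 0" for t using p by (simp add: r_def add_pos_nonneg)
  define J where "J t = (1 / r t) *\<^sub>R (v *\<^sub>R qe 1 + t *\<^sub>R qe i)" for t
  have Jq: "J t \<in> qsph" for t
  proof -
    have "norm (v *\<^sub>R qe 1 + t *\<^sub>R qe i) = r t" "fst (v *\<^sub>R qe 1 + t *\<^sub>R qe i) = 0"
      using i by (auto simp: qe_def norm_quat r_def)
    then show ?thesis using rpos[of t] by (simp add: J_def qsph_def)
  qed
  have rJ: "r t *\<^sub>R J t = v *\<^sub>R qe 1 + t *\<^sub>R qe i" for t using rpos[of t] by (simp add: J_def)
  have dr: "(r has_vector_derivative 0) (at 0)"
    unfolding r_def has_real_derivative_iff_has_vector_derivative[symmetric] using p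
    by (auto intro!: derivative_eq_intros)
  have dur: "((\<lambda>t. (u, r t)) has_derivative (\<lambda>h. (0, 0))) (at 0)"
    using dr by (intro has_derivative_Pair has_derivative_const) (simp add: has_vector_derivative_def)
  have p0: "(u, r 0) \<in> plane_sector \<theta>" using p r0 by simp
  have 1: "((\<lambda>t. \<alpha> (u, r t)) has_derivative (\<lambda>h. 0)) (at 0)"
    using has_derivative_compose[OF dur d(1)[OF p0]] by simp
  have 2: "((\<lambda>t. \<beta> (u, r t)) has_derivative (\<lambda>h. 0)) (at 0)"
    using has_derivative_compose[OF dur d(2)[OF p0]] by simp
  have dri: "((\<lambda>t. 1 / r t) has_derivative (\<lambda>h. 0)) (at 0)"
  proof -
    have "(r has_field_derivative 0) (at 0)" using dr by (simp add: has_real_derivative_iff_has_vector_derivative)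
    then have "((\<lambda>t. 1 / r t) has_field_derivative 0) (at 0)" using r0 p by (auto intro!: derivative_eq_intros)
    then show ?thesis by (simp add: has_field_derivative_def flip: lambda_zero)
  qed
  define G where "G t = (1 / r t) *\<^sub>R \<beta> (u, r t)" for t
  have dG: "(G has_derivative (\<lambda>h. 0)) (at 0)"
    unfolding G_def using has_derivative_scaleR[OF dri 2] by simp
  have qG: "((\<lambda>t. qmul x (G t)) has_derivative (\<lambda>h. 0)) (at 0)" for x
    using bounded_linear.has_derivative[OF qmul_bounded_linear dG, of x]
    by (simp add: linear_0[OF bounded_linear.linear[OF qmul_bounded_linear]])
  have "((\<lambda>t. \<alpha> (u, r t) + (v *\<^sub>R qmul (qe 1) (G t) + t *\<^sub>R qmul (qe i) (G t))) has_derivative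
      (\<lambda>h. 0 + (v *\<^sub>R 0 + (0 *\<^sub>R 0 + h *\<^sub>R qmul (qe i) (G 0))))) (at 0)"
    by (intro has_derivative_add 1 has_derivative_scaleR_right qG has_derivative_scaleR has_derivative_ident)
  then have D: "((\<lambda>t. \<alpha> (u, r t) + (v *\<^sub>R qmul (qe 1) (G t) + t *\<^sub>R qmul (qe i) (G t))) has_vector_derivative qmul (qe i) (G 0)) (at 0)"
    by (simp add: has_vector_derivative_def)
  have fe: "f (qof_real u + v *\<^sub>R qe 1 + t *\<^sub>R qe i) = \<alpha> (u, r t) + (v *\<^sub>R qmul (qe 1) (G t) + t *\<^sub>R qmul (qe i) (G t))"
    if "(u, r t) \<in> plane_sector \<theta>" for t
  proof -
    have "f (qof_real u + v *\<^sub>R qe 1 + t *\<^sub>R qe i) = \<alpha> (u, r t) + qmul (J t) (\<beta> (u, r t))"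
      using eq[OF Jq that, of t] unfolding rJ by (simp add: add.assoc)
    also have "qmul (J t) (\<beta> (u, r t)) = v *\<^sub>R qmul (qe 1) (G t) + t *\<^sub>R qmul (qe i) (G t)"
      unfolding J_def G_def by (cases "\<beta> (u, r t)"; cases "qe 1"; cases "qe i") (simp add: qmul_def algebra_simps add_divide_distrib diff_divide_distrib)
    finally show ?thesis .
  qed
  have op: "open {t. (u, r t) \<in> plane_sector \<theta>}"
    unfolding plane_sector_def r_def mem_Collect_eq by (intro open_Collect_less continuous_intros)
  have "((\<lambda>t. f (qof_real u + v *\<^sub>R qe 1 + t *\<^sub>R qe i)) has_vector_derivative qmul (qe i) (G 0)) (at 0)"
    by (rule has_vector_derivative_transform_within_open[OF D op]) (use p0 fe in auto)
  then show ?thesis unfolding qpartial_def by (simp add: vector_derivative_at G_def r0)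
qed

text \<open>The derivatives in the slice cancel, a + e1 b + e1 (- b + e1 a) = 0, and the two
  transversal directions contribute e2 e2 and e3 e3 times \<beta> / v.\<close>

lemma cauchy_fueter_slice:
  assumes \<theta>: "0 < \<theta>" "\<theta> \<le> pi" and rep: "slice_rep (sector \<theta>) f \<alpha> \<beta>"
    and p: "(u, v) \<in> plane_sector \<theta>" "v > 0"
  shows "cauchy_fueter f (qof_real u + v *\<^sub>R qe 1) = (- 2 / v) *\<^sub>R \<beta> (u, v)"
proof -
  from rep obtain a b where eq: "\<And>u v J. J \<in> qsph \<Longrightarrow> (u, v) \<in> plane_sector \<theta> \<Longrightarrow> f (qof_real u + v *\<^sub>R J) = \<alpha> (u, v) + qmul J (\<beta> (u, v))"
    and d: "\<And>p. p \<in> plane_sector \<theta> \<Longrightarrow> (\<alpha> has_derivative (\<lambda>h. fst h *\<^sub>R a p - snd h *\<^sub>R b p)) (at p)"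
      "\<And>p. p \<in> plane_sector \<theta> \<Longrightarrow> (\<beta> has_derivative (\<lambda>h. fst h *\<^sub>R b p + snd h *\<^sub>R a p)) (at p)"
    unfolding slice_rep_sector[OF \<theta>] by blast
  let ?q = "qof_real u + v *\<^sub>R qe 1"
  \<comment> \<open>In the directions 1 and e1 the point stays in the slice; x and y are the
    coordinates of the direction there.\<close>
  have par: "qpartial i f ?q = (x *\<^sub>R a (u, v) - y *\<^sub>R b (u, v)) + qmul (qe 1) (x *\<^sub>R b (u, v) + y *\<^sub>R a (u, v))"
    if xy: "\<And>t. ?q + t *\<^sub>R qe i = qof_real (u + t * x) + (v + t * y) *\<^sub>R qe 1" for i x y
  proof -
    define g where "g t = (u + t * x, v + t * y)" for t
    have dg: "(g has_derivative (\<lambda>h. (h * x, h * y))) (at 0)"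
      unfolding g_def by (auto intro!: derivative_eq_intros)
    have g0: "g 0 = (u, v)" by (simp add: g_def)
    have p0: "g 0 \<in> plane_sector \<theta>" using p g0 by simp
    have 1: "((\<lambda>t. \<alpha> (g t)) has_derivative (\<lambda>h. (h * x) *\<^sub>R a (u, v) - (h * y) *\<^sub>R b (u, v))) (at 0)"
      using has_derivative_compose[OF dg d(1)[OF p0]] by (simp add: g0)
    have 2: "((\<lambda>t. qmul (qe 1) (\<beta> (g t))) has_derivative (\<lambda>h. qmul (qe 1) ((h * x) *\<^sub>R b (u, v) + (h * y) *\<^sub>R a (u, v)))) (at 0)"
      using bounded_linear.has_derivative[OF qmul_bounded_linear has_derivative_compose[OF dg d(2)[OF p0]], of "qe 1"] by (simp add: g0)
    have D: "((\<lambda>t. \<alpha> (g t) + qmul (qe 1) (\<beta> (g t))) has_vector_derivative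
       ((x *\<^sub>R a (u, v) - y *\<^sub>R b (u, v)) + qmul (qe 1) (x *\<^sub>R b (u, v) + y *\<^sub>R a (u, v)))) (at 0)"
      unfolding has_vector_derivative_def
      by (rule has_derivative_eq_rhs[OF has_derivative_add[OF 1 2]], rule ext)
         (simp add: scaleR_add_right scaleR_diff_right linear_cmul[OF bounded_linear.linear[OF qmul_bounded_linear], symmetric] del: One_nat_def)
    have op: "open {t. g t \<in> plane_sector \<theta>}"
      unfolding plane_sector_def g_def mem_Collect_eq by (intro open_Collect_less continuous_intros)
    have "((\<lambda>t. f (?q + t *\<^sub>R qe i)) has_vector_derivative
       ((x *\<^sub>R a (u, v) - y *\<^sub>R b (u, v)) + qmul (qe 1) (x *\<^sub>R b (u, v) + y *\<^sub>R a (u, v)))) (at 0)"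
      by (rule has_vector_derivative_transform_within_open[OF D op])
         (use p0 eq[OF qe1_qsph] in \<open>auto simp: xy g_def simp del: One_nat_def\<close>)
    then show ?thesis unfolding qpartial_def by (rule vector_derivative_at)
  qed
  have q0: "qpartial 0 f ?q = (1 *\<^sub>R a (u, v) - 0 *\<^sub>R b (u, v)) + qmul (qe 1) (1 *\<^sub>R b (u, v) + 0 *\<^sub>R a (u, v))"
    by (rule par) (simp add: qof_real_def qe_def)
  have q1: "qpartial 1 f ?q = (0 *\<^sub>R a (u, v) - 1 *\<^sub>R b (u, v)) + qmul (qe 1) (0 *\<^sub>R b (u, v) + 1 *\<^sub>R a (u, v))"
    by (rule par) (simp add: qof_real_def qe_def)
  note q2 = qpartial_transversal[OF \<theta> rep p, of 2, simplified]
  note q3 = qpartial_transversal[OF \<theta> rep p, of 3, simplified]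
  show ?thesis
    unfolding cauchy_fueter_def q0 q1 using q2 q3
    by (cases "a (u, v)"; cases "b (u, v)"; cases "\<beta> (u, v)") (simp add: qmul_def qe_def field_simps)
qed

lemma slice_eq_of_cauchy_fueter_eq:
  assumes \<theta>: "0 < \<theta>" "\<theta> < pi" and f: "f \<in> Psi_L \<theta>" and g: "g \<in> Psi_L \<theta>"
    and D: "\<And>s. s \<in> sector \<theta> \<Longrightarrow> cauchy_fueter f s = cauchy_fueter g s" and s: "s \<in> sector \<theta>"
  shows "f s = g s"
proof -
  have \<theta>': "\<theta> \<le> pi" using \<theta> by simp
  obtain \<alpha> \<beta> \<alpha>' \<beta>' where rep: "slice_rep (sector \<theta>) f \<alpha> \<beta>" "slice_rep (sector \<theta>) g \<alpha>' \<beta>'"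
    using f g by (auto simp: Psi_L_def left_slice_hol_def)
  from rep(1) obtain a b where eq: "\<And>u v J. J \<in> qsph \<Longrightarrow> (u, v) \<in> plane_sector \<theta> \<Longrightarrow> f (qof_real u + v *\<^sub>R J) = \<alpha> (u, v) + qmul J (\<beta> (u, v))"
    and odd: "\<And>u v. (u, v) \<in> plane_sector \<theta> \<Longrightarrow> \<beta> (u, -v) = - \<beta> (u, v)"
    and d: "\<And>p. p \<in> plane_sector \<theta> \<Longrightarrow> (\<alpha> has_derivative (\<lambda>h. fst h *\<^sub>R a p - snd h *\<^sub>R b p)) (at p)"
      "\<And>p. p \<in> plane_sector \<theta> \<Longrightarrow> (\<beta> has_derivative (\<lambda>h. fst h *\<^sub>R b p + snd h *\<^sub>R a p)) (at p)"
    unfolding slice_rep_sector[OF \<theta>(1) \<theta>'] by blast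
  from rep(2) obtain a' b' where eq': "\<And>u v J. J \<in> qsph \<Longrightarrow> (u, v) \<in> plane_sector \<theta> \<Longrightarrow> g (qof_real u + v *\<^sub>R J) = \<alpha>' (u, v) + qmul J (\<beta>' (u, v))"
    and odd': "\<And>u v. (u, v) \<in> plane_sector \<theta> \<Longrightarrow> \<beta>' (u, -v) = - \<beta>' (u, v)"
    and d': "\<And>p. p \<in> plane_sector \<theta> \<Longrightarrow> (\<alpha>' has_derivative (\<lambda>h. fst h *\<^sub>R a' p - snd h *\<^sub>R b' p)) (at p)"
      "\<And>p. p \<in> plane_sector \<theta> \<Longrightarrow> (\<beta>' has_derivative (\<lambda>h. fst h *\<^sub>R b' p + snd h *\<^sub>R a' p)) (at p)"
    unfolding slice_rep_sector[OF \<theta>(1) \<theta>'] by blast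
  have pos: "\<beta> (u, v) = \<beta>' (u, v)" if "(u, v) \<in> plane_sector \<theta>" "v > 0" for u v
  proof -
    have "qof_real u + v *\<^sub>R qe 1 \<in> sector \<theta>" using axial_in_sector[OF \<theta>(1) \<theta>' qe1_qsph] that by blast
    from D[OF this] have "(- 2 / v) *\<^sub>R \<beta> (u, v) = (- 2 / v) *\<^sub>R \<beta>' (u, v)"
      unfolding cauchy_fueter_slice[OF \<theta>(1) \<theta>' rep(1) that] cauchy_fueter_slice[OF \<theta>(1) \<theta>' rep(2) that] .
    then show ?thesis using that(2) by simp
  qed
  have b: "\<beta> p = \<beta>' p" if p: "p \<in> plane_sector \<theta>" for p
  proof -
    obtain u v where p': "p = (u, v)" by (cases p)
    consider "v > 0" | "v = 0" | "v < 0" by linarith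
    then show ?thesis
    proof cases
      case 1 then show ?thesis using pos p p' by blast
    next
      case 2
      \<comment> \<open>The formula for D f divides by v; on the real axis oddness takes its place
        and forces both functions to vanish.\<close>
      then have "\<beta> (u, 0) = - \<beta> (u, 0)" "\<beta>' (u, 0) = - \<beta>' (u, 0)" using odd[of u 0] odd'[of u 0] p p' by simp_all
      then have "\<beta> (u, 0) = 0" "\<beta>' (u, 0) = 0" by (simp_all add: eq_neg_iff_add_eq_0 flip: scaleR_2)
      then show ?thesis using p' 2 by simp
    next
      case 3
      have "(u, - v) \<in> plane_sector \<theta>" using p p' plane_sector_flip by blast
      then show ?thesis using pos[of u "- v"] odd[of u "-v"] odd'[of u "-v"] 3 p' by simp
    qed
  qed
  have ab: "a p = a' p" "b p = b' p" if p: "p \<in> plane_sector \<theta>" for p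
  proof -
    \<comment> \<open>The derivatives of \<beta> and of \<alpha> share the coefficients a and b, so
      agreement of the \<beta> parts forces agreement of the derivatives of the \<alpha>
      parts.\<close>
    have "(\<beta>' has_derivative (\<lambda>h. fst h *\<^sub>R b p + snd h *\<^sub>R a p)) (at p)"
      by (rule has_derivative_transform_within_open[OF d(2)[OF p] open_plane_sector p]) (rule b)
    from has_derivative_unique[OF this d'(2)[OF p]]
    have e: "fst h *\<^sub>R b p + snd h *\<^sub>R a p = fst h *\<^sub>R b' p + snd h *\<^sub>R a' p" for h by (rule fun_cong)
    show "a p = a' p" "b p = b' p" using e[of "(0,1)"] e[of "(1,0)"] by simp_all
  qed
  have "((\<lambda>p. \<alpha> p - \<alpha>' p) has_derivative (\<lambda>h. 0)) (at p)" if p: "p \<in> plane_sector \<theta>" for p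
    using has_derivative_diff[OF d(1)[OF p] d'(1)[OF p]] by (simp add: ab[OF p])
  then have const: "\<alpha> p - \<alpha>' p = \<alpha> r - \<alpha>' r" if "p \<in> plane_sector \<theta>" "r \<in> plane_sector \<theta>" for p r
    using has_derivative_zero_unique_connected[OF open_plane_sector connected_plane_sector[OF \<theta>]] that by blast
  define k where "k = \<alpha> (1, 0) - \<alpha>' (1, 0)"
  have c1: "cos \<theta> < 1" using cos_monotone_0_pi[of 0 \<theta>] \<theta> by simp
  have PS: "(r, 0) \<in> plane_sector \<theta>" if "r > 0" for r :: real
    using that c1 by (simp add: plane_sector_def norm_Pair)
  have diff: "f q - g q = k" if q: "q \<in> sector \<theta>" for q
  proof -
    obtain u v J where J: "J \<in> qsph" "q = qof_real u + v *\<^sub>R J" by (metis axial_decomp)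
    then have p: "(u, v) \<in> plane_sector \<theta>" using q axial_in_sector[OF \<theta>(1) \<theta>'] by blast
    show ?thesis unfolding J(2) eq[OF J(1) p] eq'[OF J(1) p] b[OF p] using const[OF p PS[of 1]] by (simp add: k_def)
  qed
  obtain a0 c0 where f0: "a0 > 0" "c0 \<ge> 0" "\<And>s. s \<in> sector \<theta> \<Longrightarrow> norm (f s) \<le> c0 * norm s powr a0 / (1 + norm s powr (1 + 2 * a0))"
    using f by (auto simp: Psi_L_def)
  obtain a1 c1 where g0: "a1 > 0" "c1 \<ge> 0" "\<And>s. s \<in> sector \<theta> \<Longrightarrow> norm (g s) \<le> c1 * norm s powr a1 / (1 + norm s powr (1 + 2 * a1))"
    using g by (auto simp: Psi_L_def)
  have "norm k \<le> 0"
  proof (rule tendsto_lowerbound)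
    show "((\<lambda>x. c0 * exp (- a0 * x) + c1 * exp (- a1 * x)) \<longlongrightarrow> 0) at_top"
    proof -
      have "((\<lambda>x. exp (- a0 * x)) \<longlongrightarrow> 0) at_top" "((\<lambda>x. exp (- a1 * x)) \<longlongrightarrow> 0) at_top"
        using f0(1) g0(1) by real_asymp+
      then have "((\<lambda>x. c0 * exp (- a0 * x) + c1 * exp (- a1 * x)) \<longlongrightarrow> c0 * 0 + c1 * 0) at_top" by (intro tendsto_intros)
      then show ?thesis by simp
    qed
    show "\<forall>\<^sub>F x in at_top. norm k \<le> c0 * exp (- a0 * x) + c1 * exp (- a1 * x)"
      using eventually_ge_at_top[of 0]
    proof eventually_elim
      case (elim x)
      \<comment> \<open>Positive real points tending to 0, where both functions tend to 0.\<close>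
      define q where "q = qc (exp (of_real (- x)))"
      have q: "q \<in> sector \<theta>" unfolding q_def by (rule qc_exp_in_sector) (use \<theta> in auto)
      have nq: "norm q = exp (- x)" by (simp add: q_def norm_qc)
      have "norm (f q) \<le> c0 * exp (- a0 * x)" "norm (g q) \<le> c1 * exp (- a1 * x)"
        using f0(3)[OF q] g0(3)[OF q] mult_left_mono[OF powr_decay(1)[OF f0(1), of "- x"] f0(2)] mult_left_mono[OF powr_decay(1)[OF g0(1), of "- x"] g0(2)] elim
        by (simp_all add: nq)
      then show ?case using norm_triangle_ineq4[of "f q" "g q"] diff[OF q] by simp
    qed
  qed simp
  then show ?thesis using diff[OF s] by simp
qed

section \<open>Intrinsic regularizers on the sector\<close>

definition qext :: "(complex \<Rightarrow> complex) \<Rightarrow> quat \<Rightarrow> quat" where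
  "qext E q = (let v = norm (snd q); w = E (Complex (fst q) v) in qof_real (Re w) + (Im w / v) *\<^sub>R (0, snd q))"

text \<open>\<open>qext\<close> evaluates E at the representative in the closed upper half plane.
  The symmetry \<open>cE\<close> makes the result independent of the choice of sign of v and forces
  Im E = 0 on the real axis, where the quotient by v = 0 is harmless.\<close>

lemma qext_axial:
  assumes J: "J \<in> qsph" and cE: "E (Complex u (- v)) = cnj (E (Complex u v))"
  shows "qext E (qof_real u + v *\<^sub>R J) = qof_real (Re (E (Complex u v))) + Im (E (Complex u v)) *\<^sub>R J"
proof -
  obtain j where j: "J = (0, j)" using J by (cases J) (auto simp: qsph_def)
  have nj: "norm j = 1" using J by (auto simp: qsph_def j norm_Pair)
  have q: "fst (qof_real u + v *\<^sub>R J) = u" "snd (qof_real u + v *\<^sub>R J) = v *\<^sub>R j" by (simp_all add: j qof_real_def zero_prod_def[symmetric])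
  have n: "norm (v *\<^sub>R j) = \<bar>v\<bar>" by (simp add: nj)
  have J': "(0, v *\<^sub>R j) = v *\<^sub>R J" by (simp add: j)
  have ext: "qext E (qof_real u + v *\<^sub>R J) = qof_real (Re (E (Complex u \<bar>v\<bar>))) + (Im (E (Complex u \<bar>v\<bar>)) / \<bar>v\<bar> * v) *\<^sub>R J"
    unfolding qext_def q n J' Let_def scaleR_scaleR ..
  consider "v > 0" | "v = 0" | "v < 0" by linarith
  then show ?thesis
  proof cases
    case 1 then show ?thesis unfolding ext by simp
  next
    case 2
    then have "Im (E (Complex u 0)) = 0" using cE by (simp add: complex_eq_iff)
    then show ?thesis unfolding ext using 2 by simp
  next
    case 3
    have m: "E (Complex u \<bar>v\<bar>) = cnj (E (Complex u v))" using 3 cE by simp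
    show ?thesis unfolding ext m using 3 by simp
  qed
qed

lemma qext_slice:
  assumes \<theta>: "0 < \<theta>" "\<theta> \<le> pi" and E: "E holomorphic_on {w. (Re w, Im w) \<in> plane_sector \<theta>}"
    and cE: "\<And>w. (Re w, Im w) \<in> plane_sector \<theta> \<Longrightarrow> E (cnj w) = cnj (E w)"
  shows "slice_rep (sector \<theta>) (qext E) (\<lambda>p. qof_real (Re (E (Complex (fst p) (snd p))))) (\<lambda>p. qof_real (Im (E (Complex (fst p) (snd p)))))"
  unfolding slice_rep_sector[OF \<theta>]
proof (intro conjI allI impI exI ballI)
  have oOm: "open {w. (Re w, Im w) \<in> plane_sector \<theta>}" unfolding plane_sector_def
    by (simp, intro open_Collect_less continuous_intros)
  have cE': "E (Complex u (- v)) = cnj (E (Complex u v))" if "(u, v) \<in> plane_sector \<theta>" for u v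
    using cE[of "Complex u v"] that by (simp add: complex_cnj)
  have qm: "qmul J (qof_real x) = x *\<^sub>R J" for J x by (cases J) (simp add: qmul_def qof_real_def)
  show "qext E (qof_real u + v *\<^sub>R J) = qof_real (Re (E (Complex (fst (u, v)) (snd (u, v))))) + qmul J (qof_real (Im (E (Complex (fst (u, v)) (snd (u, v))))))"
    if "J \<in> qsph \<and> (u, v) \<in> plane_sector \<theta>" for u v J
    using qext_axial[OF _ cE', of J u v] that by (simp add: qm)
  show "qof_real (Re (E (Complex (fst (u, - v)) (snd (u, - v))))) = qof_real (Re (E (Complex (fst (u, v)) (snd (u, v)))))"
    "qof_real (Im (E (Complex (fst (u, - v)) (snd (u, - v))))) = - qof_real (Im (E (Complex (fst (u, v)) (snd (u, v)))))"
    if "(u, v) \<in> plane_sector \<theta>" for u v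
    using cE'[OF that] by (simp_all add: qof_real_def)
  have bl: "bounded_linear qof_real"
    by (rule bounded_linear_intro[where K = 1]) (simp_all add: qof_real_def norm_quat)
  let ?D = "\<lambda>p :: real \<times> real. deriv E (Complex (fst p) (snd p))"
  have "continuous_on (plane_sector \<theta>) ?D"
    by (rule continuous_on_compose2[OF holomorphic_on_imp_continuous_on[OF holomorphic_deriv[OF E oOm]]])
       (auto intro!: continuous_intros)
  then show "continuous_on (plane_sector \<theta>) (\<lambda>p. qof_real (Re (?D p)))" "continuous_on (plane_sector \<theta>) (\<lambda>p. qof_real (Im (?D p)))"
    by (auto intro!: bounded_linear.continuous_on[OF bl] continuous_intros)
  fix p assume p: "p \<in> plane_sector \<theta>"
  have d: "(E has_derivative (\<lambda>h. ?D p * h)) (at (Complex (fst p) (snd p)))"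
    using holomorphic_derivI[OF E oOm, of "Complex (fst p) (snd p)"] p by (simp add: has_field_derivative_def)
  have c: "((\<lambda>p. Complex (fst p) (snd p)) has_derivative (\<lambda>h. Complex (fst h) (snd h))) (at p)"
    by (rule bounded_linear_imp_has_derivative, rule bounded_linear_intro[where K = 1])
       (auto simp: complex_eq_iff norm_Pair complex_norm norm_prod_def)
  note dd = has_derivative_compose[OF c d]
  have alg: "qof_real (Re (w * Complex x y)) = x *\<^sub>R qof_real (Re w) - y *\<^sub>R qof_real (Im w)"
    "qof_real (Im (w * Complex x y)) = x *\<^sub>R qof_real (Im w) + y *\<^sub>R qof_real (Re w)" for w x y
    by (simp_all add: qof_real_def zero_prod_def)
  have 1: "((\<lambda>p. qof_real (Re (E (Complex (fst p) (snd p))))) has_derivative (\<lambda>h. qof_real (Re (?D p * Complex (fst h) (snd h))))) (at p)"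
    by (intro bounded_linear.has_derivative[OF bl] bounded_linear.has_derivative[OF bounded_linear_Re] dd)
  have 2: "((\<lambda>p. qof_real (Im (E (Complex (fst p) (snd p))))) has_derivative (\<lambda>h. qof_real (Im (?D p * Complex (fst h) (snd h))))) (at p)"
    by (intro bounded_linear.has_derivative[OF bl] bounded_linear.has_derivative[OF bounded_linear_Im] dd)
  show "((\<lambda>p. qof_real (Re (E (Complex (fst p) (snd p))))) has_derivative (\<lambda>h. fst h *\<^sub>R qof_real (Re (?D p)) - snd h *\<^sub>R qof_real (Im (?D p)))) (at p)"
    by (rule has_derivative_eq_rhs[OF 1]) (simp only: alg)
  show "((\<lambda>p. qof_real (Im (E (Complex (fst p) (snd p))))) has_derivative (\<lambda>h. fst h *\<^sub>R qof_real (Im (?D p)) + snd h *\<^sub>R qof_real (Re (?D p)))) (at p)"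
    by (rule has_derivative_eq_rhs[OF 2]) (simp only: alg)
qed

text \<open>As A and B are real, A + J B commutes with J, and J J = -1 gives the components of a
  complex product on every slice; a left factor that is not intrinsic would spoil this.\<close>

lemma slice_rep_fmul:
  assumes \<theta>: "0 < \<theta>" "\<theta> \<le> pi" and e: "slice_rep (sector \<theta>) e (\<lambda>p. qof_real (A p)) (\<lambda>p. qof_real (B p))"
    and f: "slice_rep (sector \<theta>) f \<alpha> \<beta>"
  shows "slice_rep (sector \<theta>) (fmul e f) (\<lambda>p. A p *\<^sub>R \<alpha> p - B p *\<^sub>R \<beta> p) (\<lambda>p. A p *\<^sub>R \<beta> p + B p *\<^sub>R \<alpha> p)"
proof -
  from e obtain a b where eE: "\<And>u v J. J \<in> qsph \<Longrightarrow> (u, v) \<in> plane_sector \<theta> \<Longrightarrow> e (qof_real u + v *\<^sub>R J) = qof_real (A (u, v)) + qmul J (qof_real (B (u, v)))"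
    and eP: "\<And>u v. (u, v) \<in> plane_sector \<theta> \<Longrightarrow> qof_real (A (u, -v)) = qof_real (A (u, v)) \<and> qof_real (B (u, -v)) = - qof_real (B (u, v))"
    and ac: "continuous_on (plane_sector \<theta>) a" "continuous_on (plane_sector \<theta>) b"
    and ed: "\<And>p. p \<in> plane_sector \<theta> \<Longrightarrow> ((\<lambda>p. qof_real (A p)) has_derivative (\<lambda>h. fst h *\<^sub>R a p - snd h *\<^sub>R b p)) (at p)"
      "\<And>p. p \<in> plane_sector \<theta> \<Longrightarrow> ((\<lambda>p. qof_real (B p)) has_derivative (\<lambda>h. fst h *\<^sub>R b p + snd h *\<^sub>R a p)) (at p)"
    unfolding slice_rep_sector[OF \<theta>] by blast
  from f obtain c d where fE: "\<And>u v J. J \<in> qsph \<Longrightarrow> (u, v) \<in> plane_sector \<theta> \<Longrightarrow> f (qof_real u + v *\<^sub>R J) = \<alpha> (u, v) + qmul J (\<beta> (u, v))"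
    and fP: "\<And>u v. (u, v) \<in> plane_sector \<theta> \<Longrightarrow> \<alpha> (u, -v) = \<alpha> (u, v) \<and> \<beta> (u, -v) = - \<beta> (u, v)"
    and cc: "continuous_on (plane_sector \<theta>) c" "continuous_on (plane_sector \<theta>) d"
    and fd: "\<And>p. p \<in> plane_sector \<theta> \<Longrightarrow> (\<alpha> has_derivative (\<lambda>h. fst h *\<^sub>R c p - snd h *\<^sub>R d p)) (at p)"
      "\<And>p. p \<in> plane_sector \<theta> \<Longrightarrow> (\<beta> has_derivative (\<lambda>h. fst h *\<^sub>R d p + snd h *\<^sub>R c p)) (at p)"
    unfolding slice_rep_sector[OF \<theta>] by blast
  have dA: "(A has_derivative (\<lambda>h. fst h *\<^sub>R fst (a p) - snd h *\<^sub>R fst (b p))) (at p)"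
    and dB: "(B has_derivative (\<lambda>h. fst h *\<^sub>R fst (b p) + snd h *\<^sub>R fst (a p))) (at p)" if "p \<in> plane_sector \<theta>" for p
    using has_derivative_fst[OF ed(1)[OF that]] has_derivative_fst[OF ed(2)[OF that]] by (simp_all add: qof_real_def)
  have cont: "continuous_on (plane_sector \<theta>) A" "continuous_on (plane_sector \<theta>) B" "continuous_on (plane_sector \<theta>) \<alpha>" "continuous_on (plane_sector \<theta>) \<beta>"
    by (rule continuous_at_imp_continuous_on, blast intro: has_derivative_continuous dA dB fd)+
  define x where "x p = fst (a p) *\<^sub>R \<alpha> p + A p *\<^sub>R c p - (fst (b p) *\<^sub>R \<beta> p + B p *\<^sub>R d p)" for p
  define y where "y p = fst (a p) *\<^sub>R \<beta> p + A p *\<^sub>R d p + (fst (b p) *\<^sub>R \<alpha> p + B p *\<^sub>R c p)" for p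
  show ?thesis
  proof (rule slice_rep_sectorI[OF \<theta>, where a = x and b = y])
    show "continuous_on (plane_sector \<theta>) x" "continuous_on (plane_sector \<theta>) y"
      unfolding x_def y_def by (intro continuous_intros ac cc cont)+
    show "fmul e f (qof_real u + v *\<^sub>R J) = A (u, v) *\<^sub>R \<alpha> (u, v) - B (u, v) *\<^sub>R \<beta> (u, v) + qmul J (A (u, v) *\<^sub>R \<beta> (u, v) + B (u, v) *\<^sub>R \<alpha> (u, v))"
      if that': "J \<in> qsph" "(u, v) \<in> plane_sector \<theta>" for u v J
    proof -
      note that = that'
      obtain j0 j1 j2 j3 where J0: "J = (j0, j1, j2, j3)" by (cases J) auto
      have J: "J = (0, j1, j2, j3)" using that(1) by (simp add: qsph_def J0)
      have j: "j1\<^sup>2 + j2\<^sup>2 + j3\<^sup>2 = 1" using that by (auto simp: qsph_def J norm_quat)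
      have JJ: "qmul J (qmul J z) = - z" for z
      proof -
        have "qmul J (qmul J z) = (- (j1\<^sup>2 + j2\<^sup>2 + j3\<^sup>2)) *\<^sub>R z"
          by (cases z) (simp add: J qmul_def power2_eq_square algebra_simps)
        then show ?thesis by (simp add: j)
      qed
      interpret Q: bounded_linear "qmul J" by (rule qmul_bounded_linear)
      have l: "qmul (qof_real r + s *\<^sub>R J) z = r *\<^sub>R z + s *\<^sub>R qmul J z" for r s z
        by (cases z) (simp add: J qmul_def qof_real_def algebra_simps)
      have "qmul J (qof_real (B (u, v))) = B (u, v) *\<^sub>R J" by (simp add: J qmul_def qof_real_def)
      then have "fmul e f (qof_real u + v *\<^sub>R J) = qmul (qof_real (A (u, v)) + B (u, v) *\<^sub>R J) (\<alpha> (u, v) + qmul J (\<beta> (u, v)))"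
        using eE fE that by (simp add: fmul_def)
      then show ?thesis by (simp add: l Q.add Q.scaleR JJ scaleR_add_right scaleR_diff_right)
    qed
    show "A (u, - v) *\<^sub>R \<alpha> (u, - v) - B (u, - v) *\<^sub>R \<beta> (u, - v) = A (u, v) *\<^sub>R \<alpha> (u, v) - B (u, v) *\<^sub>R \<beta> (u, v)"
      "A (u, - v) *\<^sub>R \<beta> (u, - v) + B (u, - v) *\<^sub>R \<alpha> (u, - v) = - (A (u, v) *\<^sub>R \<beta> (u, v) + B (u, v) *\<^sub>R \<alpha> (u, v))"
      if "(u, v) \<in> plane_sector \<theta>" for u v
      using eP[OF that] fP[OF that] by (simp_all add: qof_real_def)
    fix p assume p: "p \<in> plane_sector \<theta>"
    show "((\<lambda>p. A p *\<^sub>R \<alpha> p - B p *\<^sub>R \<beta> p) has_derivative (\<lambda>h. fst h *\<^sub>R x p - snd h *\<^sub>R y p)) (at p)"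
      by (rule has_derivative_eq_rhs[OF has_derivative_diff[OF has_derivative_scaleR[OF dA[OF p] fd(1)[OF p]] has_derivative_scaleR[OF dB[OF p] fd(2)[OF p]]]])
         (simp add: fun_eq_iff x_def y_def algebra_simps)
    show "((\<lambda>p. A p *\<^sub>R \<beta> p + B p *\<^sub>R \<alpha> p) has_derivative (\<lambda>h. fst h *\<^sub>R y p + snd h *\<^sub>R x p)) (at p)"
      by (rule has_derivative_eq_rhs[OF has_derivative_add[OF has_derivative_scaleR[OF dA[OF p] fd(2)[OF p]] has_derivative_scaleR[OF dB[OF p] fd(1)[OF p]]]])
         (simp add: fun_eq_iff x_def y_def algebra_simps)
  qed
qed

definition rat :: "nat \<Rightarrow> complex \<Rightarrow> complex" where "rat k w = (w / ((1 + w) * (2 + w))) ^ k"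

lemma plane_sector_exp:
  assumes "0 < \<theta>" "\<theta> \<le> pi" "(Re w, Im w) \<in> plane_sector \<theta>"
  obtains z where "\<bar>Im z\<bar> < \<theta>" "w = exp z"
proof (rule that[of "Ln w"])
  have w0: "w \<noteq> 0" using assms(3) by (auto simp: plane_sector_def)
  then show w: "w = exp (Ln w)" by simp
  have "norm w * cos \<theta> < norm w * cos (Im (Ln w))"
    using assms(3) w Re_exp[of "Ln w"] norm_exp_eq_Re[of "Ln w"] by (simp add: plane_sector_def norm_Pair cmod_def)
  then have "cos \<theta> < cos \<bar>Im (Ln w)\<bar>" using w0 by simp
  moreover have "\<bar>Im (Ln w)\<bar> \<le> pi" using mpi_less_Im_Ln[OF w0] Im_Ln_le_pi[OF w0] by (simp add: abs_le_iff)
  ultimately show "\<bar>Im (Ln w)\<bar> < \<theta>" using cos_mono_less_eq[of \<theta> "\<bar>Im (Ln w)\<bar>"] assms by simp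
qed

lemma rat_exp: "\<bar>Im z\<bar> < pi \<Longrightarrow> rat k (exp z) = rho z ^ k"
  by (simp add: rat_def rho_eq)

lemma qext_rat_slice:
  assumes \<theta>: "0 < \<theta>" "\<theta> < pi"
  shows "slice_rep (sector \<theta>) (qext (rat k)) (\<lambda>p. qof_real (Re (rat k (Complex (fst p) (snd p))))) (\<lambda>p. qof_real (Im (rat k (Complex (fst p) (snd p)))))"
proof (rule qext_slice)
  have c: "-1 < cos \<theta>" using cos_monotone_0_pi[of \<theta> pi] \<theta> by simp
  have "1 + w \<noteq> 0" "2 + w \<noteq> 0" if w: "(Re w, Im w) \<in> plane_sector \<theta>" for w
  proof -
    obtain z where z: "\<bar>Im z\<bar> < \<theta>" "w = exp z" using plane_sector_exp[OF _ _ w] \<theta> by auto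
    then show "1 + w \<noteq> 0" "2 + w \<noteq> 0" using rho_eq[of z] \<theta> by auto
  qed
  then show "rat k holomorphic_on {w. (Re w, Im w) \<in> plane_sector \<theta>}"
    unfolding rat_def by (intro holomorphic_intros) auto
  show "rat k (cnj w) = cnj (rat k w)" for w by (simp add: rat_def)
qed (use \<theta> in auto)

lemma qext_rat_intrinsic: "0 < \<theta> \<Longrightarrow> \<theta> < pi \<Longrightarrow> intrinsic_hol (sector \<theta>) (qext (rat k))"
  unfolding intrinsic_hol_def using qext_rat_slice[of \<theta> k] by blast

lemma fmul_rat_slice: "0 < \<theta> \<Longrightarrow> \<theta> < pi \<Longrightarrow> left_slice_hol (sector \<theta>) f \<Longrightarrow> left_slice_hol (sector \<theta>) (fmul (qext (rat k)) f)"
  unfolding left_slice_hol_def using slice_rep_fmul[OF _ _ qext_rat_slice[of \<theta> k]] by fastforce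

lemma qext_rat_qc:
  assumes "\<bar>Im z\<bar> < pi" shows "qext (rat k) (qc (exp z)) = qc (rho z ^ k)"
proof -
  have "qext (rat k) (qc (exp z)) = qof_real (Re (rat k (exp z))) + Im (rat k (exp z)) *\<^sub>R qe 1"
    using qext_axial[OF qe1_qsph, of "rat k" "Re (exp z)" "Im (exp z)"]
    by (simp add: qc_eq rat_def complex_cnj[symmetric] del: complex_cnj One_nat_def)
  then show ?thesis by (simp add: qc_eq[symmetric] rat_exp[OF assms] del: One_nat_def)
qed

lemma norm_qmul: "norm (qmul p q) = norm p * norm q"
proof -
  obtain a b c d where p: "p = (a, b, c, d)" by (cases p) auto
  obtain a' b' c' d' where q: "q = (a', b', c', d')" by (cases q) auto
  show ?thesis unfolding p q by (simp add: qmul_def norm_quat flip: real_sqrt_mult) (simp add: power2_eq_square algebra_simps)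
qed

lemma qext_rat_norm:
  assumes \<theta>: "0 < \<theta>" "\<theta> < pi" and M: "\<And>z. \<bar>Im z\<bar> < \<theta> \<Longrightarrow> norm (rho z) \<le> M * exp (- \<bar>Re z\<bar>)" and q: "q \<in> sector \<theta>"
  shows "norm (qext (rat k) q) \<le> (M * exp (- \<bar>ln (norm q)\<bar>)) ^ k"
proof -
  have \<theta>': "\<theta> \<le> pi" using \<theta> by simp
  obtain u v J where J: "J \<in> qsph" "q = qof_real u + v *\<^sub>R J" by (metis axial_decomp)
  then have p: "(u, v) \<in> plane_sector \<theta>" using q axial_in_sector[OF \<theta>(1) \<theta>'] by blast
  obtain z where z: "\<bar>Im z\<bar> < \<theta>" "Complex u v = exp z" using plane_sector_exp[OF \<theta>(1) \<theta>', of "Complex u v"] p by auto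
  have nq: "norm q = exp (Re z)" using norm_axial(1)[OF J(1), of u v] J(2) z(2) norm_exp_eq_Re[of z] by (simp add: complex_norm flip: z(2))
  have "rat k (Complex u (- v)) = cnj (rat k (Complex u v))" by (simp add: rat_def complex_cnj[symmetric] del: complex_cnj)
  then have "qext (rat k) q = qof_real (Re (rho z ^ k)) + Im (rho z ^ k) *\<^sub>R J"
    using qext_axial[OF J(1)] rat_exp[of z k] z \<theta> by (simp add: J(2))
  then have "norm (qext (rat k) q) = norm (rho z ^ k)" using norm_axial(1)[OF J(1)] by (simp add: cmod_def)
  also have "\<dots> \<le> (M * exp (- \<bar>ln (norm q)\<bar>)) ^ k" unfolding norm_power nq using M[OF z(1)] by (intro power_mono) auto
  finally show ?thesis .
qed

text \<open>Decay of order 2 at both ends suffices for both function classes with exponent 1: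
  multiplied by 1 + exp (3 x), the left side has terms of exponent at most x, hence also the weaker
  comparison with 2 x is checked on each sign of x.\<close>

lemma decay_powr_bounds:
  fixes x :: real
  shows "exp (- 2 * \<bar>x\<bar>) \<le> 2 * exp x powr 1 / (1 + exp x powr (1 + 2 * 1))"
    and "exp (- 2 * \<bar>x\<bar>) \<le> 2 * exp x powr (1 + 1) / (1 + exp x powr (1 + 2 * 1))"
proof -
  have P: "1 + exp (3 * x) > 0" by (simp add: add_pos_pos)
  have *: "exp (- 2 * \<bar>x\<bar>) * (1 + exp (3 * x)) \<le> 2 * exp y" if "- 2 * \<bar>x\<bar> \<le> y" "- 2 * \<bar>x\<bar> + 3 * x \<le> y" for y
  proof -
    have "exp (- 2 * \<bar>x\<bar>) * (1 + exp (3 * x)) = exp (- 2 * \<bar>x\<bar>) + exp (- 2 * \<bar>x\<bar> + 3 * x)"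
      by (simp only: exp_add distrib_left mult_1_right)
    also have "\<dots> \<le> exp y + exp y" using that by (intro add_mono) auto
    finally show ?thesis by simp
  qed
  have "exp (- 2 * \<bar>x\<bar>) * (1 + exp (3 * x)) \<le> 2 * exp x" "exp (- 2 * \<bar>x\<bar>) * (1 + exp (3 * x)) \<le> 2 * exp (2 * x)"
    by (intro *; simp add: abs_if)+
  then have "exp (- 2 * \<bar>x\<bar>) \<le> 2 * exp x / (1 + exp (3 * x))" "exp (- 2 * \<bar>x\<bar>) \<le> 2 * exp (2 * x) / (1 + exp (3 * x))"
    by (simp_all only: pos_le_divide_eq[OF P])
  then show "exp (- 2 * \<bar>x\<bar>) \<le> 2 * exp x powr 1 / (1 + exp x powr (1 + 2 * 1))"
    "exp (- 2 * \<bar>x\<bar>) \<le> 2 * exp x powr (1 + 1) / (1 + exp x powr (1 + 2 * 1))" by (simp_all add: powr_def)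
qed

lemma sector_nonzero: "s \<in> sector \<theta> \<Longrightarrow> 0 < \<theta> \<Longrightarrow> \<theta> \<le> pi \<Longrightarrow> s \<noteq> 0"
  by (auto simp: sector_eq)

lemma decay_bounds:
  assumes \<theta>: "0 < \<theta>" "\<theta> \<le> pi" and C: "C \<ge> 0"
    and le: "\<And>s. s \<in> sector \<theta> \<Longrightarrow> norm (h s) \<le> C * exp (- 2 * \<bar>ln (norm s)\<bar>)"
  shows "\<exists>a>0. \<exists>c\<ge>0. \<forall>s\<in>sector \<theta>. norm (h s) \<le> c * norm s powr a / (1 + norm s powr (1 + 2 * a))"
    and "\<exists>a>0. \<exists>c\<ge>0. \<forall>s\<in>sector \<theta>. norm (h s) \<le> c * norm s powr (1 + a) / (1 + norm s powr (1 + 2 * a))"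
proof -
  have "norm (h s) \<le> (C * 2) * norm s powr 1 / (1 + norm s powr (1 + 2 * 1)) \<and>
     norm (h s) \<le> (C * 2) * norm s powr (1 + 1) / (1 + norm s powr (1 + 2 * 1))" if s: "s \<in> sector \<theta>" for s
  proof -
    have e: "exp (ln (norm s)) = norm s" using sector_nonzero[OF s \<theta>] by simp
    show ?thesis
      using order_trans[OF le[OF s] mult_left_mono[OF decay_powr_bounds(1) C]] order_trans[OF le[OF s] mult_left_mono[OF decay_powr_bounds(2) C]]
      unfolding e by (simp only: times_divide_eq_right mult.assoc)
  qed
  then show "\<exists>a>0. \<exists>c\<ge>0. \<forall>s\<in>sector \<theta>. norm (h s) \<le> c * norm s powr a / (1 + norm s powr (1 + 2 * a))"
    "\<exists>a>0. \<exists>c\<ge>0. \<forall>s\<in>sector \<theta>. norm (h s) \<le> c * norm s powr (1 + a) / (1 + norm s powr (1 + 2 * a))"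
    using C by (intro exI[of _ 1] conjI exI[of _ "C * 2"] ballI; simp)+
qed

lemma rat_regularizer:
  assumes \<theta>: "0 < \<theta>" "\<theta> < pi" and f: "f \<in> F_L \<theta>"
  obtains k where "k > 0" "qext (rat k) \<in> Psi \<theta>" "qext (rat k) \<in> PsiQ \<theta>"
    "fmul (qext (rat k)) f \<in> Psi_L \<theta>" "fmul (qext (rat k)) f \<in> PsiQ_L \<theta>"
proof -
  have \<theta>': "\<theta> \<le> pi" using \<theta> by simp
  obtain a c where a: "a > 0" "c \<ge> 0" and fle: "\<And>s. s \<in> sector \<theta> \<Longrightarrow> norm (f s) \<le> c * (norm s powr a + norm s powr (- a))"
    and fl: "left_slice_hol (sector \<theta>) f"
    using f by (auto simp: F_L_def)
  obtain M where M: "\<And>z. \<bar>Im z\<bar> < \<theta> \<Longrightarrow> norm (rho z) \<le> M * exp (- \<bar>Re z\<bar>)" using rho_bound[OF \<theta>(2)] by blast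
  have M0: "M \<ge> 0" using order_trans[OF norm_ge_zero M[of 0]] \<theta> by simp
  \<comment> \<open>Each factor \<open>rho\<close> decays with rate 1; a of them outweigh the growth
    of f and 2 more give the rate required by \<open>decay_bounds\<close>.\<close>
  obtain k :: nat where k: "a + 2 \<le> real k" using real_arch_simple by blast
  have ek: "norm (qext (rat k) s) \<le> M ^ k * exp (- real k * \<bar>ln (norm s)\<bar>)" if "s \<in> sector \<theta>" for s
    using qext_rat_norm[OF \<theta> M that, of k] by (simp add: power_mult_distrib exp_of_nat_mult[symmetric])
  have e2: "norm (qext (rat k) s) \<le> M ^ k * exp (- 2 * \<bar>ln (norm s)\<bar>)" if "s \<in> sector \<theta>" for s
  proof -
    have "M ^ k * exp (- real k * \<bar>ln (norm s)\<bar>) \<le> M ^ k * exp (- 2 * \<bar>ln (norm s)\<bar>)"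
      by (intro mult_left_mono exp_abs_mono) (use k a M0 in auto)
    then show ?thesis using ek[OF that] by linarith
  qed
  have f2: "norm (f s) \<le> 2 * c * exp (a * \<bar>ln (norm s)\<bar>)" if s: "s \<in> sector \<theta>" for s
  proof -
    have s0: "norm s > 0" using sector_nonzero[OF s \<theta>(1) \<theta>'] by simp
    have "norm s powr a \<le> exp (a * \<bar>ln (norm s)\<bar>)" "norm s powr (- a) \<le> exp (a * \<bar>ln (norm s)\<bar>)"
      using s0 a(1) mult_left_mono[of "ln (norm s)" "\<bar>ln (norm s)\<bar>" a] mult_left_mono[of "- ln (norm s)" "\<bar>ln (norm s)\<bar>" a]
      by (auto simp: powr_def)
    then have "c * (norm s powr a + norm s powr (- a)) \<le> c * (exp (a * \<bar>ln (norm s)\<bar>) + exp (a * \<bar>ln (norm s)\<bar>))"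
      using a(2) by (intro mult_left_mono add_mono)
    then show ?thesis using fle[OF s] by simp
  qed
  have ef: "norm (fmul (qext (rat k)) f s) \<le> (M ^ k * (2 * c)) * exp (- 2 * \<bar>ln (norm s)\<bar>)" if s: "s \<in> sector \<theta>" for s
  proof -
    have "norm (fmul (qext (rat k)) f s) \<le> (M ^ k * exp (- real k * \<bar>ln (norm s)\<bar>)) * (2 * c * exp (a * \<bar>ln (norm s)\<bar>))"
      unfolding fmul_def norm_qmul using M0 by (intro mult_mono ek f2 s) auto
    also have "\<dots> = (M ^ k * (2 * c)) * exp (- (real k - a) * \<bar>ln (norm s)\<bar>)"
      by (simp add: mult_exp_exp[symmetric] algebra_simps exp_diff exp_minus field_simps)
    also have "\<dots> \<le> (M ^ k * (2 * c)) * exp (- 2 * \<bar>ln (norm s)\<bar>)"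
      by (intro mult_left_mono exp_abs_mono) (use k a M0 in auto)
    finally show ?thesis .
  qed
  note be = decay_bounds[OF \<theta>(1) \<theta>' _ e2] and bf = decay_bounds[OF \<theta>(1) \<theta>' _ ef]
  have M0': "0 \<le> M ^ k" "0 \<le> M ^ k * (2 * c)" using M0 a by auto
  show ?thesis
  proof (rule that[of k])
    show "k > 0" using k a by (cases k) auto
  qed (use be[OF M0'(1)] bf[OF M0'(2)] qext_rat_intrinsic[OF \<theta>, of k] fmul_rat_slice[OF \<theta> fl, of k] in
      \<open>simp_all add: Psi_def PsiQ_def Psi_L_def PsiQ_L_def\<close>)
qed

section \<open>Bounded operators as a Banach algebra\<close>

text \<open>A copy of the bounded operators from a space to itself: composition is a multiplication
  only when domain and codomain agree, and a type with one parameter can carry it as a class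
  instance.\<close>

typedef (overloaded) 'v endo = "UNIV :: ('v::real_normed_vector \<Rightarrow>\<^sub>L 'v) set" ..

definition ap :: "'v::real_normed_vector endo \<Rightarrow> 'v \<Rightarrow> 'v" where "ap A = blinfun_apply (Rep_endo A)"
definition endo :: "('v \<Rightarrow> 'v) \<Rightarrow> 'v::real_normed_vector endo" where "endo f = Abs_endo (Blinfun f)"

lemma ap_endo: "bounded_linear f \<Longrightarrow> ap (endo f) = f"
  by (simp add: ap_def endo_def Abs_endo_inverse bounded_linear_Blinfun_apply)

lemma endo_eqI: "(\<And>v. ap A v = ap B v) \<Longrightarrow> A = B"
  by (metis ap_def blinfun_eqI Rep_endo_inject)

instantiation endo :: (real_normed_vector) real_normed_vector
begin
definition "0 = Abs_endo (0 :: 'a \<Rightarrow>\<^sub>L 'a)"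
definition "A + B = Abs_endo (Rep_endo A + Rep_endo (B :: 'a endo))"
definition "A - B = Abs_endo (Rep_endo A - Rep_endo (B :: 'a endo))"
definition "- A = Abs_endo (- Rep_endo (A :: 'a endo))"
definition "r *\<^sub>R A = Abs_endo (r *\<^sub>R Rep_endo (A :: 'a endo))"
definition "norm A = norm (Rep_endo (A :: 'a endo))"
definition "dist A B = norm (A - (B :: 'a endo))"
definition "sgn A = inverse (norm A) *\<^sub>R (A :: 'a endo)"
definition "uniformity = (INF e\<in>{0 <..}. principal {(x, y). dist x (y :: 'a endo) < e})"
definition "open (U :: 'a endo set) = (\<forall>x\<in>U. eventually (\<lambda>(x', y). x' = x \<longrightarrow> y \<in> U) uniformity)"

lemma Rep_endo_simps:
  "Rep_endo (0 :: 'a endo) = 0" "Rep_endo (A + B) = Rep_endo A + Rep_endo B" "Rep_endo (A - B) = Rep_endo A - Rep_endo B"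
  "Rep_endo (- A) = - Rep_endo A" "Rep_endo (r *\<^sub>R A) = r *\<^sub>R Rep_endo A"
  for A B :: "'a endo"
  by (simp_all add: zero_endo_def plus_endo_def minus_endo_def uminus_endo_def scaleR_endo_def Abs_endo_inverse)

instance
  by standard
    (simp_all add: Rep_endo_inject[symmetric] Rep_endo_simps algebra_simps dist_endo_def sgn_endo_def norm_endo_def
      uniformity_endo_def open_endo_def norm_triangle_ineq)

end

instantiation endo :: (real_normed_vector) real_normed_algebra
begin
definition "A * B = Abs_endo (Rep_endo A o\<^sub>L Rep_endo (B :: 'a endo))"

lemma Rep_endo_mult: "Rep_endo (A * B) = Rep_endo A o\<^sub>L Rep_endo B" for A B :: "'a endo"
  by (simp add: times_endo_def Abs_endo_inverse)

instance
  by standard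
    (auto simp: Rep_endo_inject[symmetric] Rep_endo_simps Rep_endo_mult norm_endo_def norm_blinfun_compose blinfun.bilinear_simps intro!: blinfun_eqI)

end

instance endo :: (banach) banach
proof
  fix X :: "nat \<Rightarrow> 'a endo" assume X: "Cauchy X"
  have d: "dist (Rep_endo A) (Rep_endo B) = dist A B" for A B :: "'a endo"
    by (simp add: dist_norm norm_endo_def Rep_endo_simps)
  have "Cauchy (\<lambda>n. Rep_endo (X n))" using X by (simp add: Cauchy_def d)
  then obtain l where "(\<lambda>n. Rep_endo (X n)) \<longlonglongrightarrow> l" using Cauchy_convergent_iff convergent_def by blast
  then have "X \<longlonglongrightarrow> Abs_endo l" using d[of _ "Abs_endo l"] by (simp add: tendsto_iff Abs_endo_inverse)
  then show "convergent X" by (auto simp: convergent_def)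
qed

instantiation endo :: (real_normed_vector) monoid_mult
begin
definition "1 = Abs_endo (id_blinfun :: 'a \<Rightarrow>\<^sub>L 'a)"
instance by standard (auto simp: Rep_endo_inject[symmetric] Rep_endo_simps Rep_endo_mult one_endo_def Abs_endo_inverse intro!: blinfun_eqI)
end

lemma ap_simps [simp]: "ap 0 v = 0" "ap (A + B) v = ap A v + ap B v" "ap (A - B) v = ap A v - ap B v" "ap (- A) v = - ap A v"
    "ap (r *\<^sub>R A) v = r *\<^sub>R ap A v" "ap (A * B) v = ap A (ap B v)" "ap 1 v = v"
  by (simp_all add: ap_def Rep_endo_simps Rep_endo_mult blinfun.bilinear_simps one_endo_def Abs_endo_inverse)

lemma ap_linear: "ap A (v + w) = ap A v + ap A w" "ap A (v - w) = ap A v - ap A w" "ap A (- v) = - ap A v" "ap A (r *\<^sub>R v) = r *\<^sub>R ap A v" "ap A 0 = 0"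
  by (simp_all add: ap_def blinfun.bilinear_simps)

lemma ap_sum: "ap (sum F I) v = (\<Sum>i\<in>I. ap (F i) v)"
  by (induction I rule: infinite_finite_induct) auto

lemma norm_ap: "norm (ap A v) \<le> norm A * norm v"
  by (simp add: ap_def norm_endo_def norm_blinfun)

lemma norm_endo_le: "0 \<le> K \<Longrightarrow> (\<And>v. norm (ap A v) \<le> K * norm v) \<Longrightarrow> norm A \<le> K"
  unfolding norm_endo_def ap_def by (rule norm_blinfun_bound)

lemma ap_bounded_linear: "bounded_linear (\<lambda>A. ap A v)"
  by (rule bounded_linear_intro[where K = "norm v"]) (simp_all add: norm_ap)

text \<open>Quaternions are nested pairs; with these rules in force simplification would break every
  quantified quaternion into its four coordinates.\<close>

declare split_paired_All [simp del] split_paired_Ex [simp del]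

section \<open>Resolvents of a pair of sectorial operators\<close>

lemma sum_upto_3: "(\<Sum>i\<in>{0..3}. f i) = f 0 + f 1 + f 2 + f (3 :: nat)" "(\<Sum>i<4. f i) = f 0 + f 1 + f 2 + f (3 :: nat)"
  by (simp_all add: eval_nat_numeral)

lemma qmul_assoc: "qmul (qmul a b) c = qmul a (qmul b c)"
  by (cases a; cases b; cases c) (simp add: qmul_def algebra_simps)

lemma qmul_add: "qmul (a + b) c = qmul a c + qmul b c" "qmul c (a + b) = qmul c a + qmul c b"
  and qmul_diff: "qmul (a - b) c = qmul a c - qmul b c" "qmul c (a - b) = qmul c a - qmul c b"
  by (cases a; cases b; cases c; simp add: qmul_def algebra_simps)+

locale sectorial_pair =
  fixes lm rm :: "quat \<Rightarrow> 'v::banach \<Rightarrow> 'v" and D :: "'v set" and C :: "nat \<Rightarrow> 'v \<Rightarrow> 'v" and \<omega> :: real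
  assumes V: "two_sided_banach lm rm" and KC: "KC lm rm D C"
    and typeT: "of_type lm D C \<omega>" and typeTbar: "of_type lm D (kconj C) \<omega>"
    and omega: "0 < \<omega>" "\<omega> < pi"
begin

lemma lm_addl: "lm (a + b) v = lm a v + lm b v" and lm_add: "lm a (v + w) = lm a v + lm a w"
  and lm_mult: "lm (qmul a b) v = lm a (lm b v)" and lm_real: "lm (qof_real r) v = r *\<^sub>R v"
  and lm_norm: "norm (lm a v) \<le> norm a * norm v"
  using V by (simp_all add: two_sided_banach_def)

lemma lm_scaleRl: "lm (r *\<^sub>R a) v = r *\<^sub>R lm a v" and lm_scaleR: "lm a (r *\<^sub>R v) = r *\<^sub>R lm a v"
proof -
  have "r *\<^sub>R a = qmul (qof_real r) a" by (cases a) (simp add: qmul_def qof_real_def)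
  then show *: "lm (r *\<^sub>R a) v = r *\<^sub>R lm a v" by (simp add: lm_mult lm_real)
  have "r *\<^sub>R a = qmul a (qof_real r)" by (cases a) (simp add: qmul_def qof_real_def)
  then have "lm (r *\<^sub>R a) v = lm a (r *\<^sub>R v)" by (simp add: lm_mult lm_real)
  then show "lm a (r *\<^sub>R v) = r *\<^sub>R lm a v" using * by simp
qed

lemma lm_minus: "lm a (- v) = - lm a v" and lm_minusl: "lm (- a) v = - lm a v"
  using lm_scaleR[of a "-1" v] lm_scaleRl[of "-1" a v] by simp_all

lemma lm_units:
  "lm (qe 1) (lm (qe 1) v) = - v" "lm (qe 2) (lm (qe 2) v) = - v" "lm (qe 3) (lm (qe 3) v) = - v"
  "lm (qe 1) (lm (qe 2) v) = lm (qe 3) v" "lm (qe 2) (lm (qe 1) v) = - lm (qe 3) v"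
  "lm (qe 2) (lm (qe 3) v) = lm (qe 1) v" "lm (qe 3) (lm (qe 2) v) = - lm (qe 1) v"
  "lm (qe 3) (lm (qe 1) v) = lm (qe 2) v" "lm (qe 1) (lm (qe 3) v) = - lm (qe 2) v"
proof -
  have m: "qmul (qe 1) (qe 1) = - qe 0" "qmul (qe 2) (qe 2) = - qe 0" "qmul (qe 3) (qe 3) = - qe 0"
    "qmul (qe 1) (qe 2) = qe 3" "qmul (qe 2) (qe 1) = - qe 3" "qmul (qe 2) (qe 3) = qe 1" "qmul (qe 3) (qe 2) = - qe 1"
    "qmul (qe 3) (qe 1) = qe 2" "qmul (qe 1) (qe 3) = - qe 2" by (simp_all add: qmul_def qe_def)
  have "lm (qe 0) v = v" using lm_real[of 1 v] by (simp add: qe_def qof_real_def)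
  then show "lm (qe 1) (lm (qe 1) v) = - v" "lm (qe 2) (lm (qe 2) v) = - v" "lm (qe 3) (lm (qe 3) v) = - v"
    "lm (qe 1) (lm (qe 2) v) = lm (qe 3) v" "lm (qe 2) (lm (qe 1) v) = - lm (qe 3) v"
    "lm (qe 2) (lm (qe 3) v) = lm (qe 1) v" "lm (qe 3) (lm (qe 2) v) = - lm (qe 1) v"
    "lm (qe 3) (lm (qe 1) v) = lm (qe 2) v" "lm (qe 1) (lm (qe 3) v) = - lm (qe 2) v"
    by (simp_all add: m lm_minusl del: One_nat_def flip: lm_mult)
qed

lemma lm_diff: "lm a (v - w) = lm a v - lm a w" and lm_diffl: "lm (a - b) v = lm a v - lm b v"
  using lm_add[of a v "- w"] lm_addl[of a "- b" v] by (simp_all add: lm_minus lm_minusl)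

lemma lm_bounded_linear: "bounded_linear (lm a)"
  by (rule bounded_linear_intro[where K = "norm a"]) (simp_all add: lm_add lm_scaleR lm_norm mult.commute[of _ "norm a"])

abbreviation "T \<equiv> kcop lm C"
abbreviation "Tbar \<equiv> kcop lm (kconj C)"
abbreviation "D2 \<equiv> dom_sq lm D C"

lemma D_subspace: "two_sided_subspace lm rm D" and C_linear: "i < 4 \<Longrightarrow> two_sided_linear_on lm rm D (C i)"
  and D2_comm': "\<forall>i<4. \<forall>j<4. \<forall>v\<in>D2. C j v \<in> D \<and> C i (C j v) = C j (C i v)"
  using KC by (simp_all add: KC_def)

lemma D_add: "v \<in> D \<Longrightarrow> w \<in> D \<Longrightarrow> v + w \<in> D" and D_lm: "v \<in> D \<Longrightarrow> lm a v \<in> D" and D_0: "0 \<in> D"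
  using D_subspace by (simp_all add: two_sided_subspace_def)

lemma D_scaleR: "v \<in> D \<Longrightarrow> r *\<^sub>R v \<in> D" using D_lm[of v "qof_real r"] by (simp add: lm_real)

lemma D_minus: "v \<in> D \<Longrightarrow> - v \<in> D" using D_scaleR[of v "-1"] by simp

lemma D_diff: "v \<in> D \<Longrightarrow> w \<in> D \<Longrightarrow> v - w \<in> D" using D_add[of v "- w"] D_minus[of w] by simp

lemma C_add: "i < 4 \<Longrightarrow> v \<in> D \<Longrightarrow> w \<in> D \<Longrightarrow> C i (v + w) = C i v + C i w"
  and C_lm: "i < 4 \<Longrightarrow> v \<in> D \<Longrightarrow> C i (lm a v) = lm a (C i v)"
  using C_linear[of i] by (simp_all add: two_sided_linear_on_def right_linear_on_def)

lemma C_scaleR: "i < 4 \<Longrightarrow> v \<in> D \<Longrightarrow> C i (r *\<^sub>R v) = r *\<^sub>R C i v" using C_lm[of i v "qof_real r"] by (simp add: lm_real)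

lemma C_minus: "i < 4 \<Longrightarrow> v \<in> D \<Longrightarrow> C i (- v) = - C i v" using C_scaleR[of i v "-1"] by simp

lemma C_diff: "i < 4 \<Longrightarrow> v \<in> D \<Longrightarrow> w \<in> D \<Longrightarrow> C i (v - w) = C i v - C i w"
  using C_add[of i v "- w"] C_minus[of i w] D_minus[of w] by simp

lemma D2_D: "v \<in> D2 \<Longrightarrow> v \<in> D" and D2_T: "v \<in> D2 \<Longrightarrow> T v \<in> D" and D2_I: "v \<in> D \<Longrightarrow> T v \<in> D \<Longrightarrow> v \<in> D2"
  by (simp_all add: dom_sq_def)

lemma D2_C: "i < 4 \<Longrightarrow> v \<in> D2 \<Longrightarrow> C i v \<in> D"
  and C_comm: "i < 4 \<Longrightarrow> j < 4 \<Longrightarrow> v \<in> D2 \<Longrightarrow> C i (C j v) = C j (C i v)"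
  using D2_comm' by blast+

lemma T_eq: "T v = C 0 v + lm (qe 1) (C 1 v) + lm (qe 2) (C 2 v) + lm (qe 3) (C 3 v)"
  and Tbar_eq: "Tbar v = C 0 v - lm (qe 1) (C 1 v) - lm (qe 2) (C 2 v) - lm (qe 3) (C 3 v)"
  by (simp_all add: kcop_def kconj_def lm_minus)

lemma T_add: "v \<in> D \<Longrightarrow> w \<in> D \<Longrightarrow> T (v + w) = T v + T w" and T_scaleR: "v \<in> D \<Longrightarrow> T (r *\<^sub>R v) = r *\<^sub>R T v"
  and T_diff: "v \<in> D \<Longrightarrow> w \<in> D \<Longrightarrow> T (v - w) = T v - T w"
  by (simp_all add: T_eq C_add C_diff C_scaleR lm_add lm_diff lm_scaleR scaleR_add_right)

lemma Tbar_add: "v \<in> D \<Longrightarrow> w \<in> D \<Longrightarrow> Tbar (v + w) = Tbar v + Tbar w" and Tbar_scaleR: "v \<in> D \<Longrightarrow> Tbar (r *\<^sub>R v) = r *\<^sub>R Tbar v"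
  by (simp_all add: Tbar_eq C_add C_diff C_scaleR lm_add lm_diff lm_scaleR scaleR_diff_right)

lemma D2_add: "v \<in> D2 \<Longrightarrow> w \<in> D2 \<Longrightarrow> v + w \<in> D2" and D2_scaleR: "v \<in> D2 \<Longrightarrow> r *\<^sub>R v \<in> D2"
  and D2_diff: "v \<in> D2 \<Longrightarrow> w \<in> D2 \<Longrightarrow> v - w \<in> D2"
  by (simp_all add: dom_sq_def T_add T_scaleR T_diff D_add D_scaleR D_diff)

lemma D2_lm: "v \<in> D2 \<Longrightarrow> lm a v \<in> D2"
  by (rule D2_I) (simp_all add: T_eq C_lm D2_D D2_C D_add D_lm)

lemma D2_TbarD: "v \<in> D2 \<Longrightarrow> Tbar v \<in> D"
  by (simp add: Tbar_eq D2_C D_diff D_lm)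

abbreviation "Q \<equiv> Qcs lm C"

lemma Q_eq: "Q s v = lm (qmul s s) v - 2 *\<^sub>R lm s (C 0 v) + (C 0 (C 0 v) + C 1 (C 1 v) + C 2 (C 2 v) + C 3 (C 3 v))"
  by (simp add: Qcs_def sum_upto_3 lm_scaleRl del: One_nat_def)

lemma Q_add: "v \<in> D2 \<Longrightarrow> w \<in> D2 \<Longrightarrow> Q s (v + w) = Q s v + Q s w"
  by (simp add: Q_eq C_add D2_D D2_C lm_add scaleR_add_right)

text \<open>Two uses are intended: a in the slice of s with s' = s, and a unit orthogonal to that
  slice with s' the conjugate of s.\<close>

lemma Q_lm: "v \<in> D2 \<Longrightarrow> qmul a s = qmul s' a \<Longrightarrow> Q s' (lm a v) = lm a (Q s v)"
proof -
  assume v: "v \<in> D2" and e: "qmul a s = qmul s' a"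
  have e': "lm a (lm s x) = lm s' (lm a x)" for x using e by (metis lm_mult)
  show ?thesis by (simp add: Q_eq C_lm D2_D D2_C v lm_mult lm_add lm_diff lm_scaleR e')
qed

lemma qmul_real: "qmul a (qof_real r) = qmul (qof_real r) a"
  by (cases a) (simp add: qmul_def qof_real_def)

lemma Q_scaleR: "v \<in> D2 \<Longrightarrow> Q s (r *\<^sub>R v) = r *\<^sub>R Q s v"
  using Q_lm[of v "qof_real r" s s] by (simp add: lm_real qmul_real)

lemma Q_diff: "v \<in> D2 \<Longrightarrow> w \<in> D2 \<Longrightarrow> Q s (v - w) = Q s v - Q s w"
  using Q_add[of v "-1 *\<^sub>R w" s] D2_scaleR[of w "-1"] Q_scaleR[of w s "-1"] by simp

lemma Q_diff_param: "qmul s p = qmul p s \<Longrightarrow>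
   Q p v - Q s v = lm (qmul (p - s) (p + s)) v - 2 *\<^sub>R lm (p - s) (C 0 v)"
proof -
  assume c: "qmul s p = qmul p s"
  have "qmul (p - s) (p + s) = qmul p p - qmul s s"
    using c by (simp add: qmul_diff qmul_add)
  then show ?thesis by (simp add: Q_eq lm_diffl scaleR_diff_right)
qed

abbreviation "out s \<equiv> fst s < norm s * cos \<omega>"

lemma closure_sector: "closure (sector \<omega>) \<subseteq> {s. norm s * cos \<omega> \<le> fst s}"
  by (rule closure_minimal) (use omega in \<open>auto simp: sector_eq intro!: closed_Collect_le continuous_intros\<close>)

lemma bij_Q: assumes "out s" shows "bij_betw (Q s) D2 UNIV" "bij_betw (Qcs lm (kconj C) s) (dom_sq lm D (kconj C)) UNIV"
  using assms closure_sector typeT typeTbar by (force simp: of_type_def S_spectrum_def S_resolvent_set_def)+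

lemma Q_conj: "v \<in> D2 \<Longrightarrow> Qcs lm (kconj C) s v = Q s v"
  by (simp add: Q_eq Qcs_def kconj_def sum_upto_3 lm_scaleRl C_minus D2_C del: One_nat_def)

lemma out_minus_1: "out (qof_real (- 1))"
  using cos_monotone_0_pi[of \<omega> pi] omega by (simp add: qof_real_def norm_quat)

text \<open>On \<open>D2\<close> the two operators \<open>Q\<close> coincide. The one for T is
  already surjective from \<open>D2\<close>, while the one for the conjugate is injective on the
  possibly larger domain, so the domains agree.\<close>

lemma dom_sq_conj: "dom_sq lm D (kconj C) = D2"
proof
  let ?s = "qof_real (- 1)"
  show sub: "D2 \<subseteq> dom_sq lm D (kconj C)"
  proof
    fix v assume "v \<in> D2" then show "v \<in> dom_sq lm D (kconj C)" using D2_TbarD[of v] D2_D[of v] by (simp add: dom_sq_def)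
  qed
  show "dom_sq lm D (kconj C) \<subseteq> D2"
  proof
    fix w assume w: "w \<in> dom_sq lm D (kconj C)"
    obtain v where v: "v \<in> D2" "Q ?s v = Qcs lm (kconj C) ?s w"
      using bij_Q(1)[OF out_minus_1] by (metis (no_types, lifting) UNIV_I bij_betwE bij_betw_imp_surj_on imageE)
    then have "v = w"
      using bij_Q(2)[OF out_minus_1] w sub Q_conj[of v] by (auto simp: bij_betw_def inj_on_def subset_iff)
    then show "w \<in> D2" using v by simp
  qed
qed

lemma D2_bar_I: "v \<in> D \<Longrightarrow> Tbar v \<in> D \<Longrightarrow> v \<in> D2"
  using dom_sq_conj by (auto simp: dom_sq_def)

abbreviation "R \<equiv> Qinv lm D C"

lemma R_D2: "out s \<Longrightarrow> R s v \<in> D2" and Q_R: "out s \<Longrightarrow> Q s (R s v) = v"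
  and R_Q: "out s \<Longrightarrow> w \<in> D2 \<Longrightarrow> R s (Q s w) = w"
  using bij_Q(1)[of s] unfolding Qinv_def
  by (auto simp: bij_betw_def the_inv_into_f_f f_the_inv_into_f intro!: the_inv_into_into)

lemma R_unique: "out s \<Longrightarrow> w \<in> D2 \<Longrightarrow> Q s w = v \<Longrightarrow> R s v = w"
  using R_Q by blast

lemma R_conj: "out s \<Longrightarrow> Qinv lm D (kconj C) s v = R s v"
  unfolding Qinv_def[of _ _ "kconj C"] dom_sq_conj
  by (rule the_inv_into_f_eq)
     (use bij_Q(2)[of s] in \<open>auto simp: dom_sq_conj bij_betw_def R_D2 Q_conj Q_R\<close>)

lemma R_add: "out s \<Longrightarrow> R s (v + w) = R s v + R s w"
  by (rule R_unique) (simp_all add: D2_add R_D2 Q_add Q_R)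

lemma R_lm: "out s \<Longrightarrow> out s' \<Longrightarrow> qmul a s = qmul s' a \<Longrightarrow> R s' (lm a v) = lm a (R s v)"
  by (rule R_unique) (simp_all add: D2_lm R_D2 Q_lm[where s = s] Q_R)

lemma R_scaleR: "out s \<Longrightarrow> R s (r *\<^sub>R v) = r *\<^sub>R R s v"
  by (rule R_unique) (simp_all add: D2_scaleR R_D2 Q_scaleR Q_R)

lemma R_diff: "out s \<Longrightarrow> R s (v - w) = R s v - R s w"
  by (rule R_unique) (simp_all add: D2_diff R_D2 Q_diff Q_R)

lemma T_Tbar: "v \<in> D2 \<Longrightarrow> T (Tbar v) = C 0 (C 0 v) + C 1 (C 1 v) + C 2 (C 2 v) + C 3 (C 3 v)"
  and Tbar_T: "v \<in> D2 \<Longrightarrow> Tbar (T v) = C 0 (C 0 v) + C 1 (C 1 v) + C 2 (C 2 v) + C 3 (C 3 v)"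
proof -
  assume v: "v \<in> D2"
  have c: "C 1 (C 0 v) = C 0 (C 1 v)" "C 2 (C 0 v) = C 0 (C 2 v)" "C 3 (C 0 v) = C 0 (C 3 v)"
    "C 2 (C 1 v) = C 1 (C 2 v)" "C 3 (C 1 v) = C 1 (C 3 v)" "C 3 (C 2 v) = C 2 (C 3 v)" using v by (simp_all add: C_comm del: One_nat_def)
  show "T (Tbar v) = C 0 (C 0 v) + C 1 (C 1 v) + C 2 (C 2 v) + C 3 (C 3 v)"
    "Tbar (T v) = C 0 (C 0 v) + C 1 (C 1 v) + C 2 (C 2 v) + C 3 (C 3 v)"
    unfolding T_eq Tbar_eq
    by (simp_all add: C_add C_diff C_lm D2_C D_lm D_add D_diff v lm_add lm_diff lm_units c del: One_nat_def)
qed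

text \<open>Regularity of solutions: for \<open>r = -1\<close> the operator \<open>Q r\<close> factors through \<open>r - T\<close> and \<open>r - Tbar\<close>,
  which shows that the image of a solution under either factor lies in the domain of the other one.\<close>
lemma T_D2:
  assumes w: "w \<in> D2" and y: "Q s w \<in> D"
  shows "T w \<in> D2" "Tbar w \<in> D2"
proof -
  let ?r = "qof_real (- 1)"
  \<comment> \<open>Changing the parameter to the real point -1 alters \<open>Q\<close> only by
    terms of first order, which stay in \<open>D\<close>.\<close>
  have "Q ?r w = Q s w + (Q ?r w - Q s w)" by simp
  also have "\<dots> \<in> D"
    by (rule D_add[OF y], subst Q_diff_param) (simp_all add: qmul_real w D2_D D2_C D_diff D_lm D_scaleR)
  finally have y: "Q ?r w \<in> D" .
  have Qr: "Q ?r w = w + (T w + Tbar w) + T (Tbar w)"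
  proof -
    have "qmul ?r ?r = qof_real 1" by (simp add: qmul_def qof_real_def)
    moreover have "T w + Tbar w = 2 *\<^sub>R C 0 w" by (simp add: T_eq Tbar_eq scaleR_2)
    ultimately show ?thesis using w by (simp add: Q_eq lm_real T_Tbar del: One_nat_def)
  qed
  note d = D2_D[OF w] D2_T[OF w] D2_TbarD[OF w]
  \<comment> \<open>At -1 the operator \<open>Q\<close> is (1 + T) (1 + Tbar), so the vector (1 +
    Tbar) w is mapped by T into \<open>D\<close>.\<close>
  have "T (w + Tbar w) = Q ?r w - (w + Tbar w)" by (simp add: Qr T_add d)
  then have a: "w + Tbar w \<in> D2" by (intro D2_I) (simp_all add: y D_add D_diff d)
  have "Tbar (w + T w) = Q ?r w - (w + T w)" using T_Tbar[OF w] Tbar_T[OF w] by (simp add: Qr Tbar_add d)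
  then have b: "w + T w \<in> D2" by (intro D2_bar_I) (simp_all add: y D_add D_diff d)
  show "T w \<in> D2" "Tbar w \<in> D2" using D2_diff[OF b w] D2_diff[OF a w] by simp_all
qed

text \<open>T commutes with each component on \<open>D2\<close>, and T w is again in
  \<open>D2\<close> by \<open>T_D2\<close>, so T (C j w) = C j (T w) lies in
  \<open>D\<close>.\<close>

lemma C_D2:
  assumes w: "w \<in> D2" and y: "Q s w \<in> D" and j: "j < 4"
  shows "C j w \<in> D2"
proof (rule D2_I)
  show "C j w \<in> D" using D2_C[OF j w] .
  have "T (C j w) = C j (T w)"
    using w j by (simp add: T_eq C_add C_lm D2_C D_add D_lm C_comm[OF j] del: One_nat_def)
  then show "T (C j w) \<in> D" using D2_C[OF j T_D2(1)[OF w y]] by simp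
qed

lemma Q_C:
  assumes w: "w \<in> D2" and y: "Q s w \<in> D" and j: "j < 4"
  shows "Q s (C j w) = C j (Q s w)"
proof -
  have c2: "C j (C i (C i w)) = C i (C i (C j w))" if i: "i < 4" for i
  proof -
    have "C j (C i (C i w)) = C i (C j (C i w))" using C_comm[OF j i C_D2[OF w y i]] .
    also have "C j (C i w) = C i (C j w)" using C_comm[OF j i w] .
    finally show ?thesis .
  qed
  have d: "C i (C i w) \<in> D" if "i < 4" for i using D2_C[OF that C_D2[OF w y that]] .
  show ?thesis
    using w j by (simp add: Q_eq C_add C_diff C_lm C_scaleR D2_C D2_D D_add D_diff D_lm D_scaleR d c2 C_comm[OF j _ w] del: One_nat_def)
qed

lemma R_C: "out s \<Longrightarrow> v \<in> D \<Longrightarrow> j < 4 \<Longrightarrow> R s (C j v) = C j (R s v)"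
  by (rule R_unique) (simp_all add: C_D2[where s = s] R_D2 Q_R Q_C)

text \<open>Formally \<open>Q s\<close> and \<open>Q p\<close> commute; the work lies in the
  domains. Once \<open>Q p w\<close> is seen to be in \<open>D2\<close>, applying \<open>Q s\<close>
  to it gives v and identifies it as \<open>R s v\<close>.\<close>

lemma QR_swap:
  assumes s: "out s" and p: "out p" and c: "qmul s p = qmul p s"
  shows "Q p (R s (R p v)) = R s v"
proof -
  define x where "x = R p v"
  have x: "x \<in> D2" "x \<in> D" "Q p x = v" using R_D2[OF p] Q_R[OF p] D2_D by (auto simp: x_def)
  define w where "w = R s x"
  have w: "w \<in> D2" "Q s w = x" using R_D2[OF s] Q_R[OF s] by (auto simp: w_def)
  have C0w: "C 0 w \<in> D2" using C_D2[OF w(1), of s 0] w x by simp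
  have cc: "qmul (qmul (p - s) (p + s)) s = qmul s (qmul (p - s) (p + s))" "qmul (p - s) s = qmul s (p - s)"
  proof -
    show 2: "qmul (p - s) s = qmul s (p - s)" using c by (simp add: qmul_diff)
    have "qmul (p + s) s = qmul s (p + s)" using c by (simp add: qmul_add)
    then show "qmul (qmul (p - s) (p + s)) s = qmul s (qmul (p - s) (p + s))" using 2 by (metis qmul_assoc)
  qed
  \<comment> \<open>Writes \<open>Q p w\<close> as x plus first order terms in w, each of which lies
    in \<open>D2\<close>, so that \<open>Q s\<close> may be applied.\<close>
  have e: "Q p w = x + (lm (qmul (p - s) (p + s)) w - 2 *\<^sub>R lm (p - s) (C 0 w))"
    using Q_diff_param[OF c, of w] w by (simp add: algebra_simps)
  have d: "lm (qmul (p - s) (p + s)) w - 2 *\<^sub>R lm (p - s) (C 0 w) \<in> D2"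
    by (intro D2_diff D2_scaleR D2_lm w C0w)
  have "Q s (Q p w) = Q s x + (lm (qmul (p - s) (p + s)) x - 2 *\<^sub>R lm (p - s) (C 0 x))"
    using w x C0w d Q_C[of w s 0]
    by (simp add: e Q_add Q_diff Q_scaleR D2_lm D2_scaleR Q_lm[where s = s and s' = s, OF _ cc(1)] Q_lm[where s = s and s' = s, OF _ cc(2)])
  also have "\<dots> = v" using Q_diff_param[OF c, of x] x by (simp add: algebra_simps)
  finally have "Q s (Q p w) = v" .
  moreover have "Q p w \<in> D2" unfolding e by (intro D2_add x d)
  ultimately have "R s v = Q p w" by (intro R_unique[OF s])
  then show ?thesis by (simp add: w_def x_def)
qed

lemma R_commute:
  assumes s: "out s" and p: "out p" and c: "qmul s p = qmul p s"
  shows "R s (R p v) = R p (R s v)"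
  using QR_swap[OF assms, of v] R_Q[OF p R_D2[OF s, of "R p v"]] by simp

end

section \<open>Bounds and commutation relations for the resolvents\<close>

locale sectorial_calculus = sectorial_pair lm rm D C \<omega>
  for lm rm :: "quat \<Rightarrow> 'v::banach \<Rightarrow> 'v" and D C \<omega> +
  fixes \<theta> :: real
  assumes theta: "\<omega> < \<theta>" "\<theta> < pi"
begin

text \<open>\<open>\<phi>\<close> is the angle of the path in \<open>S_calc\<close> and
  \<open>H_calc\<close>; \<open>\<psi>\<close> lies strictly between \<omega> and
  \<open>\<phi>\<close>, so the resolvents are controlled on both sides of the path.\<close>

definition "\<phi> = (\<omega> + \<theta>) / 2"
definition "\<psi> = (\<omega> + \<phi>) / 2"

lemma angles: "0 < \<psi>" "\<omega> < \<psi>" "\<psi> < \<phi>" "\<phi> < \<theta>" "\<psi> < pi" "\<phi> < pi"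
  using omega theta by (auto simp: \<psi>_def \<phi>_def field_simps)

lemma Om_psi: "c \<in> Om \<psi> \<Longrightarrow> c \<noteq> 0" "c \<in> Om \<psi> \<Longrightarrow> cnj c \<in> Om \<psi>"
  by (auto simp: Om_def)

lemma out_qc: assumes c: "c \<in> Om \<psi>" shows "out (qc c)" "qc c \<notin> sector \<psi>" "qc c \<noteq> 0"
proof -
  have "cos \<psi> \<le> cos \<omega>" using angles omega by (intro cos_monotone_0_pi_le) auto
  then have "norm c * cos \<psi> \<le> norm c * cos \<omega>" by (intro mult_left_mono) auto
  then show "out (qc c)" using c by (simp add: Om_def norm_qc) (simp add: qc_def)
  have "fst (qc c) < norm (qc c) * cos \<psi>" using c by (simp add: Om_def norm_qc) (simp add: qc_def)
  then show "qc c \<notin> sector \<psi>" using angles by (simp add: sector_eq)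
  show "qc c \<noteq> 0" using Om_psi(1)[OF c] norm_qc[of c] by auto
qed

lemma S_resolvent_bound:
  obtains K where "K \<ge> 0" "\<And>c v. c \<in> Om \<psi> \<Longrightarrow> norm (SLres lm D C (qc c) v) \<le> K / norm c * norm v"
    "\<And>c v. c \<in> Om \<psi> \<Longrightarrow> norm (SLres lm D (kconj C) (qc c) v) \<le> K / norm c * norm v"
proof -
  from typeT obtain K1 where K1: "\<And>s v. s \<notin> sector \<psi> \<Longrightarrow> s \<noteq> 0 \<Longrightarrow> norm (SLres lm D C s v) \<le> K1 / norm s * norm v"
    using angles unfolding of_type_def by meson
  from typeTbar obtain K2 where K2: "\<And>s v. s \<notin> sector \<psi> \<Longrightarrow> s \<noteq> 0 \<Longrightarrow> norm (SLres lm D (kconj C) s v) \<le> K2 / norm s * norm v"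
    using angles unfolding of_type_def by meson
  have le: "k / norm c * norm v \<le> max 0 (max K1 K2) / norm c * norm v" if "k \<le> max K1 K2" for k and c :: complex and v :: 'v
    using that by (intro mult_right_mono divide_right_mono) auto
  show ?thesis
    by (rule that[of "max 0 (max K1 K2)"];
        (rule order_trans[OF _ le], rule K1[of "qc _", unfolded norm_qc] K2[of "qc _", unfolded norm_qc])?)
       (auto simp: out_qc)
qed

lemma resolvent_bounds:
  obtains K where "K \<ge> 0" "\<And>c v. c \<in> Om \<psi> \<Longrightarrow> norm (R (qc c) v) \<le> K / (norm c)\<^sup>2 * norm v"
    "\<And>c v i. c \<in> Om \<psi> \<Longrightarrow> i < 4 \<Longrightarrow> norm (C i (R (qc c) v)) \<le> K / norm c * norm v"
proof -
  obtain K where K: "K \<ge> 0" and KS: "\<And>c v. c \<in> Om \<psi> \<Longrightarrow> norm (SLres lm D C (qc c) v) \<le> K / norm c * norm v"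
    "\<And>c v. c \<in> Om \<psi> \<Longrightarrow> norm (SLres lm D (kconj C) (qc c) v) \<le> K / norm c * norm v"
    using S_resolvent_bound by blast
  \<comment> \<open>The S-resolvents of T and of its conjugate are M + N and M - N: \<open>N\<close>
    collects the terms whose sign changes. Half the sum and half the difference bound both.\<close>
  define M where "M c v = lm (qc c) (R (qc c) v) - C 0 (R (qc c) v)" for c v
  define N where "N c v = lm (qe 1) (C 1 (R (qc c) v)) + lm (qe 2) (C 2 (R (qc c) v)) + lm (qe 3) (C 3 (R (qc c) v))" for c v
  have SL: "SLres lm D C (qc c) v = M c v + N c v" "SLres lm D (kconj C) (qc c) v = M c v - N c v" if "c \<in> Om \<psi>" for c v
    using R_conj[OF out_qc(1)[OF that]] by (simp_all add: SLres_def M_def N_def kcop_def kconj_def lm_minus algebra_simps)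
  have MN: "norm (M c v) \<le> K / norm c * norm v" "norm (N c v) \<le> K / norm c * norm v" if c: "c \<in> Om \<psi>" for c v
  proof -
    have "2 *\<^sub>R M c v = (M c v + N c v) + (M c v - N c v)" "2 *\<^sub>R N c v = (M c v + N c v) - (M c v - N c v)"
      by (simp_all add: scaleR_2)
    then have "norm (2 *\<^sub>R M c v) \<le> norm (M c v + N c v) + norm (M c v - N c v)" "norm (2 *\<^sub>R N c v) \<le> norm (M c v + N c v) + norm (M c v - N c v)"
      by (simp_all only: norm_triangle_ineq norm_triangle_ineq4)
    then show "norm (M c v) \<le> K / norm c * norm v" "norm (N c v) \<le> K / norm c * norm v"
      using KS[OF c, of v] by (simp_all add: SL[OF c])
  qed
  have lm1: "norm (lm (qe l) x) \<le> norm x" for l x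
    using lm_norm[of "qe l" x] by (simp add: qe_def norm_quat split: if_splits)
  have Cl: "norm (C l (R (qc c) v)) \<le> K / norm c * norm v" if c: "c \<in> Om \<psi>" and l: "l \<in> {1, 2, 3}" for c v l
  proof -
    \<comment> \<open>The unit e_l passes the point of the slice unchanged for l = 1 and conjugates
      it for l = 2 and l = 3; the bound depends only on the modulus.\<close>
    define p where "p = (if l = 1 then c else cnj c)"
    have p: "p \<in> Om \<psi>" "norm p = norm c" using c Om_psi(2)[OF c] by (simp_all add: p_def)
    have qp: "qmul (qe l) (qc c) = qmul (qc p) (qe l)" using l by (auto simp: p_def qmul_def qe_def qc_def)
    have Rp: "R (qc p) (lm (qe l) v) = lm (qe l) (R (qc c) v)" by (rule R_lm[OF out_qc(1)[OF c] out_qc(1)[OF p(1)] qp])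
    have xD: "R (qc c) v \<in> D" by (rule D2_D[OF R_D2[OF out_qc(1)[OF c]]])
    have Np: "N p (lm (qe l) v) = lm (qe 1) (lm (qe l) (C 1 (R (qc c) v))) + lm (qe 2) (lm (qe l) (C 2 (R (qc c) v))) + lm (qe 3) (lm (qe l) (C 3 (R (qc c) v)))"
      by (simp add: N_def Rp C_lm xD del: One_nat_def)
    \<comment> \<open>e_l e_k e_l is e_k for k different from l and - e_l for k = l, so only the
      component l survives the subtraction.\<close>
    have "N c v - lm (qe l) (N p (lm (qe l) v)) = 2 *\<^sub>R lm (qe l) (C l (R (qc c) v))"
      unfolding Np unfolding N_def using l
      by (elim insertE emptyE) (simp_all add: lm_add lm_diff lm_units scaleR_2 lm_minus del: One_nat_def)
    then have "2 * norm (lm (qe l) (C l (R (qc c) v))) = norm (N c v - lm (qe l) (N p (lm (qe l) v)))" by simp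
    also have "\<dots> \<le> norm (N c v) + norm (N p (lm (qe l) v))" using norm_triangle_ineq4 lm1 by (meson add_left_mono order_trans)
    also have "\<dots> \<le> K / norm c * norm v + K / norm c * norm v"
      using MN(2)[OF c, of v] MN(2)[OF p(1), of "lm (qe l) v"] mult_left_mono[OF lm1[of l v], of "K / norm c"] K
      unfolding p(2) by (intro add_mono) auto
    finally have "norm (lm (qe l) (C l (R (qc c) v))) \<le> K / norm c * norm v" by simp
    moreover have "norm (C l (R (qc c) v)) = norm (lm (qe l) (lm (qe l) (C l (R (qc c) v))))"
      using l by (elim insertE emptyE) (simp_all add: lm_units del: One_nat_def)
    ultimately show ?thesis using lm1[of l "lm (qe l) (C l (R (qc c) v))"] by linarith
  qed
  have RB: "norm (R (qc c) v) \<le> 4 * K\<^sup>2 / (norm c)\<^sup>2 * norm v" if c: "c \<in> Om \<psi>" for c v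
  proof -
    note o = out_qc(1)[OF c]
    define x where "x = R (qc c) v"
    define w where "w = R (qc c) x"
    have x: "x \<in> D2" "x \<in> D" using R_D2[OF o] D2_D by (auto simp: x_def)
    have w: "w \<in> D2" "w \<in> D" "Q (qc c) w = x" using R_D2[OF o] D2_D Q_R[OF o] by (auto simp: w_def)
    have Cw: "C j w = R (qc c) (C j x)" if "j < 4" for j using R_C[OF o x(2) that] by (simp add: w_def)
    have Cx: "C j (R (qc c) (C j x)) = C j (C j w)" if "j < 4" for j using Cw[OF that] by simp
    have RM: "R (qc c) (M c v) = lm (qc c) w - C 0 w"
      using R_lm[OF o o, of "qc c" x] Cw[of 0] by (simp add: M_def R_diff[OF o] flip: x_def w_def)
    have MM: "M c (M c v) = lm (qmul (qc c) (qc c)) w - 2 *\<^sub>R lm (qc c) (C 0 w) + C 0 (C 0 w)"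
      unfolding M_def[of c "M c v"] RM using w
      by (simp add: lm_diff C_diff D_lm D2_C C_lm lm_mult scaleR_2)
    \<comment> \<open>The equation Q w = x with w = R (R v), regrouped: x is a sum of four terms,
      each the product of two operators of size K / norm c applied to v. Hence the constant 4 and
      the square.\<close>
    have "x = M c (M c v) + C 1 (R (qc c) (C 1 x)) + C 2 (R (qc c) (C 2 x)) + C 3 (R (qc c) (C 3 x))"
      using w(3) by (simp add: MM Cx Q_eq add_ac del: One_nat_def)
    then have "norm x \<le> norm (M c (M c v)) + norm (C 1 (R (qc c) (C 1 x))) + norm (C 2 (R (qc c) (C 2 x))) + norm (C 3 (R (qc c) (C 3 x)))"
      by (metis (no_types, lifting) norm_triangle_mono norm_triangle_ineq order_refl)
    also have "\<dots> \<le> K / norm c * (K / norm c * norm v) + K / norm c * (K / norm c * norm v) + K / norm c * (K / norm c * norm v) + K / norm c * (K / norm c * norm v)"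
    proof -
      have n: "K / norm c \<ge> 0" using K by simp
      have "norm (C l (R (qc c) (C l x))) \<le> K / norm c * (K / norm c * norm v)" if "l \<in> {1, 2, 3}" for l
        by (rule order_trans[OF Cl[OF c that] mult_left_mono[OF _ n]]) (use Cl[OF c that, of v] in \<open>simp add: x_def\<close>)
      moreover have "norm (M c (M c v)) \<le> K / norm c * (K / norm c * norm v)"
        by (rule order_trans[OF MN(1)[OF c] mult_left_mono[OF MN(1)[OF c] n]])
      ultimately show ?thesis by (intro add_mono) simp_all
    qed
    finally show ?thesis by (simp add: x_def power2_eq_square field_simps)
  qed
  have C0: "norm (C 0 (R (qc c) v)) \<le> (4 * K\<^sup>2 + K) / norm c * norm v" if c: "c \<in> Om \<psi>" for c v
  proof -
    have c0: "norm c > 0" using Om_psi(1)[OF c] by simp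
    have "C 0 (R (qc c) v) = lm (qc c) (R (qc c) v) - M c v" by (simp add: M_def)
    then have "norm (C 0 (R (qc c) v)) \<le> norm (lm (qc c) (R (qc c) v)) + norm (M c v)" using norm_triangle_ineq4 by metis
    also have "\<dots> \<le> norm c * (4 * K\<^sup>2 / (norm c)\<^sup>2 * norm v) + K / norm c * norm v"
      using lm_norm[of "qc c" "R (qc c) v"] mult_left_mono[OF RB[OF c, of v], of "norm c"] MN(1)[OF c, of v]
      unfolding norm_qc by (intro add_mono) auto
    also have "\<dots> = (4 * K\<^sup>2 + K) / norm c * norm v" using c0 by (simp add: field_simps power2_eq_square)
    finally show ?thesis .
  qed
  have mono: "a / b * norm v \<le> (4 * K\<^sup>2 + K) / b * norm v" if "a \<le> 4 * K\<^sup>2 + K" "b \<ge> 0" for a b :: real and v :: 'v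
    using that by (intro mult_right_mono divide_right_mono) auto
  show ?thesis
  proof (rule that[of "4 * K\<^sup>2 + K"])
    show "norm (R (qc c) v) \<le> (4 * K\<^sup>2 + K) / (norm c)\<^sup>2 * norm v" if "c \<in> Om \<psi>" for c v
      by (rule order_trans[OF RB[OF that] mono]) (use K in auto)
    show "norm (C i (R (qc c) v)) \<le> (4 * K\<^sup>2 + K) / norm c * norm v" if c: "c \<in> Om \<psi>" and i: "i < 4" for c v i
    proof (cases "i = 0")
      case True then show ?thesis using C0[OF c] by simp
    next
      case False
      then have "i \<in> {1, 2, 3}" using i by auto
      then show ?thesis by (rule order_trans[OF Cl[OF c] mono]) (use K in auto)
    qed
  qed (use K in simp)
qed

lemma R_bounded_linear: "c \<in> Om \<psi> \<Longrightarrow> bounded_linear (R (qc c))"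
  and CR_bounded_linear: "c \<in> Om \<psi> \<Longrightarrow> i < 4 \<Longrightarrow> bounded_linear (\<lambda>v. C i (R (qc c) v))"
proof -
  assume c: "c \<in> Om \<psi>"
  note o = out_qc(1)[OF c]
  obtain K where K: "\<And>v. norm (R (qc c) v) \<le> K / (norm c)\<^sup>2 * norm v"
    "\<And>i v. i < 4 \<Longrightarrow> norm (C i (R (qc c) v)) \<le> K / norm c * norm v" using resolvent_bounds c by metis
  show "bounded_linear (R (qc c))"
    by (rule bounded_linear_intro[where K = "K / (norm c)\<^sup>2"]) (use K in \<open>simp_all add: R_add[OF o] R_scaleR[OF o] mult.commute\<close>)
  show "bounded_linear (\<lambda>v. C i (R (qc c) v))" if "i < 4"
    by (rule bounded_linear_intro[where K = "K / norm c"])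
       (use K that in \<open>simp_all add: R_add[OF o] R_scaleR[OF o] C_add C_scaleR D2_D R_D2[OF o] mult.commute\<close>)
qed

definition "LL a = endo (lm a)"
definition "qq c = endo (R (qc c))"
definition "ww i c = endo (\<lambda>v. C i (R (qc c) v))"

lemma ap_LL: "ap (LL a) v = lm a v" by (simp add: LL_def ap_endo lm_bounded_linear)
lemma ap_qq: "c \<in> Om \<psi> \<Longrightarrow> ap (qq c) v = R (qc c) v" by (simp add: qq_def ap_endo R_bounded_linear)
lemma ap_ww: "c \<in> Om \<psi> \<Longrightarrow> i < 4 \<Longrightarrow> ap (ww i c) v = C i (R (qc c) v)" by (simp add: ww_def ap_endo CR_bounded_linear)

lemma quat_rep_LL: "quat_rep LL"
  by standard ((rule endo_eqI norm_endo_le; simp add: ap_LL lm_addl lm_mult lm_real lm_norm)+)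

lemma iota_LL: "quat_rep.\<iota> LL z = LL (qc z)" and jj_LL: "quat_rep.jj LL = LL (qe 2)"
  by (simp_all add: quat_rep.\<iota>_def[OF quat_rep_LL] quat_rep.jj_def[OF quat_rep_LL] qc_def zero_prod_def)

lemma qc_commute: "qmul (qc a) (qc b) = qmul (qc b) (qc a)" and qc_mult: "qmul (qc a) (qc b) = qc (a * b)"
  and qc_add: "qc (a + b) = qc a + qc b" and qc_diff: "qc (a - b) = qc a - qc b"
  by (simp_all add: qc_def qmul_def zero_prod_def)

text \<open>Every identity is checked on \<open>w = R s (R p v)\<close>, which recovers \<open>R p v = Q s w\<close> and \<open>R s v = Q p w\<close>.\<close>
lemma two_point:
  assumes s: "s \<in> Om \<psi>" and p: "p \<in> Om \<psi>"
  obtains w where "w = R (qc s) (R (qc p) v)" "w = R (qc p) (R (qc s) v)" "w \<in> D2" "w \<in> D" "R (qc p) v = Q (qc s) w" "R (qc s) v = Q (qc p) w"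
    "\<And>i. i < 4 \<Longrightarrow> C i w \<in> D2" "\<And>i. i < 4 \<Longrightarrow> C i w \<in> D"
    "\<And>i. i < 4 \<Longrightarrow> R (qc s) (C i (R (qc p) v)) = C i w" "\<And>i. i < 4 \<Longrightarrow> R (qc p) (C i (R (qc s) v)) = C i w"
proof (rule that[OF refl])
  note os = out_qc(1)[OF s] and op = out_qc(1)[OF p]
  let ?w = "R (qc s) (R (qc p) v)"
  show sym: "?w = R (qc p) (R (qc s) v)" by (rule R_commute[OF os op qc_commute])
  show w: "?w \<in> D2" "?w \<in> D" using R_D2[OF os] D2_D by auto
  show Qw: "R (qc p) v = Q (qc s) ?w" by (simp add: Q_R[OF os])
  show "R (qc s) v = Q (qc p) ?w" by (simp add: Q_R[OF op] sym)
  have xD: "R (qc p) v \<in> D" "R (qc s) v \<in> D" using R_D2[OF op] R_D2[OF os] D2_D by auto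
  fix i :: nat assume i: "i < 4"
  show "C i ?w \<in> D2" by (rule C_D2[OF w(1) _ i, of "qc s"]) (use Qw xD in simp)
  then show "C i ?w \<in> D" by (rule D2_D)
  show "R (qc s) (C i (R (qc p) v)) = C i ?w" by (rule R_C[OF os xD(1) i])
  show "R (qc p) (C i (R (qc s) v)) = C i ?w" unfolding sym by (rule R_C[OF op xD(2) i])
qed

text \<open>Applied to v, both sides become expressions in the components acting on the one vector w
  of \<open>two_point\<close>; the difference \<open>Q (qc p) w - Q (qc s) w\<close> supplies the
  factor p - s.\<close>

lemma Q_family_relations:
  assumes s: "s \<in> Om \<psi>" and p: "p \<in> Om \<psi>"
  shows "qq s * qq p = qq p * qq s"
    and "qq s - qq p = LL (qc (p - s)) * (LL (qc (p + s)) * (qq s * qq p) - 2 *\<^sub>R (ww 0 s * qq p))"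
    and "LL (qc s) * qq s - LL (qc p) * qq p = LL (qc (p - s)) * (LL (qc (s * p)) * (qq s * qq p) - (\<Sum>i<4. ww i s * ww i p))"
    and "i < 4 \<Longrightarrow> ww i s * qq p = qq p * ww i s" and "i < 4 \<Longrightarrow> ww i s * qq p = qq s * ww i p"
    and "i < 4 \<Longrightarrow> ww i s - ww i p = LL (qc (p - s)) * (LL (qc (p + s)) * (ww i s * qq p) - 2 *\<^sub>R (ww 0 s * ww i p))"
    and "i < 4 \<Longrightarrow> k < 4 \<Longrightarrow> ww i s * ww k p = ww k p * ww i s" and "i < 4 \<Longrightarrow> k < 4 \<Longrightarrow> ww i s * ww k p = ww k s * ww i p"
proof -
    note os = out_qc(1)[OF s]
    note S = ap_qq[OF s] ap_qq[OF p] ap_ww[OF s] ap_ww[OF p] ap_LL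
    note sp = two_point[OF s p]
    show "qq s * qq p = qq p * qq s"
      by (rule endo_eqI) (simp add: S R_commute[OF os out_qc(1)[OF p] qc_commute])
    have Qd: "Q (qc p) w - Q (qc s) w = lm (qc (p - s)) (lm (qc (p + s)) w - 2 *\<^sub>R C 0 w)" for w
      using Q_diff_param[where v = w and s = "qc s" and p = "qc p", OF qc_commute] by (simp add: qc_diff qc_add lm_mult lm_diff lm_scaleR)
    show "qq s - qq p = LL (qc (p - s)) * (LL (qc (p + s)) * (qq s * qq p) - 2 *\<^sub>R (ww 0 s * qq p))"
    proof (rule endo_eqI)
      fix v obtain w where w: "w = R (qc s) (R (qc p) v)" "R (qc p) v = Q (qc s) w" "R (qc s) v = Q (qc p) w" by (rule sp[of v])
      show "ap (qq s - qq p) v = ap (LL (qc (p - s)) * (LL (qc (p + s)) * (qq s * qq p) - 2 *\<^sub>R (ww 0 s * qq p))) v"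
        using Qd[of w] by (simp add: S flip: w(1)) (simp add: w(2,3))
    qed
    show "LL (qc s) * qq s - LL (qc p) * qq p = LL (qc (p - s)) * (LL (qc (s * p)) * (qq s * qq p) - (\<Sum>i<4. ww i s * ww i p))"
    proof (rule endo_eqI)
      fix v obtain w where w: "w = R (qc s) (R (qc p) v)" "R (qc p) v = Q (qc s) w" "R (qc s) v = Q (qc p) w"
        and Cw: "\<And>i. i < 4 \<Longrightarrow> R (qc s) (C i (R (qc p) v)) = C i w" by (rule sp[of v]) blast
      have "lm (qc s) (Q (qc p) w) - lm (qc p) (Q (qc s) w) = lm (qc (p - s)) (lm (qc (s * p)) w - (C 0 (C 0 w) + C 1 (C 1 w) + C 2 (C 2 w) + C 3 (C 3 w)))"
      proof -
        have l: "lm (qc a) (lm (qc b) x) = lm (qc (a * b)) x" for a b x by (simp add: qc_mult flip: lm_mult)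
        have "lm (qc (p - s)) (lm (qc (s * p)) w) = lm (qc (s * (p * p))) w - lm (qc (p * (s * s))) w"
          by (simp add: l algebra_simps qc_diff lm_diffl)
        moreover have "lm (qc s) (lm (qc p) x) = lm (qc p) (lm (qc s) x)" for x by (simp add: l mult.commute)
        ultimately show ?thesis
          by (simp add: Q_eq lm_add lm_diff lm_scaleR l qc_mult del: One_nat_def) (simp add: qc_diff lm_diffl algebra_simps del: One_nat_def)
      qed
      then show "ap (LL (qc s) * qq s - LL (qc p) * qq p) v = ap (LL (qc (p - s)) * (LL (qc (s * p)) * (qq s * qq p) - (\<Sum>i<4. ww i s * ww i p))) v"
        by (simp add: S ap_sum sum_upto_3 Cw del: One_nat_def flip: w(1)) (simp add: w(2,3) del: One_nat_def)
    qed
    have X: "ap (ww i s * qq p) v = ap (qq p * ww i s) v \<and> ap (ww i s * qq p) v = ap (qq s * ww i p) v" if i: "i < 4" for v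
    proof -
      obtain w where "w = R (qc s) (R (qc p) v)" "w = R (qc p) (R (qc s) v)" "R (qc s) (C i (R (qc p) v)) = C i w" "R (qc p) (C i (R (qc s) v)) = C i w"
        by (rule sp[of v]) (use i in blast)
      then show ?thesis by (simp add: S i)
    qed
    show "ww i s * qq p = qq p * ww i s" if "i < 4" using X[OF that] by (intro endo_eqI) (rule conjunct1)
    show "ww i s * qq p = qq s * ww i p" if "i < 4" using X[OF that] by (intro endo_eqI) (rule conjunct2)
    show "ww i s - ww i p = LL (qc (p - s)) * (LL (qc (p + s)) * (ww i s * qq p) - 2 *\<^sub>R (ww 0 s * ww i p))" if i: "i < 4"
    proof (rule endo_eqI)
      fix v obtain w where w: "w = R (qc s) (R (qc p) v)" "R (qc p) v = Q (qc s) w" "R (qc s) v = Q (qc p) w" and wD: "w \<in> D2" "w \<in> D"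
        and CD: "\<And>i. i < 4 \<Longrightarrow> C i w \<in> D" and Cw: "\<And>i. i < 4 \<Longrightarrow> R (qc s) (C i (R (qc p) v)) = C i w" by (rule sp[of v]) blast
      have d: "Q (qc s) w \<in> D" "Q (qc p) w \<in> D" using w(2,3) D2_D[OF R_D2[OF os]] D2_D[OF R_D2[OF out_qc(1)[OF p]]] by metis+
      have "C i (Q (qc p) w - Q (qc s) w) = lm (qc (p - s)) (lm (qc (p + s)) (C i w) - 2 *\<^sub>R C 0 (C i w))"
        unfolding Qd using wD CD i C_comm[OF i _ wD(1), of 0] by (simp add: C_lm C_diff C_scaleR D_lm D_diff D_scaleR)
      then have "C i (Q (qc p) w) - C i (Q (qc s) w) = lm (qc (p - s)) (lm (qc (p + s)) (C i w) - 2 *\<^sub>R C 0 (C i w))"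
        using C_diff[OF i d(2,1)] by simp
      then show "ap (ww i s - ww i p) v = ap (LL (qc (p - s)) * (LL (qc (p + s)) * (ww i s * qq p) - 2 *\<^sub>R (ww 0 s * ww i p))) v"
        by (simp add: S i Cw flip: w(1)) (simp add: w(2,3))
    qed
    have Y: "ap (ww i s * ww k p) v = ap (ww k p * ww i s) v \<and> ap (ww i s * ww k p) v = ap (ww k s * ww i p) v" if i: "i < 4" and k: "k < 4" for v
    proof -
      obtain w where "w \<in> D2" "R (qc s) (C i (R (qc p) v)) = C i w" "R (qc p) (C i (R (qc s) v)) = C i w"
        "R (qc s) (C k (R (qc p) v)) = C k w" "R (qc p) (C k (R (qc s) v)) = C k w"
      proof (rule sp[of v], goal_cases)
        case (1 w) from 1(1)[OF 1(4) 1(10)[OF i] 1(11)[OF i] 1(10)[OF k] 1(11)[OF k]] show ?case .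
      qed
      then show ?thesis using C_comm[OF i k, of w] by (simp add: S i k)
    qed
    show "ww i s * ww k p = ww k p * ww i s" if "i < 4" "k < 4" using Y[OF that] by (intro endo_eqI) (rule conjunct1)
    show "ww i s * ww k p = ww k s * ww i p" if "i < 4" "k < 4" using Y[OF that] by (intro endo_eqI) (rule conjunct2)
qed

lemma Q_calculus_ex: "\<exists>K. Q_calculus LL qq ww \<psi> K \<phi> \<theta>"
proof -
  obtain K where K: "K \<ge> 0" "\<And>c v. c \<in> Om \<psi> \<Longrightarrow> norm (R (qc c) v) \<le> K / (norm c)\<^sup>2 * norm v"
    "\<And>c v i. c \<in> Om \<psi> \<Longrightarrow> i < 4 \<Longrightarrow> norm (C i (R (qc c) v)) \<le> K / norm c * norm v"
    using resolvent_bounds by blast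
  have "Q_calculus LL qq ww \<psi> K \<phi> \<theta>"
  proof (intro_locales, rule quat_rep_LL, unfold_locales, unfold iota_LL jj_LL)
    show "0 < \<psi>" "\<psi> < pi" "\<psi> < \<phi>" "\<phi> < \<theta>" "\<theta> < pi" using angles theta by auto
    show "0 \<le> K" by (rule K)
    fix s assume s: "s \<in> Om \<psi>"
    note os = out_qc(1)[OF s]
    show "norm (qq s) \<le> K / (norm s)\<^sup>2" by (rule norm_endo_le) (use K s in \<open>simp_all add: ap_qq\<close>)
    show "qq s * LL (qc c) = LL (qc c) * qq s" for c
      by (rule endo_eqI) (simp add: ap_qq s ap_LL R_lm[OF os os qc_commute])
    have j: "qmul (qe 2) (qc (cnj s)) = qmul (qc s) (qe 2)" by (simp add: qmul_def qe_def qc_def)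
    note oc = out_qc(1)[OF Om_psi(2)[OF s]]
    show "qq s * LL (qe 2) = LL (qe 2) * qq (cnj s)"
      by (rule endo_eqI) (simp add: ap_qq s Om_psi ap_LL R_lm[OF oc os j])
    {
      fix i :: nat assume i: "i < 4"
      show "norm (ww i s) \<le> K / norm s" by (rule norm_endo_le) (use K s i in \<open>simp_all add: ap_ww\<close>)
      show "ww i s * LL (qc c) = LL (qc c) * ww i s" for c
        by (rule endo_eqI) (simp add: ap_ww s i ap_LL R_lm[OF os os qc_commute] C_lm D2_D R_D2[OF os])
      show "ww i s * LL (qe 2) = LL (qe 2) * ww i (cnj s)"
        by (rule endo_eqI) (simp add: ap_ww s i Om_psi ap_LL R_lm[OF oc os j] C_lm D2_D R_D2[OF oc])
    }
  qed (rule Q_family_relations; assumption)+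
  then show ?thesis ..
qed

end

section \<open>The functional calculi\<close>

lemma has_integral_reflect_UNIV:
  fixes f :: "real \<Rightarrow> 'b::banach"
  assumes "(f has_integral i) UNIV" shows "((\<lambda>x. f (- x)) has_integral i) UNIV"
proof -
  note f = assms[unfolded has_integral_alt'[where s = UNIV]]
  show ?thesis unfolding has_integral_alt'[where s = UNIV]
  proof (intro conjI allI impI)
    fix a b :: real
    show "(\<lambda>x. if x \<in> UNIV then f (- x) else 0) integrable_on cbox a b"
      using f integrable_reflect[of f "- a" "- b"] by simp
  next
    fix e :: real assume "e > 0"
    then obtain B where B: "B > 0" "\<And>a b. ball 0 B \<subseteq> cbox a b \<Longrightarrow> norm (integral (cbox a b) (\<lambda>x. if x \<in> UNIV then f x else 0) - i) < e"
      using f by blast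
    have "norm (integral (cbox a b) (\<lambda>x. if x \<in> UNIV then f (- x) else 0) - i) < e" if "ball 0 B \<subseteq> cbox a b" for a b :: real
    proof -
      have "ball (0::real) B \<subseteq> cbox (- b) (- a)"
      proof
        fix x :: real assume "x \<in> ball 0 B"
        then have "- x \<in> cbox a b" using that by (auto simp: dist_norm subset_iff)
        then show "x \<in> cbox (- b) (- a)" by auto
      qed
      then show ?thesis using B(2)[of "- b" "- a"] integral_reflect[of "- a" "- b" f] by simp
    qed
    then show "\<exists>B>0. \<forall>a b. ball 0 B \<subseteq> cbox a b \<longrightarrow> norm (integral (cbox a b) (\<lambda>x. if x \<in> UNIV then f (- x) else 0) - i) < e"
      using B(1) by blast
  qed
qed

text \<open>The lines return to rays by t = exp x, and to the negative half-line by reflection; for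
  t < 0 the sign of 1 / t is the orientation of the upper line.\<close>

lemma rap_path_integral:
  assumes "rap \<phi> k"
  shows "((\<lambda>t. if t < 0 then (1 / t) *\<^sub>R k (Complex (ln (- t)) \<phi>) else (1 / t) *\<^sub>R k (Complex (ln t) (- \<phi>))) has_integral CI \<phi> k) (UNIV - {0})"
    (is "(?g has_integral _) _")
proof -
  have r: "rapid (\<lambda>x. k (Complex x (- \<phi>)))" "rapid (\<lambda>x. k (Complex x \<phi>))" using assms by (simp_all add: rap_def)
  have pos: "(?g has_integral integral UNIV (\<lambda>x. k (Complex x (- \<phi>)))) {0<..}"
    by (rule has_integral_eq[OF _ rapid_integral_log[OF r(1)]]) simp
  have "((\<lambda>t. if t \<in> {0<..} then (1 / t) *\<^sub>R k (Complex (ln t) \<phi>) else 0) has_integral integral UNIV (\<lambda>x. k (Complex x \<phi>))) UNIV"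
    unfolding has_integral_restrict_UNIV by (rule rapid_integral_log[OF r(2)])
  from has_integral_reflect_UNIV[OF this]
  have "((\<lambda>t. if t \<in> {..<0} then (1 / (- t)) *\<^sub>R k (Complex (ln (- t)) \<phi>) else 0) has_integral integral UNIV (\<lambda>x. k (Complex x \<phi>))) UNIV"
    by simp
  then have "((\<lambda>t. (1 / (- t)) *\<^sub>R k (Complex (ln (- t)) \<phi>)) has_integral integral UNIV (\<lambda>x. k (Complex x \<phi>))) {..<0}"
    unfolding has_integral_restrict_UNIV .
  from has_integral_neg[OF this]
  have neg: "(?g has_integral - integral UNIV (\<lambda>x. k (Complex x \<phi>))) {..<0}"
    by (rule has_integral_eq[rotated]) simp
  have CI: "CI \<phi> k = - integral UNIV (\<lambda>x. k (Complex x \<phi>)) + integral UNIV (\<lambda>x. k (Complex x (- \<phi>)))"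
    unfolding CI_def using Henstock_Kurzweil_Integration.integral_diff[OF rapid_integrable[OF r(1)] rapid_integrable[OF r(2)]] by simp
  have "(?g has_integral CI \<phi> k) ({..<0} \<union> {0<..})"
  proof -
    have "{..<0} \<inter> {0<..} = ({} :: real set)" by auto
    then show ?thesis unfolding CI by (intro has_integral_Un[OF neg pos]) simp
  qed
  moreover have "{..<0} \<union> {0<..} = UNIV - {0 :: real}" by auto
  ultimately show ?thesis by simp
qed

context Q_calculus begin

lemma Phi_cong: "(\<And>z. \<bar>Im z\<bar> = \<bar>\<phi>\<bar> \<Longrightarrow> f z = g z) \<Longrightarrow> \<Phi> \<phi> W f = \<Phi> \<phi> W g"
  unfolding \<Phi>_def by (rule arg_cong2[where f = times, OF refl], rule CI_cong) simp

lemma S_cong: "(\<And>z. \<bar>Im z\<bar> = \<bar>\<phi>\<bar> \<Longrightarrow> f z = g z) \<Longrightarrow> S \<sigma> f = S \<sigma> g"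
  unfolding S_def by (simp only: Phi_cong[of f g])

lemma S_zero: "S \<sigma> (\<lambda>z. 0) = 0" and A_zero: "A (\<lambda>z. 0) = 0"
  by (simp_all add: S_def \<Phi>_def CI_def)

text \<open>Pairs represent quaternion valued functions \<open>g\<^sub>1 + g\<^sub>2 e\<^sub>2\<close> on a slice.\<close>

definition SP :: "real \<Rightarrow> (complex \<Rightarrow> complex) \<times> (complex \<Rightarrow> complex) \<Rightarrow> 'a" where
  "SP \<sigma> g = S \<sigma> (fst g) + S \<sigma> (snd g) * jj"

definition AP :: "(complex \<Rightarrow> complex) \<times> (complex \<Rightarrow> complex) \<Rightarrow> 'a" where
  "AP g = A (fst g) + A (snd g) * jj"

abbreviation pair_mult :: "(complex \<Rightarrow> complex) \<Rightarrow> (complex \<Rightarrow> complex) \<times> (complex \<Rightarrow> complex) \<Rightarrow> (complex \<Rightarrow> complex) \<times> (complex \<Rightarrow> complex)" where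
  "pair_mult e g \<equiv> (\<lambda>z. e z * fst g z, \<lambda>z. e z * snd g z)"

abbreviation "E0P g \<equiv> E0 \<theta> (fst g) \<and> E0 \<theta> (snd g)"
abbreviation "E1P g \<equiv> E1 \<theta> (fst g) \<and> E1 \<theta> (snd g)"

lemma SP_cong: "(\<And>z. \<bar>Im z\<bar> = \<bar>\<phi>\<bar> \<Longrightarrow> fst f z = fst g z \<and> snd f z = snd g z) \<Longrightarrow> SP \<sigma> f = SP \<sigma> g"
  and AP_cong: "(\<And>z. \<bar>Im z\<bar> = \<bar>\<phi>\<bar> \<Longrightarrow> fst f z = fst g z \<and> snd f z = snd g z) \<Longrightarrow> AP f = AP g"
  unfolding SP_def AP_def using S_cong[of "fst f" "fst g" \<sigma>] S_cong[of "snd f" "snd g" \<sigma>] Phi_cong[of "fst f" "fst g" q] Phi_cong[of "snd f" "snd g" q]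
  by simp_all

lemma SP_mult:
  assumes "E0 \<theta> e" "conj_sym \<theta> e" "E0P g" "\<sigma> * \<sigma> = 1"
  shows "SP \<sigma> (pair_mult e g) = S \<sigma> e * SP \<sigma> g"
  unfolding SP_def fst_conv snd_conv using assms by (simp add: S_mult distrib_left mult.assoc)

lemma A_jj: "E1 \<theta> e \<Longrightarrow> conj_sym \<theta> e \<Longrightarrow> A e * jj = jj * A e"
  unfolding jj_def by (rule A_L)

lemma AP_product:
  assumes e: "E1 \<theta> e" "conj_sym \<theta> e" and g: "E1P g"
  shows "AP (pair_mult e g) = S (-1) e * AP g + SP 1 g * A e"
proof -
  have "AP (pair_mult e g) = S (-1) e * A (fst g) + S 1 (fst g) * A e + (S (-1) e * A (snd g) + S 1 (snd g) * A e) * jj"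
    unfolding AP_def fst_conv snd_conv using A_product[OF e] g by simp
  also have "\<dots> = S (-1) e * AP g + SP 1 g * A e"
    unfolding AP_def SP_def by (simp add: distrib_left distrib_right mult.assoc A_jj[OF e])
  finally show ?thesis .
qed

text \<open>This is \<open>S_diff_A\<close> carried over to pairs and rearranged: the combination
  e(T) A g - g(T) A e does not change when T is replaced by its conjugate.\<close>

lemma SP_diff_AP:
  assumes e: "E1 \<theta> e" "conj_sym \<theta> e" and g: "E1P g"
  shows "S (-1) e * AP g - SP (-1) g * A e = S 1 e * AP g - SP 1 g * A e"
proof -
  have "(S (-1) e - S 1 e) * AP g = (S (-1) e - S 1 e) * A (fst g) + (S (-1) e - S 1 e) * A (snd g) * jj"
    by (simp only: AP_def distrib_left mult.assoc)
  also have "\<dots> = (S (-1) (fst g) - S 1 (fst g)) * A e + (S (-1) (snd g) - S 1 (snd g)) * A e * jj"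
    using S_diff_A[OF e(1)] g by simp
  also have "\<dots> = (S (-1) (fst g) - S 1 (fst g)) * A e + (S (-1) (snd g) - S 1 (snd g)) * (jj * A e)"
    by (simp only: mult.assoc A_jj[OF e])
  also have "\<dots> = (SP (-1) g - SP 1 g) * A e"
    by (simp only: SP_def distrib_right left_diff_distrib mult.assoc add_diff_add)
  finally show ?thesis by (simp only: left_diff_distrib) (simp add: algebra_simps)
qed

text \<open>Think of g1 = f1 f and g2 = f2 f, so that f2 g1 = f1 g2. Both sides are expressed by the
  same \<open>Y\<close>, the value of f2 g1 at T, and the same \<open>Z = AP (f2 g1)\<close>, using
  the Leibniz rule to eliminate \<open>AP g1\<close> and \<open>AP g2\<close>.\<close>

lemma regularized_difference:
  assumes f1: "E1 \<theta> f1" "conj_sym \<theta> f1" and f2: "E1 \<theta> f2" "conj_sym \<theta> f2" and g: "E1P g1" "E1P g2"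
    and eq: "\<And>z. \<bar>Im z\<bar> < \<theta> \<Longrightarrow> f2 z * fst g1 z = f1 z * fst g2 z \<and> f2 z * snd g1 z = f1 z * snd g2 z"
  shows "S 1 f2 * S (-1) f2 * (S 1 f1 * AP g1 - SP 1 g1 * A f1) = S 1 f1 * S (-1) f1 * (S 1 f2 * AP g2 - SP 1 g2 * A f2)"
proof -
  have line: "\<bar>Im z\<bar> = \<bar>\<phi>\<bar> \<Longrightarrow> \<bar>Im z\<bar> < \<theta>" for z using psi phi by simp
  note E = E1_E0[OF f1(1)] E1_E0[OF f2(1)]
  define Y where "Y = SP 1 (pair_mult f2 g1)"
  define Z where "Z = AP (pair_mult f2 g1)"
  have Y': "Y = SP 1 (pair_mult f1 g2)" and Z': "Z = AP (pair_mult f1 g2)"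
    unfolding Y_def Z_def using eq line by (intro SP_cong AP_cong; simp)+
  have g0: "E0P g1" "E0P g2" using g E1_E0 by auto
  have SY: "S 1 f2 * SP 1 g1 = Y" "S 1 f1 * SP 1 g2 = Y"
    using SP_mult[OF E(2) f2(2) g0(1), of 1] SP_mult[OF E(1) f1(2) g0(2), of 1] by (simp_all add: Y_def flip: Y')
  have P1: "S (-1) f2 * AP g1 = Z - SP 1 g1 * A f2" using AP_product[OF f2 g(1), folded Z_def] by simp
  have P2: "S (-1) f1 * AP g2 = Z - SP 1 g2 * A f1" using AP_product[OF f1 g(2), folded Z'] by simp
  have c: "S \<sigma> a * S \<tau> b = S \<tau> b * S \<sigma> a" if "a \<in> {f1, f2}" "b \<in> {f1, f2}" for a b \<sigma> \<tau>
    using that E f1(2) f2(2) by (auto intro: S_comm)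
  \<comment> \<open>After the reduction to \<open>Y\<close> and \<open>Z\<close> the two sides
    differ exactly by this identity.\<close>
  have exch: "(S (-1) f1 - S 1 f1) * Y * A f2 = (S (-1) f2 - S 1 f2) * Y * A f1"
    unfolding Y_def SP_def fst_conv snd_conv
    by (rule S_diff_exch[OF f1 f2, of "\<lambda>z. f2 z * fst g1 z" "\<lambda>z. f2 z * snd g1 z"]) (use g0 E in \<open>auto intro: E0_mult\<close>)
  have L: "S 1 f2 * S (-1) f2 * (S 1 f1 * AP g1 - SP 1 g1 * A f1) = S 1 f1 * S 1 f2 * Z - S 1 f1 * Y * A f2 - S (-1) f2 * Y * A f1"
  proof -
    have "S 1 f2 * S (-1) f2 * (S 1 f1 * AP g1) = S 1 f2 * (S (-1) f2 * S 1 f1) * AP g1" by (simp only: mult.assoc)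
    also have "\<dots> = S 1 f2 * (S 1 f1 * S (-1) f2) * AP g1" using c[of f2 f1] by simp
    also have "\<dots> = S 1 f1 * S 1 f2 * (S (-1) f2 * AP g1)" using c[of f2 f1 1 1] by (simp flip: mult.assoc)
    also have "\<dots> = S 1 f1 * S 1 f2 * Z - S 1 f1 * (S 1 f2 * SP 1 g1) * A f2" by (simp only: P1 right_diff_distrib mult.assoc)
    finally have 1: "S 1 f2 * S (-1) f2 * (S 1 f1 * AP g1) = S 1 f1 * S 1 f2 * Z - S 1 f1 * Y * A f2" by (simp only: SY)
    have "S 1 f2 * S (-1) f2 * (SP 1 g1 * A f1) = S (-1) f2 * S 1 f2 * (SP 1 g1 * A f1)" using c[of f2 f2 1 "-1"] by simp
    also have "\<dots> = S (-1) f2 * (S 1 f2 * SP 1 g1) * A f1" by (simp only: mult.assoc)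
    finally show ?thesis by (simp only: 1 SY right_diff_distrib)
  qed
  have R: "S 1 f1 * S (-1) f1 * (S 1 f2 * AP g2 - SP 1 g2 * A f2) = S 1 f1 * S 1 f2 * Z - S 1 f2 * Y * A f1 - S (-1) f1 * Y * A f2"
  proof -
    have "S 1 f1 * S (-1) f1 * (S 1 f2 * AP g2) = S 1 f1 * (S (-1) f1 * S 1 f2) * AP g2" by (simp only: mult.assoc)
    also have "\<dots> = S 1 f1 * (S 1 f2 * S (-1) f1) * AP g2" using c[of f1 f2] by simp
    also have "\<dots> = S 1 f1 * S 1 f2 * (S (-1) f1 * AP g2)" by (simp only: mult.assoc)
    also have "\<dots> = S 1 f1 * S 1 f2 * Z - S 1 f1 * S 1 f2 * SP 1 g2 * A f1" by (simp only: P2 right_diff_distrib mult.assoc)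
    also have "S 1 f1 * S 1 f2 * SP 1 g2 = S 1 f2 * (S 1 f1 * SP 1 g2)" using c[of f1 f2 1 1] by (simp flip: mult.assoc)
    finally have 1: "S 1 f1 * S (-1) f1 * (S 1 f2 * AP g2) = S 1 f1 * S 1 f2 * Z - S 1 f2 * Y * A f1" by (simp only: SY)
    have "S 1 f1 * S (-1) f1 * (SP 1 g2 * A f2) = S (-1) f1 * S 1 f1 * (SP 1 g2 * A f2)" using c[of f1 f1 1 "-1"] by simp
    also have "\<dots> = S (-1) f1 * (S 1 f1 * SP 1 g2) * A f2" by (simp only: mult.assoc)
    finally show ?thesis by (simp only: 1 SY right_diff_distrib)
  qed
  show ?thesis unfolding L R using exch by (simp add: left_diff_distrib algebra_simps)
qed

lemma S_rho_power:
  assumes "\<sigma> * \<sigma> = 1" "k > 0"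
  shows "S \<sigma> (\<lambda>z. rho z ^ k) = S \<sigma> rho ^ k \<and> E0 \<theta> (\<lambda>z. rho z ^ k)"
  using assms(2)
proof (induction k rule: nat_induct_non_zero)
  case 1 then show ?case using E0_rho by simp
next
  case (Suc n)
  then show ?case using S_mult[OF E0_rho intr_rho _ assms(1), of "\<lambda>z. rho z ^ n"] E0_mult[OF E0_rho, of "\<lambda>z. rho z ^ n"] by simp
qed

end

section \<open>From the path integrals of the definitions to contour integrals in the strip\<close>

lemma quat_split: "q = qc (cpart1 q) + qmul (qc (cpart2 q)) (qe 2)"
  by (cases q) (simp add: qc_def cpart1_def cpart2_def qmul_def qe_def)

lemma qinv_qe1: "qinv (qe 1) = qc (- \<i>)"
  by (simp add: qinv_def qe_def qcnj_def qc_def norm_quat zero_prod_def)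

lemma qc_scaleR: "r *\<^sub>R qc z = qc (of_real r * z)"
  by (simp add: qc_def zero_prod_def)

definition parts :: "(quat \<Rightarrow> quat) \<Rightarrow> (complex \<Rightarrow> complex) \<times> (complex \<Rightarrow> complex)" where
  "parts h = (\<lambda>z. cpart1 (h (qc (exp z))), \<lambda>z. cpart2 (h (qc (exp z))))"

context sectorial_calculus begin

text \<open>The interpretation of the calculus needs a term for the bound, of which only existence
  has been shown.\<close>

definition "resolvent_const = (SOME K. Q_calculus LL qq ww \<psi> K \<phi> \<theta>)"

sublocale calc: Q_calculus LL qq ww \<psi> resolvent_const \<phi> \<theta>
  unfolding resolvent_const_def by (rule someI_ex[OF Q_calculus_ex])

lemma theta_pi: "0 < \<theta>" "\<theta> \<le> pi" using angles theta by auto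

lemma parts_E0: "h \<in> Psi_L \<theta> \<Longrightarrow> calc.E0P (parts h)"
  using Psi_L_E0[OF theta_pi, of h] by (simp add: parts_def)

lemma parts_E1: "h \<in> PsiQ_L \<theta> \<Longrightarrow> calc.E1P (parts h)"
  using PsiQ_L_E1[OF theta_pi, of h] by (simp add: parts_def)

text \<open>On both rays the derivative of the path at t is its value divided by t, and the inverse
  of e1 is - i in the slice; thus ds_J / (2 pi) becomes exp z / (2 pi i) times dt / t. The second
  part of h brings the factor \<open>jj\<close> on the right.\<close>

lemma path_integral_parts:
  assumes G: "\<And>c v. c \<in> Om \<psi> \<Longrightarrow> G (qc c) v = ap (W c) v"
    and r1: "rap \<phi> (\<lambda>z. W (exp z) * calc.\<iota> (exp z * fst (parts h) z / (2 * pi * \<i>)))" "CI \<phi> (\<lambda>z. W (exp z) * calc.\<iota> (exp z * fst (parts h) z / (2 * pi * \<i>))) = Y1"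
    and r2: "rap \<phi> (\<lambda>z. W (exp z) * calc.\<iota> (exp z * snd (parts h) z / (2 * pi * \<i>)))" "CI \<phi> (\<lambda>z. W (exp z) * calc.\<iota> (exp z * snd (parts h) z / (2 * pi * \<i>))) = Y2"
  shows "(1 / (2 * pi)) *\<^sub>R integral (UNIV - {0}) (\<lambda>t. G (gam \<phi> (qe 1) t) (lm (qmul (dgam \<phi> (qe 1) t) (qmul (qinv (qe 1)) (h (gam \<phi> (qe 1) t)))) v))
     = ap (Y1 + Y2 * calc.jj) v"
proof -
  let ?f = "\<lambda>p z. W (exp z) * calc.\<iota> (exp z * p z / (2 * pi * \<i>))"
  define k where "k z = (2 * pi) *\<^sub>R ap (?f (fst (parts h)) z + ?f (snd (parts h)) z * calc.jj) v" for z
  have bl: "bounded_linear (\<lambda>X. (2 * pi) *\<^sub>R ap X v)" using bounded_linear_compose[OF bounded_linear_scaleR_right ap_bounded_linear] .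
  note r2' = rap_bounded_linear[OF bounded_linear_mult_left r2(1), of calc.jj]
  note r = rap_add[OF r1(1) r2']
  have rk: "rap \<phi> k" unfolding k_def by (rule rap_bounded_linear[OF bl r])
  have CIk: "CI \<phi> k = (2 * pi) *\<^sub>R ap (Y1 + Y2 * calc.jj) v"
    unfolding k_def CI_bounded_linear[OF bl r] CI_add[OF r1(1) r2'] CI_bounded_linear[OF bounded_linear_mult_left r2(1)] r1(2) r2(2) ..
  define I where "I t = G (gam \<phi> (qe 1) t) (lm (qmul (dgam \<phi> (qe 1) t) (qmul (qinv (qe 1)) (h (gam \<phi> (qe 1) t)))) v)" for t
  have I: "I t = (1 / t) *\<^sub>R k z" if t: "t \<noteq> 0" and z: "\<bar>Im z\<bar> = \<bar>\<phi>\<bar>" and g: "gam \<phi> (qe 1) t = qc (exp z)" "dgam \<phi> (qe 1) t = qc (exp z / t)" for t z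
  proof -
    let ?a = "fst (parts h) z" and ?b = "snd (parts h) z"
    have uv: "u / t * - \<i> * a = of_real (2 * pi / t) * (u * a / (2 * pi * \<i>))" for u a :: complex
    proof -
      have "u * a / (2 * pi * \<i>) = (u * a * - \<i>) * \<i> / ((2 * pi) * \<i>)" by (simp add: mult.assoc)
      also have "\<dots> = u * a * - \<i> / (2 * pi)" by (rule nonzero_mult_divide_mult_cancel_right) simp
      finally have "u * a / (2 * pi * \<i>) = u * a * - \<i> / (2 * pi)" .
      then show ?thesis using t by (simp add: field_simps)
    qed
    have "qmul (qc (exp z / t)) (qmul (qc (- \<i>)) (h (qc (exp z)))) = qmul (qc (exp z / t * - \<i>)) (qc ?a + qmul (qc ?b) (qe 2))"
      using quat_split[of "h (qc (exp z))"] by (simp only: parts_def fst_conv snd_conv qc_mult flip: qmul_assoc)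
    also have "\<dots> = qc (exp z / t * - \<i> * ?a) + qmul (qc (exp z / t * - \<i> * ?b)) (qe 2)"
      by (simp only: qmul_add qc_mult flip: qmul_assoc)
    also have "exp z / t * - \<i> * ?a = of_real (2 * pi / t) * (exp z * ?a / (2 * pi * \<i>))" by (rule uv)
    also have "exp z / t * - \<i> * ?b = of_real (2 * pi / t) * (exp z * ?b / (2 * pi * \<i>))" by (rule uv)
    finally have q: "qmul (qc (exp z / t)) (qmul (qc (- \<i>)) (h (qc (exp z)))) =
       (2 * pi / t) *\<^sub>R qc (exp z * ?a / (2 * pi * \<i>)) + qmul ((2 * pi / t) *\<^sub>R qc (exp z * ?b / (2 * pi * \<i>))) (qe 2)"
      by (simp only: qc_scaleR)
    have "I t = ap (W (exp z)) ((2 * pi / t) *\<^sub>R (lm (qc (exp z * ?a / (2 * pi * \<i>))) v + lm (qc (exp z * ?b / (2 * pi * \<i>))) (lm (qe 2) v)))"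
      unfolding I_def g qinv_qe1 q G[OF calc.line_in_Om[OF z]] by (simp only: lm_addl lm_mult lm_scaleRl scaleR_add_right)
    also have "\<dots> = (1 / t) *\<^sub>R k z"
      unfolding k_def iota_LL jj_LL by (simp only: ap_simps ap_LL ap_linear scaleR_scaleR) simp
    finally show ?thesis .
  qed
  have "integral (UNIV - {0}) I = CI \<phi> k"
  proof (rule integral_unique, rule has_integral_eq[OF _ rap_path_integral[OF rk]])
    fix t :: real assume "t \<in> UNIV - {0}"
    then have t: "t \<noteq> 0" by simp
    show "(if t < 0 then (1 / t) *\<^sub>R k (Complex (ln (- t)) \<phi>) else (1 / t) *\<^sub>R k (Complex (ln t) (- \<phi>))) = I t"
    proof (cases "t < 0")
      case True
      have e: "exp (Complex (ln (- t)) \<phi>) = of_real (- t) * cis \<phi>" using True by (simp add: exp_eq_polar)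
      have "I t = (1 / t) *\<^sub>R k (Complex (ln (- t)) \<phi>)"
        by (rule I[OF t]; simp add: e gam_def dgam_def True qexpJ_def qof_real_def qe_def qc_def zero_prod_def t)
      then show ?thesis using True by simp
    next
      case False
      then have t0: "t > 0" using t by simp
      have e: "exp (Complex (ln t) (- \<phi>)) = of_real t * cis (- \<phi>)" using t0 by (simp add: exp_eq_polar)
      have "I t = (1 / t) *\<^sub>R k (Complex (ln t) (- \<phi>))"
        by (rule I[OF t]; simp add: e gam_def dgam_def False qexpJ_def qof_real_def qe_def qc_def zero_prod_def t)
      then show ?thesis using False by simp
    qed
  qed
  then have "integral (UNIV - {0}) I = (2 * pi) *\<^sub>R ap (Y1 + Y2 * calc.jj) v" by (simp only: CIk)
  then show ?thesis unfolding I_def by simp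
qed

definition Cs :: "real \<Rightarrow> nat \<Rightarrow> 'v \<Rightarrow> 'v" where "Cs \<sigma> = (if \<sigma> = 1 then C else kconj C)"

lemma SLres_sL:
  assumes c: "c \<in> Om \<psi>" and \<sigma>: "\<sigma> = 1 \<or> \<sigma> = -1"
  shows "SLres lm D (Cs \<sigma>) (qc c) v = ap (calc.sL \<sigma> c) v"
  using \<sigma> R_conj[OF out_qc(1)[OF c]]
  by (auto simp: Cs_def calc.sL_def calc.sq_def iota_LL ap_qq[OF c] ap_ww[OF c] ap_LL SLres_def kcop_def kconj_def lm_minus algebra_simps simp del: One_nat_def)

lemma S_calc_eq:
  assumes h: "h \<in> Psi_L \<theta>" and \<sigma>: "\<sigma> = 1 \<or> \<sigma> = -1"
  shows "S_calc lm D (Cs \<sigma>) \<omega> \<theta> h v = ap (calc.SP \<sigma> (parts h)) v"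
proof -
  note p = parts_E0[OF h, THEN conjunct1] parts_E0[OF h, THEN conjunct2]
  show ?thesis unfolding S_calc_def Let_def calc.SP_def \<phi>_def[symmetric]
    by (rule path_integral_parts[where W = "calc.sL \<sigma>", OF SLres_sL[OF _ \<sigma>] calc.S_CI[OF p(1)] calc.S_CI[OF p(2)]])
qed

text \<open>\<open>A\<close> is normalised by 1 / (2 pi) like the S-calculus, the harmonic calculus
  by -1 / pi; the quotient -2 is moved onto the vector.\<close>

lemma H_calc_eq:
  assumes h: "h \<in> PsiQ_L \<theta>"
  shows "H_calc lm D C \<omega> \<theta> h v = ap (calc.AP (parts h)) (-2 *\<^sub>R v)"
proof -
  note p = parts_E1[OF h, THEN conjunct1] parts_E1[OF h, THEN conjunct2]
  have eq: "(1 / (2 * pi)) *\<^sub>R integral (UNIV - {0}) (\<lambda>t. R (gam \<phi> (qe 1) t) (lm (qmul (dgam \<phi> (qe 1) t) (qmul (qinv (qe 1)) (h (gam \<phi> (qe 1) t)))) v)) = ap (calc.AP (parts h)) v"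
    unfolding calc.AP_def
    by (rule path_integral_parts[where W = qq, OF ap_qq[symmetric] calc.Phi_CI[OF calc.regular_q calc.adm_q[OF p(1)]] calc.Phi_CI[OF calc.regular_q calc.adm_q[OF p(2)]]])
  have "(- 1 / pi) *\<^sub>R x = -2 *\<^sub>R ((1 / (2 * pi)) *\<^sub>R x)" for x :: 'v by simp
  then show ?thesis unfolding H_calc_def Let_def \<phi>_def[symmetric] ap_linear by (simp only: eq)
qed

lemma Cs_linear: "\<sigma> = 1 \<or> \<sigma> = -1 \<Longrightarrow> v \<in> D \<Longrightarrow> w \<in> D \<Longrightarrow> kcop lm (Cs \<sigma>) (v + w) = kcop lm (Cs \<sigma>) v + kcop lm (Cs \<sigma>) w"
  "\<sigma> = 1 \<or> \<sigma> = -1 \<Longrightarrow> v \<in> D \<Longrightarrow> kcop lm (Cs \<sigma>) (r *\<^sub>R v) = r *\<^sub>R kcop lm (Cs \<sigma>) v"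
  by (auto simp: Cs_def T_add T_scaleR Tbar_add Tbar_scaleR)

text \<open>At s = - a one has Q = (a + T) (a + Tbar), and \<open>calc.R 1 a\<close> is (a + Tbar)
  times the inverse of Q, a right inverse of a + T. For \<sigma> = -1 the factors change places,
  which is allowed since T and Tbar commute on \<open>D2\<close>.\<close>

lemma resolvent_negative:
  assumes a: "a > 0" and \<sigma>: "\<sigma> = 1 \<or> \<sigma> = -1"
  shows "ap (calc.R \<sigma> a) v \<in> D" and "a *\<^sub>R ap (calc.R \<sigma> a) v + kcop lm (Cs \<sigma>) (ap (calc.R \<sigma> a) v) = v"
proof -
  define c :: complex where "c = - of_real a"
  have c: "c \<in> Om \<psi>" unfolding c_def by (rule calc.neg_in_Om[OF a])
  have qc: "qc c = qof_real (- a)" "qmul (qc c) (qc c) = qof_real (a * a)" by (simp_all add: c_def qc_def qof_real_def qmul_def)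
  define w where "w = R (qc c) v"
  have w: "w \<in> D2" "w \<in> D" "Q (qc c) w = v" using R_D2 Q_R D2_D out_qc(1)[OF c] by (auto simp: w_def)
  define x where "x = ap (calc.R \<sigma> a) v"
  have x: "x = a *\<^sub>R w + (C 0 w - \<sigma> *\<^sub>R (lm (qe 1) (C 1 w) + lm (qe 2) (C 2 w) + lm (qe 3) (C 3 w)))"
    using qc(1) by (simp add: x_def calc.R_def c_def[symmetric] calc.sL_def calc.sq_def iota_LL ap_qq[OF c] ap_ww[OF c] ap_LL w_def lm_real del: One_nat_def)
  note d = D2_T[OF w(1)] D2_TbarD[OF w(1)]
  have v: "v = (a * a) *\<^sub>R w + a *\<^sub>R (T w + Tbar w) + T (Tbar w)"
  proof -
    have "T w + Tbar w = 2 *\<^sub>R C 0 w" by (simp add: T_eq Tbar_eq scaleR_2)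
    moreover have "v = (a * a) *\<^sub>R w - 2 *\<^sub>R ((- a) *\<^sub>R C 0 w) + (C 0 (C 0 w) + C 1 (C 1 w) + C 2 (C 2 w) + C 3 (C 3 w))"
      unfolding w(3)[symmetric] Q_eq qc(2) unfolding qc(1) lm_real ..
    ultimately show ?thesis using T_Tbar[OF w(1)] by (simp add: mult.commute)
  qed
  have "x \<in> D \<and> a *\<^sub>R x + kcop lm (Cs \<sigma>) x = v"
    using \<sigma>
  proof
    assume 1: "\<sigma> = 1"
    then have x: "x = a *\<^sub>R w + Tbar w" by (simp add: x Tbar_eq)
    then show ?thesis using 1 w d by (simp add: Cs_def v T_add T_scaleR D_add D_scaleR scaleR_add_right)
  next
    assume 1: "\<sigma> = -1"
    then have x: "x = a *\<^sub>R w + T w" by (simp add: x T_eq)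
    have "T (Tbar w) = Tbar (T w)" using T_Tbar Tbar_T w by simp
    then show ?thesis using 1 w d by (simp add: x Cs_def v Tbar_add Tbar_scaleR D_add D_scaleR scaleR_add_right)
  qed
  then show "ap (calc.R \<sigma> a) v \<in> D" "a *\<^sub>R ap (calc.R \<sigma> a) v + kcop lm (Cs \<sigma>) (ap (calc.R \<sigma> a) v) = v"
    by (simp_all add: x_def)
qed

end

lemma inj_apI: "(\<And>v. ap X v = 0 \<Longrightarrow> v = 0) \<Longrightarrow> inj (ap X)"
  by (rule injI) (metis ap_linear(2) right_minus_eq)

lemma inj_ap_power: "inj (ap X) \<Longrightarrow> inj (ap (X ^ n))"
proof (induction n)
  case 0 show ?case by (rule inj_apI) simp
next
  case (Suc n)
  have "ap (X ^ Suc n) = ap X \<circ> ap (X ^ n)" by (simp add: fun_eq_iff)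
  then show ?case using inj_compose[of "ap X" "ap (X ^ n)"] Suc by metis
qed

lemma fmul_parts:
  assumes \<theta>: "0 < \<theta>" "\<theta> \<le> pi" and e: "intrinsic_hol (sector \<theta>) e" and z: "\<bar>Im z\<bar> < \<theta>"
  shows "fst (parts (fmul e f)) z = fst (parts e) z * fst (parts f) z" "snd (parts (fmul e f)) z = fst (parts e) z * snd (parts f) z"
    "snd (parts e) z = 0"
proof -
  have e: "e (qc (exp z)) = qc (cpart1 (e (qc (exp z))))" by (rule intrinsic_cpart(1)[OF \<theta> e z])
  show "fst (parts (fmul e f)) z = fst (parts e) z * fst (parts f) z" "snd (parts (fmul e f)) z = fst (parts e) z * snd (parts f) z"
    using fmul_cpart[where e = e and f = f and q = "qc (exp z)", OF e] by (simp_all add: parts_def)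
  have "cpart2 (qc w) = 0" for w by (simp add: cpart2_def qc_def complex_eq_iff zero_prod_def[symmetric])
  then show "snd (parts e) z = 0" using e by (simp add: parts_def) metis
qed

lemma powr_decay_le_1:
  fixes x a :: real assumes "a > 0" "x \<ge> 0"
  shows "x powr a / (1 + x powr (1 + 2 * a)) \<le> 1" "x powr (1 + a) / (1 + x powr (1 + 2 * a)) \<le> 1"
proof -
  have "x powr b \<le> 1 + x powr (1 + 2 * a)" if "0 \<le> b" "b \<le> 1 + 2 * a" for b
  proof (cases "x \<le> 1")
    case True then have "x powr b \<le> 1" using powr_mono2[of b x 1] that assms by simp
    then show ?thesis using powr_ge_zero[of x "1 + 2 * a"] by linarith
  next
    case False then have "x powr b \<le> x powr (1 + 2 * a)" using that by (intro powr_mono) auto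
    then show ?thesis by simp
  qed
  moreover have "0 < 1 + x powr (1 + 2 * a)" by (simp add: add_pos_nonneg)
  ultimately show "x powr a / (1 + x powr (1 + 2 * a)) \<le> 1" "x powr (1 + a) / (1 + x powr (1 + 2 * a)) \<le> 1"
    using assms by (simp_all add: divide_le_eq_1)
qed

text \<open>For r > 0 one has r + 1 / r \<ge> 1, so the growth exponent 1 accommodates every bounded
  function.\<close>

lemma bounded_F_L:
  assumes \<theta>: "0 < \<theta>" "\<theta> \<le> pi" and f: "left_slice_hol (sector \<theta>) f" and c: "c \<ge> 0" and b: "\<And>s. s \<in> sector \<theta> \<Longrightarrow> norm (f s) \<le> c"
  shows "f \<in> F_L \<theta>"
proof -
  have "norm (f s) \<le> c * (norm s powr 1 + norm s powr (- 1))" if s: "s \<in> sector \<theta>" for s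
  proof -
    have s0: "norm s > 0" using sector_nonzero[OF s \<theta>] by simp
    have "1 \<le> norm s powr 1 + norm s powr (- 1)"
    proof (cases "norm s \<le> 1")
      case True then have "1 \<le> norm s powr (- 1)" using s0 by (simp add: powr_minus field_simps)
      then show ?thesis using s0 by (simp add: add_increasing)
    next
      case False then show ?thesis using s0 by (simp add: add_increasing2)
    qed
    from mult_left_mono[OF this c] show ?thesis using b[OF s] by simp
  qed
  then have "\<exists>c\<ge>0. \<forall>s\<in>sector \<theta>. norm (f s) \<le> c * (norm s powr 1 + norm s powr (- 1))" using c by blast
  then have "\<exists>a>0. \<exists>c\<ge>0. \<forall>s\<in>sector \<theta>. norm (f s) \<le> c * (norm s powr a + norm s powr (- a))" by (rule_tac x = 1 in exI) simp
  then show ?thesis unfolding F_L_def using f by blast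
qed

lemma Psi_L_F_L: "0 < \<theta> \<Longrightarrow> \<theta> \<le> pi \<Longrightarrow> f \<in> Psi_L \<theta> \<Longrightarrow> f \<in> F_L \<theta>"
  and PsiQ_L_F_L: "0 < \<theta> \<Longrightarrow> \<theta> \<le> pi \<Longrightarrow> f \<in> PsiQ_L \<theta> \<Longrightarrow> f \<in> F_L \<theta>"
proof -
  assume \<theta>: "0 < \<theta>" "\<theta> \<le> pi"
  show "f \<in> F_L \<theta>" if P: "f \<in> Psi_L \<theta>"
  proof -
    obtain a c where ac: "a > 0" "c \<ge> 0" and l: "left_slice_hol (sector \<theta>) f" and b: "\<And>s. s \<in> sector \<theta> \<Longrightarrow> norm (f s) \<le> c * norm s powr a / (1 + norm s powr (1 + 2 * a))"
      using P unfolding Psi_L_def by blast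
    have "norm (f s) \<le> c" if "s \<in> sector \<theta>" for s
      using b[OF that] mult_left_mono[OF powr_decay_le_1(1)[OF ac(1) norm_ge_zero[of s]] ac(2)] by simp
    then show ?thesis by (rule bounded_F_L[OF \<theta> l ac(2)])
  qed
  show "f \<in> F_L \<theta>" if P: "f \<in> PsiQ_L \<theta>"
  proof -
    obtain a c where ac: "a > 0" "c \<ge> 0" and l: "left_slice_hol (sector \<theta>) f" and b: "\<And>s. s \<in> sector \<theta> \<Longrightarrow> norm (f s) \<le> c * norm s powr (1 + a) / (1 + norm s powr (1 + 2 * a))"
      using P unfolding PsiQ_L_def by blast
    have "norm (f s) \<le> c" if "s \<in> sector \<theta>" for s
      using b[OF that] mult_left_mono[OF powr_decay_le_1(2)[OF ac(1) norm_ge_zero[of s]] ac(2)] by simp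
    then show ?thesis by (rule bounded_F_L[OF \<theta> l ac(2)])
  qed
qed

lemma Psi_Psi_L: "e \<in> Psi \<theta> \<Longrightarrow> e \<in> Psi_L \<theta>" and PsiQ_PsiQ_L: "e \<in> PsiQ \<theta> \<Longrightarrow> e \<in> PsiQ_L \<theta>"
  unfolding Psi_def Psi_L_def PsiQ_def PsiQ_L_def using intrinsic_left by blast+

section \<open>Regularization\<close>

lemma uop_eqI:
  assumes "\<And>v y. v \<in> fst A \<and> snd A v = y \<longleftrightarrow> v \<in> fst B \<and> snd B v = y" shows "uop_eq A B"
  unfolding uop_eq_def using assms by blast

text \<open>Turns composition with the inverse of an injective operator into an equation for the
  graph, the form in which unbounded operators are compared below.\<close>

lemma the_inv_eq_iff: assumes "inj A" shows "(x \<in> range A \<and> the_inv_into UNIV A x = z) \<longleftrightarrow> A z = x"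
proof
  assume "x \<in> range A \<and> the_inv_into UNIV A x = z"
  then show "A z = x" using the_inv_f_f[OF assms] by auto
next
  assume "A z = x"
  then show "x \<in> range A \<and> the_inv_into UNIV A x = z" using the_inv_f_f[OF assms, of z] by auto
qed

lemma inj_ap_mult: "inj (ap X) \<Longrightarrow> inj (ap Y) \<Longrightarrow> inj (ap (X * Y))"
  by (rule injI) (metis ap_simps(6) injD)

lemma intrinsic_parts:
  assumes \<theta>: "0 < \<theta>" "\<theta> \<le> pi" and e: "intrinsic_hol (sector \<theta>) e"
  shows "conj_sym \<theta> (fst (parts e))"
  using intrinsic_cpart(2)[OF \<theta> e] by (simp add: conj_sym_def parts_def)

locale sectorial_injective = sectorial_calculus +
  assumes injT: "inj_on T D" and injTbar: "inj_on Tbar D"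
begin

text \<open>If \<open>S \<sigma> rho\<close> kills v and x is the resolvent at -2 applied to v, then
  the resolvent at -1 gives 2 x. Hence 2 x + T x = v = 2 x + 2 T x, so T x = 0 and x = 0 by
  injectivity; for \<sigma> = -1 the same holds with Tbar.\<close>

lemma inj_S_rho_power:
  assumes \<sigma>: "\<sigma> = 1 \<or> \<sigma> = -1" and k: "k > 0"
  shows "inj (ap (calc.S \<sigma> (\<lambda>z. rho z ^ k)))"
proof -
  have \<sigma>2: "\<sigma> * \<sigma> = 1" using \<sigma> by auto
  have inj: "inj_on (kcop lm (Cs \<sigma>)) D" using \<sigma> injT injTbar by (auto simp: Cs_def)
  have "inj (ap (calc.S \<sigma> rho))"
  proof (rule inj_apI)
    fix v assume 0: "ap (calc.S \<sigma> rho) v = 0"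
    define x where "x = ap (calc.R \<sigma> 2) v"
    have x: "x \<in> D" "2 *\<^sub>R x + kcop lm (Cs \<sigma>) x = v" using resolvent_negative[of 2, OF _ \<sigma>, of v] by (simp_all add: x_def)
    have y: "ap (calc.R \<sigma> 1) v = 2 *\<^sub>R x" using 0 by (simp add: calc.S_rho[OF \<sigma>2] x_def)
    have "2 *\<^sub>R x + 2 *\<^sub>R kcop lm (Cs \<sigma>) x = v"
      using resolvent_negative(2)[of 1, OF _ \<sigma>, of v] Cs_linear(2)[OF \<sigma> x(1), of 2] by (simp add: y)
    moreover have "kcop lm (Cs \<sigma>) x = (2 *\<^sub>R x + 2 *\<^sub>R kcop lm (Cs \<sigma>) x) - (2 *\<^sub>R x + kcop lm (Cs \<sigma>) x)" by (simp add: scaleR_2)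
    ultimately have T0: "kcop lm (Cs \<sigma>) x = 0" using x(2) by simp
    moreover have "kcop lm (Cs \<sigma>) 0 = 0" using Cs_linear(2)[OF \<sigma> D_0, of 0] by simp
    ultimately have "x = 0" using inj x(1) D_0 T0 by (auto simp: inj_on_def)
    then show "v = 0" using x(2) T0 by simp
  qed
  then show ?thesis using calc.S_rho_power[OF \<sigma>2 k] by (simp add: inj_ap_power)
qed

abbreviation "intr e \<equiv> intrinsic_hol (sector \<theta>) e"
abbreviation "p1 e \<equiv> fst (parts e)"

lemma Psi_intr: "e \<in> Psi \<theta> \<Longrightarrow> intr e" and PsiQ_intr: "e \<in> PsiQ \<theta> \<Longrightarrow> intr e"
  by (simp_all add: Psi_def PsiQ_def)

lemma line_lt: "\<bar>Im z\<bar> = \<bar>\<phi>\<bar> \<Longrightarrow> \<bar>Im z\<bar> < \<theta>" using angles by simp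

lemma SP_intr: "intr e \<Longrightarrow> calc.SP \<sigma> (parts e) = calc.S \<sigma> (p1 e)"
  and AP_intr: "intr e \<Longrightarrow> calc.AP (parts e) = calc.A (p1 e)"
proof -
  assume e: "intr e"
  have z: "snd (parts e) z = 0" if "\<bar>Im z\<bar> = \<bar>\<phi>\<bar>" for z by (rule fmul_parts(3)[OF theta_pi e line_lt[OF that]])
  have "calc.S \<sigma> (snd (parts e)) = 0" using calc.S_cong[of "snd (parts e)" "\<lambda>_. 0"] z calc.S_zero by simp
  then show "calc.SP \<sigma> (parts e) = calc.S \<sigma> (p1 e)" by (simp add: calc.SP_def)
  have "calc.A (snd (parts e)) = 0" using calc.Phi_cong[of "snd (parts e)" "\<lambda>_. 0" qq] z calc.A_zero by simp
  then show "calc.AP (parts e) = calc.A (p1 e)" by (simp add: calc.AP_def)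
qed

lemma SP_fmul: "intr e \<Longrightarrow> calc.SP \<sigma> (parts (fmul e f)) = calc.SP \<sigma> (calc.pair_mult (p1 e) (parts f))"
  using fmul_parts[OF theta_pi _ line_lt] by (intro calc.SP_cong) simp

lemma SP_fmul_S:
  assumes "intr e" "e \<in> Psi_L \<theta> \<or> e \<in> PsiQ_L \<theta>" "calc.E0P (parts f)" "\<sigma> = 1 \<or> \<sigma> = -1"
  shows "calc.SP \<sigma> (parts (fmul e f)) = calc.S \<sigma> (p1 e) * calc.SP \<sigma> (parts f)"
  unfolding SP_fmul[OF assms(1)]
  by (rule calc.SP_mult) (use assms parts_E0[of e] parts_E1[of e] calc.E1_E0 intrinsic_parts[OF theta_pi] in auto)

lemma S_calc_intr:
  assumes "e \<in> Psi \<theta>" "\<sigma> = 1 \<or> \<sigma> = -1"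
  shows "S_calc lm D (Cs \<sigma>) \<omega> \<theta> e = ap (calc.S \<sigma> (p1 e))"
  using S_calc_eq[OF Psi_Psi_L[OF assms(1)] assms(2)] SP_intr[OF Psi_intr[OF assms(1)]] by auto

text \<open>One power of the rational function belongs to both regularizing classes and is injective
  at T and at the conjugate, so it serves for f(T), for f of the conjugate and for the harmonic
  calculus.\<close>

lemma regularizer_exists:
  assumes f: "f \<in> F_L \<theta>"
  obtains e where "e \<in> PsiQ \<theta>" "fmul e f \<in> PsiQ_L \<theta>"
    "\<And>\<sigma>. \<sigma> = 1 \<or> \<sigma> = -1 \<Longrightarrow> regularizer lm D (Cs \<sigma>) \<omega> \<theta> f e \<and> inj (ap (calc.S \<sigma> (p1 e)))"
proof -
  obtain k where k: "k > 0" "qext (rat k) \<in> Psi \<theta>" "qext (rat k) \<in> PsiQ \<theta>"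
    "fmul (qext (rat k)) f \<in> Psi_L \<theta>" "fmul (qext (rat k)) f \<in> PsiQ_L \<theta>"
    using rat_regularizer[OF theta_pi(1) theta(2) f] by blast
  let ?e = "qext (rat k)"
  have inj: "inj (ap (calc.S \<sigma> (p1 ?e)))" if \<sigma>: "\<sigma> = 1 \<or> \<sigma> = -1" for \<sigma>
  proof -
    have "p1 ?e z = rho z ^ k" if "\<bar>Im z\<bar> = \<bar>\<phi>\<bar>" for z
      using qext_rat_qc[of z k] line_lt[OF that] theta by (simp add: parts_def cpart1_def qc_def)
    then have "calc.S \<sigma> (p1 ?e) = calc.S \<sigma> (\<lambda>z. rho z ^ k)" by (rule calc.S_cong)
    then show ?thesis using inj_S_rho_power[OF \<sigma> k(1)] by simp
  qed
  show ?thesis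
    by (rule that[of ?e]) (use k inj S_calc_intr[OF k(2)] in \<open>simp_all add: regularizer_def\<close>)
qed

abbreviation "FLc \<sigma> f \<equiv> FL_calc lm D (Cs \<sigma>) \<omega> \<theta> f"

text \<open>The regularizer obtained is the one selected by \<open>SOME\<close> in
  \<open>FL_calc\<close>; only its defining properties are passed on.\<close>

lemma FL_graph:
  assumes f: "f \<in> F_L \<theta>" and \<sigma>: "\<sigma> = 1 \<or> \<sigma> = -1"
  obtains e where "e \<in> Psi \<theta>" "fmul e f \<in> Psi_L \<theta>" "inj (ap (calc.S \<sigma> (p1 e)))"
    "\<forall>v z. v \<in> fst (FLc \<sigma> f) \<and> snd (FLc \<sigma> f) v = z \<longleftrightarrow> ap (calc.S \<sigma> (p1 e)) z = ap (calc.SP \<sigma> (parts (fmul e f))) v"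
proof -
  define e where "e = (SOME e. regularizer lm D (Cs \<sigma>) \<omega> \<theta> f e)"
  have "\<exists>e. regularizer lm D (Cs \<sigma>) \<omega> \<theta> f e" by (rule regularizer_exists[OF f]) (use \<sigma> in blast)
  then have "regularizer lm D (Cs \<sigma>) \<omega> \<theta> f e" unfolding e_def by (rule someI_ex)
  then have e: "e \<in> Psi \<theta>" "inj (S_calc lm D (Cs \<sigma>) \<omega> \<theta> e)" "fmul e f \<in> Psi_L \<theta>" by (simp_all add: regularizer_def)
  note S = S_calc_intr[OF e(1) \<sigma>]
  have S': "S_calc lm D (Cs \<sigma>) \<omega> \<theta> (fmul e f) = ap (calc.SP \<sigma> (parts (fmul e f)))" using S_calc_eq[OF e(3) \<sigma>] by auto
  have inj: "inj (ap (calc.S \<sigma> (p1 e)))" using e(2) by (simp add: S)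
  have FL: "FLc \<sigma> f = ucomp (uinv (bop (ap (calc.S \<sigma> (p1 e))))) (bop (ap (calc.SP \<sigma> (parts (fmul e f)))))"
    unfolding FL_calc_def Let_def e_def[symmetric] S S' ..
  show ?thesis
  proof (rule that[OF e(1,3) inj], intro allI)
    fix v z
    show "v \<in> fst (FLc \<sigma> f) \<and> snd (FLc \<sigma> f) v = z \<longleftrightarrow> ap (calc.S \<sigma> (p1 e)) z = ap (calc.SP \<sigma> (parts (fmul e f))) v"
      using the_inv_eq_iff[OF inj, of "ap (calc.SP \<sigma> (parts (fmul e f))) v" z] by (simp add: FL ucomp_def uinv_def bop_def)
  qed
qed

text \<open>Functions in \<open>PsiQ\<close> may decay more slowly at infinity than those in
  \<open>Psi\<close>, so \<open>FL_calc\<close> reaches e(T) through an auxiliary d. The product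
  rule (d e)(T) = d(T) e(T) shows that d drops out and e(T) is the bounded contour integral.\<close>

lemma FL_bounded:
  assumes e: "e \<in> PsiQ \<theta>" and \<sigma>: "\<sigma> = 1 \<or> \<sigma> = -1"
  shows "fst (FLc \<sigma> e) = UNIV" "snd (FLc \<sigma> e) = ap (calc.S \<sigma> (p1 e))"
proof -
  note eL = PsiQ_PsiQ_L[OF e]
  obtain d where d: "d \<in> Psi \<theta>" "fmul d e \<in> Psi_L \<theta>" "inj (ap (calc.S \<sigma> (p1 d)))"
    "\<forall>v z. v \<in> fst (FLc \<sigma> e) \<and> snd (FLc \<sigma> e) v = z \<longleftrightarrow> ap (calc.S \<sigma> (p1 d)) z = ap (calc.SP \<sigma> (parts (fmul d e))) v"
    by (rule FL_graph[OF PsiQ_L_F_L[OF theta_pi eL] \<sigma>])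
  have "calc.SP \<sigma> (parts (fmul d e)) = calc.S \<sigma> (p1 d) * calc.S \<sigma> (p1 e)"
    using SP_fmul_S[OF Psi_intr[OF d(1)] _ _ \<sigma>, of e] Psi_Psi_L[OF d(1)] parts_E1[OF eL] calc.E1_E0 SP_intr[OF PsiQ_intr[OF e]] by simp
  then have "v \<in> fst (FLc \<sigma> e) \<and> snd (FLc \<sigma> e) v = ap (calc.S \<sigma> (p1 e)) v" for v
    unfolding d(4)[rule_format] by simp
  then show "fst (FLc \<sigma> e) = UNIV" "snd (FLc \<sigma> e) = ap (calc.S \<sigma> (p1 e))" by auto
qed

definition DfT :: "real \<Rightarrow> (quat \<Rightarrow> quat) \<Rightarrow> (quat \<Rightarrow> quat) \<Rightarrow> 'a uop" where
  "DfT \<tau> f e = ucomp (uinv (FLc (- \<tau>) e))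
       (udiff (bop (H_calc lm D C \<omega> \<theta> (fmul e f))) (ucomp (FLc \<tau> f) (bop (H_calc lm D C \<omega> \<theta> e))))"

lemma DfT_eq: "DfT_1 lm D C \<omega> \<theta> f e = DfT 1 f e" "DfT_2 lm D C \<omega> \<theta> f e = DfT (-1) f e"
  by (simp_all add: DfT_def DfT_1_def DfT_2_def Cs_def)

lemma harm_regularizer_iff:
  "harm_regularizer lm D C \<omega> \<theta> f e \<longleftrightarrow> e \<in> PsiQ \<theta> \<and> fmul e f \<in> PsiQ_L \<theta> \<and> inj (ap (calc.S 1 (p1 e))) \<and> inj (ap (calc.S (-1) (p1 e)))"
proof -
  have "uinj (FL_calc lm D C \<omega> \<theta> e) \<longleftrightarrow> inj (ap (calc.S 1 (p1 e)))" "uinj (FL_calc lm D (kconj C) \<omega> \<theta> e) \<longleftrightarrow> inj (ap (calc.S (-1) (p1 e)))" if "e \<in> PsiQ \<theta>"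
    using FL_bounded[OF that, of 1] FL_bounded[OF that, of "-1"] by (simp_all add: uinj_def Cs_def)
  then show ?thesis unfolding harm_regularizer_def by blast
qed

text \<open>The condition no longer refers to the regularizer chosen in the definition of \<open>f(T)\<close>.\<close>
lemma DfT_graph:
  assumes f: "f \<in> F_L \<theta>" and e: "harm_regularizer lm D C \<omega> \<theta> f e" and \<tau>: "\<tau> = 1 \<or> \<tau> = -1"
  shows "v \<in> fst (DfT \<tau> f e) \<and> snd (DfT \<tau> f e) v = y \<longleftrightarrow>
     ap (calc.S 1 (p1 e) * calc.S (-1) (p1 e)) y =
     ap (calc.S 1 (p1 e) * calc.AP (parts (fmul e f)) - calc.SP 1 (parts (fmul e f)) * calc.A (p1 e)) (-2 *\<^sub>R v)"
proof -
  have \<tau>': "- \<tau> = 1 \<or> - \<tau> = -1" using \<tau> by auto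
  have eQ: "e \<in> PsiQ \<theta>" "fmul e f \<in> PsiQ_L \<theta>" and inj: "\<And>\<sigma>. \<sigma> = 1 \<or> \<sigma> = -1 \<Longrightarrow> inj (ap (calc.S \<sigma> (p1 e)))"
    using e by (auto simp: harm_regularizer_iff)
  note ei = PsiQ_intr[OF eQ(1)]
  have e1: "E1 \<theta> (p1 e)" "E0 \<theta> (p1 e)" "conj_sym \<theta> (p1 e)" using parts_E1[OF PsiQ_PsiQ_L[OF eQ(1)]] calc.E1_E0 intrinsic_parts[OF theta_pi ei] by auto
  obtain d where d: "d \<in> Psi \<theta>" "fmul d f \<in> Psi_L \<theta>" "inj (ap (calc.S \<tau> (p1 d)))"
    "\<forall>v z. v \<in> fst (FLc \<tau> f) \<and> snd (FLc \<tau> f) v = z \<longleftrightarrow> ap (calc.S \<tau> (p1 d)) z = ap (calc.SP \<tau> (parts (fmul d f))) v"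
    by (rule FL_graph[OF f \<tau>])
  note di = Psi_intr[OF d(1)]
  have d1: "E0 \<theta> (p1 d)" "conj_sym \<theta> (p1 d)" using parts_E0[OF Psi_Psi_L[OF d(1)]] intrinsic_parts[OF theta_pi di] by auto
  define h where "h = H_calc lm D C \<omega> \<theta> (fmul e f) v"
  define w where "w = H_calc lm D C \<omega> \<theta> e v"
  define E where "E = calc.S (- \<tau>) (p1 e)"
  define P where "P = calc.S \<tau> (p1 d)"
  define M where "M = calc.S \<tau> (p1 e)"
  define Y where "Y = calc.SP \<tau> (parts (fmul e f))"
  have hw: "h = ap (calc.AP (parts (fmul e f))) (-2 *\<^sub>R v)" "w = ap (calc.A (p1 e)) (-2 *\<^sub>R v)"
    using H_calc_eq[OF eQ(2)] H_calc_eq[OF PsiQ_PsiQ_L[OF eQ(1)]] AP_intr[OF ei] by (simp_all add: h_def w_def)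
  have injE: "inj (ap E)" using inj \<tau>' by (simp add: E_def)
  have injM: "inj (ap M)" using inj \<tau> by (simp add: M_def)
  have injP: "inj (ap P)" using d(3) by (simp add: P_def)
  \<comment> \<open>Both sides are the value of e d f: intrinsic factors commute as functions on the
    slice, so either one can be split off first.\<close>
  have MY: "M * calc.SP \<tau> (parts (fmul d f)) = P * Y"
  proof -
    have "M * calc.SP \<tau> (parts (fmul d f)) = calc.SP \<tau> (parts (fmul e (fmul d f)))"
      unfolding M_def using SP_fmul_S[OF ei _ _ \<tau>, of "fmul d f"] PsiQ_PsiQ_L[OF eQ(1)] parts_E0[OF d(2)] by simp
    also have "\<dots> = calc.SP \<tau> (parts (fmul d (fmul e f)))"
      using fmul_parts[OF theta_pi ei line_lt] fmul_parts[OF theta_pi di line_lt] by (intro calc.SP_cong) simp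
    also have "\<dots> = P * Y"
      unfolding P_def Y_def using SP_fmul_S[OF di _ _ \<tau>, of "fmul e f"] Psi_Psi_L[OF d(1)] parts_E1[OF eQ(2)] calc.E1_E0 by simp
    finally show ?thesis .
  qed
  have MP: "M * P = P * M" unfolding M_def P_def by (rule calc.S_comm[OF e1(2,3) d1])
  have "v \<in> fst (DfT \<tau> f e) \<and> snd (DfT \<tau> f e) v = y \<longleftrightarrow> (\<exists>z. (w \<in> fst (FLc \<tau> f) \<and> snd (FLc \<tau> f) w = z) \<and> ap E y = h - z)"
  proof -
    have "(h - z \<in> range (ap E) \<and> the_inv_into UNIV (ap E) (h - z) = y) \<longleftrightarrow> ap E y = h - z" for z
      by (rule the_inv_eq_iff[OF injE])
    then show ?thesis
      unfolding DfT_def ucomp_def uinv_def udiff_def bop_def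
      by (simp add: FL_bounded[OF eQ(1) \<tau>'] E_def[symmetric] h_def[symmetric] w_def[symmetric])
  qed
  also have "\<dots> \<longleftrightarrow> (\<exists>z. ap P z = ap (calc.SP \<tau> (parts (fmul d f))) w \<and> z = h - ap E y)"
    unfolding d(4)[rule_format] P_def by (auto simp: algebra_simps)
  also have "\<dots> \<longleftrightarrow> ap P (h - ap E y) = ap (calc.SP \<tau> (parts (fmul d f))) w" by simp
  \<comment> \<open>Applying the injective e(T) loses nothing and brings d(T) to the left on both
    sides, where it can be cancelled.\<close>
  also have "\<dots> \<longleftrightarrow> ap (M * P) (h - ap E y) = ap (M * calc.SP \<tau> (parts (fmul d f))) w"
    using inj_eq[OF injM] by simp
  also have "\<dots> \<longleftrightarrow> ap P (ap M (h - ap E y)) = ap P (ap Y w)" unfolding MP MY by simp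
  also have "\<dots> \<longleftrightarrow> ap M (ap E y) = ap M h - ap Y w"
    unfolding inj_eq[OF injP] unfolding ap_linear(2) by (auto simp: algebra_simps)
  also have "\<dots> \<longleftrightarrow> ap (M * E) y = ap (M * calc.AP (parts (fmul e f)) - Y * calc.A (p1 e)) (-2 *\<^sub>R v)"
    unfolding hw by (simp only: ap_simps)
  also have "M * E = calc.S 1 (p1 e) * calc.S (-1) (p1 e)"
    using \<tau> calc.S_comm[OF e1(2,3) e1(2,3), of "-1" 1] by (auto simp: M_def E_def)
  also have "M * calc.AP (parts (fmul e f)) - Y * calc.A (p1 e) =
      calc.S 1 (p1 e) * calc.AP (parts (fmul e f)) - calc.SP 1 (parts (fmul e f)) * calc.A (p1 e)"
    using \<tau> calc.SP_diff_AP[OF e1(1,3) parts_E1[OF eQ(2)]] by (auto simp: M_def Y_def)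
  finally show ?thesis .
qed

text \<open>Regularizer, sign \<tau> and even the function may change, as long as f and g agree on
  the sector; so one statement yields the coincidence of the two operators, the independence of e
  and the last claim.\<close>

lemma DfT_unique:
  assumes f: "f \<in> F_L \<theta>" and g: "g \<in> F_L \<theta>" and fg: "\<And>s. s \<in> sector \<theta> \<Longrightarrow> f s = g s"
    and a: "harm_regularizer lm D C \<omega> \<theta> f a" and b: "harm_regularizer lm D C \<omega> \<theta> g b"
    and \<tau>: "\<tau> = 1 \<or> \<tau> = -1" "\<tau>' = 1 \<or> \<tau>' = -1"
  shows "uop_eq (DfT \<tau> f a) (DfT \<tau>' g b)"
proof (rule uop_eqI)
  fix v y
  have aQ: "a \<in> PsiQ \<theta>" "fmul a f \<in> PsiQ_L \<theta>" "inj (ap (calc.S 1 (p1 a)))" "inj (ap (calc.S (-1) (p1 a)))"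
    and bQ: "b \<in> PsiQ \<theta>" "fmul b g \<in> PsiQ_L \<theta>" "inj (ap (calc.S 1 (p1 b)))" "inj (ap (calc.S (-1) (p1 b)))"
    using a b by (auto simp: harm_regularizer_iff)
  note ai = PsiQ_intr[OF aQ(1)] and bi = PsiQ_intr[OF bQ(1)]
  have a1: "E1 \<theta> (p1 a)" "E0 \<theta> (p1 a)" "conj_sym \<theta> (p1 a)" using parts_E1[OF PsiQ_PsiQ_L[OF aQ(1)]] calc.E1_E0 intrinsic_parts[OF theta_pi ai] by auto
  have b1: "E1 \<theta> (p1 b)" "E0 \<theta> (p1 b)" "conj_sym \<theta> (p1 b)" using parts_E1[OF PsiQ_PsiQ_L[OF bQ(1)]] calc.E1_E0 intrinsic_parts[OF theta_pi bi] by auto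
  define N where "N e = calc.S 1 (p1 e) * calc.S (-1) (p1 e)" for e
  define X where "X e f = calc.S 1 (p1 e) * calc.AP (parts (fmul e f)) - calc.SP 1 (parts (fmul e f)) * calc.A (p1 e)" for e f
  have NX: "N b * X a f = N a * X b g"
    unfolding N_def X_def
  proof (rule calc.regularized_difference[OF a1(1,3) b1(1,3) parts_E1[OF aQ(2)] parts_E1[OF bQ(2)]])
    fix z assume z: "\<bar>Im z\<bar> < \<theta>"
    have "fst (parts f) z = fst (parts g) z" "snd (parts f) z = snd (parts g) z"
      using fg[OF qc_exp_in_sector[OF z theta_pi(2)]] by (simp_all add: parts_def)
    then show "p1 b z * fst (parts (fmul a f)) z = p1 a z * fst (parts (fmul b g)) z \<and> p1 b z * snd (parts (fmul a f)) z = p1 a z * snd (parts (fmul b g)) z"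
      using fmul_parts(1,2)[OF theta_pi ai z, of f] fmul_parts(1,2)[OF theta_pi bi z, of g] by simp
  qed
  have NN: "N a * N b = N b * N a"
  proof -
    have c: "calc.S \<sigma> (p1 a) * calc.S \<rho> (p1 b) = calc.S \<rho> (p1 b) * calc.S \<sigma> (p1 a)" for \<sigma> \<rho> by (rule calc.S_comm[OF a1(2,3) b1(2,3)])
    have c': "calc.S \<sigma> (p1 a) * (calc.S \<rho> (p1 b) * x) = calc.S \<rho> (p1 b) * (calc.S \<sigma> (p1 a) * x)" for \<sigma> \<rho> x
      unfolding mult.assoc[symmetric] c ..
    show ?thesis unfolding N_def by (simp only: mult.assoc c c')
  qed
  have inj: "inj (ap (N a))" "inj (ap (N b))"
    using inj_ap_mult[OF aQ(3,4)] inj_ap_mult[OF bQ(3,4)] by (simp_all only: N_def)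
  have "v \<in> fst (DfT \<tau> f a) \<and> snd (DfT \<tau> f a) v = y \<longleftrightarrow> ap (N a) y = ap (X a f) (-2 *\<^sub>R v)"
    unfolding N_def X_def by (rule DfT_graph[OF f a \<tau>(1)])
  also have "\<dots> \<longleftrightarrow> ap (N b * N a) y = ap (N b * X a f) (-2 *\<^sub>R v)" using inj_eq[OF inj(2)] by (simp only: ap_simps)
  also have "\<dots> \<longleftrightarrow> ap (N a * N b) y = ap (N a * X b g) (-2 *\<^sub>R v)" by (simp only: NX NN)
  also have "\<dots> \<longleftrightarrow> ap (N b) y = ap (X b g) (-2 *\<^sub>R v)" using inj_eq[OF inj(1)] by (simp only: ap_simps)
  also have "\<dots> \<longleftrightarrow> v \<in> fst (DfT \<tau>' g b) \<and> snd (DfT \<tau>' g b) v = y"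
    unfolding N_def X_def by (rule DfT_graph[OF g b \<tau>(2), symmetric])
  finally show "v \<in> fst (DfT \<tau> f a) \<and> snd (DfT \<tau> f a) v = y \<longleftrightarrow> v \<in> fst (DfT \<tau>' g b) \<and> snd (DfT \<tau>' g b) v = y" .
qed

lemma harm_regularizer_exists: "f \<in> F_L \<theta> \<Longrightarrow> \<exists>e. harm_regularizer lm D C \<omega> \<theta> f e"
  by (rule regularizer_exists) (auto simp: harm_regularizer_iff)

end

theorem theorem4p5:
  fixes lm rm :: "quat \<Rightarrow> 'v::banach \<Rightarrow> 'v"
    and D :: "'v set" and C :: "nat \<Rightarrow> 'v \<Rightarrow> 'v"
    and \<omega> \<theta> :: real
  assumes V: "two_sided_banach lm rm"
    and KC: "KC lm rm D C"
    and typeT: "of_type lm D C \<omega>" and typeTbar: "of_type lm D (kconj C) \<omega>"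
    and injT: "inj_on (kcop lm C) D" and injTbar: "inj_on (kcop lm (kconj C)) D"
    and \<omega>: "0 < \<omega>" "\<omega> < pi"
    and \<theta>: "\<omega> < \<theta>" "\<theta> < pi"
  shows "(\<forall>f\<in>F_L \<theta>. \<exists>e. harm_regularizer lm D C \<omega> \<theta> f e) \<and>
      (\<forall>f\<in>F_L \<theta>. \<forall>e. harm_regularizer lm D C \<omega> \<theta> f e \<longrightarrow>
           uop_eq (DfT_1 lm D C \<omega> \<theta> f e) (DfT_2 lm D C \<omega> \<theta> f e)) \<and>
      (\<forall>f\<in>F_L \<theta>. \<forall>e1 e2. harm_regularizer lm D C \<omega> \<theta> f e1 \<and> harm_regularizer lm D C \<omega> \<theta> f e2 \<longrightarrow>
           uop_eq (DfT_1 lm D C \<omega> \<theta> f e1) (DfT_1 lm D C \<omega> \<theta> f e2)) \<and>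
      (\<forall>f\<in>Psi_L \<theta>. \<forall>g\<in>Psi_L \<theta>. (\<forall>s\<in>sector \<theta>. cauchy_fueter f s = cauchy_fueter g s) \<longrightarrow>
           (\<forall>e1 e2. harm_regularizer lm D C \<omega> \<theta> f e1 \<and> harm_regularizer lm D C \<omega> \<theta> g e2 \<longrightarrow>
              uop_eq (DfT_1 lm D C \<omega> \<theta> f e1) (DfT_1 lm D C \<omega> \<theta> g e2)))"
proof -
  interpret sectorial_injective lm rm D C \<omega> \<theta>
    by unfold_locales (use assms in auto)
  show ?thesis unfolding DfT_eq
  proof (intro conjI ballI allI impI; (elim conjE)?)
    show "\<exists>e. harm_regularizer lm D C \<omega> \<theta> f e" if "f \<in> F_L \<theta>" for f by (rule harm_regularizer_exists[OF that])
    show "uop_eq (DfT 1 f e) (DfT (-1) f e)" if "f \<in> F_L \<theta>" "harm_regularizer lm D C \<omega> \<theta> f e" for f e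
      using DfT_unique[OF that(1) that(1) refl that(2) that(2)] by simp
    show "uop_eq (DfT 1 f e1) (DfT 1 f e2)" if "f \<in> F_L \<theta>" "harm_regularizer lm D C \<omega> \<theta> f e1" "harm_regularizer lm D C \<omega> \<theta> f e2" for f e1 e2
      using DfT_unique[OF that(1) that(1) refl that(2,3)] by simp
    fix f g e1 e2
    assume fg: "f \<in> Psi_L \<theta>" "g \<in> Psi_L \<theta>" "\<forall>s\<in>sector \<theta>. cauchy_fueter f s = cauchy_fueter g s"
      and e: "harm_regularizer lm D C \<omega> \<theta> f e1" "harm_regularizer lm D C \<omega> \<theta> g e2"
    have "f s = g s" if "s \<in> sector \<theta>" for s
      by (rule slice_eq_of_cauchy_fueter_eq[OF theta_pi(1) \<theta>(2) fg(1,2)]) (use fg(3) that in auto)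
    then show "uop_eq (DfT 1 f e1) (DfT 1 g e2)"
      using DfT_unique[OF Psi_L_F_L[OF theta_pi fg(1)] Psi_L_F_L[OF theta_pi fg(2)] _ e] by simp
  qed
qed

end
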